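(* Let $q$ be an odd prime power. The line-orbit distributions of the nets of conics of rank one in $\mathrm{PG}(2,q)$ are as follows. For each type $\Sigma_i$, every net of type $\Sigma_i$ (equivalently, every plane $\pi$ of type $\Sigma_i$ in $\mathrm{PG}(5,q)$) contains exactly the following numbers of lines of each type; every line type not mentioned occurs $0$ times. $\Sigma_1$: $o_5:\frac{q(q+1)}{2}$; $o_6: q+1$; $o_{10}:\frac{q(q-1)}{2}$. $\Sigma_2$: $o_5: 3$; $o_{8,1}:\frac{3(q-1)}{2}$; $o_{8,2}:\frac{3(q-1)}{2}$; $o_{14,1}:\frac{(q-1)^2}{4}$; $o_{14,2}:\frac{3(q-1)^2}{4}$. $\Sigma_3$: $o_5:1$; $o_6:1$; $o_{8,1}:q$; $o_9:q-1$; $o_{13,1}:\frac{q(q-1)}{2}$; $o_{13,2}:\frac{q(q-1)}{2}$. $\Sigma_4$: $o_5:1$; $o_{8,1}:2q$; $o_{12}:1$; $o_{13,1}:\frac{q(q-3)}{2}$; $o_{13,2}:\frac{q(q-1)}{2}$; $o_{16}:q-1$. $\Sigma_5$: $o_5:1$; $o_{8,1}:q-1$; $o_{8,2}:q-1$; $o_9:2$; $o_{13,1}:\frac{q-1}{2}$; $o_{13,2}:\frac{q-1}{2}$; $o_{14,1}:\frac{(q-1)(q-3)}{8}$; $o_{14,2}:\frac{(q-1)(3q-5)}{8}$; $o_{15,1}:\frac{(q-1)^2}{4}$; $o_{15,2}:\frac{(q+1)(q-1)}{4}$. $\Sigma_6$: $o_{8,1}:\frac{q+1}{2}$; $o_{8,2}:\frac{q+1}{2}$;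 $o_{10}:1$; $o_{15,1}:\frac{(q+1)(q-1)}{2}$; $o_{15,2}:\frac{(q+1)(q-1)}{2}$. $\Sigma_7$: $o_6:q+1$; $o_{12}:q^2$. $\Sigma_8$: $o_6:1$; $o_{8,1}:q$; $o_{12}:1$; $o_{13,1}:q(q-1)$; $o_{16}:q-1$. $\Sigma_9$: $o_6:1$; $o_{8,1}:q$; $o_{13,1}:q$; $o_{14,1}:\frac{q(q-1)}{2}$; $o_{15,1}:\frac{q(q-1)}{2}$. $\Sigma_{10}$: $o_6:1$; $o_{8,2}:q$; $o_{13,2}:q$; $o_{14,2}:\frac{q(q-1)}{2}$; $o_{15,1}:\frac{q(q-1)}{2}$. $\Sigma_{11}$, $q\equiv 0 \pmod 3$: $o_{8,1}:q$; $o_9:1$; $o_{13,1}:q$; $o_{14,1}:\frac{q(q-3)}{6}$; $o_{15,1}:\frac{q(q-1)}{2}$; $o_{17}:\frac{q^2}{3}$. $\Sigma_{11}$, $q\not\equiv 0 \pmod 3$: $o_{8,1}:q$; $o_9:1$; $o_{13,1}:q-1$; $o_{14,1}:\frac{(q-1)(q-2)}{6}$; $o_{15,1}:\frac{q(q-1)}{2}$; $o_{16}:1$; $o_{17}:\frac{(q+1)(q-1)}{3}$. $\Sigma_{12}$, $q\equiv 1 \pmod 3$: $o_{8,1}:\frac{q-1}{2}$; $o_{8,2}:\frac{q-1}{2}$; $o_9:2$; $o_{13,1}:\frac{q-7}{2}$; $o_{13,2}:\frac{q-1}{2}$; $o_{14,1}:\frac{(q-1)(q-7)}{24}+1$; $o_{14,2}:\frac{(q-1)(q-3)}{8}$;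 $o_{15,1}:\frac{(q-1)^2}{4}$; $o_{15,2}:\frac{(q+1)(q-1)}{4}$; $o_{16}:3$; $o_{17}:\frac{(q-1)(q+2)}{3}$. $\Sigma_{12}$, $q\not\equiv 1 \pmod 3$: $o_{8,1}:\frac{q-1}{2}$; $o_{8,2}:\frac{q-1}{2}$; $o_9:2$; $o_{13,1}:\frac{q-3}{2}$; $o_{13,2}:\frac{q-1}{2}$; $o_{14,1}:\frac{(q-3)(q-5)}{24}$; $o_{14,2}:\frac{(q-1)(q-3)}{8}$; $o_{15,1}:\frac{(q-1)^2}{4}$; $o_{15,2}:\frac{(q+1)(q-1)}{4}$; $o_{16}:1$; $o_{17}:\frac{q(q+1)}{3}$. $\Sigma_{13}$, $q\equiv -1 \pmod 3$: $o_{8,1}:\frac{q+1}{2}$; $o_{8,2}:\frac{q+1}{2}$; $o_{13,1}:\frac{q-5}{2}$; $o_{13,2}:\frac{q+1}{2}$; $o_{14,1}:\frac{(q+1)(q-5)}{24}+1$; $o_{14,2}:\frac{(q+1)(q-1)}{8}$; $o_{15,1}:\frac{(q+1)(q-3)}{4}$; $o_{15,2}:\frac{(q+1)(q-1)}{4}$; $o_{16}:3$; $o_{17}:\frac{(q+1)(q-2)}{3}$. $\Sigma_{13}$, $q\not\equiv -1 \pmod 3$: $o_{8,1}:\frac{q+1}{2}$; $o_{8,2}:\frac{q+1}{2}$; $o_{13,1}:\frac{q-1}{2}$; $o_{13,2}:\frac{q+1}{2}$; $o_{14,1}:\frac{(q-1)(q-3)}{24}$; $o_{14,2}:\frac{(q+1)(q-1)}{8}$;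 $o_{15,1}:\frac{(q+1)(q-3)}{4}$; $o_{15,2}:\frac{(q+1)(q-1)}{4}$; $o_{16}:1$; $o_{17}:\frac{q(q-1)}{3}$. $\Sigma_{14}$, $q\equiv 1 \pmod 3$: $o_{8,1}:\frac{q-1}{2}$; $o_{8,2}:\frac{q-1}{2}$; $o_9:2$; $o_{13,1}:\frac{q-1}{2}$; $o_{13,2}:\frac{q-1}{2}$; $o_{14,1}:\frac{(q-1)(q-7)}{24}$; $o_{14,2}:\frac{(q-1)(q-3)}{8}$; $o_{15,1}:\frac{(q-1)^2}{4}$; $o_{15,2}:\frac{(q+1)(q-1)}{4}$; $o_{17}:\frac{(q-1)^2}{3}+q$. $\Sigma_{14}$, $q\equiv -1 \pmod 3$: $o_{8,1}:\frac{q+1}{2}$; $o_{8,2}:\frac{q+1}{2}$; $o_{13,1}:\frac{q+1}{2}$; $o_{13,2}:\frac{q+1}{2}$; $o_{14,1}:\frac{(q+1)(q-5)}{24}$; $o_{14,2}:\frac{(q+1)(q-1)}{8}$; $o_{15,1}:\frac{(q+1)(q-3)}{4}$; $o_{15,2}:\frac{(q+1)(q-1)}{4}$; $o_{17}:\frac{(q+1)^2}{3}-q$. $\Sigma_{14}'$ ($q\equiv 0 \pmod 3$): $o_{8,1}:q$; $o_9:1$; $o_{14,1}:\frac{q(q-1)}{6}$; $o_{15,1}:\frac{q(q-1)}{2}$; $o_{16}:q$; $o_{17}:\frac{q(q-1)}{3}$. $\Sigma_{15}$: $o_6:1$; $o_9:q$; $o_{16}:q^2$.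
   Context: Throughout, $q$ is an odd prime power and $\mathbb{F}_q$ is the field with $q$ elements. Nets and planes. A net of conics in $\mathrm{PG}(2,q)$ is a two-dimensional linear system of conics, i.e. the projective plane of a $3$-dimensional subspace of the space of ternary quadratic forms over $\mathbb{F}_q$ (a pencil is likewise given by a $2$-dimensional subspace). The net has rank one if it contains a repeated line (a nonzero form that is a scalar multiple of the square of a linear form). Points of $\mathrm{PG}(5,q)$ are represented by nonzero symmetric $3\times 3$ matrices over $\mathbb{F}_q$ up to scalars, so lines and planes of $\mathrm{PG}(5,q)$ are $2$- and $3$-dimensional subspaces of the space of symmetric $3\times 3$ matrices. Associating to a conic the Gram matrix of its quadratic form, nets correspond to planes and pencils to lines of $\mathrm{PG}(5,q)$. The rank of a point is the rank of its matrix; the quadric Veronesean $\mathcal{V}(\mathbb{F}_q)$ is the set of points of rank $1$. A net has rank one iff the corresponding plane meets $\mathcal{V}(\mathbb{F}_q)$. Group action. $K\cong \mathrm{PGL}(3,q)$ acts on $\mathrm{PG}(5,q)$ by $M\mapsto AMA^T$, $A\in\mathrm{GL}(3,q)$. Equivalence of nets (pencils) under coordinate changes corresponds to being in the same $K$-orbit of planes (lines). Line orbits. It is known (Dickson; Lavrauw–Popiel) that there are exactly $15$ $K$-orbits of lines of $\mathrm{PG}(5,q)$, with the following representatives, where $(\alpha,\beta)$ ranges over $\mathbb{F}_q^2\setminus\{(0,0)\}$, rows are separated by semicolons, and $\varepsilon$ is a (fixed, arbitrary) non-square in $\mathbb{F}_q$. A line is "of type $o$" if it lies in the orbit $o$.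 $o_5$: $\mathrm{diag}(\alpha,\beta,0)$. $o_6$: $[\alpha,\beta,0;\ \beta,0,0;\ 0,0,0]$. $o_{8,1}$: $\mathrm{diag}(\alpha,\beta,-\beta)$. $o_{8,2}$: $\mathrm{diag}(\alpha,\beta,-\varepsilon\beta)$. $o_9$: $[\alpha,0,\beta;\ 0,\beta,0;\ \beta,0,0]$. $o_{10}$: $[v\alpha,\beta,0;\ \beta,\alpha+u\beta,0;\ 0,0,0]$, with $u,v$ satisfying ($*$). $o_{12}$: $[0,\alpha,0;\ \alpha,0,\beta;\ 0,\beta,0]$. $o_{13,1}$: $[0,\alpha,0;\ \alpha,\beta,0;\ 0,0,-\beta]$. $o_{13,2}$: $[0,\alpha,0;\ \alpha,\beta,0;\ 0,0,-\varepsilon\beta]$. $o_{14,1}$: $\mathrm{diag}(\alpha,-(\alpha+\beta),\beta)$. $o_{14,2}$: $\mathrm{diag}(\alpha,-\varepsilon(\alpha+\beta),\beta)$. $o_{15,1}$: $[v\beta,\alpha,0;\ \alpha,u\alpha+\beta,0;\ 0,0,\alpha]$, with $u,v$ satisfying ($*$) and $-v$ a square. $o_{15,2}$: the same matrix form, with $u,v$ satisfying ($*$) and $-v$ a non-square. $o_{16}$: $[0,0,\alpha;\ 0,\alpha,\beta;\ \alpha,\beta,0]$. $o_{17}$: $[v^{-1}\alpha,\beta,0;\ \beta,u\beta-w\alpha,\alpha;\ 0,\alpha,\beta]$, with $u,v,w$ satisfying ($**$). Condition ($*$): $v\neq 0$ and $v\lambda^2+uv\lambda-1\neq 0$ for all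 $\lambda\in\mathbb{F}_q$. Condition ($**$): $\lambda^3+w\lambda^2-u\lambda+v\neq 0$ for all $\lambda\in\mathbb{F}_q$. Plane orbits. It is known (Lavrauw–Popiel–Sheekey) that the planes of $\mathrm{PG}(5,q)$ meeting $\mathcal{V}(\mathbb{F}_q)$ form exactly $15$ $K$-orbits: $\Sigma_1,\dots,\Sigma_{13},\Sigma_{15}$ together with $\Sigma_{14}$ if $q\not\equiv 0\pmod 3$, or $\Sigma_{14}'$ if $q\equiv 0\pmod 3$. Representatives, with $(\alpha,\beta,\gamma)$ ranging over $\mathbb{F}_q^3\setminus\{(0,0,0)\}$ and $\varepsilon$ a fixed non-square: $\Sigma_1$: $[\alpha,\gamma,0;\ \gamma,\beta,0;\ 0,0,0]$. $\Sigma_2$: $\mathrm{diag}(\alpha,\beta,\gamma)$. $\Sigma_3$: $[\alpha,0,\gamma;\ 0,\beta,0;\ \gamma,0,0]$. $\Sigma_4$: $[\alpha,0,\gamma;\ 0,\beta,\gamma;\ \gamma,\gamma,0]$. $\Sigma_5$: $[\alpha,0,\gamma;\ 0,\beta,\gamma;\ \gamma,\gamma,\gamma]$. $\Sigma_6$: $[\alpha,\beta,0;\ \beta,\varepsilon\alpha,0;\ 0,0,\gamma]$. $\Sigma_7$: $[\alpha,\beta,\gamma;\ \beta,0,0;\ \gamma,0,0]$. $\Sigma_8$: $[\alpha,\beta,0;\ \beta,0,\gamma;\ 0,\gamma,0]$. $\Sigma_9$: $[\alpha,\beta,0;\ \beta,\gamma,0;\ 0,0,-\gamma]$. $\Sigma_{10}$: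 $[\alpha,\beta,0;\ \beta,\gamma,0;\ 0,0,-\varepsilon\gamma]$. $\Sigma_{11}$: $[0,\beta,\gamma;\ \beta,\alpha,\alpha;\ \gamma,\alpha,\alpha+\gamma]$. $\Sigma_{12}$: $[\alpha,\beta,0;\ \beta,\gamma,\beta;\ 0,\beta,\gamma]$. $\Sigma_{13}$: $[\alpha,\beta,0;\ \beta,\gamma,\beta;\ 0,\beta,\varepsilon\gamma]$. $\Sigma_{14}$ ($q\not\equiv 0 \pmod 3$): $[\alpha,\beta,0;\ \beta,c\gamma,\beta-\gamma;\ 0,\beta-\gamma,\gamma]$, where $c\in\mathbb{F}_q\setminus\{0,1\}$ is such that $-3c$ is a square in $\mathbb{F}_q$ and $\frac{\sqrt{c}+1}{\sqrt{c}-1}$ is a non-cube in $\mathbb{F}_q(\sqrt{-3})$. $\Sigma_{14}'$ ($q\equiv 0 \pmod 3$): $[\alpha+\gamma,\gamma,\gamma;\ \gamma,\beta+\gamma,\gamma;\ \gamma,\gamma,-\beta]$. $\Sigma_{15}$: $[\alpha,\beta,\gamma;\ \beta,\gamma,0;\ \gamma,0,0]$. A plane (or the corresponding net) is "of type $\Sigma_i$" if it lies in the orbit $\Sigma_i$. The line-orbit distribution of a plane $\pi$ of $\mathrm{PG}(5,q)$ is the list of the numbers of lines contained in $\pi$ belonging to each of the $15$ line orbits; the line-orbit distribution of a net is that of the corresponding plane. *)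

theory Defs
  imports
    "HOL-Analysis.Cartesian_Space"
    "HOL-Library.Function_Algebras"
    "HOL-Computational_Algebra.Nth_Powers"
    "HOL-Algebra.Algebraic_Closure_Type"
begin

section \<open>Lines and planes of \<open>PG(5,q)\<close>\<close>

text \<open>
  The field with \<open>q\<close> elements is an arbitrary type \<open>'a\<close> of sort \<open>{field, finite}\<close> with
  \<open>CARD('a) = q\<close>.  A point of \<open>PG(5,q)\<close> is a nonzero symmetric matrix up to scalars, so lines and
  planes are vector subspaces of the space of symmetric matrices of dimension \<open>2\<close> and \<open>3\<close>,
  represented by the set of all their vectors, zero included.
\<close>

definition mscale :: "'a::field \<Rightarrow> 'a^3^3 \<Rightarrow> 'a^3^3" where
  "mscale c M = (\<chi> i j. c * M $ i $ j)"

global_interpretation mvec: vector_space "mscale :: 'a::field \<Rightarrow> 'a^3^3 \<Rightarrow> 'a^3^3"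
  by standard (simp_all add: mscale_def vec_eq_iff algebra_simps)

definition PG5_line :: "('a::field^3^3) set \<Rightarrow> bool" where
  "PG5_line L \<longleftrightarrow> (\<forall>M\<in>L. transpose M = M) \<and> mvec.subspace L \<and> mvec.dim L = 2"

definition PG5_plane :: "('a::field^3^3) set \<Rightarrow> bool" where
  "PG5_plane P \<longleftrightarrow> (\<forall>M\<in>P. transpose M = M) \<and> mvec.subspace P \<and> mvec.dim P = 3"

definition K_orbit :: "('a::field^3^3) set \<Rightarrow> ('a^3^3) set set" where
  "K_orbit S = {(\<lambda>M. A ** M ** transpose A) ` S | A. invertible A}"

definition mat3 :: "'a::field list list \<Rightarrow> 'a^3^3" where
  "mat3 ms = vector (map vector ms)"


section \<open>Line orbits\<close>

datatype line_type =
    o5 | o6 | o8_1 | o8_2 | o9 | o10 | o12 | o13_1 | o13_2 | o14_1 | o14_2 | o15_1 | o15_2 | o16 | o17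

definition cond1 :: "'a::field \<Rightarrow> 'a \<Rightarrow> bool" where
  "cond1 u v \<longleftrightarrow> v \<noteq> 0 \<and> (\<forall>l. v * l^2 + u * v * l - 1 \<noteq> 0)"

definition cond2 :: "'a::field \<Rightarrow> 'a \<Rightarrow> 'a \<Rightarrow> bool" where
  "cond2 u v w \<longleftrightarrow> (\<forall>l. l^3 + w * l^2 - u * l + v \<noteq> 0)"

text \<open>
  \<open>line_reps \<epsilon> t\<close> is the set of all lines admissible as the representative of the orbit \<open>t\<close>;
  it has several elements only where the representative depends on a choice of \<open>u\<close>, \<open>v\<close>, \<open>w\<close>.
\<close>

fun line_reps :: "'a::field \<Rightarrow> line_type \<Rightarrow> ('a^3^3) set set" where
  "line_reps \<epsilon> o5 =
     {{mat3 [[\<alpha>, 0, 0], [0, \<beta>, 0], [0, 0, 0]] | \<alpha> \<beta>. True}}"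
| "line_reps \<epsilon> o6 =
     {{mat3 [[\<alpha>, \<beta>, 0], [\<beta>, 0, 0], [0, 0, 0]] | \<alpha> \<beta>. True}}"
| "line_reps \<epsilon> o8_1 =
     {{mat3 [[\<alpha>, 0, 0], [0, \<beta>, 0], [0, 0, - \<beta>]] | \<alpha> \<beta>. True}}"
| "line_reps \<epsilon> o8_2 =
     {{mat3 [[\<alpha>, 0, 0], [0, \<beta>, 0], [0, 0, - \<epsilon> * \<beta>]] | \<alpha> \<beta>. True}}"
| "line_reps \<epsilon> o9 =
     {{mat3 [[\<alpha>, 0, \<beta>], [0, \<beta>, 0], [\<beta>, 0, 0]] | \<alpha> \<beta>. True}}"
| "line_reps \<epsilon> o10 =
     {{mat3 [[v * \<alpha>, \<beta>, 0], [\<beta>, \<alpha> + u * \<beta>, 0], [0, 0, 0]] | \<alpha> \<beta>. True} | u v. cond1 u v}"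
| "line_reps \<epsilon> o12 =
     {{mat3 [[0, \<alpha>, 0], [\<alpha>, 0, \<beta>], [0, \<beta>, 0]] | \<alpha> \<beta>. True}}"
| "line_reps \<epsilon> o13_1 =
     {{mat3 [[0, \<alpha>, 0], [\<alpha>, \<beta>, 0], [0, 0, - \<beta>]] | \<alpha> \<beta>. True}}"
| "line_reps \<epsilon> o13_2 =
     {{mat3 [[0, \<alpha>, 0], [\<alpha>, \<beta>, 0], [0, 0, - \<epsilon> * \<beta>]] | \<alpha> \<beta>. True}}"
| "line_reps \<epsilon> o14_1 =
     {{mat3 [[\<alpha>, 0, 0], [0, - (\<alpha> + \<beta>), 0], [0, 0, \<beta>]] | \<alpha> \<beta>. True}}"
| "line_reps \<epsilon> o14_2 =
     {{mat3 [[\<alpha>, 0, 0], [0, - \<epsilon> * (\<alpha> + \<beta>), 0], [0, 0, \<beta>]] | \<alpha> \<beta>. True}}"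
| "line_reps \<epsilon> o15_1 =
     {{mat3 [[v * \<beta>, \<alpha>, 0], [\<alpha>, u * \<alpha> + \<beta>, 0], [0, 0, \<alpha>]] | \<alpha> \<beta>. True} | u v.
        cond1 u v \<and> is_square (- v)}"
| "line_reps \<epsilon> o15_2 =
     {{mat3 [[v * \<beta>, \<alpha>, 0], [\<alpha>, u * \<alpha> + \<beta>, 0], [0, 0, \<alpha>]] | \<alpha> \<beta>. True} | u v.
        cond1 u v \<and> \<not> is_square (- v)}"
| "line_reps \<epsilon> o16 =
     {{mat3 [[0, 0, \<alpha>], [0, \<alpha>, \<beta>], [\<alpha>, \<beta>, 0]] | \<alpha> \<beta>. True}}"
| "line_reps \<epsilon> o17 =
     {{mat3 [[inverse v * \<alpha>, \<beta>, 0], [\<beta>, u * \<beta> - w * \<alpha>, \<alpha>], [0, \<alpha>, \<beta>]] | \<alpha> \<beta>. True} | u v w.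
        cond2 u v w}"

text \<open>
  \<open>R t\<close> is the chosen representative of the line orbit \<open>t\<close>.
\<close>

definition line_orbit_distribution ::
    "(line_type \<Rightarrow> ('a::field^3^3) set) \<Rightarrow> ('a^3^3) set \<Rightarrow> line_type \<Rightarrow> nat" where
  "line_orbit_distribution R P t = card {L. PG5_line L \<and> L \<subseteq> P \<and> L \<in> K_orbit (R t)}"


section \<open>Orbits of planes meeting the quadric Veronesean\<close>

datatype plane_type =
    Sigma1 | Sigma2 | Sigma3 | Sigma4 | Sigma5 | Sigma6 | Sigma7 | Sigma8 | Sigma9 | Sigma10
  | Sigma11 | Sigma12 | Sigma13 | Sigma14 | Sigma14' | Sigma15

text \<open>The subfield \<open>F(\<surd>-3)\<close> of the algebraic closure of \<open>F\<close>; it is \<open>F\<close> itself if \<open>-3\<close> is a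
  square in \<open>F\<close>, and both square roots of \<open>-3\<close> give the same set.\<close>

definition adjoin_sqrt_minus3 :: "'a::field alg_closure set" where
  "adjoin_sqrt_minus3 = {to_ac a + to_ac b * r | a b r. r^2 = - 3}"

definition cond_c :: "'a::field \<Rightarrow> bool" where
  "cond_c c \<longleftrightarrow> c \<noteq> 0 \<and> c \<noteq> 1 \<and> is_square (- 3 * c) \<and>
     (\<exists>s\<in>adjoin_sqrt_minus3. s^2 = to_ac c \<and>
        \<not> (\<exists>t\<in>adjoin_sqrt_minus3. t^3 = (s + 1) / (s - 1)))"

fun plane_reps :: "'a::field \<Rightarrow> plane_type \<Rightarrow> ('a^3^3) set set" where
  "plane_reps \<epsilon> Sigma1 =
     {{mat3 [[\<alpha>, \<gamma>, 0], [\<gamma>, \<beta>, 0], [0, 0, 0]] | \<alpha> \<beta> \<gamma>. True}}"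
| "plane_reps \<epsilon> Sigma2 =
     {{mat3 [[\<alpha>, 0, 0], [0, \<beta>, 0], [0, 0, \<gamma>]] | \<alpha> \<beta> \<gamma>. True}}"
| "plane_reps \<epsilon> Sigma3 =
     {{mat3 [[\<alpha>, 0, \<gamma>], [0, \<beta>, 0], [\<gamma>, 0, 0]] | \<alpha> \<beta> \<gamma>. True}}"
| "plane_reps \<epsilon> Sigma4 =
     {{mat3 [[\<alpha>, 0, \<gamma>], [0, \<beta>, \<gamma>], [\<gamma>, \<gamma>, 0]] | \<alpha> \<beta> \<gamma>. True}}"
| "plane_reps \<epsilon> Sigma5 =
     {{mat3 [[\<alpha>, 0, \<gamma>], [0, \<beta>, \<gamma>], [\<gamma>, \<gamma>, \<gamma>]] | \<alpha> \<beta> \<gamma>. True}}"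
| "plane_reps \<epsilon> Sigma6 =
     {{mat3 [[\<alpha>, \<beta>, 0], [\<beta>, \<epsilon> * \<alpha>, 0], [0, 0, \<gamma>]] | \<alpha> \<beta> \<gamma>. True}}"
| "plane_reps \<epsilon> Sigma7 =
     {{mat3 [[\<alpha>, \<beta>, \<gamma>], [\<beta>, 0, 0], [\<gamma>, 0, 0]] | \<alpha> \<beta> \<gamma>. True}}"
| "plane_reps \<epsilon> Sigma8 =
     {{mat3 [[\<alpha>, \<beta>, 0], [\<beta>, 0, \<gamma>], [0, \<gamma>, 0]] | \<alpha> \<beta> \<gamma>. True}}"
| "plane_reps \<epsilon> Sigma9 =
     {{mat3 [[\<alpha>, \<beta>, 0], [\<beta>, \<gamma>, 0], [0, 0, - \<gamma>]] | \<alpha> \<beta> \<gamma>. True}}"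
| "plane_reps \<epsilon> Sigma10 =
     {{mat3 [[\<alpha>, \<beta>, 0], [\<beta>, \<gamma>, 0], [0, 0, - \<epsilon> * \<gamma>]] | \<alpha> \<beta> \<gamma>. True}}"
| "plane_reps \<epsilon> Sigma11 =
     {{mat3 [[0, \<beta>, \<gamma>], [\<beta>, \<alpha>, \<alpha>], [\<gamma>, \<alpha>, \<alpha> + \<gamma>]] | \<alpha> \<beta> \<gamma>. True}}"
| "plane_reps \<epsilon> Sigma12 =
     {{mat3 [[\<alpha>, \<beta>, 0], [\<beta>, \<gamma>, \<beta>], [0, \<beta>, \<gamma>]] | \<alpha> \<beta> \<gamma>. True}}"
| "plane_reps \<epsilon> Sigma13 =
     {{mat3 [[\<alpha>, \<beta>, 0], [\<beta>, \<gamma>, \<beta>], [0, \<beta>, \<epsilon> * \<gamma>]] | \<alpha> \<beta> \<gamma>. True}}"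
| "plane_reps \<epsilon> Sigma14 =
     {{mat3 [[\<alpha>, \<beta>, 0], [\<beta>, c * \<gamma>, \<beta> - \<gamma>], [0, \<beta> - \<gamma>, \<gamma>]] | \<alpha> \<beta> \<gamma>. True} | c.
        CARD('a) mod 3 \<noteq> 0 \<and> cond_c c}"
| "plane_reps \<epsilon> Sigma14' =
     (if CARD('a) mod 3 = 0 then
       {{mat3 [[\<alpha> + \<gamma>, \<gamma>, \<gamma>], [\<gamma>, \<beta> + \<gamma>, \<gamma>], [\<gamma>, \<gamma>, - \<beta>]] | \<alpha> \<beta> \<gamma>. True}}
      else {})"
| "plane_reps \<epsilon> Sigma15 =
     {{mat3 [[\<alpha>, \<beta>, \<gamma>], [\<beta>, \<gamma>, 0], [\<gamma>, 0, 0]] | \<alpha> \<beta> \<gamma>. True}}"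

definition plane_of_type :: "'a::field \<Rightarrow> plane_type \<Rightarrow> ('a^3^3) set \<Rightarrow> bool" where
  "plane_of_type \<epsilon> T P \<longleftrightarrow> PG5_plane P \<and> (\<exists>P0\<in>plane_reps \<epsilon> T. P \<in> K_orbit P0)"


section \<open>Nets of conics\<close>

text \<open>
  Ternary quadratic forms are represented by the functions they induce; since \<open>q\<close> is odd, a
  ternary quadratic form is determined by its function.
\<close>

definition fscale :: "'a::field \<Rightarrow> ('a^3 \<Rightarrow> 'a) \<Rightarrow> ('a^3 \<Rightarrow> 'a)" where
  "fscale c Q = (\<lambda>x. c * Q x)"

global_interpretation fvec: vector_space "fscale :: 'a::field \<Rightarrow> ('a^3 \<Rightarrow> 'a) \<Rightarrow> ('a^3 \<Rightarrow> 'a)"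
  by standard (simp_all add: fscale_def fun_eq_iff algebra_simps)

definition linear_form :: "('a::field^3 \<Rightarrow> 'a) \<Rightarrow> bool" where
  "linear_form l \<longleftrightarrow> (\<exists>a. l = (\<lambda>x. \<Sum>i\<in>UNIV. a i * x $ i))"

definition quadratic_form :: "('a::field^3 \<Rightarrow> 'a) \<Rightarrow> bool" where
  "quadratic_form Q \<longleftrightarrow> (\<exists>a. Q = (\<lambda>x. \<Sum>i\<in>UNIV. \<Sum>j\<in>UNIV. a i j * x $ i * x $ j))"

definition conic_net :: "('a::field^3 \<Rightarrow> 'a) set \<Rightarrow> bool" where
  "conic_net N \<longleftrightarrow> (\<forall>Q\<in>N. quadratic_form Q) \<and> fvec.subspace N \<and> fvec.dim N = 3"

definition repeated_line :: "('a::field^3 \<Rightarrow> 'a) \<Rightarrow> bool" where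
  "repeated_line Q \<longleftrightarrow> Q \<noteq> 0 \<and> (\<exists>c l. linear_form l \<and> Q = (\<lambda>x. c * (l x)^2))"

definition rank_one_net :: "('a::field^3 \<Rightarrow> 'a) set \<Rightarrow> bool" where
  "rank_one_net N \<longleftrightarrow> conic_net N \<and> (\<exists>Q\<in>N. repeated_line Q)"

text \<open>The symmetric matrix \<open>G\<close> with \<open>Q x = x\<^sup>T G x\<close>, recovered from \<open>Q\<close> by polarisation.\<close>

definition gram :: "('a::field^3 \<Rightarrow> 'a) \<Rightarrow> 'a^3^3" where
  "gram Q = (\<chi> i j. (Q (axis i 1 + axis j 1) - Q (axis i 1) - Q (axis j 1)) / 2)"

definition plane_of_net :: "('a::field^3 \<Rightarrow> 'a) set \<Rightarrow> ('a^3^3) set" where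
  "plane_of_net N = gram ` N"


section \<open>The table of line-orbit distributions\<close>

definition table_entries :: "plane_type \<Rightarrow> nat \<Rightarrow> (line_type \<times> rat) list" where
  "table_entries T n = (let q = rat_of_nat n in case T of
     Sigma1 \<Rightarrow> [(o5, q*(q+1)/2), (o6, q+1), (o10, q*(q-1)/2)]
   | Sigma2 \<Rightarrow> [(o5, 3), (o8_1, 3*(q-1)/2), (o8_2, 3*(q-1)/2),
       (o14_1, (q-1)^2/4), (o14_2, 3*(q-1)^2/4)]
   | Sigma3 \<Rightarrow> [(o5, 1), (o6, 1), (o8_1, q), (o9, q-1), (o13_1, q*(q-1)/2), (o13_2, q*(q-1)/2)]
   | Sigma4 \<Rightarrow> [(o5, 1), (o8_1, 2*q), (o12, 1), (o13_1, q*(q-3)/2), (o13_2, q*(q-1)/2),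
       (o16, q-1)]
   | Sigma5 \<Rightarrow> [(o5, 1), (o8_1, q-1), (o8_2, q-1), (o9, 2), (o13_1, (q-1)/2), (o13_2, (q-1)/2),
       (o14_1, (q-1)*(q-3)/8), (o14_2, (q-1)*(3*q-5)/8),
       (o15_1, (q-1)^2/4), (o15_2, (q+1)*(q-1)/4)]
   | Sigma6 \<Rightarrow> [(o8_1, (q+1)/2), (o8_2, (q+1)/2), (o10, 1),
       (o15_1, (q+1)*(q-1)/2), (o15_2, (q+1)*(q-1)/2)]
   | Sigma7 \<Rightarrow> [(o6, q+1), (o12, q^2)]
   | Sigma8 \<Rightarrow> [(o6, 1), (o8_1, q), (o12, 1), (o13_1, q*(q-1)), (o16, q-1)]
   | Sigma9 \<Rightarrow> [(o6, 1), (o8_1, q), (o13_1, q), (o14_1, q*(q-1)/2), (o15_1, q*(q-1)/2)]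
   | Sigma10 \<Rightarrow> [(o6, 1), (o8_2, q), (o13_2, q), (o14_2, q*(q-1)/2), (o15_1, q*(q-1)/2)]
   | Sigma11 \<Rightarrow>
       (if n mod 3 = 0 then
          [(o8_1, q), (o9, 1), (o13_1, q), (o14_1, q*(q-3)/6), (o15_1, q*(q-1)/2), (o17, q^2/3)]
        else
          [(o8_1, q), (o9, 1), (o13_1, q-1), (o14_1, (q-1)*(q-2)/6), (o15_1, q*(q-1)/2),
           (o16, 1), (o17, (q+1)*(q-1)/3)])
   | Sigma12 \<Rightarrow>
       (if n mod 3 = 1 then
          [(o8_1, (q-1)/2), (o8_2, (q-1)/2), (o9, 2), (o13_1, (q-7)/2), (o13_2, (q-1)/2),
           (o14_1, (q-1)*(q-7)/24 + 1), (o14_2, (q-1)*(q-3)/8),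
           (o15_1, (q-1)^2/4), (o15_2, (q+1)*(q-1)/4), (o16, 3), (o17, (q-1)*(q+2)/3)]
        else
          [(o8_1, (q-1)/2), (o8_2, (q-1)/2), (o9, 2), (o13_1, (q-3)/2), (o13_2, (q-1)/2),
           (o14_1, (q-3)*(q-5)/24), (o14_2, (q-1)*(q-3)/8),
           (o15_1, (q-1)^2/4), (o15_2, (q+1)*(q-1)/4), (o16, 1), (o17, q*(q+1)/3)])
   | Sigma13 \<Rightarrow>
       (if n mod 3 = 2 then
          [(o8_1, (q+1)/2), (o8_2, (q+1)/2), (o13_1, (q-5)/2), (o13_2, (q+1)/2),
           (o14_1, (q+1)*(q-5)/24 + 1), (o14_2, (q+1)*(q-1)/8),
           (o15_1, (q+1)*(q-3)/4), (o15_2, (q+1)*(q-1)/4), (o16, 3), (o17, (q+1)*(q-2)/3)]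
        else
          [(o8_1, (q+1)/2), (o8_2, (q+1)/2), (o13_1, (q-1)/2), (o13_2, (q+1)/2),
           (o14_1, (q-1)*(q-3)/24), (o14_2, (q+1)*(q-1)/8),
           (o15_1, (q+1)*(q-3)/4), (o15_2, (q+1)*(q-1)/4), (o16, 1), (o17, q*(q-1)/3)])
   | Sigma14 \<Rightarrow>
       (if n mod 3 = 1 then
          [(o8_1, (q-1)/2), (o8_2, (q-1)/2), (o9, 2), (o13_1, (q-1)/2), (o13_2, (q-1)/2),
           (o14_1, (q-1)*(q-7)/24), (o14_2, (q-1)*(q-3)/8),
           (o15_1, (q-1)^2/4), (o15_2, (q+1)*(q-1)/4), (o17, (q-1)^2/3 + q)]
        else
          [(o8_1, (q+1)/2), (o8_2, (q+1)/2), (o13_1, (q+1)/2), (o13_2, (q+1)/2),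
           (o14_1, (q+1)*(q-5)/24), (o14_2, (q+1)*(q-1)/8),
           (o15_1, (q+1)*(q-3)/4), (o15_2, (q+1)*(q-1)/4), (o17, (q+1)^2/3 - q)])
   | Sigma14' \<Rightarrow>
       [(o8_1, q), (o9, 1), (o14_1, q*(q-1)/6), (o15_1, q*(q-1)/2), (o16, q), (o17, q*(q-1)/3)]
   | Sigma15 \<Rightarrow> [(o6, 1), (o9, q), (o16, q^2)])"

text \<open>Line types not listed for a plane type have entry \<open>0\<close>.  Entries are rational numbers so
  that neither division nor subtraction is truncated.\<close>

definition table :: "plane_type \<Rightarrow> nat \<Rightarrow> line_type \<Rightarrow> rat" where
  "table T q t = (case map_of (table_entries T q) t of Some k \<Rightarrow> k | None \<Rightarrow> 0)"

end

theory Submission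
  imports Defs "HOL-Analysis.Determinants"
begin

text \<open>
  A line is classified by four numbers and two properties: how many of its points have rank one, how
  many have rank two and factor over the field (hyperbolic points) or do not (elliptic points), at how
  many points of rank two the determinant has a multiple zero along the line (tangent points), whether
  the determinant vanishes on the whole line, and whether all its matrices share a kernel vector. These
  data are invariant under congruence and are used to define the type of a line, \<open>ltype\<close>.  They
  determine the orbit because every line is congruent to a normal form of its type: a point of rank one,
  or a simple singular point, is moved to a coordinate point and the rest of the line is diagonalised
  around it.  The hard case is a line without singular points.  It has the form \<open>\<langle>N, N T\<rangle>\<close> with \<open>T\<close>
  acting irreducibly, so in a cyclic basis it consists of the trace-like forms
  \<open>x \<mapsto> \<phi>(x\<^sup>2)\<close> on the cubic extension, with \<open>\<phi>\<close> vanishing at one given element; since every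
  element of that extension is a square times a ground field element, all these lines are congruent. The
  outcome is \<open>line_orbit_iff_ltype\<close>.

  Let a plane contain a point of rank one, moved to the corner entry. A line of the plane either passes
  through that point and one point \<open>p\<close> of a complementary line \<open>\<langle>M, N\<rangle>\<close>, where its type can be
  read off from the entries (\<open>rank_one_line_nf\<close>), or it is a graph over \<open>\<langle>M, N\<rangle>\<close>, given by the two
  corner entries \<open>(x, y)\<close> (\<open>dist_corner\<close>).  The determinant along such a graph is
  \<open>(x b + y c) q2 + q3\<close> with a binary quadratic form \<open>q2\<close> and a binary cubic form \<open>q3\<close> that
  do not depend on \<open>x, y\<close>, and the point over \<open>p\<close>, if singular, is hyperbolic exactly when \<open>-q2 p\<close>
  is a square.

  For \<open>\<Sigma>\<^sub>1\<close> to \<open>\<Sigma>\<^sub>1\<^sub>0\<close> and \<open>\<Sigma>\<^sub>1\<^sub>5\<close> the roots of the determinant are explicit, and the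
  types of the lines depend on simple quadratic characters of \<open>x, y\<close>, which are counted. For
  \<open>\<Sigma>\<^sub>1\<^sub>1\<close> to \<open>\<Sigma>\<^sub>1\<^sub>4\<close> the forms \<open>q2\<close> and \<open>q3\<close> have no common root.  Then each \<open>p\<close> with
  \<open>q2 p \<noteq> 0\<close> has \<open>q\<close> lines with a singular point over it, two such \<open>p\<close> have one in common,
  and one line is tangent over each; counting incidences, pairs and tangents expresses all line numbers by
  the numbers \<open>h\<close> and \<open>n\<close> of hyperbolic and elliptic \<open>p\<close> and by the number of lines of type
  \<open>o16\<close> (\<open>count_equations\<close>, \<open>line_counts\<close>).  The latter are the lines whose cubic is a multiple of
  the cube of a linear form (\<open>o16_iff_cube\<close>), so they are the solutions of a small system, and here
  cube roots of unity, the residue of \<open>q\<close> modulo three and the condition on \<open>c\<close> in \<open>\<Sigma>\<^sub>1\<^sub>4\<close>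
  come in.
\<close>

section \<open>Squares and cube roots of unity in a finite field\<close>

lemma of_nat_card_eq_0: "of_nat CARD('a) = (0::'a::{field,finite})"
proof -
  have "(\<Sum>x\<in>(UNIV::'a set). x + 1) = (\<Sum>x\<in>UNIV. x)"
    by (rule sum.reindex_bij_witness[of _ "\<lambda>x. x - 1" "\<lambda>x. x + 1"]) auto
  then show ?thesis by (simp add: sum.distrib)
qed

lemma two_neq_0:
  assumes "odd CARD('a::{field,finite})" shows "(2::'a) \<noteq> 0"
proof
  assume 2: "(2::'a) = 0"
  obtain k where "CARD('a) = 2 * k + 1" using assms oddE by blast
  then have "of_nat CARD('a) = 2 * of_nat k + (1::'a)" by simp
  with 2 of_nat_card_eq_0[where 'a='a] show False by simp
qed

text \<open>Orbits of a permutation of order three have one or three elements.\<close>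

lemma card_mod_3_fixpoints:
  assumes "finite A" "\<And>x. x \<in> A \<Longrightarrow> f x \<in> A" "\<And>x. x \<in> A \<Longrightarrow> f (f (f x)) = x"
  shows "card A mod 3 = card {x\<in>A. f x = x} mod 3"
  using assms
proof (induction "card A" arbitrary: A rule: less_induct)
  case less
  show ?case
  proof (cases "\<forall>x\<in>A. f x = x")
    case True
    then have "{x\<in>A. f x = x} = A" by auto
    then show ?thesis by simp
  next
    case False
    then obtain x where x: "x \<in> A" "f x \<noteq> x" by auto
    let ?O = "{x, f x, f (f x)}"
    have ne: "f (f x) \<noteq> x" "f (f x) \<noteq> f x"
      using x less.prems(2,3) by metis+
    have cO: "card ?O = 3" using x ne by auto
    have sub: "?O \<subseteq> A" using x less.prems(2) by auto
    have cA: "card A = card (A - ?O) + 3"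
      using sub cO less.prems(1) by (metis card_Diff_subset card_mono finite_subset le_add_diff_inverse2)
    have clo: "f y \<in> A - ?O" if "y \<in> A - ?O" for y
      using that x less.prems(2,3) by (metis Diff_iff insertCI insertE singletonD)
    have "card (A - ?O) mod 3 = card {y\<in>A - ?O. f y = y} mod 3"
      by (rule less.hyps) (use cA less.prems clo in auto)
    moreover have "{y\<in>A - ?O. f y = y} = {y\<in>A. f y = y}"
      using x ne less.prems(3) by auto
    ultimately show ?thesis using cA by simp
  qed
qed

lemma sum_0_triples: "card {(a,b,c::'a::{field,finite}). a + b + c = 0} = CARD('a)^2"
proof -
  have "bij_betw (\<lambda>(a,b). (a, b, - a - b)) (UNIV::('a\<times>'a) set) {(a,b,c). a + b + c = 0}"
    by (rule bij_betwI[where g="\<lambda>(a,b,c). (a,b)"]) (auto simp: algebra_simps add_eq_0_iff)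
  then show ?thesis
    by (simp add: bij_betw_same_card[symmetric] power2_eq_square)
qed

lemma three_eq_0_iff: 
  assumes "odd CARD('a)"
  shows "(3::'a::{field,finite}) = 0 \<longleftrightarrow> CARD('a) mod 3 = 0"
proof
  assume 3: "(3::'a) = 0"
  have "of_nat CARD('a) = of_nat (3 * (CARD('a) div 3) + CARD('a) mod 3)" by simp
  also have "\<dots> = 3 * of_nat (CARD('a) div 3) + (of_nat (CARD('a) mod 3) :: 'a)"
    by (simp only: of_nat_add of_nat_mult of_nat_numeral)
  finally have *: "of_nat (CARD('a) mod 3) = (0::'a)"
    using 3 of_nat_card_eq_0[where 'a='a] by simp
  have "CARD('a) mod 3 \<in> {0,1,2}" by auto
  then show "CARD('a) mod 3 = 0"
    using * two_neq_0[OF assms] by auto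
next
  assume q: "CARD('a) mod 3 = 0"
  show "(3::'a) = 0"
  proof (rule ccontr)
    assume 3: "(3::'a) \<noteq> 0"
    let ?A = "{(a,b,c::'a). a + b + c = 0}"
    have "card ?A mod 3 = card {x\<in>?A. (\<lambda>(a,b,c). (b,c,a)) x = x} mod 3"
      by (rule card_mod_3_fixpoints) (auto simp: algebra_simps)
    also have "{x\<in>?A. (\<lambda>(a,b,c). (b,c,a)) x = x} = {(0,0,0)}"
    proof -
      have "a + a + a = 3 * a" for a::'a by simp
      then show ?thesis using 3 by auto
    qed
    finally show False using q unfolding sum_0_triples by (simp add: power_mod[symmetric] power2_eq_square mod_mult_eq[symmetric])
  qed
qed

lemma card_sqrts:
  assumes "(2::'a::field) \<noteq> 0"
  shows "card {z::'a. z^2 = d} = (if d = 0 then 1 else if is_square d then 2 else 0)"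
proof (cases "is_square d")
  case True
  then obtain r where r: "d = r^2" by (auto simp: is_nth_power_def)
  have eq: "{z::'a. z^2 = d} = {r, -r}" unfolding r by (auto simp: power2_eq_iff)
  have "r = - r \<longleftrightarrow> r = 0"
    using assms by (metis add.inverse_neutral eq_neg_iff_add_eq_0 mult_2 mult_eq_0_iff)
  with True r show ?thesis unfolding eq by (cases "r = 0") (simp_all add: card_insert_if)
next
  case False
  then have "{z::'a. z^2 = d} = {}" by (auto simp: is_nth_power_def)
  with False show ?thesis by auto
qed

definition squares :: "'a::field set" where "squares = {x. x \<noteq> 0 \<and> is_square x}"
definition nonsquares :: "'a::field set" where "nonsquares = {x. \<not> is_square x}"

lemma card_squares:
  assumes "odd CARD('a::{field,finite})"
  shows "2 * card (squares::'a set) + 1 = CARD('a)"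
proof -
  have two: "(2::'a) \<noteq> 0" using assms by (rule two_neq_0)
  have "card (UNIV - {0::'a}) = (\<Sum>x\<in>UNIV-{0::'a}. 1)" by simp
  also have "\<dots> = (\<Sum>y\<in>(\<lambda>x. x^2) ` (UNIV-{0::'a}). \<Sum>x\<in>{x. x \<in> UNIV-{0} \<and> x^2 = y}. (1::nat))"
    by (rule sum.image_gen) simp
  also have "(\<lambda>x. x^2) ` (UNIV-{0::'a}) = squares"
    by (auto simp: squares_def is_nth_power_def)
  also have "(\<Sum>y\<in>(squares::'a set). \<Sum>x\<in>{x. x \<in> UNIV-{0} \<and> x^2 = y}. (1::nat)) = (\<Sum>y\<in>(squares::'a set). (2::nat))"
  proof (rule sum.cong[OF refl])
    fix y :: 'a assume y: "y \<in> squares"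
    then have "{x. x \<in> UNIV-{0} \<and> x^2 = y} = {x. x^2 = y}" by (auto simp: squares_def)
    then show "(\<Sum>x\<in>{x. x \<in> UNIV-{0} \<and> x^2 = y}. (1::nat)) = 2"
      using y card_sqrts[OF two, of y] by (simp add: squares_def)
  qed
  finally have "card (UNIV - {0::'a}) = 2 * card (squares::'a set)" by simp
  moreover have "card (UNIV - {0::'a}) = CARD('a) - 1" by simp
  moreover have "CARD('a) > 0" by simp
  ultimately show ?thesis by linarith
qed

lemma UNIV_squares: "(UNIV::'a::field set) = {0} \<union> (squares \<union> nonsquares)"
  by (auto simp: squares_def nonsquares_def)

lemma card_nonsquares:
  assumes "odd CARD('a::{field,finite})"
  shows "card (nonsquares::'a set) = card (squares::'a set)"
proof -
  have "CARD('a) = card ({0::'a} \<union> (squares \<union> nonsquares))"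
    by (subst UNIV_squares) simp
  also have "\<dots> = 1 + (card (squares::'a set) + card (nonsquares::'a set))"
    by (subst card_Un_disjoint, simp, simp, force simp: squares_def nonsquares_def)+ simp
  finally show ?thesis using card_squares[OF assms] by simp
qed

lemma is_square_mult: "is_square a \<Longrightarrow> is_square b \<Longrightarrow> is_square (a * b :: 'a::field)"
  by (metis is_nth_power_def power_mult_distrib)

lemma is_square_mult_square [simp]:
  "r \<noteq> 0 \<Longrightarrow> is_square (r^2 * a) \<longleftrightarrow> is_square (a::'a::field)"
proof
  assume r: "r \<noteq> 0" and "is_square (r^2 * a)"
  then obtain y where "r^2 * a = y^2" by (auto simp: is_nth_power_def)
  then have "a = (y / r)^2" using r by (simp add: power_divide field_simps)
  then show "is_square a" by (auto simp: is_nth_power_def)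
qed (auto intro: is_square_mult)

text \<open>Multiplication by a nonsquare maps the squares into the nonsquares; since there are
  equally many of each, it maps the nonsquares into the squares.\<close>

lemma is_square_mult_iff:
  fixes a b :: "'a::{field,finite}"
  assumes "odd CARD('a)" "a \<noteq> 0" "b \<noteq> 0"
  shows "is_square (a * b) \<longleftrightarrow> (is_square a \<longleftrightarrow> is_square b)"
proof -
  have *: "is_square (x * y) \<longleftrightarrow> is_square y" if "is_square x" "x \<noteq> 0" for x y :: 'a
  proof -
    from that obtain r where "x = r^2" "r \<noteq> 0" by (auto simp: is_nth_power_def)
    then show ?thesis by simp
  qed
  have "is_square (a * b)" if na: "\<not> is_square a" and nb: "\<not> is_square b"
  proof -
    have sub: "(\<lambda>x. a * x) ` squares \<subseteq> nonsquares"
      using na by (auto simp: squares_def nonsquares_def) (metis * mult.commute)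
    have "card ((\<lambda>x. a * x) ` squares) = card (squares::'a set)"
      by (rule card_image) (use assms in \<open>auto simp: inj_on_def\<close>)
    then have "(\<lambda>x. a * x) ` squares = nonsquares"
      using sub card_nonsquares[OF assms(1)] by (intro card_subset_eq) auto
    moreover have "a * b \<notin> (\<lambda>x. a * x) ` squares"
      using nb assms by (auto simp: squares_def)
    ultimately show ?thesis by (auto simp: nonsquares_def)
  qed
  then show ?thesis using * assms by (metis mult.commute)
qed

text \<open>Rotating triples of product one counts the cube roots of unity modulo three; besides
  one they are the roots of \<open>x\<^sup>2 + x + 1\<close>, whose discriminant is \<open>-3\<close>.\<close>

lemma is_square_minus_3_iff:
  assumes "odd CARD('a)" "(3::'a::{field,finite}) \<noteq> 0"
  shows "is_square (- 3 :: 'a) \<longleftrightarrow> CARD('a) mod 3 = 1"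
proof -
  have two: "(2::'a) \<noteq> 0" using assms by (intro two_neq_0)
  let ?A = "{(a,b,c::'a). a * b * c = 1}"
  let ?U = "UNIV - {0::'a}"
  have "c = inverse (a * b)" if "a * b * c = 1" for a b c :: 'a
    using that by (metis inverse_unique)
  then have "bij_betw (\<lambda>(a,b). (a, b, inverse (a * b))) (?U \<times> ?U) ?A"
    by (intro bij_betwI[where g="\<lambda>(a,b,c). (a,b)"]) (auto simp del: inverse_mult_distrib, metis mult_eq_0_iff right_inverse)
  then have cA: "card ?A = (CARD('a) - 1)^2"
    by (simp add: bij_betw_same_card[symmetric] power2_eq_square card_cartesian_product)
  have "card ?A mod 3 = card {x\<in>?A. (\<lambda>(a,b,c). (b,c,a)) x = x} mod 3"
    by (rule card_mod_3_fixpoints) (auto simp: algebra_simps)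
  also have "{x\<in>?A. (\<lambda>(a,b,c). (b,c,a)) x = x} = (\<lambda>a. (a,a,a)) ` {a. a^3 = 1}"
    by (auto simp: power3_eq_cube)
  also have "card \<dots> = card {a::'a. a^3 = 1}"
    by (rule card_image) (auto simp: inj_on_def)
  also have "{a::'a. a^3 = 1} = insert 1 ((\<lambda>z. (z - 1) / 2) ` {z. z^2 = -3})"
  proof -
    have *: "a^3 = 1 \<longleftrightarrow> a = 1 \<or> (2 * a + 1)^2 = -3" for a :: 'a
    proof -
      have "4 * (a^3 - 1) = (a - 1) * ((2*a+1)^2 - (-3))"
        by (simp add: power2_eq_square power3_eq_cube algebra_simps)
      moreover have "(4::'a) \<noteq> 0" using two by (metis mult_2 mult_eq_0_iff numeral_Bit0)
      ultimately show ?thesis by (metis eq_iff_diff_eq_0 mult_eq_0_iff)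
    qed
    show ?thesis
    proof (intro Set.set_eqI iffI)
      fix a :: 'a assume "a \<in> {a. a^3 = 1}"
      then consider "a = 1" | "(2 * a + 1)^2 = -3" using * by auto
      then show "a \<in> insert 1 ((\<lambda>z. (z - 1) / 2) ` {z. z^2 = -3})"
        by cases (use two in \<open>auto intro!: image_eqI[of _ _ "2 * a + 1"]\<close>)
    next
      fix a :: 'a assume "a \<in> insert 1 ((\<lambda>z. (z - 1) / 2) ` {z. z^2 = -3})"
      then have "a = 1 \<or> (2 * a + 1)^2 = -3"
      proof
        assume "a \<in> (\<lambda>z. (z - 1) / 2) ` {z. z^2 = -3}"
        then obtain z where "a = (z - 1) / 2" "z^2 = -3" by blast
        moreover from this have "2 * a + 1 = z" using two by (simp add: mult.commute)
        ultimately show ?thesis by simp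
      qed simp
      then show "a \<in> {a. a^3 = 1}" using * by auto
    qed
  qed
  also have "card \<dots> = 1 + card {z::'a. z^2 = -3}"
  proof -
    have "1 \<notin> (\<lambda>z. (z - 1) / 2) ` {z::'a. z^2 = -3}"
    proof
      assume "1 \<in> (\<lambda>z. (z - 1) / 2) ` {z::'a. z^2 = -3}"
      then obtain z :: 'a where z: "1 = (z - 1) / 2" "z^2 = -3" by auto
      then have "z = 3" using two by (simp add: field_simps)
      then have "(2 * 2 * 3 :: 'a) = 0" using z by simp
      then show False using two assms(2) by (metis mult_eq_0_iff)
    qed
    moreover have "card ((\<lambda>z. (z - 1) / 2) ` {z::'a. z^2 = -3}) = card {z::'a. z^2 = -3}"
      by (rule card_image) (use two in \<open>auto simp: inj_on_def\<close>)
    ultimately show ?thesis by simp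
  qed
  finally have *: "(CARD('a) - 1)^2 mod 3 = (1 + card {z::'a. z^2 = -3}) mod 3" using cA by simp
  have pos: "CARD('a) > 0" by simp
  obtain n where n: "CARD('a) = Suc n" using pos by (metis gr0_implies_Suc)
  have sq: "(CARD('a) - 1)^2 mod 3 = (if CARD('a) mod 3 = 1 then 0 else 1)"
  proof -
    have "n^2 mod 3 = (n mod 3)^2 mod 3" by (simp add: power_mod)
    moreover have "n mod 3 = 0 \<or> n mod 3 = 1 \<or> n mod 3 = 2" by auto
    ultimately show ?thesis unfolding n by (elim disjE) (auto simp: mod_Suc)
  qed
  show ?thesis
    using * sq card_sqrts[OF two, of "-3"] assms(2) by (auto split: if_splits)
qed

section \<open>Symmetric matrices and congruence\<close>

no_notation fps_nth (infixl "$" 75)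

definition S :: "'a::field \<Rightarrow> 'a \<Rightarrow> 'a \<Rightarrow> 'a \<Rightarrow> 'a \<Rightarrow> 'a \<Rightarrow> 'a^3^3" where
  "S a b c d e f = mat3 [[a, b, c], [b, d, e], [c, e, f]]"

definition act :: "'a::field^3^3 \<Rightarrow> 'a^3^3 \<Rightarrow> 'a^3^3" where
  "act A M = A ** M ** transpose A"

lemma mat3_nth [simp]:
  "mat3 [[a,b,c],[d,e,f],[g,h,i]] $ 1 $ 1 = a" "mat3 [[a,b,c],[d,e,f],[g,h,i]] $ 1 $ 2 = b"
  "mat3 [[a,b,c],[d,e,f],[g,h,i]] $ 1 $ 3 = c" "mat3 [[a,b,c],[d,e,f],[g,h,i]] $ 2 $ 1 = d"
  "mat3 [[a,b,c],[d,e,f],[g,h,i]] $ 2 $ 2 = e" "mat3 [[a,b,c],[d,e,f],[g,h,i]] $ 2 $ 3 = f"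
  "mat3 [[a,b,c],[d,e,f],[g,h,i]] $ 3 $ 1 = g" "mat3 [[a,b,c],[d,e,f],[g,h,i]] $ 3 $ 2 = h"
  "mat3 [[a,b,c],[d,e,f],[g,h,i]] $ 3 $ 3 = i"
  by (simp_all add: mat3_def)

lemma mat3_eqI:
  fixes M N :: "'a::field^3^3"
  assumes "M$1$1 = N$1$1" "M$1$2 = N$1$2" "M$1$3 = N$1$3" "M$2$1 = N$2$1" "M$2$2 = N$2$2"
    "M$2$3 = N$2$3" "M$3$1 = N$3$1" "M$3$2 = N$3$2" "M$3$3 = N$3$3"
  shows "M = N"
  using assms by (simp add: vec_eq_iff forall_3)

lemma S_eq_iff [simp]:
  "S a b c d e f = S a' b' c' d' e' f' \<longleftrightarrow> a = a' \<and> b = b' \<and> c = c' \<and> d = d' \<and> e = e' \<and> f = f'"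
proof
  assume "S a b c d e f = S a' b' c' d' e' f'"
  then have "S a b c d e f $ i $ j = S a' b' c' d' e' f' $ i $ j" for i j by simp
  from this[of 1 1] this[of 1 2] this[of 1 3] this[of 2 2] this[of 2 3] this[of 3 3]
  show "a = a' \<and> b = b' \<and> c = c' \<and> d = d' \<and> e = e' \<and> f = f'" by (simp add: S_def)
qed simp

lemma S_0: "S 0 0 0 0 0 0 = 0"
  by (rule mat3_eqI) (simp_all add: S_def)

lemma S_eq_0_iff [simp]: 
  "S a b c d e f = 0 \<longleftrightarrow> a = 0 \<and> b = 0 \<and> c = 0 \<and> d = 0 \<and> e = 0 \<and> f = 0"
  unfolding S_0[symmetric] by simp

lemma mscale_S [simp]: "mscale k (S a b c d e f) = S (k*a) (k*b) (k*c) (k*d) (k*e) (k*f)"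
  by (rule mat3_eqI) (simp_all add: S_def mscale_def)

lemma S_add [simp]:
  "S a b c d e f + S a' b' c' d' e' f' = S (a+a') (b+b') (c+c') (d+d') (e+e') (f+f')"
  by (rule mat3_eqI) (simp_all add: S_def)

lemma symmetric_cases:
  fixes M :: "'a::field^3^3"
  assumes "transpose M = M"
  obtains a b c d e f where "M = S a b c d e f"
proof -
  have "M $ i $ j = M $ j $ i" for i j
    by (subst assms[symmetric]) (simp add: transpose_def)
  then have "M = S (M$1$1) (M$1$2) (M$1$3) (M$2$2) (M$2$3) (M$3$3)"
    by (intro mat3_eqI) (simp_all add: S_def)
  then show ?thesis by (rule that)
qed

lemma transpose_S [simp]: "transpose (S a b c d e f) = S a b c d e f"
  by (rule mat3_eqI) (simp_all add: S_def transpose_def)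

lemma det_S: "det (S a b c d e f) = a*d*f + 2*b*c*e - a*e^2 - d*c^2 - f*b^2"
  by (simp add: S_def det_3 power2_eq_square algebra_simps)

lemma act_S:
  "act (mat3 [[x1,x2,x3],[y1,y2,y3],[z1,z2,z3]]) (S a b c d e f) = 
   S (a*x1*x1 + d*x2*x2 + f*x3*x3 + b*(x1*x2+x2*x1) + c*(x1*x3+x3*x1) + e*(x2*x3+x3*x2))
     (a*x1*y1 + d*x2*y2 + f*x3*y3 + b*(x1*y2+x2*y1) + c*(x1*y3+x3*y1) + e*(x2*y3+x3*y2))
     (a*x1*z1 + d*x2*z2 + f*x3*z3 + b*(x1*z2+x2*z1) + c*(x1*z3+x3*z1) + e*(x2*z3+x3*z2))
     (a*y1*y1 + d*y2*y2 + f*y3*y3 + b*(y1*y2+y2*y1) + c*(y1*y3+y3*y1) + e*(y2*y3+y3*y2))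
     (a*y1*z1 + d*y2*z2 + f*y3*z3 + b*(y1*z2+y2*z1) + c*(y1*z3+y3*z1) + e*(y2*z3+y3*z2))
     (a*z1*z1 + d*z2*z2 + f*z3*z3 + b*(z1*z2+z2*z1) + c*(z1*z3+z3*z1) + e*(z2*z3+z3*z2))"
  unfolding act_def
  by (rule mat3_eqI) (simp_all add: S_def matrix_matrix_mult_def transpose_def sum_3 algebra_simps)

lemma act_act: "act A (act B M) = act (A ** B) M"
  by (simp add: act_def matrix_transpose_mul matrix_mul_assoc)

lemma act_mat_1 [simp]: "act (mat 1) M = M"
  by (simp add: act_def transpose_mat)

lemma act_add: "act A (M + N) = act A M + act A N"
  by (simp add: act_def vec_eq_iff matrix_matrix_mult_def sum.distrib algebra_simps)

lemma act_mscale: "act A (mscale k M) = mscale k (act A M)"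
  unfolding act_def mscale_def
  by (simp add: vec_eq_iff matrix_matrix_mult_def sum_distrib_left sum_distrib_right mult_ac)

lemma act_0 [simp]: "act A 0 = 0"
  by (simp add: act_def)

lemma invertible_inverse:
  assumes "invertible A" obtains B where "invertible B" "A ** B = mat 1" "B ** A = mat 1"
  using assms unfolding invertible_def by blast

lemma act_cancel: "B ** A = mat 1 \<Longrightarrow> act B (act A M) = M"
  by (simp add: act_act)

lemma act_eq_iff [simp]: "invertible A \<Longrightarrow> act A M = act A N \<longleftrightarrow> M = N"
  by (metis act_cancel invertible_inverse)

lemma act_eq_0_iff [simp]: "invertible A \<Longrightarrow> act A M = 0 \<longleftrightarrow> M = 0"
  by (metis act_eq_iff act_0)

lemma transpose_act: "transpose M = M \<Longrightarrow> transpose (act A M) = act A M"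
  by (simp add: act_def matrix_transpose_mul matrix_mul_assoc)

lemma det_act_eq_0_iff [simp]: "invertible A \<Longrightarrow> det (act A M) = 0 \<longleftrightarrow> det M = (0::'a::field)"
  by (simp add: act_def det_mul invertible_det_nz)

lemma invertible_mat3:
  "invertible (mat3 [[x1,x2,x3],[y1,y2,y3],[z1,z2,z3]] :: 'a::field^3^3) \<longleftrightarrow>
   x1*(y2*z3 - y3*z2) - x2*(y1*z3 - y3*z1) + x3*(y1*z2 - y2*z1) \<noteq> 0"
  by (simp add: invertible_det_nz det_3 algebra_simps)

section \<open>Lines\<close>

definition span2 :: "'a::field^3^3 \<Rightarrow> 'a^3^3 \<Rightarrow> ('a^3^3) set" where
  "span2 M N = {mscale s M + mscale t N | s t. True}"

definition indep2 :: "'a::field^3^3 \<Rightarrow> 'a^3^3 \<Rightarrow> bool" where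
  "indep2 M N \<longleftrightarrow> (\<forall>s t. mscale s M + mscale t N = 0 \<longrightarrow> s = 0 \<and> t = 0)"

lemma mscale_1 [simp]: "mscale 1 M = M"
  and mscale_0 [simp]: "mscale 0 M = 0"
  and mscale_0_right [simp]: "mscale k 0 = 0"
  and mscale_mscale: "mscale k (mscale l M) = mscale (k * l) M"
  and mscale_add: "mscale (k + l) M = mscale k M + mscale l M"
  and mscale_add_right: "mscale k (M + N) = mscale k M + mscale k N"
  by (simp_all add: mscale_def vec_eq_iff algebra_simps)

lemma mscale_eq_0_iff [simp]: "mscale k M = 0 \<longleftrightarrow> k = 0 \<or> M = 0"
  by (rule mvec.scale_eq_0_iff)

lemma span2_eq_span: "span2 M N = mvec.span {M, N}"
  by (auto simp: span2_def mvec.span_insert mvec.span_singleton algebra_simps)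

lemma indep2_iff: "indep2 M N \<longleftrightarrow> mvec.independent {M, N} \<and> M \<noteq> N"
proof
  assume i: "indep2 M N"
  have N0: "N \<noteq> 0" using i[unfolded indep2_def, rule_format, of 0 1] by auto
  have "M \<noteq> mscale t N" for t
    using i[unfolded indep2_def, rule_format, of 1 "-t"] by auto
  then have "M \<notin> mvec.span {N}" by (auto simp: mvec.span_singleton)
  then show "mvec.independent {M, N} \<and> M \<noteq> N" using N0
    by (metis mvec.dependent_single mvec.independent_insert mvec.span_base singletonI)
next
  assume i: "mvec.independent {M, N} \<and> M \<noteq> N"
  show "indep2 M N" unfolding indep2_def
  proof (intro allI impI)
    fix s t assume st: "mscale s M + mscale t N = 0"
    have "N \<noteq> M" using i by auto
    then have "(\<Sum>v\<in>{M,N}. mscale (if v = M then s else t) v) = 0" using st i by simp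
    then have "\<forall>v\<in>{M,N}. (if v = M then s else t) = 0"
      using i by (intro ballI) (rule mvec.independentD[of "{M,N}" "{M,N}"], auto)
    then show "s = 0 \<and> t = 0" using i by (auto split: if_splits)
  qed
qed

lemma PG5_line_iff:
  "PG5_line L \<longleftrightarrow> (\<exists>M N. transpose M = M \<and> transpose N = N \<and> indep2 M N \<and> L = span2 M N)"
proof
  assume L: "PG5_line L"
  then obtain B where B: "B \<subseteq> L" "mvec.independent B" "L \<subseteq> mvec.span B" "card B = mvec.dim L"
    using mvec.basis_exists by blast
  then obtain M N where MN: "B = {M,N}" "M \<noteq> N" using L by (metis PG5_line_def card_2_iff)
  have "L = span2 M N" using B MN L unfolding span2_eq_span PG5_line_def
    by (metis mvec.span_minimal subset_antisym)
  with B MN L show "\<exists>M N. transpose M = M \<and> transpose N = N \<and> indep2 M N \<and> L = span2 M N"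
    unfolding indep2_iff PG5_line_def by blast
next
  assume "\<exists>M N. transpose M = M \<and> transpose N = N \<and> indep2 M N \<and> L = span2 M N"
  then obtain M N where MN: "transpose M = M" "transpose N = N" "indep2 M N" "L = span2 M N" by blast
  have "transpose (mscale s M + mscale t N) = mscale s M + mscale t N" for s t
    using MN(1,2) by (simp add: transpose_def mscale_def vec_eq_iff)
  moreover have "mvec.dim L = 2"
    using MN unfolding indep2_iff span2_eq_span
    by (simp add: mvec.dim_span mvec.dim_eq_card_independent)
  moreover have "mvec.subspace L"
    unfolding MN(4) span2_eq_span by (rule mvec.subspace_span)
  ultimately show "PG5_line L"
    using MN unfolding PG5_line_def by (auto simp: span2_def[of M N] simp flip: span2_eq_span)
qed

lemma span2_rebase:
  assumes "p * s - q * r \<noteq> 0"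
  shows "span2 (mscale p M + mscale q N) (mscale r M + mscale s N) = span2 M N"
proof (intro Set.set_eqI iffI)
  fix Z assume "Z \<in> span2 (mscale p M + mscale q N) (mscale r M + mscale s N)"
  then obtain x y where "Z = mscale x (mscale p M + mscale q N) + mscale y (mscale r M + mscale s N)"
    by (auto simp: span2_def)
  then have "Z = mscale (x * p+y * r) M + mscale (x * q+y * s) N"
    by (simp add: mscale_def vec_eq_iff algebra_simps)
  then show "Z \<in> span2 M N" by (auto simp: span2_def)
next
  fix Z assume "Z \<in> span2 M N"
  then obtain x y where Z: "Z = mscale x M + mscale y N" by (auto simp: span2_def)
  define D where "D = p * s - q * r"
  have D: "D \<noteq> 0" "D = p * s - q * r" using assms by (auto simp: D_def)
  let ?x = "(x * s - y * r) / D" and ?y = "(y * p - x * q) / D"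
  have c: "?x * p + ?y * r = x" "?x * q + ?y * s = y"
    using D(1) by (simp_all add: field_simps) (simp_all add: D(2) algebra_simps)
  have "mscale ?x (mscale p M + mscale q N) + mscale ?y (mscale r M + mscale s N) = 
        mscale (?x * p + ?y * r) M + mscale (?x * q + ?y * s) N"
    by (simp only: mscale_add_right mscale_add mscale_mscale) (simp add: algebra_simps)
  then have "Z = mscale ?x (mscale p M + mscale q N) + mscale ?y (mscale r M + mscale s N)" 
    unfolding c Z ..
  then show "Z \<in> span2 (mscale p M + mscale q N) (mscale r M + mscale s N)"
    unfolding span2_def by blast
qed

lemma indep2_rebase:
  assumes "p * s - q * r \<noteq> 0" "indep2 M N"
  shows "indep2 (mscale p M + mscale q N) (mscale r M + mscale s N)"
  unfolding indep2_def
proof (intro allI impI)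
  fix x y assume "mscale x (mscale p M + mscale q N) + mscale y (mscale r M + mscale s N) = 0"
  then have "mscale (x * p+y * r) M + mscale (x * q+y * s) N = 0"
    by (simp add: mscale_def vec_eq_iff algebra_simps)
  then have e: "x * p+y * r = 0" "x * q+y * s = 0" using assms(2) by (auto simp: indep2_def)
  have "x * (p * s-q * r) = s * (x * p+y * r) - r * (x * q+y * s)" "y * (p * s-q * r) = p * (x * q+y * s) - q * (x * p+y * r)"
    by (simp_all add: algebra_simps)
  then show "x = 0 \<and> y = 0" using e assms(1) by simp
qed

lemma act_span2: "act A ` span2 M N = span2 (act A M) (act A N)"
  by (force simp: span2_def act_add act_mscale)

lemma indep2_act: "invertible A \<Longrightarrow> indep2 (act A M) (act A N) \<longleftrightarrow> indep2 M N"
  unfolding indep2_def act_mscale[symmetric] act_add[symmetric] by simp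

lemma K_orbit_def': "K_orbit L = {act A ` L | A. invertible A}"
  by (simp add: K_orbit_def act_def[abs_def])

definition cong_line :: "('a::field^3^3) set \<Rightarrow> ('a^3^3) set \<Rightarrow> bool"  (infix "\<sim>\<^sub>K" 50) where
  "L \<sim>\<^sub>K L' \<longleftrightarrow> L' \<in> K_orbit L"

lemma cong_line_refl: "L \<sim>\<^sub>K L"
  unfolding cong_line_def K_orbit_def'
  by (auto intro!: exI[of _ "mat 1"] simp: invertible_def)

lemma cong_line_sym: "L \<sim>\<^sub>K L' \<Longrightarrow> L' \<sim>\<^sub>K L"
proof -
  assume "L \<sim>\<^sub>K L'"
  then obtain A where A: "invertible A" "L' = act A ` L" by (auto simp: cong_line_def K_orbit_def')
  then obtain B where "invertible B" "B ** A = mat 1" by (metis invertible_inverse)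
  moreover from this have "L = act B ` L'" using A by (auto simp: image_image act_act)
  ultimately show ?thesis by (auto simp: cong_line_def K_orbit_def')
qed

lemma cong_line_trans [trans]: "L \<sim>\<^sub>K L' \<Longrightarrow> L' \<sim>\<^sub>K L'' \<Longrightarrow> L \<sim>\<^sub>K L''"
  unfolding cong_line_def K_orbit_def' by (auto simp: image_image act_act) (metis invertible_mult)

lemma cong_line_act: "invertible A \<Longrightarrow> L \<sim>\<^sub>K act A ` L"
  by (auto simp: cong_line_def K_orbit_def')

text \<open>Two lines are congruent as soon as some congruence maps a basis of one to
  combinations of the basis of the other.\<close>

lemma cong_lineI:
  assumes "invertible A" "p * s - q * r \<noteq> 0"
    and "M' = mscale p (act A M) + mscale q (act A N)" "N' = mscale r (act A M) + mscale s (act A N)"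
  shows "span2 M N \<sim>\<^sub>K span2 M' N'"
  using cong_line_act[OF assms(1), of "span2 M N"] span2_rebase[OF assms(2)] assms(3,4)
  by (simp add: act_span2)

section \<open>Points of a line\<close>

text \<open>Representatives of the points of the projective line.\<close>

definition P1 :: "('a::field \<times> 'a) set" where
  "P1 = insert (0, 1) ((\<lambda>t. (1, t)) ` UNIV)"

lemma P1_cases: "p \<in> P1 \<Longrightarrow> (p = (0,1) \<Longrightarrow> R) \<Longrightarrow> (\<And>t. p = (1,t) \<Longrightarrow> R) \<Longrightarrow> R"
  by (auto simp: P1_def)

lemma P1_I [simp, intro]: "(0,1) \<in> P1" "(1,t) \<in> P1" by (auto simp: P1_def)

lemma finite_P1 [simp]: "finite (P1::('a::{field,finite}\<times>'a) set)" by simp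

lemma P1_nonzero: "(b,c) \<in> P1 \<Longrightarrow> b \<noteq> 0 \<or> c \<noteq> 0" by (auto simp: P1_def)

lemma card_P1_Collect:
  "card {p\<in>P1. Q p} = card {t::'a::{field,finite}. Q (1,t)} + (if Q (0,1) then 1 else 0)"
proof -
  have "{p\<in>P1. Q p} = (\<lambda>t. (1,t)) ` {t::'a. Q (1,t)} \<union> {p. p = (0,1) \<and> Q p}"
    by (auto simp: P1_def)
  moreover have "card ((\<lambda>t. (1::'a,t)) ` {t::'a. Q (1,t)}) = card {t. Q (1,t)}"
    by (rule card_image) (auto simp: inj_on_def)
  moreover have "{p. p = (0,1) \<and> Q p} = (if Q (0::'a,1) then {(0,1)} else {})" by auto
  moreover have "(0,1) \<notin> (\<lambda>t. (1::'a,t)) ` {t::'a. Q (1,t)}" by auto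
  ultimately show ?thesis by auto
qed

lemma P1_normalize:
  fixes b c :: "'a::field"
  assumes "b \<noteq> 0 \<or> c \<noteq> 0" 
  obtains k b' c' where "k \<noteq> 0" "(b',c') \<in> P1" "b = k * b'" "c = k * c'"
proof (cases "b = 0")
  case True then show ?thesis using assms that[of c 0 1] by auto
next
  case False then show ?thesis using that[of b 1 "c / b"] by auto
qed

lemma P1_unique:
  assumes "(b,c) \<in> P1" "(b',c') \<in> P1" "b * c' = b' * (c::'a::field)"
  shows "b = b' \<and> c = c'"
  using assms by (auto simp: P1_def)

definition homog :: "('a::field^3^3 \<Rightarrow> bool) \<Rightarrow> bool" where
  "homog Q \<longleftrightarrow> (\<forall>k M. k \<noteq> 0 \<longrightarrow> Q (mscale k M) = Q M)"

definition pts :: "('a::field^3^3 \<Rightarrow> bool) \<Rightarrow> ('a^3^3) set \<Rightarrow> nat" where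
  "pts Q L = card {M\<in>L. M \<noteq> 0 \<and> Q M} div (CARD('a) - 1)"

text \<open>Each point of a line has \<open>q - 1\<close> nonzero representatives.\<close>

lemma pts_span2:
  fixes M N :: "'a::{field,finite}^3^3"
  assumes i: "indep2 M N" and Q: "homog Q"
  shows "pts Q (span2 M N) = card {p\<in>P1. Q (mscale (fst p) M + mscale (snd p) N)}"
proof -
  let ?m = "\<lambda>p. mscale (fst p) M + mscale (snd p) N"
  let ?P = "{p\<in>P1. Q (?m p)}"
  let ?f = "\<lambda>(k,p). mscale k (?m p)"
  have m: "mscale k (?m p) = mscale (k * fst p) M + mscale (k * snd p) N" for k p
    by (simp add: mscale_add_right mscale_mscale)
  have inj: "x = x' \<and> y = y'" if "mscale x M + mscale y N = mscale x' M + mscale y' N" for x y x' y'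
  proof -
    have "mscale (x - x') M + mscale (y - y') N = 0"
      using that by (simp add: mscale_def vec_eq_iff algebra_simps)
    then show ?thesis using i unfolding indep2_def by (metis eq_iff_diff_eq_0)
  qed
  have nz: "?m p \<noteq> 0" if "p \<in> P1" for p
    using that i unfolding indep2_def by (metis P1_nonzero prod.collapse)
  have "bij_betw ?f ((UNIV - {0}) \<times> ?P) {Z\<in>span2 M N. Z \<noteq> 0 \<and> Q Z}"
  proof (rule bij_betw_imageI)
    show "inj_on ?f ((UNIV - {0}) \<times> ?P)"
    proof (rule inj_onI)
      fix u v assume uv: "u \<in> (UNIV - {0}) \<times> ?P" "v \<in> (UNIV - {0}) \<times> ?P" and f: "?f u = ?f v"
      obtain k b c k' b' c' where u: "u = (k,(b,c))" and v: "v = (k',(b',c'))"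
        by (cases u, cases v) auto
      have h: "k \<noteq> 0" "k' \<noteq> 0" "(b,c) \<in> P1" "(b',c') \<in> P1" using uv u v by auto
      have "mscale k (?m (b,c)) = mscale k' (?m (b',c'))" using f u v by simp
      then have kk: "k * b = k' * b' \<and> k * c = k' * c'"
        unfolding m using inj by simp
      have "k * k' * (b * c') = k * b * (k' * c')" by (simp add: mult_ac)
      also have "\<dots> = k' * b' * (k * c)" using kk by simp
      also have "\<dots> = k * k' * (b' * c)" by (simp add: mult_ac)
      finally have "b * c' = b' * c" using h by simp
      then have bc: "b = b'" "c = c'" using P1_unique h by blast+
      moreover from this have "k = k'" using kk P1_nonzero[OF h(3)] by auto
      ultimately show "u = v" using u v by simp
    qed
    show "?f ` ((UNIV - {0}) \<times> ?P) = {Z\<in>span2 M N. Z \<noteq> 0 \<and> Q Z}"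
    proof (intro Set.set_eqI iffI)
      fix Z assume "Z \<in> ?f ` ((UNIV - {0}) \<times> ?P)"
      then obtain k p where k: "k \<noteq> 0" "p \<in> P1" "Q (?m p)" "Z = mscale k (?m p)" by auto
      moreover have "Z \<in> span2 M N" unfolding k m span2_def by blast
      ultimately show "Z \<in> {Z\<in>span2 M N. Z \<noteq> 0 \<and> Q Z}"
        using Q nz by (auto simp: homog_def)
    next
      fix Z assume Z: "Z \<in> {Z\<in>span2 M N. Z \<noteq> 0 \<and> Q Z}"
      then obtain x y where xy: "Z = mscale x M + mscale y N" by (auto simp: span2_def)
      then have "x \<noteq> 0 \<or> y \<noteq> 0" using Z by auto
      then obtain k b c where k: "k \<noteq> 0" "(b,c) \<in> P1" "x = k * b" "y = k * c" by (rule P1_normalize)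
      then have "Z = mscale k (?m (b,c))" unfolding m xy by simp
      then show "Z \<in> ?f ` ((UNIV - {0}) \<times> ?P)" using Z Q k
        by (auto intro!: image_eqI[of _ _ "(k,(b,c))"] simp: homog_def)
    qed
  qed
  then have "card {Z\<in>span2 M N. Z \<noteq> 0 \<and> Q Z} = (CARD('a) - 1) * card ?P"
    by (simp add: bij_betw_same_card[symmetric] card_cartesian_product)
  moreover have "CARD('a) - 1 > 0"
  proof -
    have "card {0,1::'a} \<le> CARD('a)" by (rule card_mono) auto
    then show ?thesis by simp
  qed
  ultimately show ?thesis unfolding pts_def by simp
qed

lemma pts_act:
  fixes L :: "('a::field^3^3) set"
  assumes "invertible A"
  shows "pts Q (act A ` L) = pts (\<lambda>M. Q (act A M)) L"
proof -
  have "{M\<in>act A ` L. M \<noteq> 0 \<and> Q M} = act A ` {M\<in>L. M \<noteq> 0 \<and> Q (act A M)}"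
    using assms by auto
  moreover have "card (act A ` {M\<in>L. M \<noteq> 0 \<and> Q (act A M)}) = card {M\<in>L. M \<noteq> 0 \<and> Q (act A M)}"
    by (rule card_image) (use assms in \<open>auto simp: inj_on_def\<close>)
  ultimately show ?thesis by (simp add: pts_def)
qed

section \<open>Invariants of a line\<close>

definition rank_one :: "'a::field^3^3 \<Rightarrow> bool" where
  "rank_one M \<longleftrightarrow> M \<noteq> 0 \<and> (\<exists>c a. M = (\<chi> i j. c * a $ i * a $ j))"

text \<open>The quadratic form of \<open>M\<close> is a product of two linear forms over the ground field.\<close>

definition split :: "'a::field^3^3 \<Rightarrow> bool" where
  "split M \<longleftrightarrow> (\<exists>a b. M = (\<chi> i j. a $ i * b $ j + b $ i * a $ j))"

definition hyperbolic :: "'a::field^3^3 \<Rightarrow> bool" where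
  "hyperbolic M \<longleftrightarrow> det M = 0 \<and> \<not> rank_one M \<and> split M"

definition elliptic :: "'a::field^3^3 \<Rightarrow> bool" where
  "elliptic M \<longleftrightarrow> det M = 0 \<and> \<not> rank_one M \<and> \<not> split M"

definition quadf :: "'a::field^3^3 \<Rightarrow> 'a^3 \<Rightarrow> 'a" where
  "quadf M k = (\<Sum>i\<in>UNIV. k $ i * (M *v k) $ i)"

text \<open>The determinant has gradient \<open>k k\<^sup>T\<close>, up to a factor, at a matrix of rank two with kernel
  \<open>k\<close>.  So the following says that the determinant vanishes at least twice at \<open>M\<close> along \<open>L\<close>.\<close>

definition tangent :: "('a::field^3^3) set \<Rightarrow> 'a^3^3 \<Rightarrow> bool" where
  "tangent L M \<longleftrightarrow> M \<noteq> 0 \<and> det M = 0 \<and> \<not> rank_one M \<and> (\<exists>k. k \<noteq> 0 \<and> M *v k = 0 \<and> (\<forall>Z\<in>L. quadf Z k = 0))"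

definition all_singular :: "('a::field^3^3) set \<Rightarrow> bool" where
  "all_singular L \<longleftrightarrow> (\<forall>M\<in>L. det M = 0)"

definition common_kernel :: "('a::field^3^3) set \<Rightarrow> bool" where
  "common_kernel L \<longleftrightarrow> (\<exists>k. k \<noteq> 0 \<and> (\<forall>M\<in>L. M *v k = 0))"

text \<open>The last case covers the one remaining coincidence: a triple point and a simple point
  whose residual quadratic is irreducible.\<close>

definition ltype :: "('a::{field,finite}^3^3) set \<Rightarrow> line_type" where
  "ltype L =
    (let r = pts rank_one L; s = pts hyperbolic L; n = pts elliptic L in
     if r = 2 then o5
     else if r = 1 then
       (if all_singular L then o6 else if s > 0 then o8_1 else if n > 0 then o8_2 else o9)
     else if all_singular L then (if common_kernel L then o10 else o12)
     else if s = 3 then o14_1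
     else if n = 2 then o14_2
     else if s = 2 then o13_1
     else if s = 1 \<and> n = 1 then o13_2
     else if n = 1 then o15_2
     else if s = 0 then o17
     else if pts (tangent L) L = 0 then o15_1 else o16)"

lemma act_outer: 
  "act A (\<chi> i j. a $ i * b $ j) = (\<chi> i j. (A *v a) $ i * (A *v b) $ j)"
  unfolding act_def
  by (simp add: vec_eq_iff matrix_matrix_mult_def matrix_vector_mult_def transpose_def
      sum_distrib_left sum_distrib_right sum_product mult_ac)

lemma split_act_imp: "split M \<Longrightarrow> split (act A M)"
proof -
  assume "split M"
  then obtain a b where M: "M = (\<chi> i j. a $ i * b $ j) + (\<chi> i j. b $ i * a $ j)"
    unfolding split_def by (auto simp: vec_eq_iff)
  show ?thesis unfolding split_def M act_add act_outer
    by (intro exI[of _ "A *v a"] exI[of _ "A *v b"]) (simp add: vec_eq_iff)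
qed

lemma rank_one_act_imp: "rank_one M \<Longrightarrow> invertible A \<Longrightarrow> rank_one (act A M)"
proof -
  assume r: "rank_one M" and A: "invertible A"
  then obtain c a where M: "M = mscale c (\<chi> i j. a $ i * a $ j)"
    unfolding rank_one_def by (auto simp: vec_eq_iff mscale_def mult.assoc)
  have "\<exists>c a. act A M = (\<chi> i j. c * a $ i * a $ j)"
    unfolding M act_mscale act_outer
    by (intro exI[of _ c] exI[of _ "A *v a"]) (simp add: vec_eq_iff mscale_def mult.assoc)
  then show ?thesis using r A unfolding rank_one_def by simp
qed

lemma split_act [simp]: "invertible A \<Longrightarrow> split (act A M) = split M"
  by (metis split_act_imp act_cancel invertible_inverse)

lemma rank_one_act [simp]: "invertible A \<Longrightarrow> rank_one (act A M) = rank_one M"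
  by (metis rank_one_act_imp act_cancel invertible_inverse)

lemma hyperbolic_act [simp]: "invertible A \<Longrightarrow> hyperbolic (act A M) = hyperbolic M"
  and elliptic_act [simp]: "invertible A \<Longrightarrow> elliptic (act A M) = elliptic M"
  by (simp_all add: hyperbolic_def elliptic_def)

lemma quadf_act: "quadf (act A M) k = quadf M (transpose A *v k)"
proof -
  have e: "quadf M k = (\<Sum>i\<in>UNIV. \<Sum>j\<in>UNIV. k $ i * M $ i $ j * k $ j)" for M :: "'a^3^3" and k
    unfolding quadf_def matrix_vector_mult_def by (simp add: sum_distrib_left mult_ac)
  show ?thesis unfolding e 
    unfolding act_def matrix_matrix_mult_def matrix_vector_mult_def transpose_def sum_3
    by (simp add: algebra_simps)
qed

lemma tangent_act_imp:
  assumes A: "invertible A" and t: "tangent L M"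
  shows "tangent (act A ` L) (act A M)"
proof -
  obtain k where k: "k \<noteq> 0" "M *v k = 0" "\<forall>Z\<in>L. quadf Z k = 0" using t by (auto simp: tangent_def)
  obtain B where B: "invertible B" "A ** B = mat 1" "B ** A = mat 1" using A by (rule invertible_inverse)
  have tB: "transpose A ** transpose B = mat 1" using B by (metis matrix_transpose_mul transpose_mat)
  then have kk: "transpose A *v (transpose B *v k) = k"
    by (metis matrix_vector_mul_assoc matrix_vector_mul_lid)
  have "transpose B *v k \<noteq> 0" using kk k(1) by (metis matrix_vector_mult_0_right)
  moreover have "act A M *v (transpose B *v k) = A *v (M *v (transpose A *v (transpose B *v k)))"
    unfolding act_def by (metis matrix_vector_mul_assoc)
  then have "act A M *v (transpose B *v k) = 0" unfolding kk k(2) by simp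
  moreover have "\<forall>Z\<in>act A ` L. quadf Z (transpose B *v k) = 0"
    using k(3) kk by (auto simp: quadf_act)
  ultimately show ?thesis using t A by (auto simp: tangent_def)
qed

lemma tangent_act: "invertible A \<Longrightarrow> tangent (act A ` L) (act A M) = tangent L M"
proof
  assume A: "invertible A" and t: "tangent (act A ` L) (act A M)"
  obtain B where B: "invertible B" "A ** B = mat 1" "B ** A = mat 1" using A by (rule invertible_inverse)
  from tangent_act_imp[OF B(1) t] show "tangent L M"
    using B by (simp add: image_image act_cancel)
qed (rule tangent_act_imp)

lemma all_singular_act: "invertible A \<Longrightarrow> all_singular (act A ` L) = all_singular L"
  by (auto simp: all_singular_def)

lemma common_kernel_act_imp:
  assumes A: "invertible A" and c: "common_kernel L" shows "common_kernel (act A ` L)"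
proof -
  obtain k where k: "k \<noteq> 0" "\<forall>M\<in>L. M *v k = 0" using c by (auto simp: common_kernel_def)
  obtain B where B: "invertible B" "A ** B = mat 1" "B ** A = mat 1" using A by (rule invertible_inverse)
  have tB: "transpose A ** transpose B = mat 1" using B by (metis matrix_transpose_mul transpose_mat)
  then have kk: "transpose A *v (transpose B *v k) = k"
    by (metis matrix_vector_mul_assoc matrix_vector_mul_lid)
  have "transpose B *v k \<noteq> 0" using kk k(1) by (metis matrix_vector_mult_0_right)
  moreover have "act A M *v (transpose B *v k) = A *v (M *v (transpose A *v (transpose B *v k)))" for M
    unfolding act_def by (metis matrix_vector_mul_assoc)
  ultimately show ?thesis using k(2) unfolding common_kernel_def kk by auto
qed

lemma common_kernel_act: "invertible A \<Longrightarrow> common_kernel (act A ` L) = common_kernel L"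
proof
  assume A: "invertible A" and t: "common_kernel (act A ` L)"
  obtain B where B: "invertible B" "A ** B = mat 1" "B ** A = mat 1" using A by (rule invertible_inverse)
  from common_kernel_act_imp[OF B(1) t] show "common_kernel L"
    using B by (simp add: image_image act_cancel)
qed (rule common_kernel_act_imp)

text \<open>Everything that enters the definition is expressed by rank, kernels and values of quadratic
  forms, which a congruence carries along.\<close>

lemma ltype_cong: "L \<sim>\<^sub>K L' \<Longrightarrow> ltype L = ltype L'"
proof -
  assume "L \<sim>\<^sub>K L'"
  then obtain A where A: "invertible A" "L' = act A ` L"
    unfolding cong_line_def K_orbit_def' by blast
  show ?thesis
    unfolding A(2) ltype_def Let_def pts_act[OF A(1)] all_singular_act[OF A(1)]
      common_kernel_act[OF A(1)] tangent_act[OF A(1)]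
    using A(1) by simp
qed

lemma homog_simps: 
  "homog (rank_one :: 'a::field^3^3 \<Rightarrow> bool)" "homog (hyperbolic :: 'a^3^3 \<Rightarrow> bool)"
  "homog (elliptic :: 'a^3^3 \<Rightarrow> bool)"
proof -
  have *: "rank_one (mscale k M)" if k: "k \<noteq> 0" and r: "rank_one M" for k and M :: "'a^3^3"
  proof -
    obtain c a where "M = (\<chi> i j. c * a $ i * a $ j)" using r unfolding rank_one_def by blast
    then have "mscale k M = (\<chi> i j. (k * c) * a $ i * a $ j)"
      by (simp add: mscale_def mult.assoc)
    then show ?thesis using k r unfolding rank_one_def by auto
  qed
  have inv: "mscale (inverse k) (mscale k M) = M" if "k \<noteq> 0" for k and M :: "'a^3^3"
    using that by (simp add: mscale_mscale)
  have r: "rank_one (mscale k M) = rank_one M" if "k \<noteq> 0" for k and M :: "'a^3^3"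
    using * that inv by (metis inverse_nonzero_iff_nonzero)
  have **: "split (mscale k M)" if sp: "split M" for k and M :: "'a^3^3"
  proof -
    obtain a b where "M = (\<chi> i j. a $ i * b $ j + b $ i * a $ j)" using sp unfolding split_def by blast
    then have "mscale k M = (\<chi> i j. (k *s a) $ i * b $ j + b $ i * (k *s a) $ j)"
      by (simp add: mscale_def algebra_simps)
    then show ?thesis unfolding split_def by blast
  qed
  have s: "split (mscale k M) = split M" if "k \<noteq> 0" for k and M :: "'a^3^3"
    using ** that inv by metis
  have d: "det (mscale k M) = 0 \<longleftrightarrow> det M = 0" if "k \<noteq> 0" for k and M :: "'a^3^3"
  proof -
    have "det (mscale k M) = k^3 * det M"
      by (simp add: mscale_def det_3 power3_eq_cube algebra_simps)
    then show ?thesis using that by simp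
  qed
  show "homog (rank_one :: 'a^3^3 \<Rightarrow> bool)" "homog (hyperbolic :: 'a^3^3 \<Rightarrow> bool)"
    "homog (elliptic :: 'a^3^3 \<Rightarrow> bool)"
    using r s d by (auto simp: homog_def hyperbolic_def elliptic_def)
qed

lemma homog_tangent: "homog (tangent L)"
  unfolding homog_def
proof (intro allI impI)
  fix k :: 'a and M :: "'a^3^3" assume k: "k \<noteq> 0"
  have "mscale k M *v v = 0 \<longleftrightarrow> M *v v = 0" for v
    using k by (simp add: vec_eq_iff mscale_def matrix_vector_mult_def mult.assoc flip: sum_distrib_left)
  moreover have "homog hyperbolic" "homog elliptic" "homog rank_one" by (rule homog_simps)+
  moreover have "det M = 0 \<and> \<not> rank_one M \<longleftrightarrow> hyperbolic M \<or> elliptic M" for M :: "'a^3^3"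
    by (auto simp: hyperbolic_def elliptic_def)
  ultimately show "tangent L (mscale k M) = tangent L M"
    using k unfolding tangent_def homog_def conj_assoc[symmetric] by auto
qed

section \<open>Criteria in coordinates\<close>

locale odd_field =
  fixes \<epsilon> :: "'a::{field,finite}"
  assumes odd_card: "odd CARD('a)" and nonsquare: "\<not> is_square \<epsilon>"
begin

lemma two [simp]: "(2::'a) \<noteq> 0" using odd_card by (rule two_neq_0)

lemma four [simp]: "(4::'a) \<noteq> 0" using two by (metis mult_2 mult_eq_0_iff numeral_Bit0)

lemma eps_nonzero [simp]: "\<epsilon> \<noteq> 0" using nonsquare by auto

lemma is_square_eps_mult: "k \<noteq> 0 \<Longrightarrow> is_square (\<epsilon> * k) \<longleftrightarrow> \<not> is_square (k::'a)"
  using is_square_mult_iff[OF odd_card eps_nonzero] nonsquare by blast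

lemma nonsquare_cases:
  assumes "\<not> is_square (x::'a)" obtains r where "r \<noteq> 0" "x = \<epsilon> * r^2"
proof -
  have x: "x \<noteq> 0" using assms by auto
  then have "is_square (\<epsilon> * x)" using is_square_eps_mult assms by blast
  then obtain r where r: "\<epsilon> * x = r^2" by (auto simp: is_nth_power_def)
  then have "x = \<epsilon> * (r / \<epsilon>)^2" "r / \<epsilon> \<noteq> 0"
    using x by (auto simp: power2_eq_square field_simps)
  then show ?thesis using that by blast
qed

lemma square_cases':
  assumes "is_square (x::'a)" "x \<noteq> 0" obtains r where "r \<noteq> 0" "x = r^2"
  using assms by (auto simp: is_nth_power_def)

lemma rank_one_S:
  "rank_one (S a b c d e f :: 'a^3^3) \<longleftrightarrow>
    S a b c d e f \<noteq> 0 \<and> b^2 = a*d \<and> c^2 = a*f \<and> e^2 = d*f \<and> b*c*e = a*d*f"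
  (is "_ \<longleftrightarrow> ?R")
proof
  assume "rank_one (S a b c d e f)"
  then obtain k v where M: "S a b c d e f = (\<chi> i j. k * v $ i * v $ j)" and nz: "S a b c d e f \<noteq> 0"
    unfolding rank_one_def by blast
  have "S a b c d e f $ i $ j = k * v $ i * v $ j" for i j using M by simp
  from this[of 1 1] this[of 1 2] this[of 1 3] this[of 2 2] this[of 2 3] this[of 3 3]
  have "a = k * v$1 * v$1" "b = k * v$1 * v$2" "c = k * v$1 * v$3" "d = k * v$2 * v$2"
    "e = k * v$2 * v$3" "f = k * v$3 * v$3" by (simp_all add: S_def)
  then show ?R using nz by (simp add: power2_eq_square mult_ac)
next
  assume R: ?R
  have *: "(a*e-b*c)^2 = 0 \<and> (b*f-c*e)^2 = 0 \<and> (c*d-b*e)^2 = 0"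
  proof -
    have eq: "b^2 = a*d" "c^2 = a*f" "e^2 = d*f" "b*c*e = a*d*f" using R by auto
    have "(a*e-b*c)^2 = a^2*e^2 - 2*a*(b*c*e) + b^2*c^2" "(b*f-c*e)^2 = b^2*f^2 - 2*f*(b*c*e) + c^2*e^2"
      "(c*d-b*e)^2 = c^2*d^2 - 2*d*(b*c*e) + b^2*e^2"
      by (simp_all add: power2_eq_square algebra_simps)
    then show ?thesis unfolding eq by (simp add: power2_eq_square)
  qed
  then have m: "a*e = b*c" "b*f = c*e" "c*d = b*e" by auto
  define v :: "'a^3" where "v = (if a \<noteq> 0 then vector [a,b,c] else if d \<noteq> 0 then vector [b,d,e] else vector [c,e,f])"
  define k where "k = (if a \<noteq> 0 then 1/a else if d \<noteq> 0 then 1/d else 1/f)"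
  have "f \<noteq> 0" if "a = 0" "d = 0" using R that by auto
  then have "S a b c d e f = (\<chi> i j. k * v $ i * v $ j)"
    using R m unfolding k_def v_def
    by (intro mat3_eqI) (auto simp: S_def power2_eq_square field_simps)
  then show "rank_one (S a b c d e f)" using R unfolding rank_one_def by blast
qed

lemma split_block:
  assumes "e^2 - d*f = r^2" "r \<noteq> (0::'a)"
  shows "split (S 0 0 0 d e f)"
proof (cases "d = 0")
  case True
  have "S 0 0 0 d e f = (\<chi> i j. (vector [0,0,1]::'a^3) $ i * (vector [0,e,f/2]::'a^3) $ j + 
      (vector [0,e,f/2]::'a^3) $ i * (vector [0,0,1]::'a^3) $ j)"
    using True by (intro mat3_eqI) (auto simp: S_def)
  then show ?thesis unfolding split_def by blast
next
  case False
  define h where "h = 1 / (2::'a)"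
  have h: "x * h + h * x = x" "h * 2 = 1" for x by (simp_all add: h_def)
  define k where "k = (e - r) / d"
  have k: "d * k = e - r" using False by (simp add: k_def)
  have "d * ((e + r) * k) = (e + r) * (d * k)" by (simp add: mult_ac)
  also have "\<dots> = d * f" unfolding k using assms by (simp add: power2_eq_square algebra_simps)
  finally have f: "(e + r) * k = f" using False by simp
  have e1: "d * (h * k) + h * (e + r) = e" 
  proof -
    have "d * (h * k) + h * (e + r) = h * (d * k + e + r)" by (simp add: algebra_simps)
    then show ?thesis unfolding k using h(2) h(1)[of e] by (simp add: algebra_simps)
  qed
  have e2: "(e + r) * (h * k) + h * k * (e + r) = f"
    using h(2) h(1)[of "(e + r) * k"] f by (simp add: algebra_simps)
  have "S 0 0 0 d e f = (\<chi> i j. (vector [0,d,e+r]::'a^3) $ i * (vector [0,h,h*k]::'a^3) $ j + 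
      (vector [0,h,h*k]::'a^3) $ i * (vector [0,d,e+r]::'a^3) $ j)"
    using h(2) h(1)[of d] e1 e2 by (intro mat3_eqI) (simp_all add: S_def algebra_simps)
  then show ?thesis unfolding split_def by blast
qed

text \<open>A singular form whose restriction to a coordinate line is nondegenerate is congruent to that
  restriction.\<close>

lemma split_minor:
  assumes det: "det (S a b c d e f) = (0::'a)" and sq: "is_square (e^2 - d*f)" "e^2 - d*f \<noteq> 0"
  shows "split (S a b c d e f)"
proof -
  obtain r where r: "e^2 - d*f = r^2" "r \<noteq> 0" using sq by (metis square_cases')
  define D where "D = e^2 - d*f"
  have D: "D \<noteq> 0" "d * f = e^2 - D" using sq by (auto simp: D_def)
  define p q where "p = (c*e - b*f) / D" and "q = (b*e - c*d) / D"
  have pq: "D * p = c*e - b*f" "D * q = b*e - c*d" using D by (auto simp: p_def q_def)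
  have "D * (p*d+q*e) = (D*p)*d + (D*q)*e" "D * (p*e+q*f) = (D*p)*e + (D*q)*f"
    "D * (p*b + q*c) = (D*p)*b + (D*q)*c" by (simp_all add: algebra_simps)
  moreover have "(c*e - b*f)*d + (b*e - c*d)*e = D*b" "(c*e - b*f)*e + (b*e - c*d)*f = D*c"
    unfolding D_def by (simp_all add: power2_eq_square algebra_simps)
  moreover have "(c*e - b*f)*b + (b*e - c*d)*c = D*a"
    using det unfolding D_def det_S by (simp add: power2_eq_square algebra_simps)
  ultimately have "D * (p*d+q*e) = D * b" "D * (p*e+q*f) = D * c" "D * (p*b + q*c) = D * a"
    unfolding pq by simp_all
  then have bc: "p*d+q*e = b" "p*e+q*f = c" and a: "p*b+q*c = a" using D by simp_all
  have "S a b c d e f = act (mat3 [[1,p,q],[0,1,0],[0,0,1]]) (S 0 0 0 d e f)"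
    unfolding act_S using bc by (simp add: a[symmetric]) (simp add: bc[symmetric] algebra_simps)
  then show ?thesis using split_block[OF r] split_act_imp by metis
qed

lemma split_S:
  assumes det: "det (S a b c d e f) = (0::'a)"
  shows "split (S a b c d e f) \<longleftrightarrow> is_square (b^2 - a*d) \<and> is_square (c^2 - a*f) \<and> is_square (e^2 - d*f)"
    (is "_ \<longleftrightarrow> ?R")
proof
  assume "split (S a b c d e f)"
  then obtain u v where M: "S a b c d e f = (\<chi> i j. u $ i * v $ j + v $ i * u $ j)"
    unfolding split_def by blast
  have "S a b c d e f $ i $ j = u $ i * v $ j + v $ i * u $ j" for i j using M by simp
  from this[of 1 1] this[of 1 2] this[of 1 3] this[of 2 2] this[of 2 3] this[of 3 3]
  have e: "a = u$1 * v$1 + v$1 * u$1" "b = u$1 * v$2 + v$1 * u$2" "c = u$1 * v$3 + v$1 * u$3"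
    "d = u$2 * v$2 + v$2 * u$2" "e = u$2 * v$3 + v$2 * u$3" "f = u$3 * v$3 + v$3 * u$3"
    by (simp_all add: S_def)
  have "b^2 - a*d = (u$1 * v$2 - v$1 * u$2)^2" "c^2 - a*f = (u$1 * v$3 - v$1 * u$3)^2"
    "e^2 - d*f = (u$2 * v$3 - v$2 * u$3)^2"
    unfolding e by (simp_all add: power2_eq_square algebra_simps)
  then show ?R by simp
next
  assume R: ?R
  consider "e^2 - d*f \<noteq> 0" | "c^2 - a*f \<noteq> 0" | "b^2 - a*d \<noteq> 0"
    | "e^2 = d*f" "c^2 = a*f" "b^2 = a*d" by auto
  then show "split (S a b c d e f)"
  proof cases
    case 1 then show ?thesis using R split_minor[OF det] by blast
  next
    case 2
    have "S a b c d e f = act (mat3 [[0,1,0],[1,0,0],[0,0,1]]) (S d b e a c f)"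
      by (simp add: act_S)
    moreover have "det (S d b e a c f) = 0" using det by (simp add: det_S algebra_simps)
    ultimately show ?thesis using R 2 split_minor split_act_imp by metis
  next
    case 3
    have "S a b c d e f = act (mat3 [[0,1,0],[0,0,1],[1,0,0]]) (S f c e a b d)"
      by (simp add: act_S)
    moreover have "det (S f c e a b d) = 0" using det by (simp add: det_S algebra_simps)
    ultimately show ?thesis using R 3 split_minor split_act_imp by metis
  next
    case 4
    show ?thesis
    proof (cases "S a b c d e f = 0")
      case True
      then show ?thesis unfolding split_def by (intro exI[of _ 0]) (simp add: vec_eq_iff)
    next
      case False
      have "2 * (b*c*e - a*d*f) = 0" using det 4 unfolding det_S by (simp add: algebra_simps)
      then have "rank_one (S a b c d e f)" using 4 False unfolding rank_one_S by simp
      then obtain k v where M: "S a b c d e f = (\<chi> i j. k * v $ i * v $ j)"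
        unfolding rank_one_def by blast
      show ?thesis unfolding M split_def
        by (intro exI[of _ v] exI[of _ "(k / 2) *s v"]) (simp add: vec_eq_iff algebra_simps)
    qed
  qed
qed

lemma det_S_eq_0_imp: 
  assumes "det (S a b c d e f) = (0::'a)" "b^2 = a*d" "c^2 = a*f" "e^2 = d*f"
  shows "b*c*e = a*d*f"
proof -
  have "2 * (b*c*e - a*d*f) = 0" using assms unfolding det_S by (simp add: algebra_simps)
  then show ?thesis by simp
qed

lemma rank_one_S':
  "rank_one (S a b c d e f :: 'a^3^3) \<longleftrightarrow>
    S a b c d e f \<noteq> 0 \<and> det (S a b c d e f) = 0 \<and> b^2 = a*d \<and> c^2 = a*f \<and> e^2 = d*f"
  unfolding rank_one_S using det_S_eq_0_imp by (auto simp: det_S algebra_simps)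

lemma rank_one_det: "rank_one M \<Longrightarrow> transpose M = M \<Longrightarrow> det M = (0::'a)"
  by (metis symmetric_cases rank_one_S')

end

section \<open>Normal forms\<close>

no_notation vector_scalar_mult (infixl "*s" 70)

lemma PG5_line_cong: "L \<sim>\<^sub>K L' \<Longrightarrow> PG5_line L \<Longrightarrow> PG5_line L'"
  unfolding cong_line_def K_orbit_def' PG5_line_iff
  by (auto simp: act_span2) (metis indep2_act transpose_act)

lemma indep2_PG5_line: 
  assumes "PG5_line (span2 M N)" shows "indep2 M N"
proof -
  have d: "mvec.dim (mvec.span {M,N}) = 2" using assms by (simp add: PG5_line_def span2_eq_span)
  then have d2: "mvec.dim {M,N} = 2" by (simp add: mvec.dim_span)
  obtain B where B: "B \<subseteq> {M,N}" "mvec.independent B" "card B = 2"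
    using mvec.basis_exists[of "{M,N}"] d2 by metis
  have "card B \<le> card {M,N}" using B by (intro card_mono) auto
  then have "M \<noteq> N" "B = {M,N}" using B by (auto simp: card_insert_if card_subset_eq split: if_splits)
  with B show ?thesis by (simp add: indep2_iff)
qed

context odd_field
begin

lemma eight [simp]: "(8::'a) \<noteq> 0" and sixteen [simp]: "(16::'a) \<noteq> 0"
proof -
  have e: "(8::'a) = 2 * 4" "(16::'a) = 4 * 4" by simp_all
  show "(8::'a) \<noteq> 0" "(16::'a) \<noteq> 0" unfolding e mult_eq_0_iff by simp_all
qed

definition no_rank_one :: "('a^3^3) set \<Rightarrow> bool" where
  "no_rank_one L \<longleftrightarrow> (\<forall>M\<in>L. \<not> rank_one M)"

lemma no_rank_one_cong: "L \<sim>\<^sub>K L' \<Longrightarrow> no_rank_one L \<Longrightarrow> no_rank_one L'"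
  by (auto simp: cong_line_def K_orbit_def' no_rank_one_def)

lemma no_rank_oneD:
  assumes "no_rank_one (span2 (S a b c d e f) (S a' b' c' d' e' f'))"
  shows "\<not> rank_one (S (s * a+t * a') (s * b+t * b') (s * c+t * c') (s * d+t * d') (s * e+t * e') (s * f+t * f'))"
proof -
  have "mscale s (S a b c d e f) + mscale t (S a' b' c' d' e' f') \<in> span2 (S a b c d e f) (S a' b' c' d' e' f')"
    by (auto simp: span2_def)
  then show ?thesis using assms unfolding no_rank_one_def by fastforce
qed

definition nonsingular_line :: "('a^3^3) set \<Rightarrow> bool" where
  "nonsingular_line L \<longleftrightarrow> PG5_line L \<and> (\<forall>M\<in>L. M \<noteq> 0 \<longrightarrow> det M \<noteq> 0)"

fun normal_form :: "line_type \<Rightarrow> ('a^3^3) set \<Rightarrow> bool" where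
  "normal_form o5 L \<longleftrightarrow> L = span2 (S 1 0 0 0 0 0) (S 0 0 0 1 0 0)"
| "normal_form o6 L \<longleftrightarrow> L = span2 (S 1 0 0 0 0 0) (S 0 1 0 0 0 0)"
| "normal_form o8_1 L \<longleftrightarrow> L = span2 (S 1 0 0 0 0 0) (S 0 0 0 1 0 (-1))"
| "normal_form o8_2 L \<longleftrightarrow> L = span2 (S 1 0 0 0 0 0) (S 0 0 0 1 0 (-\<epsilon>))"
| "normal_form o9 L \<longleftrightarrow> L = span2 (S 1 0 0 0 0 0) (S 0 0 1 1 0 0)"
| "normal_form o10 L \<longleftrightarrow> L = span2 (S 0 1 0 0 0 0) (S 1 0 0 \<epsilon> 0 0)"
| "normal_form o12 L \<longleftrightarrow> L = span2 (S 0 1 0 0 0 0) (S 0 0 0 0 1 0)"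
| "normal_form o13_1 L \<longleftrightarrow> L = span2 (S 0 1 0 0 0 0) (S 0 0 0 1 0 (-1))"
| "normal_form o13_2 L \<longleftrightarrow> L = span2 (S 0 1 0 0 0 0) (S 0 0 0 1 0 (-\<epsilon>))"
| "normal_form o14_1 L \<longleftrightarrow> L = span2 (S 1 0 0 (-1) 0 0) (S 0 0 0 (-1) 0 1)"
| "normal_form o14_2 L \<longleftrightarrow> L = span2 (S 1 0 0 (-\<epsilon>) 0 0) (S 0 0 0 (-\<epsilon>) 0 1)"
| "normal_form o15_1 L \<longleftrightarrow> L = span2 (S 0 1 0 0 0 0) (S 1 0 0 \<epsilon> 0 1)"
| "normal_form o15_2 L \<longleftrightarrow> (\<exists>p q. \<not> is_square (p^2 - \<epsilon>*q^2) \<and>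
      L = span2 (S 1 0 0 (-\<epsilon>) 0 0) (S p (\<epsilon>*q) 0 (\<epsilon>*p) 0 1))"
| "normal_form o16 L \<longleftrightarrow> L = span2 (S 0 0 1 1 0 0) (S 0 0 0 0 1 0)"
| "normal_form o17 L \<longleftrightarrow> nonsingular_line L"

definition has_nf :: "('a^3^3) set \<Rightarrow> bool" where
  "has_nf L \<longleftrightarrow> (\<exists>t L'. normal_form t L' \<and> L \<sim>\<^sub>K L')"

lemma has_nfI: "normal_form t L \<Longrightarrow> has_nf L"
  unfolding has_nf_def using cong_line_refl by blast

lemma has_nf_cong: "L \<sim>\<^sub>K L' \<Longrightarrow> has_nf L' \<Longrightarrow> has_nf L"
  unfolding has_nf_def using cong_line_trans by blast

text \<open>Binary quadratic forms, by the coordinates of a new basis.\<close>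

lemma binary_hyperbolic:
  assumes "is_square (b^2 - a * d)" "b^2 - a * d \<noteq> (0::'a)"
  obtains p q r s k where "p * s - q * r \<noteq> 0" "k \<noteq> 0" 
    "a * p * p + d * q * q + b * (p * q+q * p) = 0" "a * p * r + d * q * s + b * (p * s+q * r) = k" "a * r * r + d * s * s + b * (r * s+s * r) = 0"
proof (cases "a = 0")
  case True
  then have "b \<noteq> 0" using assms by auto
  then show ?thesis using True by (intro that[where p=1 and q=0 and r="-d" and s="2 * b"]) (auto simp: algebra_simps)
next
  case False
  obtain n where n: "b^2 - a * d = n^2" "n \<noteq> 0" using assms by (metis square_cases')
  have d: "d = (b^2 - n^2) / a" using n False by (simp add: field_simps)
  show ?thesis 
  proof (rule that[where p="n-b" and q=a and r="-n-b" and s=a and k="-2 * a * n^2"])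
    have "(n-b) * a - a * (-n-b) = 2 * n * a" by (simp add: algebra_simps)
    then show "(n-b) * a - a * (-n-b) \<noteq> 0" using False n by simp
  qed (use False n(2) in \<open>simp_all add: d field_simps power2_eq_square\<close>)
qed

lemma binary_diag:
  assumes "b^2 - a * d \<noteq> (0::'a)"
  obtains p q r s k m where "p * s - q * r \<noteq> 0" "k \<noteq> 0" "m \<noteq> 0"
    "a * p * p + d * q * q + b * (p * q+q * p) = k" "a * p * r + d * q * s + b * (p * s+q * r) = 0" "a * r * r + d * s * s + b * (r * s+s * r) = m"
    "\<exists>n. n \<noteq> 0 \<and> - (k * m) = n^2 * (b^2 - a * d)"
proof -
  consider "a \<noteq> 0" | "a = 0" "d \<noteq> 0" | "a = 0" "d = 0" by auto
  then show ?thesis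
  proof cases
    case 1
    show ?thesis
      by (rule that[where p=1 and q=0 and r="-b" and s=a and k=a and m="-a * (b^2-a * d)"])
        (use 1 assms in \<open>auto simp: algebra_simps power2_eq_square intro!: exI[of _ a]\<close>)
  next
    case 2
    show ?thesis
      by (rule that[where p=0 and q=1 and r=d and s="-b" and k=d and m="-d * (b^2-a * d)"])
        (use 2 assms in \<open>auto simp: algebra_simps power2_eq_square intro!: exI[of _ d]\<close>)
  next
    case 3
    then have b: "b \<noteq> 0" using assms by auto
    show ?thesis
    proof (rule that[where p=1 and q=1 and r=1 and s="-1" and k="2 * b" and m="-2 * b"])
      show "1 * -1 - 1 * (1::'a) \<noteq> 0" using two by (metis add.inverse_inverse diff_minus_eq_add minus_add_distrib mult_1 mult_minus_right neg_equal_0_iff_equal one_add_one uminus_add_conv_diff)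
      show "\<exists>n. n \<noteq> 0 \<and> - (2 * b * (- 2 * b)) = n\<^sup>2 * (b\<^sup>2 - a * d)"
        using 3 by (intro exI[of _ 2]) (simp add: power2_eq_square algebra_simps)
    qed (use 3 b in \<open>auto simp: algebra_simps\<close>)
  qed
qed

lemma binary_rank_one:
  assumes "b^2 = a * d" "a \<noteq> 0 \<or> d \<noteq> (0::'a)"
  obtains p q r s k where "p * s - q * r \<noteq> 0" "k \<noteq> 0" 
    "a * p * p + d * q * q + b * (p * q+q * p) = k" "a * p * r + d * q * s + b * (p * s+q * r) = 0" "a * r * r + d * s * s + b * (r * s+s * r) = 0"
proof (cases "a = 0")
  case False
  show ?thesis
    by (rule that[where p=1 and q=0 and r="-b" and s=a and k=a])
      (use False assms in \<open>auto simp: algebra_simps power2_eq_square\<close>)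
next
  case True
  then show ?thesis using assms
    by (intro that[where p=0 and q=1 and r="1" and s=0 and k=d]) auto
qed

lemma vector2_frame:
  assumes "z \<noteq> 0 \<or> v \<noteq> (0::'a)"
  obtains p q r s where "p * s - q * r \<noteq> 0" "p * z+q * v = 1" "r * z+s * v = 0"
proof (cases "z = 0")
  case True
  then show ?thesis using assms by (intro that[of 0 0 "1/v" 1]) auto
next
  case False
  then show ?thesis by (intro that[of "1/z" 1 0 "-v/z"]) auto
qed

lemma vector3_frame:
  assumes "k1 \<noteq> 0 \<or> k2 \<noteq> 0 \<or> k3 \<noteq> (0::'a)"
  obtains x1 x2 x3 y1 y2 y3 where "invertible (mat3 [[x1,x2,x3],[y1,y2,y3],[k1,k2,k3]])"
proof -
  consider "k1 \<noteq> 0" | "k2 \<noteq> 0" | "k3 \<noteq> 0" using assms by auto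
  then show ?thesis
  proof cases
    case 1 then show ?thesis by (intro that[of 0 1 0 0 0 1]) (simp add: invertible_mat3)
  next
    case 2 then show ?thesis by (intro that[of 1 0 0 0 0 1]) (simp add: invertible_mat3)
  next
    case 3 then show ?thesis by (intro that[of 1 0 0 0 1 0]) (simp add: invertible_mat3)
  qed
qed

text \<open>A singular matrix is brought to block form by putting its kernel last.\<close>

lemma singular_frame:
  assumes "k1 \<noteq> 0 \<or> k2 \<noteq> 0 \<or> k3 \<noteq> (0::'a)"
    and "a * k1+b * k2+c * k3 = 0" "b * k1+d * k2+e * k3 = 0" "c * k1+e * k2+f * k3 = 0"
    and "quad = a'*k1 * k1 + d'*k2 * k2 + f'*k3 * k3 + b'*(k1 * k2+k2 * k1) + c'*(k1 * k3+k3 * k1) + e'*(k2 * k3+k3 * k2)"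
  shows "\<exists>x y z u v w m n. span2 (S a b c d e f) (S a' b' c' d' e' f') \<sim>\<^sub>K
           span2 (S x y 0 z 0 0) (S u v w m n quad)"
proof -
  obtain x1 x2 x3 y1 y2 y3 where A: "invertible (mat3 [[x1,x2,x3],[y1,y2,y3],[k1,k2,k3]])"
    using vector3_frame assms(1) by blast
  let ?A = "mat3 [[x1,x2,x3],[y1,y2,y3],[k1,k2,k3]]"
  have e: "a * r1 * k1 + d * r2 * k2 + f * r3 * k3 + b * (r1 * k2+r2 * k1) + c * (r1 * k3+r3 * k1) + e * (r2 * k3+r3 * k2) = 0" for r1 r2 r3
  proof -
    have "a * r1 * k1 + d * r2 * k2 + f * r3 * k3 + b * (r1 * k2+r2 * k1) + c * (r1 * k3+r3 * k1) + e * (r2 * k3+r3 * k2) =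
      r1 * (a * k1+b * k2+c * k3) + r2 * (b * k1+d * k2+e * k3) + r3 * (c * k1+e * k2+f * k3)" by (simp add: algebra_simps)
    then show ?thesis unfolding assms(2-4) by simp
  qed
  obtain x y z where 1: "act ?A (S a b c d e f) = S x y 0 z 0 0"
    unfolding act_S e by blast
  obtain u v w m n where 2: "act ?A (S a' b' c' d' e' f') = S u v w m n quad"
    unfolding act_S assms(5) by blast
  have "span2 (S a b c d e f) (S a' b' c' d' e' f') \<sim>\<^sub>K span2 (S x y 0 z 0 0) (S u v w m n quad)"
    by (rule cong_lineI[OF A, where p=1 and q=0 and r=0 and s=1]) (simp_all only: 1 2, simp_all)
  then show ?thesis by blast
qed

lemma singular_kernel:
  assumes "det (S a b c d e f) = (0::'a)"
  shows "\<exists>k1 k2 k3. (k1 \<noteq> 0 \<or> k2 \<noteq> 0 \<or> k3 \<noteq> 0) \<and>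
    a * k1+b * k2+c * k3 = 0 \<and> b * k1+d * k2+e * k3 = 0 \<and> c * k1+e * k2+f * k3 = 0"
proof -
  have "\<not> invertible (S a b c d e f)" using assms by (simp add: invertible_det_nz)
  then obtain k where k: "k \<noteq> 0" "S a b c d e f *v k = 0"
    unfolding invertible_left_inverse matrix_left_invertible_ker by blast
  have "(S a b c d e f *v k) $ i = 0" for i using k by simp
  from this[of 1] this[of 2] this[of 3]
  have "a * k$1+b * k$2+c * k$3 = 0 \<and> b * k$1+d * k$2+e * k$3 = 0 \<and> c * k$1+e * k$2+f * k$3 = 0"
    by (simp add: matrix_vector_mult_def sum_3 S_def)
  moreover have "k$1 \<noteq> 0 \<or> k$2 \<noteq> 0 \<or> k$3 \<noteq> 0" using k(1) by (auto simp: vec_eq_iff forall_3)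
  ultimately show ?thesis by blast
qed

subsection \<open>Lines with a point of rank one\<close>

lemma rank_one_frame:
  assumes "rank_one (S a b c d e f :: 'a^3^3)"
  shows "\<exists>A k. invertible A \<and> k \<noteq> 0 \<and> act A (S a b c d e f) = S k 0 0 0 0 0"
proof -
  have R: "S a b c d e f \<noteq> 0" "b^2 = a * d" "c^2 = a * f" "e^2 = d * f" "b * c * e = a * d * f"
    using assms unfolding rank_one_S by auto
  then have R': "b * b = a * d" "c * c = a * f" "e * e = d * f" by (simp_all add: power2_eq_square)
  consider "a \<noteq> 0" | "a = 0" "d \<noteq> 0" | "a = 0" "d = 0" by blast
  then show ?thesis
  proof cases
    case 1
    have "a * (a * e) = a * (b * c)" 
    proof -
      have "(a * e-b * c)^2 = a * a * (e^2) - 2 * a * (b * c * e) + (b * b) * (c * c)" by (simp add: power2_eq_square algebra_simps)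
      also have "\<dots> = 0" unfolding R R' by (simp add: algebra_simps)
      finally show ?thesis by simp
    qed
    then have ae: "a * e = b * c" using 1 by simp
    have "act (mat3 [[1,0,0],[-b/a,1,0],[-c/a,0,1]]) (S a b c d e f) = S a 0 0 0 0 0"
      unfolding act_S using 1 R' ae by (simp add: field_simps)
    then show ?thesis using 1 by (intro exI[of _ "mat3 [[1,0,0],[-b/a,1,0],[-c/a,0,1]]"] exI[of _ a]) 
        (simp add: invertible_mat3)
  next
    case 2
    then have "b = 0" "c = 0" using R by auto
    then have "act (mat3 [[0,1,0],[1,0,0],[0,-e/d,1]]) (S a b c d e f) = S d 0 0 0 0 0"
      unfolding act_S using 2 R' by (simp add: field_simps)
    then show ?thesis using 2 by (intro exI[of _ "mat3 [[0,1,0],[1,0,0],[0,-e/d,1]]"] exI[of _ d]) 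
        (simp add: invertible_mat3)
  next
    case 3
    then have "b = 0" "c = 0" "e = 0" "f \<noteq> 0" using R by auto
    then show ?thesis using 3 
      by (intro exI[of _ "mat3 [[0,0,1],[0,1,0],[1,0,0]]"] exI[of _ f]) (simp add: invertible_mat3 act_S)
  qed
qed

text \<open>The type of the line through the corner point and the matrix with zero corner entry, border
  \<open>(b, c)\<close> and block \<open>[d, e; e, f]\<close>: a nonsingular block decides by its
  discriminant; for a singular one, \<open>b\<^sup>2 f + c\<^sup>2 d - 2 b c e\<close> is minus the
  determinant.\<close>

definition rank_one_type :: "'a \<Rightarrow> 'a \<Rightarrow> 'a \<Rightarrow> 'a \<Rightarrow> 'a \<Rightarrow> line_type" where
  "rank_one_type b c d e f =
    (if e^2 \<noteq> d * f then (if is_square (e^2 - d * f) then o8_1 else o8_2)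
     else if b^2 * f + c^2 * d \<noteq> 2 * b * c * e then o9
     else if d \<noteq> 0 \<or> e \<noteq> 0 \<or> f \<noteq> 0 then o5 else o6)"

lemma rank_one_line_nf:
  assumes L: "PG5_line (span2 (S 1 0 0 0 0 0) (S 0 b c d e f))"
  shows "\<exists>L'. normal_form (rank_one_type b c d e f) L' \<and> span2 (S 1 0 0 0 0 0) (S 0 b c d e (f::'a)) \<sim>\<^sub>K L'"
proof -
  have nz: "S 0 b c d e f \<noteq> 0"
    using indep2_PG5_line[OF L, unfolded indep2_def, rule_format, of 0 1] by auto
  consider "e^2 - d * f \<noteq> 0" | "e^2 = d * f" "d \<noteq> 0 \<or> f \<noteq> 0" | "d = 0" "e = 0" "f = 0"
    by (cases "e^2 = d * f"; cases "d = 0"; cases "f = 0") auto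
  then show ?thesis
  proof cases
    case 1
    define D where "D = e^2 - d * f"
    have D: "D \<noteq> 0" using 1 by (simp add: D_def)
    define p where "p = (c * e - b * f) / D"
    define q where "q = (b * e - c * d) / D"
    have pq: "D * p = c * e - b * f" "D * q = b * e - c * d" using D by (auto simp: p_def q_def)
    have "D * (p * d+q * e) = (D * p) * d + (D * q) * e" "D * (p * e+q * f) = (D * p) * e + (D * q) * f" by (simp_all add: algebra_simps)
    moreover have "(c * e - b * f) * d + (b * e - c * d) * e = D * b" "(c * e - b * f) * e + (b * e - c * d) * f = D * c"
      unfolding D_def by (simp_all add: power2_eq_square algebra_simps)
    ultimately have "D * (p * d+q * e) = D * b" "D * (p * e+q * f) = D * c" unfolding pq by simp_all
    then have bc: "p * d+q * e = b" "p * e+q * f = c" using D by simp_all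
    obtain x y z w k m n where g: "x * w - y * z \<noteq> 0" "k \<noteq> 0" "m \<noteq> 0"
      "d * x * x + f * y * y + e * (x * y+y * x) = k" "d * x * z + f * y * w + e * (x * w+y * z) = 0" "d * z * z + f * w * w + e * (z * w+w * z) = m"
      "n \<noteq> 0" "- (k * m) = n^2 * (e^2 - d * f)"
      using binary_diag[OF 1] by metis
    have c1: "span2 (S 1 0 0 0 0 0) (S 0 b c d e f) \<sim>\<^sub>K span2 (S 1 0 0 0 0 0) (S 0 0 0 d e f)"
    proof (rule cong_lineI[where A="mat3 [[1,-p,-q],[0,1,0],[0,0,1]]" and p=1 and q=0 and r="p * b+q * c" and s=1])
    qed (simp_all add: invertible_mat3 act_S bc[symmetric] algebra_simps)
    have c2: "span2 (S 1 0 0 0 0 0) (S 0 0 0 d e f) \<sim>\<^sub>K span2 (S 1 0 0 0 0 0) (S 0 0 0 k 0 m)"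
      by (rule cong_lineI[where A="mat3 [[1,0,0],[0,x,y],[0,z,w]]" and p=1 and q=0 and r=0 and s=1])
        (use g in \<open>simp_all add: invertible_mat3 act_S\<close>)
    have c3: "span2 (S 1 0 0 0 0 0) (S 0 0 0 k 0 m) \<sim>\<^sub>K span2 (S 1 0 0 0 0 0) (S 0 0 0 1 0 (-g))" 
      if "r \<noteq> 0" "g \<noteq> 0" "- (k * m) = g * r^2" for r g
    proof -
      have "k * m = - (g * r^2)" using that by (metis minus_minus)
      then have m: "m = - (g * r^2 / k)" using g(2) by (simp add: field_simps)
      show ?thesis
        by (rule cong_lineI[where A="mat3 [[1,0,0],[0,1,0],[0,0,k/r]]" and p=1 and q=0 and r=0 and s="1/k"])
          (use that g(2) in \<open>simp_all add: invertible_mat3 act_S m field_simps power2_eq_square\<close>)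
    qed
    show ?thesis
    proof (cases "is_square (e^2 - d * f)")
      case True
      then have "is_square (-(k * m))" "-(k * m) \<noteq> 0" using g by (auto simp: is_square_mult)
      then obtain r where "r \<noteq> 0" "-(k * m) = r^2" by (metis square_cases')
      then have "span2 (S 1 0 0 0 0 0) (S 0 b c d e f) \<sim>\<^sub>K span2 (S 1 0 0 0 0 0) (S 0 0 0 1 0 (-1))"
        by (intro cong_line_trans[OF cong_line_trans[OF c1 c2] c3[of r]]) simp_all
      then show ?thesis using 1 True by (simp add: rank_one_type_def)
    next
      case False
      then have "\<not> is_square (-(k * m))" using g by simp
      then obtain r where "r \<noteq> 0" "-(k * m) = \<epsilon> * r^2" by (rule nonsquare_cases)
      then have "span2 (S 1 0 0 0 0 0) (S 0 b c d e f) \<sim>\<^sub>K span2 (S 1 0 0 0 0 0) (S 0 0 0 1 0 (-\<epsilon>))"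
        by (intro cong_line_trans[OF cong_line_trans[OF c1 c2] c3[of r]]) simp_all
      then show ?thesis using 1 False by (simp add: rank_one_type_def)
    qed
  next
    case 2
    obtain x y z w k where g: "x * w - y * z \<noteq> 0" "k \<noteq> 0" 
      "d * x * x + f * y * y + e * (x * y+y * x) = k" "d * x * z + f * y * w + e * (x * w+y * z) = 0" "d * z * z + f * w * w + e * (z * w+w * z) = 0"
      using binary_rank_one[OF 2] by metis
    define b' where "b' = b * x + c * y"
    define c' where "c' = b * z + c * w"
    have c1: "span2 (S 1 0 0 0 0 0) (S 0 b c d e f) \<sim>\<^sub>K span2 (S 1 0 0 0 0 0) (S 0 b' c' k 0 0)"
      by (rule cong_lineI[where A="mat3 [[1,0,0],[0,x,y],[0,z,w]]" and p=1 and q=0 and r=0 and s=1])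
        (use g in \<open>simp_all add: invertible_mat3 act_S b'_def c'_def\<close>)
    have def0: "d \<noteq> 0 \<or> e \<noteq> 0 \<or> f \<noteq> 0" using 2 by auto
    have ker: "d * z + e * w = 0" "e * z + f * w = 0"
    proof -
      have 1: "x * (d * z + e * w) + y * (e * z + f * w) = 0" "z * (d * z + e * w) + w * (e * z + f * w) = 0"
        using g(4,5) by (simp_all add: algebra_simps)
      have "(x * w - y * z) * (d * z + e * w) = w * (x * (d * z + e * w) + y * (e * z + f * w)) - y * (z * (d * z + e * w) + w * (e * z + f * w))"
        "(x * w - y * z) * (e * z + f * w) = x * (z * (d * z + e * w) + w * (e * z + f * w)) - z * (x * (d * z + e * w) + y * (e * z + f * w))"
        by (simp_all add: algebra_simps)
      then show "d * z + e * w = 0" "e * z + f * w = 0" using g(1) unfolding 1 by auto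
    qed
    have c'0: "b^2 * f + c^2 * d = 2 * b * c * e \<longleftrightarrow> c' = 0"
    proof (cases "z = 0")
      case True
      then have w: "w \<noteq> 0" "e = 0" "f = 0" using g(1) ker by auto
      then show ?thesis using True def0 by (auto simp: c'_def)
    next
      case False
      have "e * z = - (f * w)" "d * z = - (e * w)" using ker by (simp_all add: eq_neg_iff_add_eq_0)
      then have e: "e = - (f * w) / z" and d: "d = - (e * w) / z"
        using False by (metis nonzero_mult_div_cancel_right)+
      have f0: "f \<noteq> 0" using def0 e d by auto
      have eq: "b^2 * f + c^2 * d - 2 * b * c * e = f / z^2 * c'^2"
      proof -
        have d': "d = f * (w / z)^2" unfolding d using e False by (simp add: power2_eq_square)
        have e': "e = - f * (w / z)" using e by simp
        have c'': "c' = z * (b + c * (w / z))" using False by (simp add: c'_def distrib_left)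
        have "f / z^2 * c'^2 = f * (b + c * (w / z))^2" 
          unfolding c'' using False by (simp add: power_mult_distrib)
        also have "\<dots> = b^2 * f + c^2 * d - 2 * b * c * e"
          unfolding d' unfolding e' by (simp add: power2_eq_square algebra_simps)
        finally show ?thesis by simp
      qed
      have "b^2 * f + c^2 * d - 2 * b * c * e = 0 \<longleftrightarrow> c' = 0" unfolding eq using f0 False by simp
      then show ?thesis by simp
    qed
    have c2: "span2 (S 1 0 0 0 0 0) (S 0 b' c' k 0 0) \<sim>\<^sub>K span2 (S 1 0 0 0 0 0) (S 0 0 c' k 0 0)"
      by (rule cong_lineI[where A="mat3 [[1,-b'/k,0],[0,1,0],[0,0,1]]" and p=1 and q=0 and r="b'*b'/k" and s=1])
        (use g in \<open>simp_all add: invertible_mat3 act_S\<close>)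
    have c3: "span2 (S 1 0 0 0 0 0) (S 0 0 c' k 0 0) \<sim>\<^sub>K span2 (S 1 0 0 0 0 0) (S 0 0 g 1 0 0)"
      if "c' = 0 \<and> g = 0 \<or> c' \<noteq> 0 \<and> g = 1" for g
      by (rule cong_lineI[where A="mat3 [[1,0,0],[0,1,0],[0,0,if c' = 0 then 1 else k/c']]" and p=1 and q=0 and r=0 and s="1/k"])
        (use g that in \<open>auto simp add: invertible_mat3 act_S\<close>)
    show ?thesis
    proof (cases "c' = 0")
      case True
      then have "span2 (S 1 0 0 0 0 0) (S 0 b c d e f) \<sim>\<^sub>K span2 (S 1 0 0 0 0 0) (S 0 0 0 1 0 0)"
        using c3[of 0] by (intro cong_line_trans[OF cong_line_trans[OF c1 c2]]) simp
      then show ?thesis using 2(1) True c'0 def0 by (simp add: rank_one_type_def)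
    next
      case False
      then have "span2 (S 1 0 0 0 0 0) (S 0 b c d e f) \<sim>\<^sub>K span2 (S 1 0 0 0 0 0) (S 0 0 1 1 0 0)"
        using c3[of 1] by (intro cong_line_trans[OF cong_line_trans[OF c1 c2]]) simp
      then show ?thesis using 2(1) False c'0 by (simp add: rank_one_type_def)
    qed
  next
    case 3
    then have bc: "b \<noteq> 0 \<or> c \<noteq> 0" using nz by auto
    obtain p q r s where g: "p * s - q * r \<noteq> 0" "p * b+q * c = 1" "r * b+s * c = 0"
      using vector2_frame[OF bc] by metis
    have "span2 (S 1 0 0 0 0 0) (S 0 b c d e f) \<sim>\<^sub>K span2 (S 1 0 0 0 0 0) (S 0 1 0 0 0 0)"
      by (rule cong_lineI[where A="mat3 [[1,0,0],[0,p,q],[0,r,s]]" and p=1 and q=0 and r=0 and s=1])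
        (use g 3 in \<open>simp_all add: invertible_mat3 act_S mult.commute\<close>)
    then show ?thesis using 3 by (simp add: rank_one_type_def)
  qed
qed

lemma has_nf_rank_one:
  assumes "PG5_line (span2 (S 1 0 0 0 0 0) (S 0 b c d e f))"
  shows "has_nf (span2 (S 1 0 0 0 0 0) (S 0 b c d e (f::'a)))"
  using rank_one_line_nf[OF assms] unfolding has_nf_def by blast

subsection \<open>Lines without points of rank one\<close>

text \<open>In the next lemmas the first matrix is a simple zero of the determinant along the line,
  which is what the nonzero last entry of the second matrix says.\<close>

lemma clear_last:
  assumes "n \<noteq> (0::'a)"
  shows "\<exists>x y w. span2 (S a b 0 d 0 0) (S x' y' z w' v n) \<sim>\<^sub>K span2 (S a b 0 d 0 0) (S x y 0 w 0 1)"
proof -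
  have "span2 (S a b 0 d 0 0) (S x' y' z w' v n) \<sim>\<^sub>K 
    span2 (S a b 0 d 0 0) (S ((x'-z * z/n)/n) ((y'-z * v/n)/n) 0 ((w'-v * v/n)/n) 0 1)"
    by (rule cong_lineI[where A="mat3 [[1,0,-z/n],[0,1,-v/n],[0,0,1]]" and p=1 and q=0 and r=0 and s="1/n"])
      (use assms in \<open>simp_all add: invertible_mat3 act_S field_simps\<close>)
  then show ?thesis by blast
qed

lemma has_nf_diag2:
  assumes "x \<noteq> (0::'a)"
  shows "has_nf (span2 (S x 0 0 0 0 1) (S 0 0 0 x 0 1))"
proof (cases "is_square (-x)")
  case True
  then obtain r where r: "r \<noteq> 0" "-x = r^2" using assms square_cases'[of "-x"] by auto
  then have x: "x = - (r^2)" by (metis minus_minus)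
  have "span2 (S x 0 0 0 0 1) (S 0 0 0 x 0 1) \<sim>\<^sub>K span2 (S 1 0 0 (-1) 0 0) (S 0 0 0 (-1) 0 1)"
    by (rule cong_lineI[where A="mat3 [[1/r,0,0],[0,0,1],[0,1/r,0]]" and p="-1" and q=0 and r=0 and s="-1"])
      (use r in \<open>simp_all add: invertible_mat3 act_S x power2_eq_square\<close>)
  then show ?thesis using has_nfI[of o14_1] has_nf_cong by (simp; blast)
next
  case False
  then obtain r where r: "r \<noteq> 0" "-x = \<epsilon> * r^2" by (rule nonsquare_cases)
  then have x: "x = - (\<epsilon> * r^2)" by (metis minus_minus)
  have "span2 (S x 0 0 0 0 1) (S 0 0 0 x 0 1) \<sim>\<^sub>K span2 (S 1 0 0 (-\<epsilon>) 0 0) (S 0 0 0 (-\<epsilon>) 0 1)"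
    by (rule cong_lineI[where A="mat3 [[1/r,0,0],[0,0,\<epsilon>],[0,1/r,0]]" and p="-1/\<epsilon>" and q=0 and r=0 and s="-1/\<epsilon>"])
      (use r in \<open>simp_all add: invertible_mat3 act_S x power2_eq_square\<close>)
  then show ?thesis using has_nfI[of o14_2] has_nf_cong by (simp; blast)
qed

lemma has_nf_hyperbolic_diag:
  assumes nr: "no_rank_one (span2 (S 0 1 0 0 0 0) (S x 0 0 w 0 1))"
  shows "has_nf (span2 (S 0 1 0 0 0 0) (S x 0 0 w 0 (1::'a)))"
proof -
  have swap: "span2 (S 0 1 0 0 0 0) (S x 0 0 w 0 1) \<sim>\<^sub>K span2 (S 0 1 0 0 0 0) (S w 0 0 x 0 1)" for x w :: 'a
    by (rule cong_lineI[where A="mat3 [[0,1,0],[1,0,0],[0,0,1]]" and p=1 and q=0 and r=0 and s=1])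
      (simp_all add: invertible_mat3 act_S)
  have scale: "span2 (S 0 1 0 0 0 0) (S x 0 0 w 0 1) \<sim>\<^sub>K span2 (S 0 1 0 0 0 0) (S (s * s * x) 0 0 (t * t * w) 0 1)"
    if "s \<noteq> 0" "t \<noteq> 0" for x w s t :: 'a
    by (rule cong_lineI[where A="mat3 [[s,0,0],[0,t,0],[0,0,1]]" and p="1/(s * t)" and q=0 and r=0 and s=1])
      (use that in \<open>simp_all add: invertible_mat3 act_S\<close>)
  have one: "has_nf (span2 (S 0 1 0 0 0 0) (S 0 0 0 w 0 1))" if w: "w \<noteq> 0" for w :: 'a
  proof (cases "is_square (-w)")
    case True
    then obtain r where r: "r \<noteq> 0" "-w = r^2" using w square_cases'[of "-w"] by auto
    then have x: "w = - (r^2)" by (metis minus_minus)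
    have "span2 (S 0 1 0 0 0 0) (S 0 0 0 w 0 1) \<sim>\<^sub>K span2 (S 0 1 0 0 0 0) (S 0 0 0 1 0 (-1))"
      by (rule cong_lineI[where A="mat3 [[1,0,0],[0,1/r,0],[0,0,1]]" and p=r and q=0 and r=0 and s="-1"])
        (use r in \<open>simp_all add: invertible_mat3 act_S x power2_eq_square\<close>)
    then show ?thesis using has_nfI[of o13_1] has_nf_cong by (simp; blast)
  next
    case False
    then obtain r where r: "r \<noteq> 0" "-w = \<epsilon> * r^2" by (rule nonsquare_cases)
    then have x: "w = - (\<epsilon> * r^2)" by (metis minus_minus)
    have "span2 (S 0 1 0 0 0 0) (S 0 0 0 w 0 1) \<sim>\<^sub>K span2 (S 0 1 0 0 0 0) (S 0 0 0 1 0 (-\<epsilon>))"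
      by (rule cong_lineI[where A="mat3 [[1,0,0],[0,1/r,0],[0,0,\<epsilon>]]" and p=r and q=0 and r=0 and s="-1/\<epsilon>"])
        (use r in \<open>simp_all add: invertible_mat3 act_S x power2_eq_square\<close>)
    then show ?thesis using has_nfI[of o13_2] has_nf_cong by (simp; blast)
  qed
  have two_cases: "has_nf (span2 (S 0 1 0 0 0 0) (S x 0 0 w 0 1))" 
    if h: "is_square x" "x \<noteq> 0" "\<not> is_square w" for x w :: 'a
  proof -
    obtain r where r: "r \<noteq> 0" "x = r^2" using square_cases'[OF h(1,2)] by metis
    obtain t where t: "t \<noteq> 0" "w = \<epsilon> * t^2" using nonsquare_cases[OF h(3)] by metis
    have "1/r * (1/r) * x = 1" "1/t * (1/t) * w = \<epsilon>" using r t by (simp_all add: power2_eq_square)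
    then have "span2 (S 0 1 0 0 0 0) (S x 0 0 w 0 1) \<sim>\<^sub>K span2 (S 0 1 0 0 0 0) (S 1 0 0 \<epsilon> 0 1)"
      using scale[of "1/r" "1/t" x w] r t by simp
    then show ?thesis using has_nfI[of o15_1] has_nf_cong by (simp; blast)
  qed
  consider "x = 0" "w = 0" | "x = 0" "w \<noteq> 0" | "x \<noteq> 0" "w = 0" | "x \<noteq> 0" "w \<noteq> 0" "is_square (x * w)"
    | "x \<noteq> 0" "w \<noteq> 0" "\<not> is_square (x * w)" by blast
  then show ?thesis
  proof cases
    case 1
    then show ?thesis using no_rank_oneD[OF nr, of 0 1] by (simp add: rank_one_S)
  next
    case 2 then show ?thesis using one by simp
  next
    case 3 then show ?thesis using one swap[of x 0] has_nf_cong by blast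
  next
    case 4
    then obtain r where r: "r \<noteq> 0" "x * w = r^2" using square_cases'[of "x * w"] by auto
    then have w: "w = r^2 / x" using 4 by (simp add: field_simps)
    have "span2 (S 0 1 0 0 0 0) (S x 0 0 w 0 1) \<sim>\<^sub>K span2 (S x 0 0 0 0 1) (S 0 0 0 x 0 1)"
    proof (rule cong_lineI[where A="mat3 [[1/2,x/(2 * r),0],[1/2,-x/(2 * r),0],[0,0,1]]" and p=r and q=1 and r="-r" and s=1])
      have f: "u / 4 + (u / 4 + (u / 4 + u / 4)) = u" for u :: 'a
        using four by (simp add: field_simps)
      show "invertible (mat3 [[1/2,x/(2 * r),0],[1/2,-x/(2 * r),0],[0,0,1]])"
        using 4 r by (simp add: invertible_mat3 field_simps)
      show "S x 0 0 0 0 1 = mscale r (act (mat3 [[1/2,x/(2 * r),0],[1/2,-x/(2 * r),0],[0,0,1]]) (S 0 1 0 0 0 0)) +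
         mscale 1 (act (mat3 [[1/2,x/(2 * r),0],[1/2,-x/(2 * r),0],[0,0,1]]) (S x 0 0 w 0 1))"
        "S 0 0 0 x 0 1 = mscale (-r) (act (mat3 [[1/2,x/(2 * r),0],[1/2,-x/(2 * r),0],[0,0,1]]) (S 0 1 0 0 0 0)) +
         mscale 1 (act (mat3 [[1/2,x/(2 * r),0],[1/2,-x/(2 * r),0],[0,0,1]]) (S x 0 0 w 0 1))"
        using 4 r by (simp_all add: act_S w field_simps power2_eq_square)
    qed (use r in simp)
    then show ?thesis using has_nf_diag2 4 has_nf_cong by blast
  next
    case 5
    then have "is_square x \<and> \<not> is_square w \<or> is_square w \<and> \<not> is_square x"
      using is_square_mult_iff[OF odd_card] by blast
    then show ?thesis using two_cases[of x w] two_cases[of w x] swap[of x w] 5 has_nf_cong by blast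
  qed
qed

lemma has_nf_hyperbolic:
  assumes nr: "no_rank_one (span2 (S a b 0 d 0 0) (S x y z w v n))" and n: "n \<noteq> (0::'a)"
    and sq: "is_square (b^2 - a * d)" "b^2 - a * d \<noteq> 0"
  shows "has_nf (span2 (S a b 0 d 0 0) (S x y z w v n))"
proof -
  obtain x1 y1 w1 where c1: "span2 (S a b 0 d 0 0) (S x y z w v n) \<sim>\<^sub>K span2 (S a b 0 d 0 0) (S x1 y1 0 w1 0 1)"
    using clear_last[OF n] by blast
  obtain p q r s k where g: "p * s - q * r \<noteq> 0" "k \<noteq> 0" 
    "a * p * p + d * q * q + b * (p * q+q * p) = 0" "a * p * r + d * q * s + b * (p * s+q * r) = k" "a * r * r + d * s * s + b * (r * s+s * r) = 0"
    using binary_hyperbolic[OF sq] by metis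
  obtain x2 y2 w2 where c2: "act (mat3 [[p,q,0],[r,s,0],[0,0,1]]) (S x1 y1 0 w1 0 1) = S x2 y2 0 w2 0 1"
    by (simp add: act_S)
  have "span2 (S a b 0 d 0 0) (S x1 y1 0 w1 0 1) \<sim>\<^sub>K span2 (S 0 1 0 0 0 0) (S x2 0 0 w2 0 1)"
  proof (rule cong_lineI[where A="mat3 [[p,q,0],[r,s,0],[0,0,1]]" and p="1/k" and q=0 and r="-y2/k" and s=1])
    show "S 0 1 0 0 0 0 = mscale (1/k) (act (mat3 [[p,q,0],[r,s,0],[0,0,1]]) (S a b 0 d 0 0)) +
      mscale 0 (act (mat3 [[p,q,0],[r,s,0],[0,0,1]]) (S x1 y1 0 w1 0 1))"
      using g by (simp add: act_S)
    show "S x2 0 0 w2 0 1 = mscale (-y2/k) (act (mat3 [[p,q,0],[r,s,0],[0,0,1]]) (S a b 0 d 0 0)) +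
      mscale 1 (act (mat3 [[p,q,0],[r,s,0],[0,0,1]]) (S x1 y1 0 w1 0 1))"
      unfolding c2 using g by (simp add: act_S)
  qed (use g in \<open>simp_all add: invertible_mat3\<close>)
  then have c: "span2 (S a b 0 d 0 0) (S x y z w v n) \<sim>\<^sub>K span2 (S 0 1 0 0 0 0) (S x2 0 0 w2 0 1)"
    using c1 cong_line_trans by blast
  then show ?thesis using has_nf_hyperbolic_diag no_rank_one_cong[OF c nr] has_nf_cong by blast
qed

text \<open>With \<open>p, q\<close> for \<open>w = p + q \<surd>\<epsilon>\<close> and \<open>z, t\<close> for a point \<open>Z = z + t \<surd>\<epsilon>\<close> the two forms
  here are the norm of \<open>Z\<close> and the real part of \<open>w Z\<^sup>2\<close> plus a square.\<close>

lemma elliptic_span_hyperbolic: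
  assumes nr: "no_rank_one (span2 (S 1 0 0 (-\<epsilon>) 0 0) (S p (\<epsilon>*q) 0 (\<epsilon>*p) 0 1))"
    and sq: "is_square (p^2 - \<epsilon>*q^2)"
  shows "has_nf (span2 (S 1 0 0 (-\<epsilon>) 0 0) (S p (\<epsilon>*q) 0 (\<epsilon>*p) 0 1))"
proof -
  let ?L = "span2 (S 1 0 0 (-\<epsilon>) 0 0) (S p (\<epsilon>*q) 0 (\<epsilon>*p) 0 1)"
  obtain n where n: "p^2 - \<epsilon>*q^2 = n^2" using sq by (auto simp: is_nth_power_def)
  have pq: "p \<noteq> 0 \<or> q \<noteq> 0" using no_rank_oneD[OF nr, of 0 1] by (auto simp: rank_one_S)
  have main: "has_nf ?L" if s: "is_square (-(p+m))" "p + m \<noteq> 0" and m: "m^2 = n^2" for m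
  proof -
    obtain P c where P: "P \<noteq> 0" "p + m = P" and c: "c = \<epsilon>*q/P" using s by blast
    have q: "q = c * P/\<epsilon>" using P c by simp
    have "\<epsilon>*((p + m) * (p - m)) = \<epsilon>*(p^2 - n^2)" using m by (simp add: power2_eq_square algebra_simps)
    also have "\<dots> = (\<epsilon>*q) * (\<epsilon>*q)" using n by (simp add: power2_eq_square algebra_simps)
    also have "\<epsilon>*q = c * P" using P c by simp
    finally have "P * (\<epsilon>*(p - m)) = P * (c * c * P)" using P by (simp add: mult_ac)
    then have "\<epsilon>*(p - m) = c * c * P" using P(1) by simp
    then have d: "p - m = c * c * P/\<epsilon>" by (simp add: eq_divide_eq mult.commute)
    have "2 * p = (p + m) + (p - m)" "2 * m = (p + m) - (p - m)" by (simp_all add: algebra_simps)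
    then have pm: "2 * p = P + c * c * P/\<epsilon>" "2 * m = P - c * c * P/\<epsilon>" unfolding d P(2) .
    then have p: "p = (P + c * c * P/\<epsilon>)/2" and m': "m = (P - c * c * P/\<epsilon>)/2" by (simp_all add: eq_divide_eq mult.commute)
    define k where "k = c^2 - \<epsilon>"
    have c: "?L \<sim>\<^sub>K span2 (S P 0 0 1 0 0) (S 1 0 (-c) 0 0 k)"
      by (rule cong_lineI[where A="mat3 [[1,0,0],[0,0,1],[-c,1,0]]" and p=m and q=1 and r=1 and s=0])
        (simp_all add: invertible_mat3 act_S k_def q p m' field_simps power2_eq_square)
    have "k \<noteq> 0" using nonsquare unfolding k_def by (metis eq_iff_diff_eq_0 is_nth_power_def)
    then show ?thesis
      using has_nf_hyperbolic[OF no_rank_one_cong[OF c nr]] s P has_nf_cong[OF c] by simp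
  qed
  have n': "(p+n) * (p-n) = \<epsilon>*q^2" using n by (simp add: power2_eq_square algebra_simps)
  show ?thesis
  proof (cases "q = 0")
    case False
    then have nz: "-(p+n) \<noteq> 0" "-(p-n) \<noteq> 0" using n' by auto
    have "\<not> is_square (\<epsilon>*q^2)" using False is_square_eps_mult[of "q^2"] by simp
    then have "\<not> is_square ((-(p+n)) * (-(p-n)))" unfolding minus_mult_minus n' .
    then have "is_square (-(p+n)) \<or> is_square (-(p-n))"
      using is_square_mult_iff[OF odd_card nz] by blast
    moreover have "p + n \<noteq> 0" "p + - n \<noteq> 0" using nz by (auto simp del: minus_add_distrib)
    ultimately show ?thesis using main[of n, OF _ _ refl] main[of "-n"] 
      by (metis diff_conv_add_uminus power2_minus)
  next
    case True
    then have p: "p \<noteq> 0" using pq by simp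
    show ?thesis
    proof (cases "is_square (-(p+p))")
      case True then show ?thesis using main[of p] p n \<open>q = 0\<close> by (simp flip: mult_2)
    next
      case False
      then have sq': "is_square (\<epsilon> * (-(p+p)))" using is_square_eps_mult[of "-(p+p)"] p by (simp flip: mult_2)
      have c: "?L \<sim>\<^sub>K span2 (S (2 * \<epsilon>*p) 0 0 1 0 0) (S (-\<epsilon>) 0 0 0 0 1)"
        by (rule cong_lineI[where A="mat3 [[0,1,0],[0,0,1],[1,0,0]]" and p="-p" and q=1 and r=1 and s=0])
          (simp_all add: invertible_mat3 act_S True)
      then show ?thesis
        using has_nf_hyperbolic[OF no_rank_one_cong[OF c nr]] sq' p has_nf_cong[OF c] by (simp add: algebra_simps)
    qed
  qed
qed

lemma has_nf_elliptic:
  assumes nr: "no_rank_one (span2 (S a b 0 d 0 0) (S x y z w v n))" and n: "n \<noteq> (0::'a)"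
    and sq: "\<not> is_square (b^2 - a * d)"
  shows "has_nf (span2 (S a b 0 d 0 0) (S x y z w v n))"
proof -
  obtain x1 y1 w1 where c1: "span2 (S a b 0 d 0 0) (S x y z w v n) \<sim>\<^sub>K span2 (S a b 0 d 0 0) (S x1 y1 0 w1 0 1)"
    using clear_last[OF n] by blast
  have "b^2 - a * d \<noteq> 0" using sq by auto
  then obtain p q r s k m j where g: "p * s - q * r \<noteq> 0" "k \<noteq> 0" "m \<noteq> 0"
      "a * p * p + d * q * q + b * (p * q+q * p) = k" "a * p * r + d * q * s + b * (p * s+q * r) = 0" "a * r * r + d * s * s + b * (r * s+s * r) = m"
      "j \<noteq> 0" "- (k * m) = j^2 * (b^2 - a * d)"
    using binary_diag[of b a d] by metis
  then have "\<not> is_square (-(k * m))" using sq by simp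
  then obtain t where t: "t \<noteq> 0" "-(k * m) = \<epsilon> * t^2" by (rule nonsquare_cases)
  obtain x2 y2 w2 where c2: "act (mat3 [[p,q,0],[r,s,0],[0,0,1]]) (S x1 y1 0 w1 0 1) = S x2 y2 0 w2 0 1"
    by (simp add: act_S)
  have c2': "span2 (S a b 0 d 0 0) (S x1 y1 0 w1 0 1) \<sim>\<^sub>K span2 (S k 0 0 m 0 0) (S x2 y2 0 w2 0 1)"
  proof (rule cong_lineI[where A="mat3 [[p,q,0],[r,s,0],[0,0,1]]" and p="1" and q=0 and r=0 and s=1])
  qed (use g in \<open>simp_all only: c2\<close>, simp_all add: invertible_mat3 act_S)
  have "k * m = - (\<epsilon> * t^2)" using t by (metis minus_minus)
  then have m: "m = - (\<epsilon> * t^2 / k)" using g(2) by (simp add: field_simps)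
  define u where "u = k/t * (k/t) * w2"
  define j where "j = k/t * y2"
  have c3: "span2 (S k 0 0 m 0 0) (S x2 y2 0 w2 0 1) \<sim>\<^sub>K span2 (S 1 0 0 (-\<epsilon>) 0 0) (S x2 j 0 u 0 1)"
    by (rule cong_lineI[where A="mat3 [[1,0,0],[0,k/t,0],[0,0,1]]" and p="1/k" and q=0 and r=0 and s=1])
      (use g(2) t(1) in \<open>simp_all add: invertible_mat3 act_S m u_def j_def power2_eq_square\<close>)
  define P where "P = (x2 + u/\<epsilon>)/2"
  define Q where "Q = j/\<epsilon>"
  define l where "l = (u/\<epsilon> - x2)/2"
  have PQ: "P = x2 + l" "\<epsilon> * P = u - \<epsilon> * l" "\<epsilon>*Q = j"
    unfolding P_def l_def Q_def by (simp_all add: field_simps)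
  have c4: "span2 (S 1 0 0 (-\<epsilon>) 0 0) (S x2 j 0 u 0 1) \<sim>\<^sub>K 
    span2 (S 1 0 0 (-\<epsilon>) 0 0) (S P (\<epsilon>*Q) 0 (\<epsilon>*P) 0 1)"
    unfolding PQ(2,3) unfolding PQ(1)
    by (rule cong_lineI[where A="mat3 [[1,0,0],[0,1,0],[0,0,1]]" and p=1 and q=0 and r=l and s=1])
      (simp_all add: invertible_mat3 act_S mult.commute)
  have c: "span2 (S a b 0 d 0 0) (S x y z w v n) \<sim>\<^sub>K span2 (S 1 0 0 (-\<epsilon>) 0 0) (S P (\<epsilon>*Q) 0 (\<epsilon>*P) 0 1)"
    using c1 c2' c3 c4 cong_line_trans by blast
  show ?thesis
  proof (cases "is_square (P^2 - \<epsilon>*Q^2)")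
    case True
    then show ?thesis using elliptic_span_hyperbolic[OF no_rank_one_cong[OF c nr]] has_nf_cong[OF c] by blast
  next
    case False
    then show ?thesis using has_nf_cong[OF c] has_nfI[of o15_2] by fastforce
  qed
qed

lemma has_nf_simple:
  assumes nr: "no_rank_one (span2 (S a b 0 d 0 0) (S x y z w v n))" and n: "n \<noteq> (0::'a)"
    and L: "PG5_line (span2 (S a b 0 d 0 0) (S x y z w v n))"
  shows "has_nf (span2 (S a b 0 d 0 0) (S x y z w v n))"
proof -
  have "S a b 0 d 0 0 \<noteq> 0" using indep2_PG5_line[OF L, unfolded indep2_def, rule_format, of 1 0] by auto
  then have "b^2 - a * d \<noteq> 0" using no_rank_oneD[OF nr, of 1 0] by (auto simp: rank_one_S)
  then show ?thesis using has_nf_hyperbolic[OF nr n] has_nf_elliptic[OF nr n] by blast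
qed

text \<open>A common kernel: a pencil of binary forms none of which is a square.\<close>

lemma has_nf_binary:
  assumes nr: "no_rank_one (span2 (S a b 0 d 0 0) (S x y 0 w 0 0))" 
    and L: "PG5_line (span2 (S a b 0 d 0 0) (S x y 0 w 0 (0::'a)))"
  shows "has_nf (span2 (S a b 0 d 0 0) (S x y 0 w 0 (0::'a)))"
proof -
  obtain a1 b1 d1 y1 w1 where c1: "span2 (S a b 0 d 0 0) (S x y 0 w 0 0) \<sim>\<^sub>K span2 (S a1 b1 0 d1 0 0) (S 0 y1 0 w1 0 0)"
  proof (cases "a = 0")
    case True
    have "span2 (S a b 0 d 0 0) (S x y 0 w 0 0) \<sim>\<^sub>K span2 (S x y 0 w 0 0) (S 0 b 0 d 0 0)"
      by (rule cong_lineI[where A="mat3 [[1,0,0],[0,1,0],[0,0,1]]" and p=0 and q=1 and r=1 and s=0])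
        (simp_all add: invertible_mat3 act_S True)
    then show ?thesis using that by blast
  next
    case False
    have "span2 (S a b 0 d 0 0) (S x y 0 w 0 0) \<sim>\<^sub>K span2 (S a b 0 d 0 0) (S 0 (y-x/a * b) 0 (w-x/a * d) 0 0)"
      by (rule cong_lineI[where A="mat3 [[1,0,0],[0,1,0],[0,0,1]]" and p=1 and q=0 and r="-x/a" and s=1])
        (use False in \<open>simp_all add: invertible_mat3 act_S\<close>)
    then show ?thesis using that by blast
  qed
  have nr1: "no_rank_one (span2 (S a1 b1 0 d1 0 0) (S 0 y1 0 w1 0 0))"
    and L1: "PG5_line (span2 (S a1 b1 0 d1 0 0) (S 0 y1 0 w1 0 0))"
    using no_rank_one_cong[OF c1 nr] PG5_line_cong[OF c1 L] by auto
  have "S 0 y1 0 w1 0 0 \<noteq> 0" using indep2_PG5_line[OF L1, unfolded indep2_def, rule_format, of 0 1] by auto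
  then have y: "y1 \<noteq> 0" using no_rank_oneD[OF nr1, of 0 1] by (auto simp: rank_one_S)
  obtain a2 b2 d2 where A: "act (mat3 [[1,0,0],[-w1/(2 * y1),1,0],[0,0,1]]) (S a1 b1 0 d1 0 0) = S a2 b2 0 d2 0 0"
    by (simp add: act_S)
  have c2: "span2 (S a1 b1 0 d1 0 0) (S 0 y1 0 w1 0 0) \<sim>\<^sub>K span2 (S 0 1 0 0 0 0) (S a2 0 0 d2 0 0)"
  proof (rule cong_lineI[where A="mat3 [[1,0,0],[-w1/(2 * y1),1,0],[0,0,1]]" and p=0 and q="1/y1" and r=1 and s="-b2/y1"])
    have "w1/2+w1/2 = w1" using two by (simp add: field_simps)
    then show "S 0 1 0 0 0 0 = mscale 0 (act (mat3 [[1,0,0],[-w1/(2 * y1),1,0],[0,0,1]]) (S a1 b1 0 d1 0 0)) +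
      mscale (1/y1) (act (mat3 [[1,0,0],[-w1/(2 * y1),1,0],[0,0,1]]) (S 0 y1 0 w1 0 0))"
      "S a2 0 0 d2 0 0 = mscale 1 (act (mat3 [[1,0,0],[-w1/(2 * y1),1,0],[0,0,1]]) (S a1 b1 0 d1 0 0)) +
      mscale (-b2/y1) (act (mat3 [[1,0,0],[-w1/(2 * y1),1,0],[0,0,1]]) (S 0 y1 0 w1 0 0))"
      using y unfolding A by (simp_all add: act_S field_simps)
  qed (use y in \<open>simp_all add: invertible_mat3\<close>)
  have nr2: "no_rank_one (span2 (S 0 1 0 0 0 0) (S a2 0 0 d2 0 0))"
    and L2: "PG5_line (span2 (S 0 1 0 0 0 0) (S a2 0 0 d2 0 0))"
    using no_rank_one_cong[OF c2 nr1] PG5_line_cong[OF c2 L1] by auto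
  have "S a2 0 0 d2 0 0 \<noteq> 0" using indep2_PG5_line[OF L2, unfolded indep2_def, rule_format, of 0 1] by auto
  then have ad: "a2 \<noteq> 0" "d2 \<noteq> 0" using no_rank_oneD[OF nr2, of 0 1] by (auto simp: rank_one_S)
  have "\<not> is_square (a2 * d2)"
  proof
    assume "is_square (a2 * d2)"
    then obtain s where "a2 * d2 = s^2" by (auto simp: is_nth_power_def)
    then show False using no_rank_oneD[OF nr2, of s 1] ad by (simp add: rank_one_S)
  qed
  then obtain t where t: "t \<noteq> 0" "a2 * d2 = \<epsilon>*t^2" by (rule nonsquare_cases)
  then have d2: "d2 = \<epsilon>*t^2/a2" using ad by (simp add: field_simps)
  have c3: "span2 (S 0 1 0 0 0 0) (S a2 0 0 d2 0 0) \<sim>\<^sub>K span2 (S 0 1 0 0 0 0) (S 1 0 0 \<epsilon> 0 0)"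
    by (rule cong_lineI[where A="mat3 [[1,0,0],[0,a2/t,0],[0,0,1]]" and p="t/a2" and q=0 and r=0 and s="1/a2"])
      (use ad t in \<open>simp_all add: invertible_mat3 act_S d2 power2_eq_square\<close>)
  have "has_nf (span2 (S 0 1 0 0 0 0) (S 1 0 0 \<epsilon> 0 0))" using has_nfI[of o10] by simp
  then show ?thesis using c1 c2 c3 has_nf_cong by blast
qed

lemma has_nf_tangent:
  assumes nr: "no_rank_one (span2 (S a b 0 d 0 0) (S x y z w v 0))" 
    and L: "PG5_line (span2 (S a b 0 d 0 0) (S x y z w v (0::'a)))"
    and zv: "z \<noteq> 0 \<or> v \<noteq> 0"
  shows "has_nf (span2 (S a b 0 d 0 0) (S x y z w v (0::'a)))"
proof -
  obtain p q r s where g: "p * s - q * r \<noteq> 0" "p * z+q * v = 1" "r * z+s * v = 0"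
    using vector2_frame[OF zv] by metis
  obtain a1 b1 d1 where A1: "act (mat3 [[p,q,0],[r,s,0],[0,0,1]]) (S a b 0 d 0 0) = S a1 b1 0 d1 0 0"
    by (simp add: act_S)
  have g': "z * p+v * q = 1" "z * r+v * s = 0" using g by (simp_all add: mult.commute)
  obtain x1 y1 w1 where A2: "act (mat3 [[p,q,0],[r,s,0],[0,0,1]]) (S x y z w v 0) = S x1 y1 1 w1 0 0"
    by (simp add: act_S g g')
  have c1: "span2 (S a b 0 d 0 0) (S x y z w v 0) \<sim>\<^sub>K span2 (S a1 b1 0 d1 0 0) (S x1 y1 1 w1 0 0)"
    by (rule cong_lineI[where A="mat3 [[p,q,0],[r,s,0],[0,0,1]]" and p=1 and q=0 and r=0 and s=1])
      (simp_all only: A1 A2, use g in \<open>simp_all add: invertible_mat3\<close>)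
  have c2: "span2 (S a1 b1 0 d1 0 0) (S x1 y1 1 w1 0 0) \<sim>\<^sub>K span2 (S a1 b1 0 d1 0 0) (S 0 0 1 w1 0 0)"
    by (rule cong_lineI[where A="mat3 [[1,0,-x1/2],[0,1,-y1],[0,0,1]]" and p=1 and q=0 and r=0 and s=1])
      (simp_all add: invertible_mat3 act_S field_simps)
  have c12: "span2 (S a b 0 d 0 0) (S x y z w v 0) \<sim>\<^sub>K span2 (S a1 b1 0 d1 0 0) (S 0 0 1 w1 0 0)"
    using c1 c2 cong_line_trans by blast
  have nr1: "no_rank_one (span2 (S a1 b1 0 d1 0 0) (S 0 0 1 w1 0 0))"
    and L1: "PG5_line (span2 (S a1 b1 0 d1 0 0) (S 0 0 1 w1 0 0))"
    using no_rank_one_cong[OF c12 nr] PG5_line_cong[OF c12 L] by auto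
  show ?thesis
  proof (cases "d1 = 0")
    case False
    have c3: "span2 (S a1 b1 0 d1 0 0) (S 0 0 1 w1 0 0) \<sim>\<^sub>K 
      span2 (S (-w1/d1 * a1) (-w1/d1 * b1) 1 0 0 0) (S a1 b1 0 d1 0 0)"
      by (rule cong_lineI[where A="mat3 [[1,0,0],[0,1,0],[0,0,1]]" and p="-w1/d1" and q=1 and r=1 and s=0])
        (use False in \<open>simp_all add: invertible_mat3 act_S\<close>)
    obtain x y z u v w m n where c4: "span2 (S (-w1/d1 * a1) (-w1/d1 * b1) 1 0 0 0) (S a1 b1 0 d1 0 0) \<sim>\<^sub>K
           span2 (S x y 0 z 0 0) (S u v w m n d1)"
      using singular_frame[where ?k1.0=0 and ?k2.0=1 and ?k3.0="w1/d1 * b1" and a="-w1/d1 * a1" 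
          and b="-w1/d1 * b1" and c=1 and d=0 and e=0 and f=0 and a'=a1 and b'=b1 and c'=0 and d'=d1 and e'=0 and f'=0 and quad=d1] 
      by auto
    have c: "span2 (S a1 b1 0 d1 0 0) (S 0 0 1 w1 0 0) \<sim>\<^sub>K span2 (S x y 0 z 0 0) (S u v w m n d1)"
      using c3 c4 cong_line_trans by blast
    show ?thesis
      using has_nf_simple[OF no_rank_one_cong[OF c nr1] False PG5_line_cong[OF c L1]] c c12 has_nf_cong by blast
  next
    case True
    have "S a1 b1 0 d1 0 0 \<noteq> 0" using indep2_PG5_line[OF L1, unfolded indep2_def, rule_format, of 1 0] by auto
    then have b: "b1 \<noteq> 0" using no_rank_oneD[OF nr1, of 1 0] True by (auto simp: rank_one_S)
    define t where "t = a1/(2 * b1)"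
    have t: "b1 * t+b1 * t = a1" using b two by (simp add: t_def field_simps)
    have c3: "span2 (S a1 b1 0 d1 0 0) (S 0 0 1 w1 0 0) \<sim>\<^sub>K span2 (S 0 1 0 0 0 0) (S 0 0 1 w1 0 0)"
      by (rule cong_lineI[where A="mat3 [[1,-t,-w1 * t * t/2],[0,1,t * w1],[0,0,1]]" and p="1/b1" and q=0 and r=0 and s=1])
        (use b two True t[symmetric] in \<open>simp_all add: invertible_mat3 act_S field_simps\<close>)
    have c4: "span2 (S 0 1 0 0 0 0) (S 0 0 1 w1 0 0) \<sim>\<^sub>K span2 (S 0 0 1 1 0 0) (S 0 0 0 0 1 0)" if "w1 \<noteq> 0"
      by (rule cong_lineI[where A="mat3 [[0,0,w1],[0,1,0],[1,0,0]]" and p=0 and q="1/w1" and r=1 and s=0])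
        (use that in \<open>simp_all add: invertible_mat3 act_S\<close>)
    have c5: "span2 (S 0 1 0 0 0 0) (S 0 0 1 0 0 0) \<sim>\<^sub>K span2 (S 0 1 0 0 0 0) (S 0 0 0 0 1 (0::'a))"
      by (rule cong_lineI[where A="mat3 [[0,1,0],[1,0,0],[0,0,1]]" and p=1 and q=0 and r=0 and s=1])
        (simp_all add: invertible_mat3 act_S)
    have "has_nf (span2 (S 0 1 0 0 0 0) (S 0 0 1 w1 0 0))"
      using has_nfI[of o12] has_nfI[of o16] c4 c5 has_nf_cong by (cases "w1 = 0"; simp; blast)
    then show ?thesis using c3 c12 has_nf_cong by blast
  qed
qed

theorem line_has_nf:
  assumes L: "PG5_line L" shows "has_nf L"
proof -
  obtain M N where MN: "transpose M = M" "transpose N = N" "indep2 M N" "L = span2 M N"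
    using L unfolding PG5_line_iff by blast
  have other: "\<exists>N'. transpose N' = N' \<and> L = span2 Z N'" if Z: "Z \<in> L" "Z \<noteq> 0" for Z
  proof -
    obtain s t where st: "Z = mscale s M + mscale t N" using Z MN by (auto simp: span2_def)
    then have "s \<noteq> 0 \<or> t \<noteq> 0" using Z by auto
    then show ?thesis
    proof
      assume "s \<noteq> 0"
      then have "L = span2 Z (mscale 0 M + mscale 1 N)" unfolding st MN by (subst span2_rebase) auto
      then show ?thesis using MN(2) by auto
    next
      assume "t \<noteq> 0"
      then have "L = span2 Z (mscale 1 M + mscale 0 N)" unfolding st MN by (subst span2_rebase) auto
      then show ?thesis using MN(1) by auto
    qed
  qed
  have symL: "transpose Z = Z" if "Z \<in> L" for Z using L that by (auto simp: PG5_line_def)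
  consider Z where "Z \<in> L" "rank_one Z" | Z where "no_rank_one L" "Z \<in> L" "Z \<noteq> 0" "det Z = 0"
    | "nonsingular_line L"
    using L unfolding no_rank_one_def nonsingular_line_def by blast
  then show ?thesis
  proof cases
    case (1 Z)
    then have "Z \<noteq> 0" by (simp add: rank_one_def)
    then obtain N' where N': "transpose N' = N'" "L = span2 Z N'" using other 1 by blast
    obtain a b c d e f where Z: "Z = S a b c d e f" using symL[OF 1(1)] by (rule symmetric_cases)
    obtain A k where A: "invertible A" "k \<noteq> 0" "act A Z = S k 0 0 0 0 0" using rank_one_frame 1 Z by blast
    obtain a b c d e f where N: "act A N' = S a b c d e f" using transpose_act[OF N'(1)] by (rule symmetric_cases)
    have c: "L \<sim>\<^sub>K span2 (S 1 0 0 0 0 0) (S 0 b c d e f)"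
      unfolding N'(2)
      by (rule cong_lineI[OF A(1), where p="1/k" and q=0 and r="-a/k" and s=1]) (use A(2) in \<open>simp_all add: A(3) N\<close>)
    show ?thesis using has_nf_rank_one[OF PG5_line_cong[OF c L]] has_nf_cong[OF c] by blast
  next
    case (2 Z)
    then obtain N' where N': "transpose N' = N'" "L = span2 Z N'" using other by blast
    obtain a b c d e f where Z: "Z = S a b c d e f" using symL[OF 2(2)] by (rule symmetric_cases)
    obtain a' b' c' d' e' f' where N: "N' = S a' b' c' d' e' f'" using N'(1) by (rule symmetric_cases)
    obtain k1 k2 k3 where k: "k1 \<noteq> 0 \<or> k2 \<noteq> 0 \<or> k3 \<noteq> 0" 
      "a * k1+b * k2+c * k3 = 0" "b * k1+d * k2+e * k3 = 0" "c * k1+e * k2+f * k3 = 0"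
      using singular_kernel 2(4) unfolding Z by blast
    define quad where "quad = a'*k1 * k1 + d'*k2 * k2 + f'*k3 * k3 + b'*(k1 * k2+k2 * k1) + c'*(k1 * k3+k3 * k1) + e'*(k2 * k3+k3 * k2)"
    obtain x y z u v w m n where c: "L \<sim>\<^sub>K span2 (S x y 0 z 0 0) (S u v w m n quad)"
      unfolding N'(2) Z N using singular_frame[OF k quad_def] by blast
    note nr = no_rank_one_cong[OF c 2(1)] and L' = PG5_line_cong[OF c L]
    have "has_nf (span2 (S x y 0 z 0 0) (S u v w m n quad))"
    proof (cases "quad = 0")
      case True
      then show ?thesis using has_nf_binary[of x y z u v m] has_nf_tangent[of x y z u v w m n] nr L' 
        by (cases "w = 0 \<and> n = 0") auto
    qed (use has_nf_simple[OF nr _ L'] in blast)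
    then show ?thesis using has_nf_cong[OF c] by blast
  next
    case 3
    then show ?thesis using has_nfI[of o17] by simp
  qed
qed

end

section \<open>The cubic extension\<close>

text \<open>The Lagrange argument: multiplication by \<open>x\<close> permutes \<open>G\<close>.\<close>

lemma power_card_eq_1:
  fixes G :: "'b::field set"
  assumes G: "finite G" "0 \<notin> G" "\<And>x y. x \<in> G \<Longrightarrow> y \<in> G \<Longrightarrow> x * y \<in> G" and x: "x \<in> G"
  shows "x ^ card G = 1"
proof -
  have inj: "inj_on (\<lambda>y. x * y) G" using x G(2) by (auto simp: inj_on_def)
  have "(\<lambda>y. x * y) ` G = G"
    by (rule card_subset_eq) (use G x card_image[OF inj] in auto)
  then have "(\<Prod>y\<in>G. y) = (\<Prod>y\<in>(\<lambda>y. x * y) ` G. y)" by simp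
  also have "\<dots> = (\<Prod>y\<in>G. x * y)" by (simp add: prod.reindex[OF inj])
  also have "\<dots> = x ^ card G * (\<Prod>y\<in>G. y)" by (simp add: prod.distrib)
  finally show ?thesis using G by (simp add: prod_zero_iff)
qed

lemma power_eq_self_bound:
  assumes "n \<ge> (2::nat)"
  shows "finite {x::'b::field. x ^ n = x}" "card {x::'b. x ^ n = x} \<le> n"
proof -
  let ?p = "Polynomial.monom 1 n - Polynomial.monom (1::'b) 1"
  have c: "poly.coeff ?p n = 1" using assms by simp
  then have "?p \<noteq> 0" by (metis coeff_0 zero_neq_one)
  moreover have "{x. poly ?p x = 0} = {x. x ^ n = x}" by (simp add: poly_monom)
  ultimately show "finite {x::'b. x ^ n = x}" using poly_roots_finite by metis
  have "degree ?p \<le> n" using assms by (intro degree_diff_le) (auto simp: degree_monom_eq)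
  then show "card {x::'b. x ^ n = x} \<le> n"
    using card_poly_roots_bound[OF \<open>?p \<noteq> 0\<close>] \<open>{x. poly ?p x = 0} = _\<close> by simp
qed

lemma power_CARD: "(x::'a::{field,finite}) ^ CARD('a) = x"
proof (cases "x = 0")
  case False
  have "x ^ card (UNIV - {0::'a}) = 1" by (rule power_card_eq_1) (use False in auto)
  then have "x ^ (CARD('a) - 1) = 1" by simp
  moreover have "CARD('a) = Suc (CARD('a) - 1)" by simp
  ultimately show ?thesis by (metis mult.right_neutral power_Suc)
qed simp

lemma CARD_ge_2: "CARD('a::{field,finite}) \<ge> 2"
proof -
  have "card {0,1::'a} \<le> CARD('a)" by (rule card_mono) auto
  then show ?thesis by simp
qed

lemma range_to_ac: "range to_ac = {x::'a::{field,finite} alg_closure. x ^ CARD('a) = x}"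
proof (rule card_seteq)
  show "card {x::'a alg_closure. x ^ CARD('a) = x} \<le> card (range (to_ac::'a \<Rightarrow> _))"
    using power_eq_self_bound(2)[OF CARD_ge_2[where 'a='a]] card_image[OF inj_to_ac] by metis
  show "range to_ac \<subseteq> {x::'a alg_closure. x ^ CARD('a) = x}"
    by (auto simp flip: to_ac_power simp: power_CARD)
qed (rule power_eq_self_bound(1)[OF CARD_ge_2])

definition cubic_ext :: "'a::{field,finite} alg_closure set" where
  "cubic_ext = {x. x ^ (CARD('a) ^ 3) = x}"

lemma cubic_ext_mult: "x \<in> cubic_ext \<Longrightarrow> y \<in> cubic_ext \<Longrightarrow> x * y \<in> cubic_ext"
  and cubic_ext_divide: "x \<in> cubic_ext \<Longrightarrow> y \<in> cubic_ext \<Longrightarrow> x / y \<in> cubic_ext"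
  and cubic_ext_power: "x \<in> cubic_ext \<Longrightarrow> x ^ n \<in> cubic_ext"
  and cubic_ext_inverse: "x \<in> cubic_ext \<Longrightarrow> inverse x \<in> cubic_ext"
  by (simp_all add: cubic_ext_def power_mult_distrib power_divide power_inverse) 
     (metis power_commutes power_mult mult.commute)

text \<open>Every element is a square up to a factor from the ground field: the norm
  \<open>z\<^sup>1\<^sup>+\<^sup>q\<^sup>+\<^sup>q\<^sup>2\<close> lies in the ground field, and \<open>2 + q + q\<^sup>2\<close> is even.\<close>

lemma cubic_ext_square_class:
  assumes odd: "odd CARD('a::{field,finite})" and z: "(z::'a alg_closure) \<in> cubic_ext" "z \<noteq> 0"
  obtains c k where "c \<noteq> 0" "k \<in> cubic_ext" "k \<noteq> 0" "z = to_ac c * k^2"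
proof -
  let ?q = "CARD('a)"
  define N where "N = z ^ (1 + ?q + ?q^2)"
  have zq: "z ^ (?q^3) = z" using z by (simp add: cubic_ext_def)
  have "N ^ ?q = z ^ (?q + ?q^2) * z ^ (?q^3)"
    unfolding N_def by (simp flip: power_mult power_add add: power2_eq_square power3_eq_cube algebra_simps)
  also have "\<dots> = N" unfolding zq N_def by (simp add: power_add)
  finally obtain c where c: "N = to_ac c" using range_to_ac[where 'a='a] by blast
  obtain m where m: "?q + ?q^2 = 2 * m" using odd by (metis evenE even_add even_power)
  define k where "k = z ^ (m + 1)"
  have "(m + 1) * 2 = 2 * m + 2" by simp
  then have "k^2 = z ^ (2 * m + 2)" unfolding k_def by (metis power_mult)
  also have "2 * m + 2 = Suc (1 + 2 * m)" by simp
  also have "z ^ Suc (1 + 2 * m) = z ^ (1 + 2 * m) * z" by (rule power_Suc2)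
  also have "\<dots> = N * z" unfolding m[symmetric] N_def by (simp only: add.assoc)
  finally have "k^2 = to_ac c * z" using c by simp
  then have kz: "k^2 = to_ac c * z" .
  have "N \<noteq> 0" using z by (simp add: N_def)
  then have c0: "c \<noteq> 0" using c by auto
  show ?thesis
  proof (rule that)
    show "z = to_ac (inverse c) * k^2" unfolding kz using c0 by simp
    show "k \<in> cubic_ext" unfolding k_def using z(1) by (rule cubic_ext_power)
    show "k \<noteq> 0" unfolding k_def using z(2) by (rule power_not_zero)
  qed (use c0 in simp)
qed

locale irreducible_cubic =
  fixes a b d :: "'a::{field,finite}" and \<theta> :: "'a alg_closure"
  assumes theta: "\<theta>^3 = to_ac a * \<theta>^2 + to_ac b * \<theta> + to_ac d"
    and no_root: "\<And>t::'a. t^3 \<noteq> a * t^2 + b * t + d"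
begin

definition comb :: "'a \<Rightarrow> 'a \<Rightarrow> 'a \<Rightarrow> 'a alg_closure" where
  "comb p r s = to_ac p + to_ac r * \<theta> + to_ac s * \<theta>^2"

lemma theta_not_ground: "\<theta> \<noteq> to_ac t"
proof
  assume "\<theta> = to_ac t"
  with theta have "to_ac (t^3) = to_ac (a * t^2 + b * t + d)" by simp
  then show False using no_root[of t] by (simp only: to_ac_eq_iff)
qed

lemma comb_linear_eq_0: "to_ac p + to_ac r * \<theta> = 0 \<Longrightarrow> p = 0 \<and> r = 0"
proof -
  assume e: "to_ac p + to_ac r * \<theta> = 0"
  have "r = 0"
  proof (rule ccontr)
    assume "r \<noteq> 0"
    then have "\<theta> = to_ac (- p / r)" using e by (simp add: field_simps add_eq_0_iff)
    then show False using theta_not_ground by blast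
  qed
  then show ?thesis using e by simp
qed

text \<open>A quadratic relation would divide the cubic and leave a linear factor.\<close>

lemma comb_eq_0: "comb p r s = 0 \<Longrightarrow> p = 0 \<and> r = 0 \<and> s = 0"
proof -
  assume e: "comb p r s = 0"
  have "s = 0"
  proof (rule ccontr)
    assume s: "s \<noteq> 0"
    define u v where "u = - p / s" and "v = - r / s"
    have ps: "p = - (s * u)" "r = - (s * v)" using s by (simp_all add: u_def v_def)
    have "to_ac s * (\<theta>^2 - (to_ac u + to_ac v * \<theta>)) = 0"
      using e unfolding comb_def ps by (simp add: algebra_simps)
    then have t2: "\<theta>^2 = to_ac u + to_ac v * \<theta>" using s by simp
    have "\<theta>^3 = \<theta> * \<theta>^2" by (simp add: power2_eq_square power3_eq_cube)
    also have "\<dots> = \<theta> * (to_ac u + to_ac v * \<theta>)" unfolding t2 ..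
    also have "\<dots> = to_ac u * \<theta> + to_ac v * \<theta>^2" by (simp add: algebra_simps power2_eq_square)
    finally have "to_ac u * \<theta> + to_ac v * \<theta>^2 = to_ac a * \<theta>^2 + to_ac b * \<theta> + to_ac d" using theta by simp
    then have "to_ac (u * v - d - a * u) + to_ac (u + v^2 - b - a * v) * \<theta> = 0"
      unfolding t2 by (simp add: algebra_simps power2_eq_square)
    then have "u * v - d - a * u = 0 \<and> u + v^2 - b - a * v = 0" by (rule comb_linear_eq_0)
    then have d: "d = u * v - a * u" and b: "b = u + v^2 - a * v" by (simp_all add: algebra_simps)
    have "(a-v)^3 = a * (a-v)^2 + b * (a-v) + d"
      unfolding b d by (simp add: power2_eq_square power3_eq_cube algebra_simps)
    then show False using no_root by blast
  qed
  then show ?thesis using e comb_linear_eq_0[of p r] by (simp add: comb_def)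
qed

lemma comb_diff: "comb p r s - comb p' r' s' = comb (p-p') (r-r') (s-s')"
  by (simp add: comb_def algebra_simps)

lemma comb_inj: "comb p r s = comb p' r' s' \<longleftrightarrow> p = p' \<and> r = r' \<and> s = s'"
  using comb_eq_0[of "p-p'" "r-r'" "s-s'"] comb_diff[of p r s p' r' s'] by auto

definition span_theta :: "'a alg_closure set" where
  "span_theta = range (\<lambda>(p,r,s). comb p r s)"

lemma theta_comb: "\<theta> * comb p r s = comb (s * d) (p+s * b) (r+s * a)"
proof -
  have "\<theta> * comb p r s = to_ac p * \<theta> + to_ac r * \<theta>^2 + to_ac s * \<theta>^3"
    by (simp add: comb_def algebra_simps power2_eq_square power3_eq_cube)
  then show ?thesis unfolding theta by (simp add: comb_def algebra_simps)
qed

lemma comb_mem: "comb p r s \<in> span_theta"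
  unfolding span_theta_def by (rule image_eqI[of _ _ "(p,r,s)"]) auto

lemma span_theta_cases: "x \<in> span_theta \<Longrightarrow> (\<And>p r s. x = comb p r s \<Longrightarrow> P) \<Longrightarrow> P"
  unfolding span_theta_def by auto

lemma span_theta_add: "x \<in> span_theta \<Longrightarrow> y \<in> span_theta \<Longrightarrow> x + y \<in> span_theta"
proof (elim span_theta_cases)
  fix p r s p' r' s' assume "x = comb p r s" "y = comb p' r' s'"
  then have "x + y = comb (p+p') (r+r') (s+s')" by (simp add: comb_def algebra_simps)
  then show "x + y \<in> span_theta" by (simp add: comb_mem)
qed

lemma span_theta_scale: "x \<in> span_theta \<Longrightarrow> to_ac c * x \<in> span_theta"
proof (elim span_theta_cases)
  fix p r s assume "x = comb p r s"
  then have "to_ac c * x = comb (c * p) (c * r) (c * s)" by (simp add: comb_def algebra_simps)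
  then show "to_ac c * x \<in> span_theta" by (simp add: comb_mem)
qed

lemma span_theta_theta: "x \<in> span_theta \<Longrightarrow> \<theta> * x \<in> span_theta"
  by (elim span_theta_cases) (simp add: theta_comb comb_mem)

lemma span_theta_mult: "x \<in> span_theta \<Longrightarrow> y \<in> span_theta \<Longrightarrow> x * y \<in> span_theta"
proof -
  assume x: "x \<in> span_theta" and y: "y \<in> span_theta"
  obtain p r s where "x = comb p r s" using x by (auto simp: span_theta_def)
  then have "x * y = to_ac p * y + (to_ac r * (\<theta> * y) + to_ac s * (\<theta> * (\<theta> * y)))"
    by (simp add: comb_def algebra_simps power2_eq_square)
  then show ?thesis using y span_theta_add span_theta_scale span_theta_theta by simp
qed

lemma card_span_theta: "finite span_theta" "card span_theta = CARD('a)^3"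
proof -
  have "inj (\<lambda>(p,r,s). comb p r s)" by (auto simp: inj_on_def comb_inj)
  then show "card span_theta = CARD('a)^3"
    unfolding span_theta_def by (simp add: card_image power3_eq_cube)
qed (simp add: span_theta_def)

text \<open>Both sides have \<open>q\<^sup>3\<close> elements; hence the field generated by the root of an irreducible
  cubic does not depend on the cubic.\<close>

lemma span_theta_eq: "span_theta = cubic_ext"
proof (rule card_seteq)
  have q: "CARD('a)^3 \<ge> 2"
    using CARD_ge_2[where 'a='a] self_le_power[of "CARD('a)" 3] by linarith
  show "finite (cubic_ext::'a alg_closure set)" unfolding cubic_ext_def
    by (rule power_eq_self_bound(1)[OF q])
  show "card (cubic_ext::'a alg_closure set) \<le> card span_theta" 
    unfolding cubic_ext_def card_span_theta by (rule power_eq_self_bound(2)[OF q])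
  show "span_theta \<subseteq> cubic_ext"
  proof
    fix x assume x: "x \<in> span_theta"
    show "x \<in> cubic_ext"
    proof (cases "x = 0")
      case False
      have z: "0 \<in> span_theta" using comb_mem[of 0 0 0] by (simp add: comb_def)
      have "x ^ card (span_theta - {0}) = 1"
        by (rule power_card_eq_1) (use card_span_theta(1) span_theta_mult x False in auto)
      moreover obtain n where n: "CARD('a)^3 = Suc n" using q by (cases "CARD('a)^3") auto
      ultimately have "x ^ n = 1"
        using card_span_theta z by simp
      then show ?thesis unfolding cubic_ext_def n by simp
    qed (simp add: cubic_ext_def)
  qed
qed

end

section \<open>Lines without singular points\<close>

definition ac_comb :: "'a::field alg_closure^3 \<Rightarrow> 'a^3 \<Rightarrow> 'a alg_closure" where
  "ac_comb e v = (\<Sum>i\<in>UNIV. to_ac (v $ i) * e $ i)"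

definition ac_basis :: "'a::{field,finite} alg_closure^3 \<Rightarrow> bool" where
  "ac_basis e \<longleftrightarrow> bij_betw (ac_comb e) UNIV cubic_ext"

definition functional :: "('a::{field,finite} alg_closure \<Rightarrow> 'a) \<Rightarrow> bool" where
  "functional \<phi> \<longleftrightarrow> (\<forall>c. \<forall>x\<in>cubic_ext. \<forall>y\<in>cubic_ext. \<phi> (to_ac c * x + y) = c * \<phi> x + \<phi> y)"

text \<open>The forms \<open>x \<mapsto> \<phi> (x\<^sup>2)\<close> on the cubic extension, for the functionals \<open>\<phi>\<close> that vanish at
  \<open>z\<close>, written in the basis \<open>e\<close>.\<close>

definition field_line :: "'a::{field,finite} alg_closure^3 \<Rightarrow> 'a alg_closure \<Rightarrow> ('a^3^3) set" where
  "field_line e z = {(\<chi> i j. \<phi> (e $ i * e $ j)) | \<phi>. functional \<phi> \<and> \<phi> z = 0}"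

lemma ac_comb_linear: "ac_comb e (\<chi> i. c * v $ i + w $ i) = to_ac c * ac_comb e v + ac_comb e w"
  by (simp add: ac_comb_def sum.distrib algebra_simps sum_distrib_left)

lemma ac_comb_axis: "ac_comb e (axis i 1) = e $ i"
proof -
  have "ac_comb e (axis i 1) = (\<Sum>j\<in>UNIV. if j = i then e $ j else 0)"
    unfolding ac_comb_def by (rule sum.cong) (auto simp: axis_def)
  then show ?thesis by simp
qed

context
  fixes e :: "'a::{field,finite} alg_closure^3"
  assumes e: "ac_basis e"
begin

lemma ac_basis_mem: "ac_comb e v \<in> cubic_ext" "e $ i \<in> cubic_ext"
  using e unfolding ac_basis_def bij_betw_def by (auto simp flip: ac_comb_axis)

lemma cubic_ext_linear: "(x::'a alg_closure) \<in> cubic_ext \<Longrightarrow> y \<in> cubic_ext \<Longrightarrow> to_ac c * x + y \<in> cubic_ext"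
proof -
  assume "x \<in> cubic_ext" "y \<in> cubic_ext"
  then obtain v w where "x = ac_comb e v" "y = ac_comb e w"
    using e unfolding ac_basis_def bij_betw_def by blast
  then have "to_ac c * x + y = ac_comb e (\<chi> i. c * v $ i + w $ i)" by (simp add: ac_comb_linear)
  then show ?thesis using ac_basis_mem by simp
qed

lemma cubic_ext_0: "0 \<in> cubic_ext" by (simp add: cubic_ext_def)

lemma functional_0: "functional (\<phi> :: 'a alg_closure \<Rightarrow> 'a) \<Longrightarrow> \<phi> 0 = 0"
  unfolding functional_def using cubic_ext_0 by (metis add.right_neutral mult_cancel_right1 mult_zero_left add_cancel_right_left to_ac_0 mult_zero_left)

lemma functional_scale: "functional (\<phi> :: 'a alg_closure \<Rightarrow> 'a) \<Longrightarrow> x \<in> cubic_ext \<Longrightarrow> \<phi> (to_ac c * x) = c * \<phi> x"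
  using functional_0 cubic_ext_0 unfolding functional_def by (metis add.right_neutral)

lemma functional_sum:
  assumes \<phi>: "functional (\<phi> :: 'a alg_closure \<Rightarrow> 'a)" and I: "finite I" and x: "\<And>i. i \<in> I \<Longrightarrow> x i \<in> cubic_ext"
  shows "\<phi> (\<Sum>i\<in>I. to_ac (c i) * x i) = (\<Sum>i\<in>I. c i * \<phi> (x i)) \<and> (\<Sum>i\<in>I. to_ac (c i) * x i) \<in> cubic_ext"
  using I x
proof (induction I)
  case (insert i I)
  then show ?case using \<phi> cubic_ext_linear unfolding functional_def by simp
qed (simp add: functional_0 \<phi> cubic_ext_0)

end

text \<open>Replacing \<open>x\<close> by \<open>k x\<close> moves the annihilated point by \<open>k\<^sup>2\<close>, and only its class modulo the
  ground field matters; so squares up to scalars being everything makes all these lines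
  congruent.\<close>

lemma field_line_cong:
  assumes odd: "odd CARD('a::{field,finite})" and e: "ac_basis e" and e': "ac_basis e'"
    and z: "z \<in> cubic_ext" "z \<noteq> 0" "z' \<in> cubic_ext" "z' \<noteq> (0::'a alg_closure)"
  shows "field_line e z \<sim>\<^sub>K field_line e' z'"
proof -
  obtain c k where ck: "c \<noteq> 0" "k \<in> cubic_ext" "k \<noteq> 0" "z' / z = to_ac c * k^2"
    using cubic_ext_square_class[OF odd, of "z' / z"] z cubic_ext_divide by (metis divide_eq_0_iff)
  have z': "z' = to_ac c * (k^2 * z)" using ck z by (simp add: field_simps)
  note ac_basis_mem[OF e, simp] ac_basis_mem[OF e', simp] cubic_ext_mult[simp] cubic_ext_inverse[simp] cubic_ext_power[simp]
  have "\<exists>v. e' $ i / k = ac_comb e v" for i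
    using e cubic_ext_divide[of "e' $ i" k] ck(2) unfolding ac_basis_def bij_betw_def by auto
  then obtain A where A: "\<And>i. e' $ i / k = ac_comb e (A i)" by metis
  have "\<exists>v. k * e $ i = ac_comb e' v" for i
    using e' cubic_ext_mult[of k "e $ i"] ck(2) unfolding ac_basis_def bij_betw_def by auto
  then obtain B where B: "\<And>i. k * e $ i = ac_comb e' (B i)" by metis
  define A' B' where "A' = (\<chi> i j. A i $ j)" and "B' = (\<chi> i j. B i $ j)"
  have eA: "e' $ i = (\<Sum>j\<in>UNIV. to_ac (A' $ i $ j) * (k * e $ j))" for i
  proof -
    have "e' $ i = k * (e' $ i / k)" using ck by simp
    then show ?thesis unfolding A ac_comb_def A'_def by (simp add: sum_distrib_left algebra_simps)
  qed
  have "ac_comb e' ((A' ** B') $ i) = e' $ i" for i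
  proof -
    have "e' $ i = (\<Sum>j\<in>UNIV. to_ac (A' $ i $ j) * (\<Sum>l\<in>UNIV. to_ac (B' $ j $ l) * e' $ l))"
      by (subst eA) (simp add: B ac_comb_def B'_def)
    also have "\<dots> = (\<Sum>j\<in>UNIV. \<Sum>l\<in>UNIV. to_ac (A' $ i $ j * B' $ j $ l) * e' $ l)"
      by (simp add: sum_distrib_left mult.assoc)
    also have "\<dots> = (\<Sum>l\<in>UNIV. \<Sum>j\<in>UNIV. to_ac (A' $ i $ j * B' $ j $ l) * e' $ l)" by (rule sum.swap)
    also have "\<dots> = ac_comb e' ((A' ** B') $ i)"
      by (simp add: ac_comb_def matrix_matrix_mult_def to_ac_sum sum_distrib_right)
    finally show ?thesis by simp
  qed
  then have "(A' ** B') $ i = axis i 1" for i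
    using e' unfolding ac_basis_def bij_betw_def inj_on_def by (metis ac_comb_axis UNIV_I)
  then have "A' ** B' = mat 1" by (simp add: vec_eq_iff mat_def axis_def)
  then have invA: "invertible A'" by (metis invertible_def matrix_left_right_inverse)
  have gram: "(\<chi> i j. \<phi> (e' $ i * e' $ j)) = act A' (\<chi> i j. \<phi> (k^2 * (e $ i * e $ j)))" if \<phi>: "functional \<phi>" for \<phi>
  proof -
    have "\<phi> (e' $ i * e' $ j) = (\<Sum>l\<in>UNIV. \<Sum>m\<in>UNIV. A' $ i $ l * A' $ j $ m * \<phi> (k^2 * (e $ l * e $ m)))" for i j
    proof -
      have m: "k^2 * (e $ l * e $ m) \<in> cubic_ext" for l m using ck by simp
      have "e' $ i * e' $ j = (\<Sum>l\<in>UNIV. \<Sum>m\<in>UNIV. to_ac (A' $ i $ l * A' $ j $ m) * (k^2 * (e $ l * e $ m)))"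
        by (simp add: eA[of i] eA[of j] sum_product power2_eq_square mult_ac)
      also have "\<dots> = (\<Sum>(l,m)\<in>UNIV. to_ac (A' $ i $ l * A' $ j $ m) * (k^2 * (e $ l * e $ m)))"
        by (simp add: sum.cartesian_product)
      also have "\<phi> \<dots> = (\<Sum>(l,m)\<in>UNIV. A' $ i $ l * A' $ j $ m * \<phi> (k^2 * (e $ l * e $ m)))"
        using functional_sum[OF e \<phi>, of UNIV "\<lambda>(l,m). k^2 * (e $ l * e $ m)" "\<lambda>(l,m). A' $ i $ l * A' $ j $ m"] m
        by (simp add: case_prod_unfold)
      finally show ?thesis by (simp add: sum.cartesian_product)
    qed
    then show ?thesis
      by (simp add: vec_eq_iff act_def matrix_matrix_mult_def transpose_def sum_3 algebra_simps)
  qed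
  have "field_line e' z' = act A' ` field_line e z"
  proof (intro Set.set_eqI iffI)
    fix M assume "M \<in> field_line e' z'"
    then obtain \<phi> where \<phi>: "functional \<phi>" "\<phi> z' = 0" "M = (\<chi> i j. \<phi> (e' $ i * e' $ j))"
      unfolding field_line_def by blast
    have f: "functional (\<lambda>x. \<phi> (k^2 * x))"
      using \<phi>(1) ck(2) unfolding functional_def by (simp add: distrib_left mult.left_commute[of "k^2"])
    have "c * \<phi> (k^2 * z) = 0" using \<phi> functional_scale[OF e \<phi>(1), of "k^2 * z" c] ck z unfolding z' by simp
    then have "\<phi> (k^2 * z) = 0" using ck by simp
    then have "(\<chi> i j. \<phi> (k^2 * (e $ i * e $ j))) \<in> field_line e z"
      unfolding field_line_def mem_Collect_eq using f by (intro exI[of _ "\<lambda>x. \<phi> (k^2 * x)"]) simp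
    then show "M \<in> act A' ` field_line e z" unfolding \<phi>(3) gram[OF \<phi>(1)] by blast
  next
    fix M assume "M \<in> act A' ` field_line e z"
    then obtain \<psi> where \<psi>: "functional \<psi>" "\<psi> z = 0" "M = act A' (\<chi> i j. \<psi> (e $ i * e $ j))"
      unfolding field_line_def by blast
    define \<phi> where "\<phi> = (\<lambda>x. \<psi> (inverse (k^2) * x))"
    have f: "functional \<phi>"
      using \<psi>(1) ck(2) unfolding functional_def \<phi>_def
      by (simp add: distrib_left mult.left_commute[of "inverse (k^2)"] del: power_inverse)
    have "\<phi> z' = \<psi> (to_ac c * z)" unfolding \<phi>_def z' using ck by (simp add: field_simps)
    also have "\<dots> = 0" using functional_scale[OF e \<psi>(1)] z \<psi> by simp
    finally have "\<phi> z' = 0" .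
    moreover have "M = (\<chi> i j. \<phi> (e' $ i * e' $ j))"
    proof -
      have i: "inverse (k^2) * (k^2 * x) = x" for x using ck(3) by simp
      have "\<phi> (k^2 * x) = \<psi> x" for x unfolding \<phi>_def i ..
      then show ?thesis unfolding \<psi>(3) gram[OF f] by (simp only:)
    qed
    ultimately show "M \<in> field_line e' z'" unfolding field_line_def using f by blast
  qed
  then show ?thesis using cong_line_act[OF invA] by simp
qed

text \<open>In the basis \<open>1, \<theta>, \<theta>\<^sup>2\<close> with \<open>\<theta>\<^sup>3 = a \<theta>\<^sup>2 + b \<theta> + d\<close>, the Gram matrix of \<open>(x, y) \<mapsto> \<phi> (x y)\<close> is
  the Hankel matrix of the recurrent sequence \<open>\<phi> (\<theta>\<^sup>i)\<close>.\<close>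

definition hankel :: "'a::field \<Rightarrow> 'a \<Rightarrow> 'a \<Rightarrow> 'a \<Rightarrow> 'a \<Rightarrow> 'a \<Rightarrow> 'a^3^3" where
  "hankel a b d u v w = 
     (let x = d * u + b * v + a * w; y = d * v + b * w + a * x in S u v w w x y)"

lemma hankel_linear: 
  "mscale p (hankel a b d u v w) + mscale q (hankel a b d u' v' w') =
   hankel a b d (p * u + q * u') (p * v + q * v') (p * w + q * w')"
  by (simp add: hankel_def Let_def algebra_simps)

lemma hankel_eq_iff: "hankel a b d u v w = hankel a b d u' v' w' \<longleftrightarrow> u = u' \<and> v = v' \<and> w = w'"
  by (auto simp: hankel_def Let_def)

context irreducible_cubic
begin

definition pow_basis :: "'a alg_closure^3" where
  "pow_basis = vector [1, \<theta>, \<theta>^2]"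

lemma ac_comb_pow_basis: "ac_comb pow_basis v = comb (v$1) (v$2) (v$3)"
  by (simp add: ac_comb_def pow_basis_def sum_3 comb_def)

lemma ac_basis_pow_basis: "ac_basis pow_basis"
  unfolding ac_basis_def bij_betw_def
proof
  show "inj (ac_comb pow_basis)"
    by (auto simp: inj_on_def ac_comb_pow_basis comb_inj vec_eq_iff forall_3)
  have "comb p r s \<in> range (ac_comb pow_basis)" for p r s
    by (rule image_eqI[of _ _ "vector [p,r,s]"]) (simp_all add: ac_comb_pow_basis)
  then show "range (ac_comb pow_basis) = cubic_ext"
    unfolding span_theta_eq[symmetric] by (auto elim!: span_theta_cases simp: ac_comb_pow_basis comb_mem)
qed

lemma functional_comb:
  assumes "functional \<phi>" 
  shows "\<phi> (comb p r s) = p * \<phi> 1 + r * \<phi> \<theta> + s * \<phi> (\<theta>^2)"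
proof -
  note B = ac_basis_pow_basis
  have "\<phi> (\<Sum>i\<in>UNIV. to_ac ((vector [p,r,s]::'a^3) $ i) * pow_basis $ i) = 
    (\<Sum>i\<in>UNIV. (vector [p,r,s]::'a^3) $ i * \<phi> (pow_basis $ i))"
    using functional_sum[OF B assms, of UNIV "\<lambda>i. pow_basis $ i" "\<lambda>i. (vector [p,r,s]::'a^3) $ i"]
      ac_basis_mem(2)[OF B] by simp
  then show ?thesis by (simp add: sum_3 pow_basis_def comb_def)
qed

lemma gram_functional:
  assumes "functional \<phi>"
  shows "(\<chi> i j. \<phi> (pow_basis $ i * pow_basis $ j)) = hankel a b d (\<phi> 1) (\<phi> \<theta>) (\<phi> (\<theta>^2))"
proof -
  have 3: "\<theta>^3 = comb d b a" using theta by (simp add: comb_def)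
  have "\<theta>^4 = \<theta> * \<theta>^3" by (simp add: power_numeral_reduce)
  then have 4: "\<theta>^4 = comb (a * d) (d + a * b) (b + a * a)" unfolding 3 theta_comb .
  have "\<theta> * \<theta> = \<theta>^2" "\<theta> * \<theta>^2 = \<theta>^3" "\<theta>^2 * \<theta> = \<theta>^3" "\<theta>^2 * \<theta>^2 = \<theta>^4"
    by (simp_all add: power_numeral_reduce)
  then show ?thesis
    by (intro mat3_eqI) (simp_all add: hankel_def Let_def S_def pow_basis_def 3 4 functional_comb[OF assms] algebra_simps)
qed

lemma functional_exists:
  obtains \<phi> where "functional \<phi>" "\<phi> 1 = u" "\<phi> \<theta> = v" "\<phi> (\<theta>^2) = w"
proof
  define g where "g = inv_into UNIV (ac_comb pow_basis)"
  define \<phi> where "\<phi> x = u * g x $ 1 + v * g x $ 2 + w * g x $ 3" for x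
  have inj: "inj (ac_comb pow_basis)" using ac_basis_pow_basis by (simp add: ac_basis_def bij_betw_def)
  have g: "g (ac_comb pow_basis x) = x" for x unfolding g_def by (rule inv_f_f[OF inj])
  show "functional \<phi>"
    unfolding functional_def
  proof (intro allI ballI)
    fix c and x y :: "'a alg_closure" assume "x \<in> cubic_ext" "y \<in> cubic_ext"
    then obtain p r where "x = ac_comb pow_basis p" "y = ac_comb pow_basis r"
      using ac_basis_pow_basis unfolding ac_basis_def bij_betw_def by blast
    then show "\<phi> (to_ac c * x + y) = c * \<phi> x + \<phi> y"
      by (simp add: \<phi>_def g flip: ac_comb_linear) (simp add: algebra_simps)
  qed
  have "g 1 = vector [1,0,0]" "g \<theta> = vector [0,1,0]" "g (\<theta>^2) = vector [0,0,1]"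
    using g[of "vector [1,0,0]"] g[of "vector [0,1,0]"] g[of "vector [0,0,1]"]
    by (simp_all add: ac_comb_pow_basis comb_def)
  then show "\<phi> 1 = u" "\<phi> \<theta> = v" "\<phi> (\<theta>^2) = w" by (simp_all add: \<phi>_def)
qed

lemma field_line_pow_basis:
  "field_line pow_basis (comb p r s) = {hankel a b d u v w | u v w. p * u + r * v + s * w = 0}"
proof (intro Set.set_eqI iffI)
  fix M assume "M \<in> field_line pow_basis (comb p r s)"
  then show "M \<in> {hankel a b d u v w | u v w. p * u + r * v + s * w = 0}"
    unfolding field_line_def using gram_functional functional_comb by fastforce
next
  fix M assume "M \<in> {hankel a b d u v w | u v w. p * u + r * v + s * w = 0}"
  then obtain u v w where M: "M = hankel a b d u v w" "p * u + r * v + s * w = 0" by blast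
  obtain \<phi> where \<phi>: "functional \<phi>" "\<phi> 1 = u" "\<phi> \<theta> = v" "\<phi> (\<theta>^2) = w" by (rule functional_exists)
  have "M = (\<chi> i j. \<phi> (pow_basis $ i * pow_basis $ j))" 
    unfolding gram_functional[OF \<phi>(1)] M \<phi> ..
  moreover have "\<phi> (comb p r s) = 0" using M \<phi> by (simp add: functional_comb)
  ultimately show "M \<in> field_line pow_basis (comb p r s)" unfolding field_line_def using \<phi>(1) by blast
qed

end

lemma matrix_kernel:
  fixes A :: "'a::field^3^3"
  assumes "\<not> invertible A" obtains x where "x \<noteq> 0" "A *v x = 0"
proof -
  have "\<not> (\<exists>B. B ** A = mat 1)" using assms invertible_left_inverse by blast
  then have "\<not> (\<forall>x. A *v x = 0 \<longrightarrow> x = 0)" by (subst (asm) matrix_left_invertible_ker)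
  then show ?thesis using that by blast
qed

lemma kernel_not_invertible:
  fixes A :: "'a::field^3^3"
  assumes "x \<noteq> 0" "A *v x = 0" shows "\<not> invertible A"
proof
  assume "invertible A"
  then obtain B where "B ** A = mat 1" by (metis invertible_inverse)
  then have "x = B *v (A *v x)" by (simp add: matrix_vector_mul_assoc)
  then show False using assms by simp
qed

context odd_field
begin

lemma nonsingular_line_cong: 
  assumes "L \<sim>\<^sub>K L'" "nonsingular_line L" shows "nonsingular_line L'"
  using assms PG5_line_cong[OF assms(1)] unfolding nonsingular_line_def cong_line_def K_orbit_def' by auto

lemma nonsingular_lineD:
  assumes "nonsingular_line (span2 N M)" "v \<noteq> 0" "M *v v = (\<chi> i. \<rho> * (N *v v) $ i)"
  shows False
proof -
  let ?Z = "mscale (-\<rho>) N + mscale 1 M"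
  have "?Z \<in> span2 N M" unfolding span2_def by blast
  moreover have "?Z \<noteq> 0"
    using indep2_PG5_line[of N M] assms(1) unfolding nonsingular_line_def indep2_def by (metis zero_neq_one)
  ultimately have "det ?Z \<noteq> 0" using assms(1) by (auto simp: nonsingular_line_def)
  moreover have "?Z *v v = 0"
  proof -
    have "?Z *v v = (\<chi> i. (M *v v) $ i - \<rho> * (N *v v) $ i)"
      by (simp add: vec_eq_iff matrix_vector_mult_def mscale_def sum_3 algebra_simps)
    then show ?thesis unfolding assms(3) by (simp add: vec_eq_iff)
  qed
  ultimately show False using kernel_not_invertible[OF assms(2)] by (simp add: invertible_det_nz)
qed

text \<open>A line without singular points has the form \<open>\<langle>N, N T\<rangle>\<close>, where the characteristic polynomial
  of \<open>T\<close> has no roots; so every nonzero vector is cyclic for \<open>T\<close>.\<close>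

lemma nonsingular_line_hankel:
  assumes L: "nonsingular_line L"
  obtains a b d s0 s1 s2 where "\<And>t::'a. t^3 \<noteq> a * t^2 + b * t + d"
    "L \<sim>\<^sub>K span2 (hankel a b d s0 s1 s2) (hankel a b d s1 s2 (d * s0 + b * s1 + a * s2))"
proof -
  have PL: "PG5_line L" using L by (simp add: nonsingular_line_def)
  then obtain N M where NM: "transpose N = N" "transpose M = M" "indep2 N M" "L = span2 N M"
    unfolding PG5_line_iff by blast
  have "mscale 1 N + mscale 0 M \<in> L" unfolding NM span2_def by blast
  then have "N \<in> L" by simp
  moreover have "N \<noteq> 0" using NM(3)[unfolded indep2_def, rule_format, of 1 0] by auto
  ultimately have "invertible N" using L by (simp add: nonsingular_line_def invertible_det_nz)
  then obtain Ni where Ni: "N ** Ni = mat 1" "Ni ** N = mat 1" by (metis invertible_inverse)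
  define T where "T = Ni ** M"
  have NT: "N ** T = M" unfolding T_def using Ni by (simp add: matrix_mul_assoc)
  have TN: "transpose T ** N = M" using NT NM by (metis matrix_transpose_mul)
  define c0 c1 c2 where "c0 = (axis 1 1 :: 'a^3)" and "c1 = T *v c0" and "c2 = T *v c1"
  define C where "C = (vector [c0, c1, c2] :: 'a^3^3)"
  have C: "C $ 1 = c0" "C $ 2 = c1" "C $ 3 = c2" by (simp_all add: C_def)
  have c0: "c0 \<noteq> 0" "c0 $ 1 = 1" "c0 $ 2 = 0" "c0 $ 3 = 0" by (simp_all add: c0_def axis_def vec_eq_iff)
  have invC: "invertible C"
  proof (rule ccontr)
    assume "\<not> invertible C"
    then obtain w where w: "w \<noteq> 0" "C *v w = 0" by (rule matrix_kernel)
    have "(C *v w) $ i = (\<Sum>j\<in>UNIV. C $ i $ j * w $ j)" for i by (simp add: matrix_vector_mult_def)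
    then have cw: "(\<Sum>j\<in>UNIV. C $ i $ j * w $ j) = 0" for i using w(2) by simp
    define w' where "w' = transpose T *v w"
    have adj: "(\<Sum>j\<in>UNIV. (T *v x) $ j * w $ j) = (\<Sum>j\<in>UNIV. x $ j * w' $ j)" for x
      unfolding w'_def by (simp add: matrix_vector_mult_def transpose_def sum_3 algebra_simps)
    have w1: "w $ 1 = 0" using cw[of 1] by (simp add: C c0 sum_3)
    have w1': "w' $ 1 = 0" using cw[of 2] adj[of c0] by (simp add: C c0 c1_def[symmetric] sum_3)
    have e: "c1 $ 2 * w $ 2 + c1 $ 3 * w $ 3 = 0" using cw[of 2] w1 by (simp add: C sum_3)
    have e': "c1 $ 2 * w' $ 2 + c1 $ 3 * w' $ 3 = 0" 
      using cw[of 3] adj[of c1] w1' by (simp add: C c2_def[symmetric] sum_3)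
    show False
    proof (cases "c1 $ 2 = 0 \<and> c1 $ 3 = 0")
      case True
      then have "T *v c0 = (\<chi> i. c1 $ 1 * c0 $ i)"
        unfolding c1_def[symmetric] by (simp add: vec_eq_iff forall_3 c0)
      moreover have "M *v c0 = N *v (T *v c0)" using NT by (simp add: matrix_vector_mul_assoc)
      ultimately have "M *v c0 = (\<chi> i. c1 $ 1 * (N *v c0) $ i)"
        by (simp add: vec_eq_iff matrix_vector_mult_def sum_distrib_left mult.left_commute)
      then show False using nonsingular_lineD L c0(1) unfolding NM by blast
    next
      case False
      have 1: "c1 $ 2 * (w $ 2 * w' $ 3 - w' $ 2 * w $ 3) = 0"
      proof -
        have "c1 $ 2 * (w $ 2 * w' $ 3 - w' $ 2 * w $ 3) = 
          (c1 $ 2 * w $ 2 + c1 $ 3 * w $ 3) * w' $ 3 - (c1 $ 2 * w' $ 2 + c1 $ 3 * w' $ 3) * w $ 3"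
          by (simp add: algebra_simps)
        then show ?thesis unfolding e e' by simp
      qed
      have 2: "c1 $ 3 * (w $ 2 * w' $ 3 - w' $ 2 * w $ 3) = 0"
      proof -
        have "c1 $ 3 * (w $ 2 * w' $ 3 - w' $ 2 * w $ 3) = 
          (c1 $ 2 * w' $ 2 + c1 $ 3 * w' $ 3) * w $ 2 - (c1 $ 2 * w $ 2 + c1 $ 3 * w $ 3) * w' $ 2"
          by (simp add: algebra_simps)
        then show ?thesis unfolding e e' by simp
      qed
      have cross: "w $ 2 * w' $ 3 = w' $ 2 * w $ 3" using 1 2 False by auto
      have "\<exists>\<rho>. w' = (\<chi> i. \<rho> * w $ i)"
      proof (cases "w $ 2 = 0")
        case True
        then have "w $ 3 \<noteq> 0" using w(1) w1 by (auto simp: vec_eq_iff forall_3)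
        then show ?thesis using cross True w1 w1'
          by (intro exI[of _ "w' $ 3 / w $ 3"]) (simp add: vec_eq_iff forall_3)
      next
        case False
        then show ?thesis using cross w1 w1'
          by (intro exI[of _ "w' $ 2 / w $ 2"]) (simp add: vec_eq_iff forall_3 field_simps)
      qed
      then obtain \<rho> where \<rho>: "w' = (\<chi> i. \<rho> * w $ i)" by blast
      define y where "y = Ni *v w"
      have Ny: "N *v y = w" unfolding y_def using Ni by (simp add: matrix_vector_mul_assoc)
      have "M *v y = transpose T *v (N *v y)" using TN by (simp add: matrix_vector_mul_assoc)
      then have "M *v y = (\<chi> i. \<rho> * (N *v y) $ i)" unfolding Ny w'_def[symmetric] \<rho> .
      moreover have "y \<noteq> 0" using Ny w(1) by auto
      ultimately show False using nonsingular_lineD L unfolding NM by blast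
    qed
  qed
  then obtain Ci where Ci: "C ** Ci = mat 1" "Ci ** C = mat 1" by (metis invertible_inverse)
  define x where "x = transpose Ci *v (T *v c2)"
  have "transpose C *v x = (transpose C ** transpose Ci) *v (T *v c2)"
    unfolding x_def by (rule matrix_vector_mul_assoc)
  also have "transpose C ** transpose Ci = mat 1" using Ci by (metis matrix_transpose_mul transpose_mat)
  finally have x: "T *v c2 = transpose C *v x" by simp
  define d b a where "d = x $ 1" and "b = x $ 2" and "a = x $ 3"
  define P where "P = (mat3 [[0,0,d],[1,0,b],[0,1,a]] :: 'a^3^3)"
  have TC: "T ** transpose C = transpose C ** P"
  proof -
    have *: "(T ** transpose C) $ i $ j = (T *v (C $ j)) $ i" for i j
      by (simp add: matrix_matrix_mult_def matrix_vector_mult_def transpose_def)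
    have "(T *v c2) $ i = c0 $ i * d + c1 $ i * b + c2 $ i * a" for i
      unfolding x by (simp add: matrix_vector_mult_def transpose_def sum_3 C d_def b_def a_def)
    then have "T *v c2 = (\<chi> i. c0 $ i * d + c1 $ i * b + c2 $ i * a)" by (simp add: vec_eq_iff)
    then show ?thesis
      by (intro mat3_eqI; simp add: * C c1_def[symmetric] c2_def[symmetric];
          simp add: matrix_matrix_mult_def transpose_def sum_3 P_def C)
  qed
  have MP: "act C M = act C N ** P"
  proof -
    have "act C M = C ** (N ** T) ** transpose C" unfolding NT act_def ..
    also have "\<dots> = C ** N ** (T ** transpose C)" by (simp add: matrix_mul_assoc)
    also have "\<dots> = act C N ** P" unfolding TC act_def by (simp add: matrix_mul_assoc)
    finally show ?thesis .
  qed
  have c: "L \<sim>\<^sub>K span2 (act C N) (act C M)"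
    using cong_line_act[OF invC] unfolding NM act_span2[symmetric] by blast
  have L': "nonsingular_line (span2 (act C N) (act C M))" by (rule nonsingular_line_cong[OF c L])
  obtain s0 s1 s2 e1 e2 e3 where N': "act C N = S s0 s1 s2 e1 e2 e3"
    using transpose_act[OF NM(1)] by (rule symmetric_cases)
  obtain m0 m1 m2 f1 f2 f3 where M': "act C M = S m0 m1 m2 f1 f2 f3"
    using transpose_act[OF NM(2)] by (rule symmetric_cases)
  have "S m0 m1 m2 f1 f2 f3 $ i $ j = (S s0 s1 s2 e1 e2 e3 ** P) $ i $ j" for i j
    using MP unfolding N' M' by simp
  from this[of 1 1] this[of 1 2] this[of 2 1] this[of 1 3] this[of 3 1] this[of 2 2] this[of 2 3] this[of 3 2] this[of 3 3]
  have "act C N = hankel a b d s0 s1 s2" "act C M = hankel a b d s1 s2 (d * s0 + b * s1 + a * s2)"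
    unfolding N' M' hankel_def Let_def
    by (simp_all add: S_def P_def matrix_matrix_mult_def sum_3 algebra_simps)
  then have "L \<sim>\<^sub>K span2 (hankel a b d s0 s1 s2) (hankel a b d s1 s2 (d * s0 + b * s1 + a * s2))" using c by simp
  moreover have "t^3 \<noteq> a * t^2 + b * t + d" for t
  proof
    assume t: "t^3 = a * t^2 + b * t + d"
    define y where "y = (vector [t^2 - a * t - b, t - a, 1] :: 'a^3)"
    have "P *v y = (\<chi> i. t * y $ i)"
      using t unfolding P_def y_def
      by (simp add: vec_eq_iff forall_3 matrix_vector_mult_def sum_3 power2_eq_square power3_eq_cube algebra_simps)
    then have "act C M *v y = act C N *v (\<chi> i. t * y $ i)" unfolding MP by (simp flip: matrix_vector_mul_assoc)
    also have "\<dots> = (\<chi> i. t * (act C N *v y) $ i)"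
      by (simp add: vec_eq_iff matrix_vector_mult_def sum_distrib_left mult.left_commute)
    finally have *: "act C M *v y = (\<chi> i. t * (act C N *v y) $ i)" .
    have "y $ 3 \<noteq> 0" by (simp add: y_def)
    then have "y \<noteq> 0" by auto
    then show False using nonsingular_lineD[OF L' _ *] by blast
  qed
  ultimately show ?thesis using that by blast
qed

lemma nonsingular_line_field_line:
  assumes L: "nonsingular_line L"
  shows "\<exists>e z. ac_basis e \<and> z \<in> cubic_ext \<and> z \<noteq> 0 \<and> L \<sim>\<^sub>K field_line e z"
proof -
  obtain a b d s0 s1 s2 where nr: "\<And>t::'a. t^3 \<noteq> a * t^2 + b * t + d"
    and c: "L \<sim>\<^sub>K span2 (hankel a b d s0 s1 s2) (hankel a b d s1 s2 (d * s0 + b * s1 + a * s2))"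
    using nonsingular_line_hankel[OF L] by blast
  define s3 where "s3 = d * s0 + b * s1 + a * s2"
  have ind: "indep2 (hankel a b d s0 s1 s2) (hankel a b d s1 s2 s3)"
    using c L PG5_line_cong indep2_PG5_line unfolding nonsingular_line_def s3_def by blast
  have "\<exists>\<theta>. poly [:- to_ac d, - to_ac b, - to_ac a, 1:] \<theta> = 0"
    by (rule alg_closed_imp_poly_has_root) simp
  then obtain \<theta> where "poly [:- to_ac d, - to_ac b, - to_ac a, 1:] \<theta> = 0" ..
  then have th: "\<theta>^3 = to_ac a * \<theta>^2 + to_ac b * \<theta> + to_ac d"
    by (simp add: power2_eq_square power3_eq_cube algebra_simps add_eq_0_iff)
  interpret irreducible_cubic a b d \<theta> by unfold_locales (use th nr in auto)
  have "\<not> invertible (mat3 [[s0,s1,s2],[s1,s2,s3],[0,0,0]])" by (simp add: invertible_mat3)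
  then obtain z where z: "z \<noteq> 0" "mat3 [[s0,s1,s2],[s1,s2,s3],[0,0,0]] *v z = 0" by (rule matrix_kernel)
  have "(mat3 [[s0,s1,s2],[s1,s2,s3],[0,0,0]] *v z) $ i = 0" for i using z by simp
  from this[of 1] this[of 2]
  have z1: "s0 * z $ 1 + s1 * z $ 2 + s2 * z $ 3 = 0" and z2: "s1 * z $ 1 + s2 * z $ 2 + s3 * z $ 3 = 0"
    by (simp_all add: matrix_vector_mult_def sum_3)
  let ?z = "comb (z $ 1) (z $ 2) (z $ 3)"
  have "?z \<noteq> 0" using comb_eq_0 z(1) by (auto simp: vec_eq_iff forall_3)
  have "span2 (hankel a b d s0 s1 s2) (hankel a b d s1 s2 s3) = field_line pow_basis ?z"
  proof (intro Set.set_eqI iffI)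
    fix Z assume "Z \<in> span2 (hankel a b d s0 s1 s2) (hankel a b d s1 s2 s3)"
    then obtain p q where Z: "Z = hankel a b d (p * s0 + q * s1) (p * s1 + q * s2) (p * s2 + q * s3)"
      unfolding span2_def hankel_linear by blast
    have "z $ 1 * (p * s0 + q * s1) + z $ 2 * (p * s1 + q * s2) + z $ 3 * (p * s2 + q * s3) = 
      p * (s0 * z $ 1 + s1 * z $ 2 + s2 * z $ 3) + q * (s1 * z $ 1 + s2 * z $ 2 + s3 * z $ 3)"
      by (simp add: algebra_simps)
    then show "Z \<in> field_line pow_basis ?z" unfolding field_line_pow_basis Z z1 z2 by auto
  next
    fix Z assume "Z \<in> field_line pow_basis ?z"
    then obtain u v w where Z: "Z = hankel a b d u v w" and uvw: "z $ 1 * u + z $ 2 * v + z $ 3 * w = 0"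
      unfolding field_line_pow_basis by blast
    let ?W = "mat3 [[u,v,w],[s0,s1,s2],[s1,s2,s3]]"
    have "?W *v z = 0"
      using uvw z1 z2 by (simp add: vec_eq_iff forall_3 matrix_vector_mult_def sum_3 mult.commute)
    then have "\<not> invertible ?W" using kernel_not_invertible z(1) by blast
    then have "\<not> invertible (transpose ?W)" by (simp add: invertible_det_nz)
    then obtain y where y: "y \<noteq> 0" "transpose ?W *v y = 0" by (rule matrix_kernel)
    have "(transpose ?W *v y) $ i = 0" for i using y by simp
    from this[of 1] this[of 2] this[of 3]
    have ye: "u * y $ 1 + s0 * y $ 2 + s1 * y $ 3 = 0" "v * y $ 1 + s1 * y $ 2 + s2 * y $ 3 = 0"
      "w * y $ 1 + s2 * y $ 2 + s3 * y $ 3 = 0"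
      by (simp_all add: matrix_vector_mult_def sum_3 transpose_def)
    have "y $ 1 \<noteq> 0"
    proof
      assume "y $ 1 = 0"
      then have "mscale (y $ 2) (hankel a b d s0 s1 s2) + mscale (y $ 3) (hankel a b d s1 s2 s3) = 0"
        using ye unfolding hankel_linear by (simp add: hankel_def Let_def mult.commute)
      then have "y $ 2 = 0 \<and> y $ 3 = 0" using ind unfolding indep2_def by blast
      then show False using y(1) \<open>y $ 1 = 0\<close> by (auto simp: vec_eq_iff forall_3)
    qed
    have solve: "x = (- q / y) * p + (- r / y) * g" if "x * y + p * q + g * r = 0" "y \<noteq> 0" for x y p q r g :: 'a
    proof -
      have "x * y = - q * p + - r * g" using that(1) by (simp add: add_eq_0_iff algebra_simps)
      then have "x = (- q * p + - r * g) / y" using that(2) by (simp add: eq_divide_eq)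
      then show ?thesis by (simp add: diff_divide_distrib)
    qed
    have "u = (- y $ 2 / y $ 1) * s0 + (- y $ 3 / y $ 1) * s1"
      "v = (- y $ 2 / y $ 1) * s1 + (- y $ 3 / y $ 1) * s2"
      "w = (- y $ 2 / y $ 1) * s2 + (- y $ 3 / y $ 1) * s3"
      by (rule solve[OF ye(1) \<open>y $ 1 \<noteq> 0\<close>] solve[OF ye(2) \<open>y $ 1 \<noteq> 0\<close>] solve[OF ye(3) \<open>y $ 1 \<noteq> 0\<close>])+
    then show "Z \<in> span2 (hankel a b d s0 s1 s2) (hankel a b d s1 s2 s3)"
      unfolding Z span2_def hankel_linear by blast
  qed
  moreover have "?z \<in> cubic_ext" using comb_mem span_theta_eq by blast
  ultimately show ?thesis using c ac_basis_pow_basis \<open>?z \<noteq> 0\<close> unfolding s3_def by metis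
qed

lemma nonsingular_lines_cong:
  assumes "nonsingular_line L" "nonsingular_line L'" shows "L \<sim>\<^sub>K L'"
proof -
  obtain e z e' z' where "ac_basis e" "z \<in> cubic_ext" "z \<noteq> 0" "L \<sim>\<^sub>K field_line e z"
    "ac_basis e'" "z' \<in> cubic_ext" "z' \<noteq> 0" "L' \<sim>\<^sub>K field_line e' z'"
    using nonsingular_line_field_line assms by meson
  then show ?thesis using field_line_cong[OF odd_card] by (meson cong_line_sym cong_line_trans)
qed

text \<open>An element \<open>z + t \<surd>\<epsilon>\<close> of square norm \<open>n\<^sup>2\<close> is a square, since
  \<open>2 (z + n) (z + t \<surd>\<epsilon>) = (z + n + t \<surd>\<epsilon>)\<^sup>2\<close> and \<open>2 (z + n)\<close> is a square for one of the signs of \<open>n\<close>.\<close>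

lemma quadratic_ext_sqrt:
  assumes n: "z^2 - \<epsilon> * t^2 = n^2" "n \<noteq> (0::'a)"
  obtains k l where "z = k^2 + \<epsilon> * l^2" "t = 2 * k * l" 
proof (cases "t = 0")
  case True
  then have z: "z \<noteq> 0" using n by auto
  show ?thesis
  proof (cases "is_square z")
    case True then show ?thesis using that[of _ 0] \<open>t = 0\<close> by (auto simp: is_nth_power_def)
  next
    case False then show ?thesis using that[of 0] \<open>t = 0\<close> nonsquare_cases[of z] by auto
  qed
next
  case False
  have "(2 * (z + n)) * (2 * (z - n)) = 4 * (z^2 - n^2)" by (simp add: power2_eq_square algebra_simps)
  also have "z^2 - n^2 = \<epsilon> * t^2" using n by (simp add: algebra_simps)
  also have "4 * (\<epsilon> * t^2) = \<epsilon> * (2 * t)^2" by (simp add: power2_eq_square)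
  finally have e: "(2 * (z + n)) * (2 * (z - n)) = \<epsilon> * (2 * t)^2" .
  have "\<epsilon> * (2 * t)^2 \<noteq> 0" using False by simp
  then have nz: "2 * (z + n) \<noteq> 0" "2 * (z - n) \<noteq> 0" unfolding e[symmetric] by auto
  have "\<not> is_square (\<epsilon> * (2 * t)^2)" 
    using False two is_square_eps_mult[of "(2 * t)^2"] is_nth_power_nth_power[of 2 "2 * t"]
    by (metis mult_eq_0_iff power_eq_0_iff)
  then have "is_square (2 * (z + n)) \<or> is_square (2 * (z - n))"
    using is_square_mult_iff[OF odd_card nz] unfolding e by blast
  then obtain m where m: "m^2 = n^2" "is_square (2 * (z + m))" "2 * (z + m) \<noteq> 0"
    using nz by (metis diff_conv_add_uminus power2_minus)
  then obtain s where s: "s \<noteq> 0" "2 * (z + m) = s^2" using square_cases' by metis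
  show ?thesis
  proof (rule that)
    have "\<epsilon> * t^2 = z^2 - m^2" using n(1) m(1) by (simp add: algebra_simps)
    then have "(z + m)^2 + \<epsilon> * t^2 = z * (2 * (z + m))" by (simp add: power2_eq_square algebra_simps)
    then have "((z + m)^2 + \<epsilon> * t^2) / s^2 = z" unfolding s(2) using s(1) by simp
    then have "z = (z + m)^2 / s^2 + \<epsilon> * t^2 / s^2" by (simp only: add_divide_distrib)
    then show "z = ((z + m) / s)^2 + \<epsilon> * (t / s)^2" by (simp only: power_divide times_divide_eq_right)
    have "2 * ((z + m) / s) * (t / s) = (2 * (z + m)) * t / s^2" by (simp add: power2_eq_square)
    then show "t = 2 * ((z + m) / s) * (t / s)" unfolding s(2) using s(1) by simp
  qed
qed

lemma normal_form_o15_2_cong: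
  assumes "\<not> is_square (p^2 - \<epsilon> * q^2)" "\<not> is_square (p'^2 - \<epsilon> * q'^2)"
  shows "span2 (S 1 0 0 (-\<epsilon>) 0 0) (S p (\<epsilon>*q) 0 (\<epsilon>*p) 0 1) \<sim>\<^sub>K
         span2 (S 1 0 0 (-\<epsilon>) 0 0) (S p' (\<epsilon>*q') 0 (\<epsilon>*p') 0 (1::'a))"
proof -
  define m where "m = p^2 - \<epsilon> * q^2"
  define m' where "m' = p'^2 - \<epsilon> * q'^2"
  have m: "m \<noteq> 0" "m' \<noteq> 0" using assms unfolding m_def m'_def by (metis is_nth_power_0 zero_less_numeral)+
  define z where "z = (p' * p - \<epsilon> * q' * q) / m"
  define t where "t = (q' * p - p' * q) / m"
  have mz: "m * z = p' * p - \<epsilon> * q' * q" "m * t = q' * p - p' * q" using m by (simp_all add: z_def t_def)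
  have "m^2 * (z^2 - \<epsilon> * t^2) = (m * z)^2 - \<epsilon> * (m * t)^2" by (simp add: power2_eq_square algebra_simps)
  also have "\<dots> = m * m'" unfolding mz unfolding m_def m'_def by (simp add: power2_eq_square algebra_simps)
  finally have zt: "m * (z^2 - \<epsilon> * t^2) = m'" using m by (simp add: power2_eq_square)
  have "is_square (m * m')" using is_square_mult_iff[OF odd_card m] assms unfolding m_def m'_def by blast
  then obtain r where r: "m * m' = r^2" by (auto simp: is_nth_power_def)
  have "z^2 - \<epsilon> * t^2 = m * m' / m^2" using zt m by (simp add: power2_eq_square field_simps)
  then have "z^2 - \<epsilon> * t^2 = (r / m)^2" unfolding r by (simp add: power_divide)
  moreover have "r / m \<noteq> 0" using r m by auto
  ultimately obtain k l where kl: "z = k^2 + \<epsilon> * l^2" "t = 2 * k * l" by (rule quadratic_ext_sqrt)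
  have "z^2 - \<epsilon> * t^2 = (k^2 - \<epsilon> * l^2)^2" unfolding kl by (simp add: power2_eq_square algebra_simps)
  then have kl0: "k^2 - \<epsilon> * l^2 \<noteq> 0" using zt m by auto
  have "m * (p * z + \<epsilon> * q * t) = p * (m * z) + \<epsilon> * q * (m * t)" by (simp add: algebra_simps)
  also have "\<dots> = m * p'" unfolding mz unfolding m_def by (simp add: power2_eq_square algebra_simps)
  finally have p': "p' = p * z + \<epsilon> * q * t" using m by simp
  have "m * (q * z + p * t) = q * (m * z) + p * (m * t)" by (simp add: algebra_simps)
  also have "\<dots> = m * q'" unfolding mz unfolding m_def by (simp add: power2_eq_square algebra_simps)
  finally have q': "q' = q * z + p * t" using m by simp
  show ?thesis
    by (rule cong_lineI[where A="mat3 [[k,l,0],[\<epsilon>*l,k,0],[0,0,1]]" and p="1/(k^2 - \<epsilon> * l^2)" and q=0 and r=0 and s=1])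
      (use kl0 in \<open>simp_all add: invertible_mat3 act_S p' q' kl power2_eq_square field_simps\<close>)
qed

text \<open>The types with a single normal form are immediate; the work lies in the types whose normal form
  involves a choice.\<close>

lemma normal_form_cong:
  assumes "normal_form t L" "normal_form t L'" shows "L \<sim>\<^sub>K L'"
proof (cases t)
  case o15_2
  then show ?thesis using assms normal_form_o15_2_cong by auto
next
  case o17
  then show ?thesis using assms nonsingular_lines_cong by simp
qed (use assms cong_line_refl in auto)

end

section \<open>The fifteen types of lines\<close>

context odd_field
begin

text \<open>The entry-wise product with the adjugate: the derivative of the determinant at the first
  matrix in the direction of the second.\<close>

definition ddet :: "'a \<Rightarrow> 'a \<Rightarrow> 'a \<Rightarrow> 'a \<Rightarrow> 'a \<Rightarrow> 'a \<Rightarrow> 'a \<Rightarrow> 'a \<Rightarrow> 'a \<Rightarrow> 'a \<Rightarrow> 'a \<Rightarrow> 'a \<Rightarrow> 'a" where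
  "ddet a b c d e f a' b' c' d' e' f' = 
    a'*(d * f - e^2) + d'*(a * f - c^2) + f'*(a * d - b^2)
    + 2 * b'*(c * e - b * f) + 2 * c'*(b * e - c * d) + 2 * e'*(b * c - a * e)"

lemma quadf_S: 
  "quadf (S a b c d e f) k = a * (k$1)^2 + d * (k$2)^2 + f * (k$3)^2 + 2 * b * k$1 * k$2 + 2 * c * k$1 * k$3 + 2 * e * k$2 * k$3"
  by (simp add: quadf_def matrix_vector_mult_def sum_3 S_def power2_eq_square algebra_simps)

lemma quadf_linear: "quadf (mscale s M + mscale t N) k = s * quadf M k + t * quadf (N::'a^3^3) k"
  by (simp add: quadf_def matrix_vector_mult_def sum_3 mscale_def algebra_simps)

lemma quadf_span2: "(\<forall>Z\<in>span2 M N. quadf Z k = 0) \<longleftrightarrow> quadf M k = 0 \<and> quadf (N::'a^3^3) k = 0"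
proof
  assume h: "\<forall>Z\<in>span2 M N. quadf Z k = 0"
  have "mscale 1 M + mscale 0 N \<in> span2 M N" "mscale 0 M + mscale 1 N \<in> span2 M N"
    unfolding span2_def by blast+
  then show "quadf M k = 0 \<and> quadf N k = 0" using h by auto
next
  assume "quadf M k = 0 \<and> quadf N k = 0"
  then show "\<forall>Z\<in>span2 M N. quadf Z k = 0" by (auto simp: span2_def quadf_linear)
qed

lemma tangent_minor:
  assumes det: "det (S a b c d e f) = (0::'a)" and m: "e^2 - d * f \<noteq> 0"
  shows "tangent (span2 (S a1 b1 c1 d1 e1 f1) (S a2 b2 c2 d2 e2 f2)) (S a b c d e f) \<longleftrightarrow>
    ddet a b c d e f a1 b1 c1 d1 e1 f1 = 0 \<and> ddet a b c d e f a2 b2 c2 d2 e2 f2 = 0"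
proof -
  define D where "D = d * f - e^2"
  define k where "k = (vector [D, c * e - b * f, b * e - c * d] :: 'a^3)"
  have D: "D \<noteq> 0" using m by (simp add: D_def)
  have k_nth: "k $ 1 = D" "k $ 2 = c * e - b * f" "k $ 3 = b * e - c * d" by (simp_all add: k_def)
  have adf: "a * d * f = a * e^2 + d * c^2 + f * b^2 - 2 * b * c * e" using det by (simp add: det_S algebra_simps)
  have k0: "k \<noteq> 0" using D k_nth(1) by auto
  have Mk: "S a b c d e f *v k = 0"
    using adf by (simp add: vec_eq_iff forall_3 matrix_vector_mult_def sum_3 S_def k_nth D_def power2_eq_square algebra_simps)
  have kk: "D * (a * f - c^2) = (c * e - b * f)^2" "D * (a * d - b^2) = (b * e - c * d)^2" 
    "D * (b * c - a * e) = (c * e - b * f) * (b * e - c * d)"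
  proof -
    have "D * (a * f - c^2) - (c * e - b * f)^2 = f * det (S a b c d e f)"
      "D * (a * d - b^2) - (b * e - c * d)^2 = d * det (S a b c d e f)"
      "D * (b * c - a * e) - (c * e - b * f) * (b * e - c * d) = - e * det (S a b c d e f)"
      unfolding det_S D_def by (simp_all add: power2_eq_square algebra_simps)
    then show "D * (a * f - c^2) = (c * e - b * f)^2" "D * (a * d - b^2) = (b * e - c * d)^2" 
      "D * (b * c - a * e) = (c * e - b * f) * (b * e - c * d)" using det by simp_all
  qed
  have quad: "quadf (S a' b' c' d' e' f') k = D * ddet a b c d e f a' b' c' d' e' f'" for a' b' c' d' e' f'
  proof -
    have "D * ddet a b c d e f a' b' c' d' e' f' =
      a'*D^2 + d'*(D * (a * f - c^2)) + f'*(D * (a * d - b^2)) + 2 * b'*D * (c * e - b * f) + 2 * c'*D * (b * e - c * d)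
      + 2 * e'*(D * (b * c - a * e))"
      unfolding ddet_def D_def[symmetric] by (simp add: power2_eq_square algebra_simps)
    then show ?thesis unfolding kk quadf_S k_nth by (simp add: power2_eq_square algebra_simps)
  qed
  have uniq: "\<exists>s. s \<noteq> 0 \<and> v = (\<chi> i. s * k $ i)" if v: "v \<noteq> 0" "S a b c d e f *v v = 0" for v
  proof -
    have "(S a b c d e f *v v) $ i = 0" for i using v by simp
    from this[of 2] this[of 3]
    have e: "b * v$1 + d * v$2 + e * v$3 = 0" "c * v$1 + e * v$2 + f * v$3 = 0"
      by (simp_all add: matrix_vector_mult_def sum_3 S_def)
    have "D * v$2 - v$1 * (c * e - b * f) = f * (b * v$1 + d * v$2 + e * v$3) - e * (c * v$1 + e * v$2 + f * v$3)"
      "D * v$3 - v$1 * (b * e - c * d) = d * (c * v$1 + e * v$2 + f * v$3) - e * (b * v$1 + d * v$2 + e * v$3)"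
      unfolding D_def by (simp_all add: power2_eq_square algebra_simps)
    then have h: "D * v$2 = v$1 * (c * e - b * f)" "D * v$3 = v$1 * (b * e - c * d)" unfolding e by simp_all
    have vk: "v = (\<chi> i. v$1 / D * k $ i)"
      using h D by (simp add: vec_eq_iff forall_3 k_nth nonzero_eq_divide_eq mult.commute)
    moreover have "v$1 \<noteq> 0"
    proof
      assume "v$1 = 0"
      then have "v = 0" using vk by (simp add: vec_eq_iff)
      then show False using v by simp
    qed
    ultimately show ?thesis using D by (intro exI[of _ "v$1 / D"]) simp
  qed
  have scale: "quadf (S a' b' c' d' e' f') (\<chi> i. s * k $ i) = s^2 * quadf (S a' b' c' d' e' f') k" for s a' b' c' d' e' f'
    by (simp add: quadf_S power2_eq_square algebra_simps)
  have "\<not> rank_one (S a b c d e f)" "S a b c d e f \<noteq> 0" using m by (auto simp: rank_one_S)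
  then have "tangent (span2 (S a1 b1 c1 d1 e1 f1) (S a2 b2 c2 d2 e2 f2)) (S a b c d e f) \<longleftrightarrow>
    (\<exists>v. v \<noteq> 0 \<and> S a b c d e f *v v = 0 \<and> quadf (S a1 b1 c1 d1 e1 f1) v = 0 \<and> quadf (S a2 b2 c2 d2 e2 f2) v = 0)"
    unfolding tangent_def quadf_span2 using det by simp
  also have "\<dots> \<longleftrightarrow> quadf (S a1 b1 c1 d1 e1 f1) k = 0 \<and> quadf (S a2 b2 c2 d2 e2 f2) k = 0"
  proof
    assume "\<exists>v. v \<noteq> 0 \<and> S a b c d e f *v v = 0 \<and> quadf (S a1 b1 c1 d1 e1 f1) v = 0 \<and> quadf (S a2 b2 c2 d2 e2 f2) v = 0"
    then obtain v where v: "v \<noteq> 0" "S a b c d e f *v v = 0" "quadf (S a1 b1 c1 d1 e1 f1) v = 0" "quadf (S a2 b2 c2 d2 e2 f2) v = 0"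
      by blast
    obtain s where "s \<noteq> 0" "v = (\<chi> i. s * k $ i)" using uniq v by blast
    then show "quadf (S a1 b1 c1 d1 e1 f1) k = 0 \<and> quadf (S a2 b2 c2 d2 e2 f2) k = 0" using v scale by simp
  qed (use k0 Mk in blast)
  finally show ?thesis using D by (simp add: quad)
qed

lemma tangent_S:
  "tangent (span2 (S a1 b1 c1 d1 e1 f1) (S a2 b2 c2 d2 e2 f2)) (S a b c d e (f::'a)) \<longleftrightarrow>
    S a b c d e f \<noteq> 0 \<and> det (S a b c d e f) = 0 \<and> \<not> rank_one (S a b c d e f) \<and>
    ddet a b c d e f a1 b1 c1 d1 e1 f1 = 0 \<and> ddet a b c d e f a2 b2 c2 d2 e2 f2 = 0"
proof (cases "det (S a b c d e f) = 0 \<and> \<not> rank_one (S a b c d e f) \<and> S a b c d e f \<noteq> 0")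
  case True
  then consider "e^2 - d * f \<noteq> 0" | "c^2 - a * f \<noteq> 0" | "b^2 - a * d \<noteq> 0" using rank_one_S' by auto
  then show ?thesis
  proof cases
    case 1 then show ?thesis using tangent_minor True by blast
  next
    case 2
    let ?A = "mat3 [[0,1,0],[1,0,0],[0,0,1]] :: 'a^3^3"
    have A: "invertible ?A" and s: "act ?A (S a b c d e f) = S d b e a c f" for a b c d e f
      by (simp_all add: invertible_mat3 act_S)
    have "tangent (span2 (S a1 b1 c1 d1 e1 f1) (S a2 b2 c2 d2 e2 f2)) (S a b c d e f) \<longleftrightarrow> 
      tangent (span2 (S d1 b1 e1 a1 c1 f1) (S d2 b2 e2 a2 c2 f2)) (S d b e a c f)"
      using tangent_act[OF A, of "span2 (S a1 b1 c1 d1 e1 f1) (S a2 b2 c2 d2 e2 f2)" "S a b c d e f"]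
      unfolding act_span2 s by simp
    also have "\<dots> \<longleftrightarrow> ddet d b e a c f d1 b1 e1 a1 c1 f1 = 0 \<and> ddet d b e a c f d2 b2 e2 a2 c2 f2 = 0"
      by (rule tangent_minor) (use True 2 in \<open>simp_all add: det_S algebra_simps\<close>)
    also have "\<dots> \<longleftrightarrow> ddet a b c d e f a1 b1 c1 d1 e1 f1 = 0 \<and> ddet a b c d e f a2 b2 c2 d2 e2 f2 = 0"
      by (simp add: ddet_def algebra_simps)
    finally show ?thesis using True by simp
  next
    case 3
    let ?A = "mat3 [[0,0,1],[0,1,0],[1,0,0]] :: 'a^3^3"
    have A: "invertible ?A" and s: "act ?A (S a b c d e f) = S f e c d b a" for a b c d e f
      by (simp_all add: invertible_mat3 act_S)
    have "tangent (span2 (S a1 b1 c1 d1 e1 f1) (S a2 b2 c2 d2 e2 f2)) (S a b c d e f) \<longleftrightarrow> 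
      tangent (span2 (S f1 e1 c1 d1 b1 a1) (S f2 e2 c2 d2 b2 a2)) (S f e c d b a)"
      using tangent_act[OF A, of "span2 (S a1 b1 c1 d1 e1 f1) (S a2 b2 c2 d2 e2 f2)" "S a b c d e f"]
      unfolding act_span2 s by simp
    also have "\<dots> \<longleftrightarrow> ddet f e c d b a f1 e1 c1 d1 b1 a1 = 0 \<and> ddet f e c d b a f2 e2 c2 d2 b2 a2 = 0"
      by (rule tangent_minor) (use True 3 in \<open>simp_all add: det_S algebra_simps\<close>)
    also have "\<dots> \<longleftrightarrow> ddet a b c d e f a1 b1 c1 d1 e1 f1 = 0 \<and> ddet a b c d e f a2 b2 c2 d2 e2 f2 = 0"
      by (simp add: ddet_def algebra_simps)
    finally show ?thesis using True by simp
  qed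
qed (auto simp: tangent_def)

lemma pts_S:
  fixes a b c d e f :: 'a
  assumes "indep2 (S a b c d e f) (S a' b' c' d' e' f')" "homog Q"
  shows "pts Q (span2 (S a b c d e f) (S a' b' c' d' e' f')) =
    card {t. Q (S (a + t * a') (b + t * b') (c + t * c') (d + t * d') (e + t * e') (f + t * f'))} +
    (if Q (S a' b' c' d' e' f') then 1 else 0)"
  unfolding pts_span2[OF assms] card_P1_Collect by simp

lemma indep2_S:
  "indep2 (S a b c d e f) (S a' b' c' d' e' f') \<longleftrightarrow> 
   (\<forall>s t. s * a + t * a' = 0 \<and> s * b + t * b' = 0 \<and> s * c + t * c' = 0 \<and> s * d + t * d' = 0 \<and> s * e + t * e' = 0 \<and> s * f + t * f' = (0::'a)
     \<longrightarrow> s = 0 \<and> t = 0)"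
  by (simp add: indep2_def)

lemma PG5_line_S: "indep2 (S a b c d e f) (S a' b' c' d' e' f') \<Longrightarrow> 
    PG5_line (span2 (S a b c d e f) (S a' b' c' d' e' (f'::'a)))"
  unfolding PG5_line_iff by (metis transpose_S)

lemma all_singular_S:
  "all_singular (span2 (S a b c d e f) (S a' b' c' d' e' (f'::'a))) \<longleftrightarrow>
    (\<forall>s t. det (S (s * a + t * a') (s * b + t * b') (s * c + t * c') (s * d + t * d') (s * e + t * e') (s * f + t * f')) = 0)"
  by (auto simp: all_singular_def span2_def)

lemma common_kernel_S:
  "common_kernel (span2 (S a b c d e f) (S a' b' c' d' e' (f'::'a))) \<longleftrightarrow>
    (\<exists>x y z. (x \<noteq> 0 \<or> y \<noteq> 0 \<or> z \<noteq> 0) \<and> a * x+b * y+c * z = 0 \<and> b * x+d * y+e * z = 0 \<and> c * x+e * y+f * z = 0 \<and>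
      a'*x+b'*y+c'*z = 0 \<and> b'*x+d'*y+e'*z = 0 \<and> c'*x+e'*y+f'*z = 0)" (is "_ \<longleftrightarrow> (\<exists>x y z. ?P x y z)")
proof -
  have mv: "S a b c d e f *v k = 0 \<longleftrightarrow> a * k$1+b * k$2+c * k$3 = 0 \<and> b * k$1+d * k$2+e * k$3 = 0 \<and> c * k$1+e * k$2+f * k$3 = 0"
    for a b c d e f and k :: "'a^3"
    by (simp add: vec_eq_iff forall_3 matrix_vector_mult_def sum_3 S_def)
  have "(\<forall>M\<in>span2 M N. M *v k = 0) \<longleftrightarrow> M *v k = 0 \<and> N *v k = 0" for M N :: "'a^3^3" and k
  proof
    assume h: "\<forall>Z\<in>span2 M N. Z *v k = 0"
    have "mscale 1 M + mscale 0 N \<in> span2 M N" "mscale 0 M + mscale 1 N \<in> span2 M N"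
      unfolding span2_def by blast+
    then show "M *v k = 0 \<and> N *v k = 0" using h by auto
  next
    assume h: "M *v k = 0 \<and> N *v k = 0"
    have "(mscale s M + mscale t N) *v k = (\<chi> i. s * (M *v k) $ i + t * (N *v k) $ i)" for s t
      by (simp add: vec_eq_iff matrix_vector_mult_def mscale_def sum_3 algebra_simps)
    moreover have "(\<chi> i. s * (0::'a^3) $ i + t * (0::'a^3) $ i) = 0" for s t :: 'a by (simp add: vec_eq_iff)
    ultimately show "\<forall>Z\<in>span2 M N. Z *v k = 0" using h unfolding span2_def by auto
  qed
  then have "common_kernel (span2 (S a b c d e f) (S a' b' c' d' e' f')) \<longleftrightarrow> 
    (\<exists>k. k \<noteq> 0 \<and> S a b c d e f *v k = 0 \<and> S a' b' c' d' e' f' *v k = 0)"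
    unfolding common_kernel_def by simp
  also have "\<dots> \<longleftrightarrow> (\<exists>k::'a^3. ?P (k$1) (k$2) (k$3))"
  proof -
    have "k \<noteq> 0 \<longleftrightarrow> k$1 \<noteq> 0 \<or> k$2 \<noteq> 0 \<or> k$3 \<noteq> 0" for k :: "'a^3" by (simp add: vec_eq_iff forall_3)
    then show ?thesis unfolding mv by simp
  qed
  also have "\<dots> \<longleftrightarrow> (\<exists>x y z. ?P x y z)"
  proof
    assume "\<exists>x y z. ?P x y z"
    then obtain x y z where "?P x y z" by blast
    then show "\<exists>k::'a^3. ?P (k$1) (k$2) (k$3)"
      by (intro exI[of _ "vector [x,y,z]"]) simp
  qed blast
  finally show ?thesis .
qed

lemma hyperbolic_S: "hyperbolic (S a b c d e (f::'a)) \<longleftrightarrow> det (S a b c d e f) = 0 \<and> \<not> rank_one (S a b c d e f) \<and> 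
    is_square (b^2 - a * d) \<and> is_square (c^2 - a * f) \<and> is_square (e^2 - d * f)"
  using split_S by (auto simp: hyperbolic_def)

lemma elliptic_S: "elliptic (S a b c d e (f::'a)) \<longleftrightarrow> det (S a b c d e f) = 0 \<and> \<not> rank_one (S a b c d e f) \<and> 
    \<not> (is_square (b^2 - a * d) \<and> is_square (c^2 - a * f) \<and> is_square (e^2 - d * f))"
  using split_S by (auto simp: elliptic_def)

lemmas pts_S_simps = pts_S[OF _ homog_simps(1)] pts_S[OF _ homog_simps(2)] pts_S[OF _ homog_simps(3)]
  pts_S[OF _ homog_tangent]

lemma is_square_eps [simp]: "\<not> is_square \<epsilon>" by (rule nonsquare)

lemma is_square_sq [simp]: "is_square (x * x :: 'a)" by (metis is_nth_power_nth_power power2_eq_square)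

lemma minus_one_ne [simp]: "(-1::'a) \<noteq> 1" "(1::'a) \<noteq> -1"
  using two by (metis add.right_inverse one_add_one)+

lemma det_zero_S: "det (S a b c d e f) = 0 \<longleftrightarrow> a * d * f + 2 * b * c * e = a * e^2 + d * c^2 + f * b^2" for a b c d e f :: 'a
  by (auto simp: det_S algebra_simps)

lemma all_singular_SD:
  assumes "all_singular (span2 (S a b c d e f) (S a' b' c' d' e' (f'::'a)))"
  shows "det (S (s * a + t * a') (s * b + t * b') (s * c + t * c') (s * d + t * d') (s * e + t * e') (s * f + t * f')) = 0"
  using assms unfolding all_singular_S by blast

definition profile :: "('a^3^3) set \<Rightarrow> nat \<times> nat \<times> nat \<times> nat" where
  "profile L = (pts rank_one L, pts hyperbolic L, pts elliptic L, pts (tangent L) L)"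

lemma ltype_profile:
  assumes "\<not> all_singular L" "profile L = (0, s, n, p)"
  shows "ltype L = (if s = 3 then o14_1 else if n = 2 then o14_2 else if s = 2 then o13_1
     else if s = 1 \<and> n = 1 then o13_2 else if n = 1 then o15_2 else if s = 0 then o17
     else if p = 0 then o15_1 else o16)"
  using assms by (simp add: ltype_def profile_def Let_def)

lemma ltype_cases:
  "pts rank_one L = 2 \<Longrightarrow> ltype L = o5"
  "pts rank_one L = 1 \<Longrightarrow> all_singular L \<Longrightarrow> ltype L = o6"
  "pts rank_one L = 1 \<Longrightarrow> \<not> all_singular L \<Longrightarrow> pts hyperbolic L > 0 \<Longrightarrow> ltype L = o8_1"
  "pts rank_one L = 1 \<Longrightarrow> \<not> all_singular L \<Longrightarrow> pts hyperbolic L = 0 \<Longrightarrow> pts elliptic L > 0 \<Longrightarrow> ltype L = o8_2"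
  "pts rank_one L = 1 \<Longrightarrow> \<not> all_singular L \<Longrightarrow> pts hyperbolic L = 0 \<Longrightarrow> pts elliptic L = 0 \<Longrightarrow> ltype L = o9"
  "pts rank_one L = 0 \<Longrightarrow> all_singular L \<Longrightarrow> common_kernel L \<Longrightarrow> ltype L = o10"
  "pts rank_one L = 0 \<Longrightarrow> all_singular L \<Longrightarrow> \<not> common_kernel L \<Longrightarrow> ltype L = o12"
  for L :: "('a^3^3) set"
  by (simp_all add: ltype_def Let_def)

lemma ltype_o5: "ltype (span2 (S 1 0 0 0 0 0) (S 0 0 0 1 0 (0::'a))) = o5"
proof -
  have i: "indep2 (S 1 0 0 0 0 0) (S 0 0 0 1 0 (0::'a))" by (simp add: indep2_S)
  show ?thesis by (rule ltype_cases) (simp add: pts_S_simps(1)[OF i] rank_one_S)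
qed

lemma ltype_o6: "ltype (span2 (S 1 0 0 0 0 0) (S 0 1 0 0 0 (0::'a))) = o6"
proof -
  have i: "indep2 (S 1 0 0 0 0 0) (S 0 1 0 0 0 (0::'a))" by (simp add: indep2_S)
  show ?thesis by (rule ltype_cases) (simp_all add: pts_S_simps(1)[OF i] rank_one_S all_singular_S det_S)
qed

lemma ltype_o8:
  assumes "k \<noteq> (0::'a)"
  shows "ltype (span2 (S 1 0 0 0 0 0) (S 0 0 0 1 0 (-k))) = (if is_square k then o8_1 else o8_2)"
proof -
  have i: "indep2 (S 1 0 0 0 0 0) (S 0 0 0 1 0 (-k))" by (simp add: indep2_S)
  have "\<not> all_singular (span2 (S 1 0 0 0 0 0) (S 0 0 0 1 0 (-k)))"
    using all_singular_SD[of 1 0 0 0 0 0 0 0 0 1 0 "-k" 1 1] assms by (auto simp: det_S)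
  then show ?thesis using assms ltype_cases(3,4)[of "span2 (S 1 0 0 0 0 0) (S 0 0 0 1 0 (-k))"]
    by (simp add: pts_S_simps(1,2,3)[OF i] rank_one_S hyperbolic_S elliptic_S det_S)
qed

lemma ltype_o9: "ltype (span2 (S 1 0 0 0 0 0) (S 0 0 1 1 0 (0::'a))) = o9"
proof -
  have i: "indep2 (S 1 0 0 0 0 0) (S 0 0 1 1 0 (0::'a))" by (simp add: indep2_S)
  have "\<not> all_singular (span2 (S 1 0 0 0 0 0) (S 0 0 1 1 0 (0::'a)))"
    using all_singular_SD[of 1 0 0 0 0 0 0 0 1 1 0 0 1 1] by (auto simp: det_S)
  then show ?thesis using ltype_cases(5)[of "span2 (S 1 0 0 0 0 0) (S 0 0 1 1 0 (0::'a))"]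
    by (simp add: pts_S_simps(1,2,3)[OF i] rank_one_S hyperbolic_S elliptic_S det_S)
qed

lemma ltype_binary:
  assumes i: "indep2 (S a b 0 d 0 0) (S a' b' 0 d' 0 0)"
    and nr: "\<And>t. (b + t * b')^2 \<noteq> (a + t * a') * (d + t * d')" "b'^2 \<noteq> a' * (d'::'a)"
  shows "ltype (span2 (S a b 0 d 0 0) (S a' b' 0 d' 0 0)) = o10"
proof (rule ltype_cases)
  show "common_kernel (span2 (S a b 0 d 0 0) (S a' b' 0 d' 0 0))"
    unfolding common_kernel_S by (intro exI[of _ 0] exI[of _ 0] exI[of _ 1]) simp
qed (use nr in \<open>simp_all add: pts_S_simps(1)[OF i] rank_one_S all_singular_S det_S\<close>)

lemma ltype_o12: "ltype (span2 (S 0 1 0 0 0 0) (S 0 0 0 0 1 (0::'a))) = o12"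
proof -
  have i: "indep2 (S 0 1 0 0 0 0) (S 0 0 0 0 1 (0::'a))" by (simp add: indep2_S)
  show ?thesis 
    by (rule ltype_cases) (simp_all add: pts_S_simps(1)[OF i] rank_one_S all_singular_S common_kernel_S det_S)
qed

lemma profile_o13:
  assumes "k \<noteq> 0"
  defines "L \<equiv> span2 (S 0 1 0 0 0 0) (S 0 0 0 1 0 (-k))"
  shows "\<not> all_singular L" "profile L = (if is_square k then (0,2,0,1) else (0,1,1,1))"
proof -
  have i: "indep2 (S 0 1 0 0 0 0) (S 0 0 0 1 0 (-k))" by (simp add: indep2_S)
  show "\<not> all_singular L" unfolding L_def
    using all_singular_SD[of 0 1 0 0 0 0 0 0 0 1 0 "-k" 1 1] assms by (auto simp: det_S)
  show "profile L = (if is_square k then (0,2,0,1) else (0,1,1,1))" unfolding L_def profile_def using assms(1)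
    by (simp add: pts_S_simps[OF i] rank_one_S hyperbolic_S elliptic_S tangent_S ddet_def det_S Collect_conv_if)
qed

lemma profile_o14:
  assumes "k \<noteq> 0"
  defines "L \<equiv> span2 (S 1 0 0 (-k) 0 0) (S 0 0 0 (-k) 0 1)"
  shows "\<not> all_singular L" "profile L = (if is_square k then (0,3,0,0) else (0,1,2,0))"
proof -
  have i: "indep2 (S 1 0 0 (-k) 0 0) (S 0 0 0 (-k) 0 1)" using assms by (simp add: indep2_S)
  have z: "-k = t * k \<longleftrightarrow> t = -1" "k = -(t * k) \<longleftrightarrow> t = -1" "k + t * k = 0 \<longleftrightarrow> t = -1" for t
  proof -
    have "k + t * k = k * (1 + t)" by (simp add: algebra_simps)
    moreover have "1 + t = 0 \<longleftrightarrow> t = -1" by (metis add.inverse_inverse eq_neg_iff_add_eq_0 add.commute)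
    ultimately show z: "k + t * k = 0 \<longleftrightarrow> t = -1" using assms(1) by simp
    show "-k = t * k \<longleftrightarrow> t = -1" by (metis z neg_eq_iff_add_eq_0)
    show "k = -(t * k) \<longleftrightarrow> t = -1" by (metis z eq_neg_iff_add_eq_0)
  qed
  show "\<not> all_singular L" unfolding L_def
    using all_singular_SD[of 1 0 0 "-k" 0 0 0 0 0 "-k" 0 1 1 1] assms by (auto simp: det_S)
  have r: "pts rank_one L = 0" unfolding L_def using assms(1)
    by (auto simp add: pts_S_simps[OF i] rank_one_S z)
  have dz: "det (S 1 0 0 (-k + t * (-k)) 0 t) = 0 \<longleftrightarrow> t = 0 \<or> t = -1" for t using z[of t] assms(1) by (auto simp: det_S)
  have pt: "{t. Q (S 1 0 0 (-k + t * (-k)) 0 t)} = (if Q (S 1 0 0 (-k) 0 0) then {0} else {}) \<union> (if Q (S 1 0 0 0 0 (-1)) then {-1} else {})"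
    if h: "\<And>M. Q M \<Longrightarrow> transpose M = M \<Longrightarrow> det M = 0" for Q
  proof -
    have "t = 0 \<or> t = -1" if "Q (S 1 0 0 (-k + t * (-k)) 0 t)" for t
      using h[OF that] dz[of t] by simp
    then show ?thesis by force
  qed
  have h: "{t. hyperbolic (S 1 0 0 (-k + t * (-k)) 0 t)} = (if is_square k then {0,-1} else {-1})"
    by (subst pt, simp add: hyperbolic_def, use assms(1) in \<open>auto simp: hyperbolic_S rank_one_S det_S\<close>)
  have e: "{t. elliptic (S 1 0 0 (-k + t * (-k)) 0 t)} = (if is_square k then {} else {0})"
    by (subst pt, simp add: elliptic_def, use assms(1) in \<open>auto simp: elliptic_S rank_one_S det_S\<close>)
  have tg: "{t. tangent L (S 1 0 0 (-k + t * (-k)) 0 t)} = {}"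
    unfolding L_def by (subst pt, simp add: tangent_def, use assms(1) in \<open>auto simp: tangent_S ddet_def\<close>)
  show "profile L = (if is_square k then (0,3,0,0) else (0,1,2,0))" unfolding profile_def r
    using assms(1) h e tg[unfolded L_def] unfolding L_def
    by (simp add: pts_S_simps[OF i] rank_one_S hyperbolic_S elliptic_S tangent_S ddet_def det_S Collect_conv_if)
qed

lemma profile_o15_1: 
  defines "L \<equiv> span2 (S 0 1 0 0 0 0) (S 1 0 0 \<epsilon> 0 1)"
  shows "\<not> all_singular L" "profile L = (0,1,0,0)"
proof -
  have i: "indep2 (S 0 1 0 0 0 0) (S 1 0 0 \<epsilon> 0 1)" by (simp add: indep2_S)
  show "\<not> all_singular L" unfolding L_def
    using all_singular_SD[of 0 1 0 0 0 0 1 0 0 \<epsilon> 0 1 0 1] by (auto simp: det_S)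
  have z: "t * (t * \<epsilon>) * t = t \<longleftrightarrow> t = 0" for t
  proof
    assume h: "t * (t * \<epsilon>) * t = t"
    show "t = 0"
    proof (rule ccontr)
      assume t: "t \<noteq> 0"
      then have "\<epsilon> = (1/t)^2" using h by (simp add: field_simps power2_eq_square)
      then show False using nonsquare by (metis is_nth_power_nth_power)
    qed
  qed simp
  have dz: "det (S t 1 0 (t * \<epsilon>) 0 t) = 0 \<longleftrightarrow> t = 0" for t using z[of t] by (auto simp: det_S)
  have pt: "{t. Q (S t 1 0 (t * \<epsilon>) 0 t)} = (if Q (S 0 1 0 0 0 0) then {0} else {})"
    if h: "\<And>M. Q M \<Longrightarrow> transpose M = M \<Longrightarrow> det M = 0" for Q
  proof -
    have "t = 0" if "Q (S t 1 0 (t * \<epsilon>) 0 t)" for t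
      using h[OF that] dz[of t] by simp
    then show ?thesis by force
  qed
  have r: "{t. rank_one (S t 1 0 (t * \<epsilon>) 0 t)} = {}"
    by (subst pt, rule rank_one_det, auto simp: rank_one_S)
  have h: "{t. hyperbolic (S t 1 0 (t * \<epsilon>) 0 t)} = {0}"
    by (subst pt, simp add: hyperbolic_def, auto simp: hyperbolic_S rank_one_S det_S)
  have e: "{t. elliptic (S t 1 0 (t * \<epsilon>) 0 t)} = {}"
    by (subst pt, simp add: elliptic_def, auto simp: elliptic_S rank_one_S det_S)
  have tg: "{t. tangent L (S t 1 0 (t * \<epsilon>) 0 t)} = {}"
    unfolding L_def by (subst pt, simp add: tangent_def, auto simp: tangent_S ddet_def)
  show "profile L = (0,1,0,0)" unfolding profile_def 
    using r h e tg[unfolded L_def] unfolding L_def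
    by (simp add: pts_S_simps[OF i] rank_one_S hyperbolic_S elliptic_S tangent_S ddet_def det_S Collect_conv_if)
qed

lemma profile_o15_2:
  assumes nsq: "\<not> is_square (p^2 - \<epsilon> * q^2)"
  defines "L \<equiv> span2 (S 1 0 0 (-\<epsilon>) 0 0) (S p (\<epsilon>*q) 0 (\<epsilon>*p) 0 1)"
  shows "\<not> all_singular L" "profile L = (0,0,1,0)"
proof -
  have i: "indep2 (S 1 0 0 (-\<epsilon>) 0 0) (S p (\<epsilon>*q) 0 (\<epsilon>*p) 0 1)" by (simp add: indep2_S)
  have nz: "p^2 - \<epsilon> * q^2 \<noteq> 0" using nsq by auto
  have d1: "det (S p (\<epsilon>*q) 0 (\<epsilon>*p) 0 1) = \<epsilon> * (p^2 - \<epsilon> * q^2)" by (simp add: det_S power2_eq_square algebra_simps)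
  then have d1': "det (S p (\<epsilon>*q) 0 (\<epsilon>*p) 0 1) \<noteq> 0" using nz by simp
  show "\<not> all_singular L" unfolding L_def
    using all_singular_SD[of 1 0 0 "-\<epsilon>" 0 0 p "\<epsilon>*q" 0 "\<epsilon>*p" 0 1 0 1] d1' by auto
  have dz: "det (S (1+t * p) (t * (\<epsilon>*q)) 0 (-\<epsilon>+t * (\<epsilon>*p)) 0 t) = 0 \<longleftrightarrow> t = 0" for t
  proof
    assume h: "det (S (1+t * p) (t * (\<epsilon>*q)) 0 (-\<epsilon>+t * (\<epsilon>*p)) 0 t) = 0"
    have e: "det (S (1+t * p) (t * (\<epsilon>*q)) 0 (-\<epsilon>+t * (\<epsilon>*p)) 0 t) = t * \<epsilon> * (t^2 * (p^2 - \<epsilon> * q^2) - 1)"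
      by (simp add: det_S power2_eq_square algebra_simps)
    show "t = 0"
    proof (rule ccontr)
      assume t: "t \<noteq> 0"
      then have "t^2 * (p^2 - \<epsilon> * q^2) = 1" using h unfolding e by simp
      then have "p^2 - \<epsilon> * q^2 = (1/t)^2" using t by (simp add: field_simps power2_eq_square)
      then show False using nsq by (metis is_nth_power_nth_power)
    qed
  qed (simp add: det_S)
  have pt: "{t. Q (S (1+t * p) (t * (\<epsilon>*q)) 0 (-\<epsilon>+t * (\<epsilon>*p)) 0 t)} = (if Q (S 1 0 0 (-\<epsilon>) 0 0) then {0} else {})"
    if h: "\<And>M. Q M \<Longrightarrow> transpose M = M \<Longrightarrow> det M = 0" for Q
  proof -
    have "t = 0" if "Q (S (1+t * p) (t * (\<epsilon>*q)) 0 (-\<epsilon>+t * (\<epsilon>*p)) 0 t)" for t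
      using h[OF that] dz[of t] by simp
    then show ?thesis by force
  qed
  have q: "\<not> Q (S p (\<epsilon>*q) 0 (\<epsilon>*p) 0 1)" if h: "\<And>M. Q M \<Longrightarrow> transpose M = M \<Longrightarrow> det M = 0" for Q
    using h[of "S p (\<epsilon>*q) 0 (\<epsilon>*p) 0 1"] d1' by auto
  have P: "pts Q L = (if Q (S 1 0 0 (-\<epsilon>) 0 0) then 1 else 0)" 
    if h: "\<And>M. Q M \<Longrightarrow> transpose M = M \<Longrightarrow> det M = 0" and "homog Q" for Q
    unfolding L_def pts_S[OF i that(2)] using pt[OF h] q[OF h] by simp
  have "pts rank_one L = (if rank_one (S 1 0 0 (-\<epsilon>) 0 0) then 1 else 0)"
    by (rule P[OF _ homog_simps(1)]) (rule rank_one_det)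
  moreover have "pts hyperbolic L = (if hyperbolic (S 1 0 0 (-\<epsilon>) 0 0) then 1 else 0)"
    by (rule P[OF _ homog_simps(2)]) (simp add: hyperbolic_def)
  moreover have "pts elliptic L = (if elliptic (S 1 0 0 (-\<epsilon>) 0 0) then 1 else 0)"
    by (rule P[OF _ homog_simps(3)]) (simp add: elliptic_def)
  moreover have "pts (tangent L) L = (if tangent L (S 1 0 0 (-\<epsilon>) 0 0) then 1 else 0)"
    by (rule P[OF _ homog_tangent]) (simp add: tangent_def)
  ultimately show "profile L = (0,0,1,0)" unfolding profile_def
    by (simp add: L_def rank_one_S hyperbolic_S elliptic_S det_S tangent_S ddet_def)
qed

lemma profile_o16: 
  defines "L \<equiv> span2 (S 0 0 1 1 0 0) (S 0 0 0 0 1 (0::'a))"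
  shows "\<not> all_singular L" "profile L = (0,1,0,1)"
proof -
  have i: "indep2 (S 0 0 1 1 0 0) (S 0 0 0 0 1 (0::'a))" by (simp add: indep2_S)
  show "\<not> all_singular L" unfolding L_def
    using all_singular_SD[of 0 0 1 1 0 0 0 0 0 0 1 0 1 0] by (auto simp: det_S)
  show "profile L = (0,1,0,1)" unfolding L_def profile_def
    by (simp add: pts_S_simps[OF i] rank_one_S hyperbolic_S elliptic_S tangent_S ddet_def det_S Collect_conv_if)
qed

lemma profile_o17:
  assumes "nonsingular_line L" shows "\<not> all_singular L" "profile L = (0,0,0,0)"
proof -
  obtain M N where MN: "indep2 M N" "L = span2 M N" using assms unfolding nonsingular_line_def PG5_line_iff by blast
  have sym: "transpose Z = Z" if "Z \<in> L" for Z using assms that by (auto simp: nonsingular_line_def PG5_line_def)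
  have "mscale 1 M + mscale 0 N \<in> L" unfolding MN span2_def by blast
  moreover have "M \<noteq> 0" using MN(1)[unfolded indep2_def, rule_format, of 1 0] by auto
  ultimately show "\<not> all_singular L" using assms by (auto simp: all_singular_def nonsingular_line_def)
  have e: "{M\<in>L. M \<noteq> 0 \<and> Q M} = {}" if "\<And>M. Q M \<Longrightarrow> transpose M = M \<Longrightarrow> det M = 0" for Q
    using assms that sym by (auto simp: nonsingular_line_def)
  have z: "pts Q L = 0" if "\<And>M. Q M \<Longrightarrow> transpose M = M \<Longrightarrow> det M = 0" for Q
  proof -
    have "{M\<in>L. M \<noteq> 0 \<and> Q M} = {}" by (rule e) (rule that)
    then show ?thesis unfolding pts_def by (simp only: card.empty div_0)
  qed
  have "pts rank_one L = 0" by (rule z) (rule rank_one_det)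
  moreover have "pts hyperbolic L = 0" by (rule z) (simp add: hyperbolic_def)
  moreover have "pts elliptic L = 0" by (rule z) (simp add: elliptic_def)
  moreover have "pts (tangent L) L = 0" by (rule z) (simp add: tangent_def)
  ultimately show "profile L = (0,0,0,0)" by (simp add: profile_def)
qed

text \<open>The third family of representatives in coordinates, for both classes of \<open>-v\<close>.\<close>

lemma profile_o15_rep:
  assumes c: "cond1 u (v::'a)"
  defines "L \<equiv> span2 (S 0 1 0 u 0 1) (S v 0 0 1 0 0)"
  shows "\<not> all_singular L" "profile L = (if is_square (-v) then (0,1,0,0) else (0,0,1,0))"
proof -
  have i: "indep2 (S 0 1 0 u 0 1) (S v 0 0 1 0 0)" by (simp add: indep2_S)
  have v: "v \<noteq> 0" using c by (simp add: cond1_def)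
  have dz: "det (S (t * v) 1 0 (u+t) 0 1) \<noteq> 0" for t
  proof -
    have "v * t^2 + u * v * t - 1 \<noteq> 0" using c by (simp add: cond1_def)
    then show ?thesis by (simp add: det_S power2_eq_square algebra_simps)
  qed
  show "\<not> all_singular L" unfolding L_def
    using all_singular_SD[of 0 1 0 u 0 1 v 0 0 1 0 0 1 0] by (auto simp: det_S)
  have P: "pts Q L = (if Q (S v 0 0 1 0 0) then 1 else 0)" 
    if h: "\<And>M. Q M \<Longrightarrow> transpose M = M \<Longrightarrow> det M = 0" and "homog Q" for Q
  proof -
    have "{t. Q (S (0 + t * v) (1 + t * 0) (0 + t * 0) (u + t * 1) (0 + t * 0) (1 + t * 0))} = {}"
    proof -
      have "\<not> Q (S (t * v) 1 0 (u+t) 0 1)" for t using h[of "S (t * v) 1 0 (u+t) 0 1"] dz[of t] by auto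
      then show ?thesis by simp
    qed
    then show ?thesis unfolding L_def pts_S[OF i that(2)] by simp
  qed
  have "pts rank_one L = (if rank_one (S v 0 0 1 0 0) then 1 else 0)"
    by (rule P[OF _ homog_simps(1)]) (rule rank_one_det)
  moreover have "pts hyperbolic L = (if hyperbolic (S v 0 0 1 0 0) then 1 else 0)"
    by (rule P[OF _ homog_simps(2)]) (simp add: hyperbolic_def)
  moreover have "pts elliptic L = (if elliptic (S v 0 0 1 0 0) then 1 else 0)"
    by (rule P[OF _ homog_simps(3)]) (simp add: elliptic_def)
  moreover have "pts (tangent L) L = (if tangent L (S v 0 0 1 0 0) then 1 else 0)"
    by (rule P[OF _ homog_tangent]) (simp add: tangent_def)
  ultimately show "profile L = (if is_square (-v) then (0,1,0,0) else (0,0,1,0))" unfolding profile_def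
    using v by (simp add: L_def rank_one_S hyperbolic_S elliptic_S det_S tangent_S ddet_def)
qed

lemma nonsingular_line_o17_rep:
  assumes c: "cond2 u v (w::'a)"
  shows "nonsingular_line (span2 (S (inverse v) 0 0 (-w) 1 0) (S 0 1 0 u 0 1))"
proof -
  have i: "indep2 (S (inverse v) 0 0 (-w) 1 0) (S 0 1 0 u 0 1)" by (simp add: indep2_S)
  have v: "v \<noteq> 0" using c unfolding cond2_def by (metis add.right_neutral diff_zero mult_zero_right power_zero_numeral add_0)
  have "det (S (s * inverse v) t 0 (s * (-w)+t * u) s t) \<noteq> 0" if st: "s \<noteq> 0 \<or> t \<noteq> 0" for s t
  proof (cases "t = 0")
    case True
    then show ?thesis using st v by (simp add: det_S)
  next
    case False
    have "v * det (S (s * inverse v) t 0 (s * (-w)+t * u) s t) = - (s^3 + w * s^2 * t - u * s * t^2 + v * t^3)"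
      using v by (simp add: det_S power2_eq_square power3_eq_cube algebra_simps)
    also have "\<dots> = - (t^3 * ((s/t)^3 + w * (s/t)^2 - u * (s/t) + v))"
      using False by (simp add: power2_eq_square power3_eq_cube algebra_simps)
    also have "\<dots> \<noteq> 0" 
    proof -
      have "(s/t)^3 + w * (s/t)^2 - u * (s/t) + v \<noteq> 0" using c unfolding cond2_def by blast
      then show ?thesis using False by (metis mult_eq_0_iff neg_equal_0_iff_equal power_eq_0_iff)
    qed
    finally show ?thesis by auto
  qed
  then have "det M \<noteq> 0" if "M \<in> span2 (S (inverse v) 0 0 (-w) 1 0) (S 0 1 0 u 0 1)" "M \<noteq> 0" for M
    using that unfolding span2_def by fastforce
  then show ?thesis unfolding nonsingular_line_def using PG5_line_S[OF i] by blast
qed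

lemma ltype_nonsingular_line: "nonsingular_line L \<Longrightarrow> ltype L = o17"
  using ltype_profile[OF profile_o17] by simp

lemma ltype_normal_form: "normal_form t L \<Longrightarrow> ltype L = t"
proof (cases t)
  case o10
  assume "normal_form t L"
  then have L: "L = span2 (S 0 1 0 0 0 0) (S 1 0 0 \<epsilon> 0 0)" using o10 by simp
  have "\<epsilon> \<noteq> 0" "t^2 * \<epsilon> \<noteq> 1" for t
  proof -
    show "t^2 * \<epsilon> \<noteq> 1"
    proof
      assume h: "t^2 * \<epsilon> = 1"
      then have "t \<noteq> 0" by auto
      then have "\<epsilon> = (1/t)^2" using h by (simp add: field_simps)
      then show False using nonsquare by (metis is_nth_power_nth_power)
    qed
  qed simp
  then show ?thesis unfolding L o10
    by (intro ltype_binary) (auto simp: indep2_S power2_eq_square mult.assoc)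
qed (auto simp: ltype_o5 ltype_o6 ltype_o8[of 1, simplified] ltype_o8 ltype_o9 ltype_o12
    ltype_profile[OF profile_o13(1)[of 1] profile_o13(2)[of 1, simplified], simplified]
    ltype_profile[OF profile_o13(1)[of \<epsilon>] profile_o13(2)[of \<epsilon>, simplified], simplified]
    ltype_profile[OF profile_o14(1)[of 1] profile_o14(2)[of 1, simplified], simplified]
    ltype_profile[OF profile_o14(1)[of \<epsilon>] profile_o14(2)[of \<epsilon>, simplified], simplified]
    ltype_profile[OF profile_o15_1] ltype_profile[OF profile_o15_2] ltype_profile[OF profile_o16] ltype_nonsingular_line)

lemma line_reps_normal_form:
  assumes "L \<in> line_reps \<epsilon> t" "t \<notin> {o10, o15_1, o15_2, o17}"
  shows "normal_form t L"
  using assms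
  by (cases t) (auto simp: span2_def S_def[symmetric] algebra_simps)

lemma normal_form_PG5_line: "normal_form t L \<Longrightarrow> PG5_line L"
  by (cases t) (auto simp: indep2_S nonsingular_line_def intro!: PG5_line_S)

lemma line_reps_type:
  assumes "L \<in> line_reps \<epsilon> t" shows "PG5_line L \<and> ltype L = t"
proof (cases "t \<in> {o10, o15_1, o15_2, o17}")
  case False
  then show ?thesis using line_reps_normal_form assms ltype_normal_form normal_form_PG5_line by blast
next
  case True
  then consider "t = o10" | "t = o15_1" | "t = o15_2" | "t = o17" by blast
  then show ?thesis
  proof cases
    case 1
    then obtain u v where L: "L = span2 (S v 0 0 1 0 0) (S 0 1 0 u 0 0)" and c: "cond1 u v"
      using assms by (auto simp: span2_def S_def[symmetric] algebra_simps)
    have "t\<^sup>2 \<noteq> v * (1 + t * u)" for t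
    proof
      assume h: "t\<^sup>2 = v * (1 + t * u)"
      show False
      proof (cases "t = 0")
        case False
        have "v * (1/t)^2 + u * v * (1/t) - 1 = (v * (1 + t * u) - t^2) / t^2"
          using False by (simp add: field_simps power2_eq_square)
        then show ?thesis using c h unfolding cond1_def by (metis diff_self div_0)
      qed (use h c in \<open>simp add: cond1_def\<close>)
    qed
    then have "ltype L = t" unfolding 1 L using c
      by (intro ltype_binary) (auto simp: indep2_S cond1_def)
    moreover have "PG5_line L" unfolding L by (rule PG5_line_S) (simp add: indep2_S)
    ultimately show ?thesis by simp
  next
    case 2
    then obtain u v where L: "L = span2 (S 0 1 0 u 0 1) (S v 0 0 1 0 0)" and c: "cond1 u v" "is_square (-v)"
      using assms by (auto simp: span2_def S_def[symmetric] algebra_simps)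
    have "PG5_line L" unfolding L by (rule PG5_line_S) (simp add: indep2_S)
    then show ?thesis using L c ltype_profile[OF profile_o15_rep(1)[OF c(1)], of 1 0 0] profile_o15_rep(2)[OF c(1)] 2 by simp
  next
    case 3
    then obtain u v where L: "L = span2 (S 0 1 0 u 0 1) (S v 0 0 1 0 0)" and c: "cond1 u v" "\<not> is_square (-v)"
      using assms by (auto simp: span2_def S_def[symmetric] algebra_simps)
    have "PG5_line L" unfolding L by (rule PG5_line_S) (simp add: indep2_S)
    then show ?thesis using L c ltype_profile[OF profile_o15_rep(1)[OF c(1)], of 0 1 0] profile_o15_rep(2)[OF c(1)] 3 by simp
  next
    case 4
    then obtain u v w where L: "L = span2 (S (inverse v) 0 0 (-w) 1 0) (S 0 1 0 u 0 1)" and c: "cond2 u v w"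
      using assms by (auto simp: span2_def S_def[symmetric] algebra_simps)
    have "PG5_line L" unfolding L by (rule PG5_line_S) (simp add: indep2_S)
    then show ?thesis using L ltype_nonsingular_line[OF nonsingular_line_o17_rep[OF c]] 4 by simp
  qed
qed

text \<open>The line and the representative are congruent to normal forms of their types, and normal forms
  of the same type are congruent.\<close>

theorem line_orbit_iff_ltype:
  assumes R: "R t \<in> line_reps \<epsilon> t" and L: "PG5_line L"
  shows "L \<in> K_orbit (R t) \<longleftrightarrow> ltype L = t"
proof
  assume "L \<in> K_orbit (R t)"
  then have "R t \<sim>\<^sub>K L" by (simp add: cong_line_def)
  then show "ltype L = t" using ltype_cong line_reps_type[OF R] by metis
next
  assume t: "ltype L = t"
  obtain t1 L1 where 1: "normal_form t1 L1" "L \<sim>\<^sub>K L1" using line_has_nf[OF L] unfolding has_nf_def by blast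
  obtain t2 L2 where 2: "normal_form t2 L2" "R t \<sim>\<^sub>K L2" 
    using line_has_nf line_reps_type[OF R] unfolding has_nf_def by blast
  have "t1 = t2" using ltype_normal_form 1 2 ltype_cong t line_reps_type[OF R] by metis
  then have "L1 \<sim>\<^sub>K L2" using normal_form_cong 1 2 by blast
  then have "R t \<sim>\<^sub>K L" using 1 2 cong_line_sym cong_line_trans by blast
  then show "L \<in> K_orbit (R t)" by (simp add: cong_line_def)
qed

end

section \<open>Lines in a plane\<close>

definition span3 :: "'a::field^3^3 \<Rightarrow> 'a^3^3 \<Rightarrow> 'a^3^3 \<Rightarrow> ('a^3^3) set" where
  "span3 E M N = {mscale a E + mscale b M + mscale c N | a b c. True}"

definition indep3 :: "'a::field^3^3 \<Rightarrow> 'a^3^3 \<Rightarrow> 'a^3^3 \<Rightarrow> bool" where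
  "indep3 E M N \<longleftrightarrow> (\<forall>a b c. mscale a E + mscale b M + mscale c N = 0 \<longrightarrow> a = 0 \<and> b = 0 \<and> c = 0)"

lemma span2_subset:
  assumes "U \<in> span3 E M N" "W \<in> span3 E M N" shows "span2 U W \<subseteq> span3 E M N"
proof
  fix Z assume "Z \<in> span2 U W"
  then obtain s t where Z: "Z = mscale s U + mscale t W" by (auto simp: span2_def)
  obtain a b c a' b' c' where "U = mscale a E + mscale b M + mscale c N" "W = mscale a' E + mscale b' M + mscale c' N"
    using assms by (auto simp: span3_def)
  then have "Z = mscale (s * a + t * a') E + mscale (s * b + t * b') M + mscale (s * c + t * c') N"
    unfolding Z by (simp add: mscale_def vec_eq_iff algebra_simps)
  then show "Z \<in> span3 E M N" unfolding span3_def by blast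
qed

text \<open>A line in the plane \<open>\<langle>E, M, N\<rangle>\<close> passes through \<open>E\<close> and one point of \<open>\<langle>M, N\<rangle>\<close>, or it is the graph
  of a linear function with values in \<open>\<langle>E\<rangle>\<close>.\<close>

lemma lines_in_span3:
  fixes E M N :: "'a::field^3^3"
  assumes sym: "transpose E = E" "transpose M = M" "transpose N = N" and ind: "indep3 E M N"
  defines "f \<equiv> \<lambda>p. span2 E (mscale (fst p) M + mscale (snd p) N)"
    and "g \<equiv> \<lambda>(x,y). span2 (mscale x E + M) (mscale y E + N)"
  shows "{L. PG5_line L \<and> L \<subseteq> span3 E M N} = f ` P1 \<union> range g" "inj_on f P1" "inj g" "f ` P1 \<inter> range g = {}"
proof -
  let ?V = "\<lambda>a b c. mscale a E + mscale b M + mscale c N"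
  have inj: "a = a' \<and> b = b' \<and> c = c'" if "?V a b c = ?V a' b' c'" for a b c a' b' c'
  proof -
    have "?V (a - a') (b - b') (c - c') = ?V a b c - ?V a' b' c'"
      by (simp add: mscale_def vec_eq_iff algebra_simps)
    then show ?thesis using ind that unfolding indep3_def by (metis cancel_comm_monoid_add_class.diff_cancel eq_iff_diff_eq_0)
  qed
  have V0: "?V 0 0 0 = 0" by simp
  have Vs: "mscale s (?V a b c) + mscale t (?V a' b' c') = ?V (s * a+t * a') (s * b+t * b') (s * c+t * c')" for s t a b c a' b' c'
    by (simp add: mscale_def vec_eq_iff algebra_simps)
  have VE: "E = ?V 1 0 0" by simp
  have fV: "f p = span2 (?V 1 0 0) (?V 0 (fst p) (snd p))" for p unfolding f_def by simp
  have gV: "g (x,y) = span2 (?V x 1 0) (?V y 0 1)" for x y unfolding g_def by simp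
  have symV: "transpose (?V a b c) = ?V a b c" for a b c
    using sym by (simp add: transpose_def mscale_def vec_eq_iff)
  have VI: "?V a b c \<in> span3 E M N" for a b c unfolding span3_def by blast
  have lineV: "PG5_line (span2 (?V a b c) (?V a' b' c'))" if "\<And>s t. s * a+t * a' = 0 \<Longrightarrow> s * b+t * b' = 0 \<Longrightarrow> s * c+t * c' = 0 \<Longrightarrow> s = 0 \<and> t = 0" for a b c a' b' c'
    unfolding PG5_line_iff
  proof (intro exI conjI)
    show "indep2 (?V a b c) (?V a' b' c')"
      unfolding indep2_def Vs using that inj[of _ _ _ 0 0 0] V0 by metis
  qed (rule symV refl)+
  show "{L. PG5_line L \<and> L \<subseteq> span3 E M N} = f ` P1 \<union> range g"
  proof (intro Set.set_eqI iffI)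
    fix L assume "L \<in> {L. PG5_line L \<and> L \<subseteq> span3 E M N}"
    then obtain U W where UW: "indep2 U W" "L = span2 U W" and sub: "L \<subseteq> span3 E M N"
      unfolding PG5_line_iff by blast
    have "mscale 1 U + mscale 0 W \<in> L" "mscale 0 U + mscale 1 W \<in> L" unfolding UW span2_def by blast+
    then have "U \<in> span3 E M N" "W \<in> span3 E M N" using sub by auto
    then obtain u1 u2 u3 w1 w2 w3 where U: "U = ?V u1 u2 u3" and W: "W = ?V w1 w2 w3"
      unfolding span3_def by blast
    define D where "D = u2 * w3 - u3 * w2"
    show "L \<in> f ` P1 \<union> range g"
    proof (cases "D = 0")
      case False
      have "(w3/D) * (u2/D) - (-u3/D) * (-w2/D) = D / (D * D)" unfolding D_def by (simp add: diff_divide_distrib mult.commute)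
      then have "span2 (mscale (w3/D) U + mscale (-u3/D) W) (mscale (-w2/D) U + mscale (u2/D) W) = L"
        unfolding UW(2) using False by (intro span2_rebase) simp
      note rb = this
      have c: "(w3/D) * u2 + (-u3/D) * w2 = 1" "(w3/D) * u3 + (-u3/D) * w3 = 0" "(-w2/D) * u2 + (u2/D) * w2 = 0" "(-w2/D) * u3 + (u2/D) * w3 = 1"
        using False by (simp_all add: mult.commute flip: diff_divide_distrib add_divide_distrib) (simp_all add: D_def mult.commute)
      have "L = span2 (?V ((w3/D) * u1 + (-u3/D) * w1) 1 0) (?V ((-w2/D) * u1 + (u2/D) * w1) 0 1)"
        using rb[unfolded U W Vs c] by (rule HOL.sym)
      then have "L = g ((w3/D) * u1 + (-u3/D) * w1, (-w2/D) * u1 + (u2/D) * w1)" unfolding gV .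
      then show ?thesis by blast
    next
      case True
      obtain s t where st: "s \<noteq> 0 \<or> t \<noteq> 0" "s * u2+t * w2 = 0" "s * u3+t * w3 = 0"
      proof (cases "u2 = 0 \<and> w2 = 0")
        case True
        show ?thesis
        proof (cases "u3 = 0 \<and> w3 = 0")
          case True then show ?thesis using \<open>u2 = 0 \<and> w2 = 0\<close> that[of 1 0] by simp
        next
          case False then show ?thesis using True that[of w3 "-u3"] by (auto simp: mult.commute)
        qed
      next
        case False
        then show ?thesis using True that[of w2 "-u2"] unfolding D_def by (auto simp: mult.commute)
      qed
      define k where "k = s * u1+t * w1"
      have Uk: "mscale s U + mscale t W = ?V k 0 0" unfolding U W Vs st k_def ..
      have k: "k \<noteq> 0"
      proof
        assume "k = 0"
        then have "mscale s U + mscale t W = 0" using Uk by simp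
        then show False using UW(1) st(1) unfolding indep2_def by blast
      qed
      obtain s' t' where st': "s * t' - t * s' \<noteq> 0"
        using st(1) that[of 1 0] that[of 0 1] by auto
      define o1 o2 o3 where "o1 = s'*u1+t'*w1" and "o2 = s'*u2+t'*w2" and "o3 = s'*u3+t'*w3"
      have Uo: "mscale s' U + mscale t' W = ?V o1 o2 o3" unfolding U W Vs o1_def o2_def o3_def ..
      have L1: "L = span2 (?V k 0 0) (?V o1 o2 o3)" 
        unfolding UW(2) Uk[symmetric] Uo[symmetric] by (rule span2_rebase[OF st', symmetric])
      have i1: "indep2 (?V k 0 0) (?V o1 o2 o3)"
        unfolding Uk[symmetric] Uo[symmetric] by (rule indep2_rebase[OF st' UW(1)])
      have "o2 \<noteq> 0 \<or> o3 \<noteq> 0"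
      proof (rule ccontr)
        assume "\<not> ?thesis"
        then have "mscale (- o1) (?V k 0 0) + mscale k (?V o1 o2 o3) = 0" by (simp add: mscale_mscale mult.commute flip: mscale_add)
        then show False using i1 k unfolding indep2_def by blast
      qed
      then obtain r b c where r: "r \<noteq> 0" "(b,c) \<in> P1" "o2 = r * b" "o3 = r * c" by (rule P1_normalize)
      have "span2 (mscale (1/k) (?V k 0 0) + mscale 0 (?V o1 o2 o3)) (mscale (-o1/(k * r)) (?V k 0 0) + mscale (1/r) (?V o1 o2 o3)) = L"
        unfolding L1 using k r by (intro span2_rebase) simp
      then have "L = f (b,c)" unfolding fV Vs using k r by simp
      then show ?thesis using r by blast
    qed
  next
    fix L assume "L \<in> f ` P1 \<union> range g"
    then show "L \<in> {L. PG5_line L \<and> L \<subseteq> span3 E M N}"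
    proof
      assume "L \<in> f ` P1"
      then obtain b c where bc: "(b,c) \<in> P1" "L = span2 (?V 1 0 0) (?V 0 b c)" by (auto simp: fV)
      have "PG5_line L" unfolding bc(2) by (rule lineV) (use P1_nonzero[OF bc(1)] in auto)
      then show ?thesis using span2_subset[OF VI VI] bc(2) by blast
    next
      assume "L \<in> range g"
      then obtain x y where L: "L = span2 (?V x 1 0) (?V y 0 1)" using gV by (metis rangeE surj_pair)
      have "PG5_line L" unfolding L by (rule lineV) auto
      then show ?thesis using span2_subset[OF VI VI] L by blast
    qed
  qed
  have mem: "?V a b c \<in> span2 (?V a1 b1 c1) (?V a2 b2 c2) \<longleftrightarrow> (\<exists>s t. a = s * a1+t * a2 \<and> b = s * b1+t * b2 \<and> c = s * c1+t * c2)" 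
    for a b c a1 b1 c1 a2 b2 c2
    unfolding span2_def Vs using inj by blast
  have self: "?V a2 b2 c2 \<in> span2 (?V a1 b1 c1) (?V a2 b2 c2)" "?V a1 b1 c1 \<in> span2 (?V a1 b1 c1) (?V a2 b2 c2)" for a1 b1 c1 a2 b2 c2
    unfolding mem by (intro exI[of _ 0] exI[of _ 1]; simp) (intro exI[of _ 1] exI[of _ 0]; simp)
  show "inj_on f P1"
  proof (rule inj_onI)
    fix p p' assume p: "p \<in> P1" "p' \<in> P1" "f p = f p'"
    then have "?V 0 (fst p) (snd p) \<in> span2 (?V 1 0 0) (?V 0 (fst p') (snd p'))"
      using self unfolding fV by metis
    then obtain t where "fst p = t * fst p'" "snd p = t * snd p'" unfolding mem by auto
    then have "fst p * snd p' = fst p' * snd p" by (simp add: mult_ac)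
    then show "p = p'" using P1_unique p(1,2) by (metis prod.collapse)
  qed
  show "inj g"
  proof (rule injI)
    fix u v assume h: "g u = g v"
    obtain x y x' y' where uv: "u = (x,y)" "v = (x',y')" by (cases u, cases v)
    have "?V x 1 0 \<in> span2 (?V x' 1 0) (?V y' 0 1)" "?V y 0 1 \<in> span2 (?V x' 1 0) (?V y' 0 1)"
      using h self unfolding uv gV by metis+
    then show "u = v" unfolding uv mem by auto
  qed
  show "f ` P1 \<inter> range g = {}"
  proof -
    have "f p \<noteq> g (x,y)" for p x y
    proof
      assume "f p = g (x,y)"
      then have "?V 1 0 0 \<in> span2 (?V x 1 0) (?V y 0 1)" using self unfolding fV gV by metis
      then show False unfolding mem by auto
    qed
    then show ?thesis by auto
  qed
qed

definition type_count :: "('a::{field,finite}^3^3) set \<Rightarrow> line_type \<Rightarrow> nat" where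
  "type_count P t = card {L. PG5_line L \<and> L \<subseteq> P \<and> ltype L = t}"

lemma dist_act:
  assumes A: "invertible A" shows "type_count (act A ` P) t = type_count P t"
proof -
  obtain B where B: "invertible B" "A ** B = mat 1" "B ** A = mat 1" using A by (rule invertible_inverse)
  have c: "L \<sim>\<^sub>K act A ` L" for L by (rule cong_line_act[OF A])
  have "bij_betw (\<lambda>L. act A ` L) {L. PG5_line L \<and> L \<subseteq> P \<and> ltype L = t} {L. PG5_line L \<and> L \<subseteq> act A ` P \<and> ltype L = t}"
  proof (rule bij_betwI[where g="\<lambda>L. act B ` L"])
    show "(\<lambda>L. act A ` L) \<in> {L. PG5_line L \<and> L \<subseteq> P \<and> ltype L = t} \<rightarrow> {L. PG5_line L \<and> L \<subseteq> act A ` P \<and> ltype L = t}"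
      using PG5_line_cong[OF c] ltype_cong[OF c] by auto
    show "(\<lambda>L. act B ` L) \<in> {L. PG5_line L \<and> L \<subseteq> act A ` P \<and> ltype L = t} \<rightarrow> {L. PG5_line L \<and> L \<subseteq> P \<and> ltype L = t}"
    proof (intro funcsetI, clarify)
      fix L assume L: "PG5_line L" "L \<subseteq> act A ` P"
      have cB: "L \<sim>\<^sub>K act B ` L" by (rule cong_line_act[OF B(1)])
      have "act B ` L \<subseteq> act B ` act A ` P" using L by blast
      also have "\<dots> = P" using B by (simp add: image_image act_cancel)
      finally show "PG5_line (act B ` L) \<and> act B ` L \<subseteq> P \<and> ltype (act B ` L) = ltype L"
        using PG5_line_cong[OF cB L(1)] ltype_cong[OF cB] by simp
    qed
  qed (use B in \<open>simp_all add: image_image act_cancel\<close>)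
  then show ?thesis unfolding type_count_def by (simp add: bij_betw_same_card)
qed

context odd_field
begin

lemma line_orbit_distribution_eq:
  assumes "\<And>t. R t \<in> line_reps \<epsilon> t"
  shows "line_orbit_distribution R P t = type_count P t"
proof -
  have "{L. PG5_line L \<and> L \<subseteq> P \<and> L \<in> K_orbit (R t)} = {L. PG5_line L \<and> L \<subseteq> P \<and> ltype L = t}"
    using line_orbit_iff_ltype[of R t, OF assms] by blast
  then show ?thesis by (simp add: line_orbit_distribution_def type_count_def)
qed

text \<open>From now on a plane contains the rank one point with single nonzero entry in the corner.
  The second count concerns the lines through it.\<close>

definition line_xy where
  "line_xy l m u v w l' m' u' v' w' x y = span2 (S x l m u v w) (S y l' m' u' v' (w'::'a))"

lemma dist_corner:
  assumes ind: "\<And>b c. b * l+c * l' = 0 \<Longrightarrow> b * m+c * m' = 0 \<Longrightarrow> b * u+c * u' = 0 \<Longrightarrow> b * v+c * v' = 0 \<Longrightarrow> b * w+c * w' = (0::'a) \<Longrightarrow> b = 0 \<and> c = 0"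
  shows "type_count (span3 (S 1 0 0 0 0 0) (S 0 l m u v w) (S 0 l' m' u' v' w')) t =
    card {p. ltype (line_xy l m u v w l' m' u' v' w' (fst p) (snd p)) = t} +
    card {s. rank_one_type (l+s * l') (m+s * m') (u+s * u') (v+s * v') (w+s * w') = t} +
    (if rank_one_type l' m' u' v' w' = t then 1 else 0)"
proof -
  let ?E = "S 1 0 0 0 0 0 :: 'a^3^3" and ?M = "S 0 l m u v w" and ?N = "S 0 l' m' u' v' w'"
  let ?f = "\<lambda>p. span2 ?E (mscale (fst p) ?M + mscale (snd p) ?N)"
  let ?g = "\<lambda>(x,y). span2 (mscale x ?E + ?M) (mscale y ?E + ?N)"
  have "indep3 ?E ?M ?N" unfolding indep3_def
  proof (intro allI impI)
    fix a b c assume "mscale a ?E + mscale b ?M + mscale c ?N = 0"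
    then have "a = 0" "b * l+c * l' = 0" "b * m+c * m' = 0" "b * u+c * u' = 0" "b * v+c * v' = 0" "b * w+c * w' = 0" by simp_all
    then show "a = 0 \<and> b = 0 \<and> c = 0" using ind[of b c] by simp
  qed
  note lines = lines_in_span3[OF transpose_S transpose_S transpose_S this]
  have ty: "ltype (span2 ?E (S 0 b c d e f)) = rank_one_type b c d e f" if h: "PG5_line (span2 ?E (S 0 b c d e f))" for b c d e f
  proof -
    obtain L' where "normal_form (rank_one_type b c d e f) L'" "span2 ?E (S 0 b c d e f) \<sim>\<^sub>K L'"
      using rank_one_line_nf[OF h] by blast
    then show ?thesis using ltype_normal_form[of "rank_one_type b c d e f" L'] by (metis ltype_cong)
  qed
  have fty: "ltype (?f p) = rank_one_type (fst p * l+snd p * l') (fst p * m+snd p * m') (fst p * u+snd p * u') (fst p * v+snd p * v') (fst p * w+snd p * w')"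
    if "p \<in> P1" for p
  proof -
    have e: "?f p = span2 ?E (S 0 (fst p * l+snd p * l') (fst p * m+snd p * m') (fst p * u+snd p * u') (fst p * v+snd p * v') (fst p * w+snd p * w'))"
      by simp
    have "?f p \<in> ?f ` P1" using that by (rule imageI)
    then have "PG5_line (?f p)" using lines(1) by blast
    then show ?thesis using ty by (simp only: e)
  qed
  have "{L. PG5_line L \<and> L \<subseteq> span3 ?E ?M ?N \<and> ltype L = t} = ?f ` {p\<in>P1. ltype (?f p) = t} \<union> ?g ` {p. ltype (?g p) = t}"
  proof -
    have u: "{L \<in> f ` A \<union> range g. C L} = f ` {p\<in>A. C (f p)} \<union> g ` {p. C (g p)}" for f g :: "'a \<times> 'a \<Rightarrow> ('a^3^3) set" and A C
      by blast
    have "{L. PG5_line L \<and> L \<subseteq> span3 ?E ?M ?N \<and> ltype L = t} = {L \<in> {L. PG5_line L \<and> L \<subseteq> span3 ?E ?M ?N}. ltype L = t}"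
      by (simp only: mem_Collect_eq conj_assoc)
    then show ?thesis unfolding lines(1) u .
  qed
  moreover have "?f ` {p\<in>P1. ltype (?f p) = t} \<inter> ?g ` {p. ltype (?g p) = t} = {}"
    by (rule subset_antisym[OF order_trans[OF Int_mono equalityD1[OF lines(4)]]]) auto
  ultimately have "type_count (span3 ?E ?M ?N) t = card (?f ` {p\<in>P1. ltype (?f p) = t}) + card (?g ` {p. ltype (?g p) = t})"
    unfolding type_count_def by (simp add: card_Un_disjoint)
  also have "card (?f ` {p\<in>P1. ltype (?f p) = t}) = card {p\<in>P1. ltype (?f p) = t}"
    by (rule card_image) (rule inj_on_subset[OF lines(2)], auto)
  also have "card (?g ` {p. ltype (?g p) = t}) = card {p. ltype (?g p) = t}"
    by (rule card_image) (rule inj_on_subset[OF lines(3)], auto)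
  also have "card {p\<in>P1. ltype (?f p) = t} = 
    card {s. rank_one_type (l+s * l') (m+s * m') (u+s * u') (v+s * v') (w+s * w') = t} + (if rank_one_type l' m' u' v' w' = t then 1 else 0)"
  proof -
    have e: "{p\<in>P1. ltype (?f p) = t} = {p\<in>P1. rank_one_type (fst p * l+snd p * l') (fst p * m+snd p * m') (fst p * u+snd p * u') (fst p * v+snd p * v') (fst p * w+snd p * w') = t}"
      by (rule Collect_cong) (use fty in \<open>auto simp only:\<close>)
    show ?thesis unfolding e card_P1_Collect by simp
  qed
  also have "{p. ltype (?g p) = t} = {p. ltype (line_xy l m u v w l' m' u' v' w' (fst p) (snd p)) = t}"
    by (simp add: line_xy_def case_prod_unfold)
  finally show ?thesis by simp
qed

end

section \<open>Double counting\<close>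

lemma linear_root_iff: "a \<noteq> 0 \<Longrightarrow> x * a + b = 0 \<longleftrightarrow> x = - b / (a::'a::field)"
  by (metis eq_neg_iff_add_eq_0 nonzero_eq_divide_eq)

lemma double_count:
  assumes "finite A" "finite B"
  shows "(\<Sum>x\<in>A. card {y\<in>B. R x y}) = (\<Sum>y\<in>B. card {x\<in>A. R x y})"
proof -
  have "(\<Sum>x\<in>A. card {y\<in>B. R x y}) = (\<Sum>x\<in>A. \<Sum>y\<in>B. if R x y then 1 else 0)"
    using assms by (intro sum.cong refl) (simp add: sum.If_cases Int_def)
  also have "\<dots> = (\<Sum>y\<in>B. \<Sum>x\<in>A. if R x y then 1 else 0)" by (rule sum.swap)
  also have "\<dots> = (\<Sum>y\<in>B. card {x\<in>A. R x y})"
    using assms by (intro sum.cong refl) (simp add: sum.If_cases Int_def)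
  finally show ?thesis .
qed

context odd_field
begin

text \<open>The numbers of rank one, hyperbolic, elliptic and tangent points. The default is right for
  \<open>o17\<close>, the only other type in \<open>generic_types\<close>.\<close>

fun standard_profile :: "line_type \<Rightarrow> nat \<times> nat \<times> nat \<times> nat" where
  "standard_profile o13_1 = (0,2,0,1)"
| "standard_profile o13_2 = (0,1,1,1)"
| "standard_profile o14_1 = (0,3,0,0)"
| "standard_profile o14_2 = (0,1,2,0)"
| "standard_profile o15_1 = (0,1,0,0)"
| "standard_profile o15_2 = (0,0,1,0)"
| "standard_profile o16 = (0,1,0,1)"
| "standard_profile _ = (0,0,0,0)"

text \<open>The types of lines that have a nonsingular point and no point of rank one.\<close>

definition generic_types :: "line_type set" where
  "generic_types = {o13_1, o13_2, o14_1, o14_2, o15_1, o15_2, o16, o17}"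

lemma profile_cong: "L \<sim>\<^sub>K L' \<Longrightarrow> profile L = profile L'"
proof -
  assume "L \<sim>\<^sub>K L'"
  then obtain A where A: "invertible A" "L' = act A ` L"
    unfolding cong_line_def K_orbit_def' by blast
  show ?thesis
    unfolding A(2) profile_def pts_act[OF A(1)] tangent_act[OF A(1)] using A(1) by simp
qed

lemma profile_ltype:
  assumes L: "PG5_line L" "pts rank_one L = 0" "\<not> all_singular L"
  shows "profile L = standard_profile (ltype L)" "ltype L \<in> generic_types"
proof -
  show g: "ltype L \<in> generic_types"
    using L(2,3) by (simp add: ltype_def Let_def generic_types_def)
  obtain t L' where t: "normal_form t L'" "L \<sim>\<^sub>K L'" using line_has_nf[OF L(1)] unfolding has_nf_def by blast
  have tt: "ltype L = t" using ltype_normal_form t ltype_cong by metis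
  have "profile L' = standard_profile t"
    using t(1) g[unfolded tt generic_types_def]
    by (elim insertE) (auto simp: profile_o13(2)[of 1, simplified] profile_o13(2)[of \<epsilon>, simplified] 
        profile_o14(2)[of 1, simplified] profile_o14(2)[of \<epsilon>, simplified] profile_o15_1(2) profile_o15_2(2) profile_o16(2) profile_o17(2))
  then show "profile L = standard_profile (ltype L)" using profile_cong[OF t(2)] tt by simp
qed

text \<open>The determinant along a line, as a binary cubic.\<close>

lemma det_pencil:
  "det (S (b * a1+c * a2) (b * b1+c * b2) (b * c1+c * c2) (b * d1+c * d2) (b * e1+c * e2) (b * f1+c * f2)) =
   b^3 * det (S a1 b1 c1 d1 e1 f1) + b^2 * c * ddet a1 b1 c1 d1 e1 f1 a2 b2 c2 d2 e2 f2 +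
   b * c^2 * ddet a2 b2 c2 d2 e2 f2 a1 b1 c1 d1 e1 f1 + c^3 * det (S a2 b2 c2 d2 e2 (f2::'a))"
  by (simp add: det_S ddet_def power2_eq_square power3_eq_cube algebra_simps)

lemma ddet_pencil:
  "ddet (b * a1+c * a2) (b * b1+c * b2) (b * c1+c * c2) (b * d1+c * d2) (b * e1+c * e2) (b * f1+c * f2) a1 b1 c1 d1 e1 f1 =
   3 * b^2 * det (S a1 b1 c1 d1 e1 f1) + 2 * b * c * ddet a1 b1 c1 d1 e1 f1 a2 b2 c2 d2 e2 f2 +
   c^2 * ddet a2 b2 c2 d2 e2 f2 a1 b1 c1 d1 e1 f1"
  "ddet (b * a1+c * a2) (b * b1+c * b2) (b * c1+c * c2) (b * d1+c * d2) (b * e1+c * e2) (b * f1+c * f2) a2 b2 c2 d2 e2 f2 =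
   b^2 * ddet a1 b1 c1 d1 e1 f1 a2 b2 c2 d2 e2 f2 +
   2 * b * c * ddet a2 b2 c2 d2 e2 f2 a1 b1 c1 d1 e1 f1 + 3 * c^2 * det (S a2 b2 c2 d2 e2 f2)"
  by (simp_all add: det_S ddet_def power2_eq_square power3_eq_cube algebra_simps)

text \<open>The cubic of a line of type \<open>o16\<close> is the cube of a linear form.\<close>

lemma o16_iff_cube:
  fixes a1 b1 c1 d1 e1 f1 a2 b2 c2 d2 e2 f2 :: 'a
  defines "L \<equiv> span2 (S a1 b1 c1 d1 e1 f1) (S a2 b2 c2 d2 e2 f2)"
  assumes i: "indep2 (S a1 b1 c1 d1 e1 f1) (S a2 b2 c2 d2 e2 f2)"
    and r: "pts rank_one L = 0" and ns: "\<not> all_singular L"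
  shows "ltype L = o16 \<longleftrightarrow> (\<exists>k \<alpha> \<beta>. det (S a1 b1 c1 d1 e1 f1) = k * \<alpha>^3 \<and> 
    ddet a1 b1 c1 d1 e1 f1 a2 b2 c2 d2 e2 f2 = 3 * k * \<alpha>^2 * \<beta> \<and>
    ddet a2 b2 c2 d2 e2 f2 a1 b1 c1 d1 e1 f1 = 3 * k * \<alpha>*\<beta>^2 \<and> det (S a2 b2 c2 d2 e2 f2) = k * \<beta>^3)"
proof -
  define K0 K1 K2 K3 where "K0 = det (S a1 b1 c1 d1 e1 f1)" and "K1 = ddet a1 b1 c1 d1 e1 f1 a2 b2 c2 d2 e2 f2"
    and "K2 = ddet a2 b2 c2 d2 e2 f2 a1 b1 c1 d1 e1 f1" and "K3 = det (S a2 b2 c2 d2 e2 f2)"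
  define Z where "Z p = S (fst p * a1+snd p * a2) (fst p * b1+snd p * b2) (fst p * c1+snd p * c2) (fst p * d1+snd p * d2) (fst p * e1+snd p * e2) (fst p * f1+snd p * f2)" for p
  have Zm: "mscale (fst p) (S a1 b1 c1 d1 e1 f1) + mscale (snd p) (S a2 b2 c2 d2 e2 f2) = Z p" for p by (simp add: Z_def)
  have pts: "pts Q L = card {p\<in>P1. Q (Z p)}" if "homog Q" for Q
    unfolding L_def pts_span2[OF i that] Zm ..
  have PL: "PG5_line L" unfolding L_def by (rule PG5_line_S[OF i])
  have detZ: "det (Z p) = (fst p)^3 * K0 + (fst p)^2 * snd p * K1 + fst p * (snd p)^2 * K2 + (snd p)^3 * K3" for p
    unfolding Z_def det_pencil K0_def K1_def K2_def K3_def ..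
  have "card {p\<in>P1. rank_one (Z p)} = 0" using r pts[OF homog_simps(1)] by simp
  then have "{p\<in>P1. rank_one (Z p)} = {}" by (simp only: card_0_eq[OF finite])
  then have nr: "\<not> rank_one (Z p)" if "p \<in> P1" for p using that by blast
  have nz: "Z p \<noteq> 0" if "p \<in> P1" for p
  proof
    assume "Z p = 0"
    then have "fst p = 0 \<and> snd p = 0" using i[unfolded indep2_def] unfolding Zm[symmetric] by blast
    then show False using P1_nonzero[of "fst p" "snd p"] that by (metis prod.collapse)
  qed
  have tan: "tangent L (Z p) \<longleftrightarrow> det (Z p) = 0 \<and> 3 * (fst p)^2 * K0 + 2 * fst p * snd p * K1 + (snd p)^2 * K2 = 0 \<and>
      (fst p)^2 * K1 + 2 * fst p * snd p * K2 + 3 * (snd p)^2 * K3 = 0" if "p \<in> P1" for p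
    using nr[OF that] nz[OF that] unfolding L_def Z_def tangent_S ddet_pencil K0_def K1_def K2_def K3_def by auto
  have n0: "\<not> (K0 = 0 \<and> K1 = 0 \<and> K2 = 0 \<and> K3 = 0)"
  proof
    assume K: "K0 = 0 \<and> K1 = 0 \<and> K2 = 0 \<and> K3 = 0"
    have "all_singular L" unfolding L_def all_singular_S det_pencil using K by (simp add: K0_def K1_def K2_def K3_def)
    then show False using ns by simp
  qed
  show ?thesis unfolding K0_def[symmetric] K1_def[symmetric] K2_def[symmetric] K3_def[symmetric]
  proof
    assume "ltype L = o16"
    then have prof: "profile L = (0,1,0,1)" using profile_ltype(1)[OF PL r ns] by simp
    have hyp: "card {p\<in>P1. hyperbolic (Z p)} = 1" and ell: "card {p\<in>P1. elliptic (Z p)} = 0" and tg: "card {p\<in>P1. tangent L (Z p)} = 1"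
      using prof unfolding profile_def by (simp_all add: pts homog_simps homog_tangent)
    have "{p\<in>P1. elliptic (Z p)} = {}" using ell by (simp only: card_0_eq[OF finite])
    then have sing: "hyperbolic (Z p)" if "p \<in> P1" "det (Z p) = 0" for p
      using nr[OF that(1)] that unfolding hyperbolic_def elliptic_def by blast
    have uniq: "p = p'" if "p \<in> P1" "p' \<in> P1" "det (Z p) = 0" "det (Z p') = 0" for p p'
      using hyp sing that by (metis (mono_tags, lifting) card_1_singletonE mem_Collect_eq singletonD)
    obtain p where p: "p \<in> P1" "tangent L (Z p)" using tg by (metis (mono_tags, lifting) card_1_singletonE insertI1 mem_Collect_eq)
    have dp: "det (Z p) = 0" using p tan by blast
    consider "p = (0,1)" | t where "p = (1,t)" using P1_cases[OF p(1)] by blast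
    then show "\<exists>k \<alpha> \<beta>. K0 = k * \<alpha>^3 \<and> K1 = 3 * k * \<alpha>^2 * \<beta> \<and> K2 = 3 * k * \<alpha>*\<beta>^2 \<and> K3 = k * \<beta>^3"
    proof cases
      assume "p = (0,1)"
      then have 1: "fst p = 0" "snd p = 1" "p = (0,1)" by simp_all
      have K: "K3 = 0" "K2 = 0" using tan[OF p(1)] p(2) detZ[of p] unfolding 1(1,2) by auto
      have "K1 = 0"
      proof (rule ccontr)
        assume K1: "K1 \<noteq> 0"
        have "det (Z (1,-K0/K1)) = 0" unfolding detZ using K K1 by simp
        then show False using uniq[OF p(1) _ dp, of "(1,-K0/K1)"] 1(3) by simp
      qed
      then show ?thesis using K by (intro exI[of _ K0] exI[of _ 1] exI[of _ 0]) simp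
    next
      fix t assume 2: "p = (1,t)"
      have h: "K0 + t * K1 + t^2 * K2 + t^3 * K3 = 0" "3 * K0 + 2 * t * K1 + t^2 * K2 = 0" "K1 + 2 * t * K2 + 3 * t^2 * K3 = 0"
        using tan[OF p(1)] p(2) dp unfolding 2 detZ by simp_all
      define e where "e = K2 + 2 * t * K3"
      have K2: "K2 = e - 2 * t * K3" by (simp add: e_def)
      have "K1 = - (2 * t * K2 + 3 * t^2 * K3)" using h(3) by (simp only: eq_neg_iff_add_eq_0 add.assoc)
      then have K1: "K1 = t^2 * K3 - 2 * t * e" unfolding K2 by (simp add: power2_eq_square algebra_simps)
      have "K0 = - (t * K1 + t^2 * K2 + t^3 * K3)" using h(1) by (simp only: eq_neg_iff_add_eq_0 add.assoc)
      then have K0: "K0 = t^2 * e" unfolding K1 K2 by (simp add: power2_eq_square power3_eq_cube algebra_simps)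
      have "K3 \<noteq> 0"
      proof
        assume "K3 = 0"
        then have "det (Z (0,1)) = 0" unfolding detZ by simp
        then show False using uniq[OF p(1) _ dp, of "(0,1)"] 2 by simp
      qed
      have "det (Z (1,-e/K3)) = 0"
      proof -
        have "1^3 * K0 + 1^2 * s * K1 + 1 * s^2 * K2 + s^3 * K3 = (s-t)^2 * (K3 * s+e)" for s
          unfolding K0 K1 K2 by (simp add: power2_eq_square power3_eq_cube algebra_simps)
        note factor = this
        show ?thesis unfolding detZ fst_conv snd_conv factor using \<open>K3 \<noteq> 0\<close> by simp
      qed
      then have "t = -e/K3" using uniq[OF p(1) _ dp, of "(1,-e/K3)"] 2 by simp
      then have e: "e = -t * K3" using \<open>K3 \<noteq> 0\<close> by (simp add: field_simps)
      show ?thesis unfolding K0 K1 K2 e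
        by (intro exI[of _ K3] exI[of _ "-t"] exI[of _ 1]) (simp add: power2_eq_square power3_eq_cube algebra_simps)
    qed
  next
    assume "\<exists>k \<alpha> \<beta>. K0 = k * \<alpha>^3 \<and> K1 = 3 * k * \<alpha>^2 * \<beta> \<and> K2 = 3 * k * \<alpha>*\<beta>^2 \<and> K3 = k * \<beta>^3"
    then obtain k \<alpha> \<beta> where K: "K0 = k * \<alpha>^3" "K1 = 3 * k * \<alpha>^2 * \<beta>" "K2 = 3 * k * \<alpha>*\<beta>^2" "K3 = k * \<beta>^3" by blast
    have k0: "k \<noteq> 0" and "\<alpha> \<noteq> 0 \<or> \<beta> \<noteq> 0" using n0 K by auto
    then have "\<beta> \<noteq> 0 \<or> -\<alpha> \<noteq> 0" by auto
    then obtain r b c where bc: "r \<noteq> 0" "(b,c) \<in> P1" "\<beta> = r * b" "-\<alpha> = r * c" by (rule P1_normalize)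
    then have \<alpha>: "\<alpha> = - (r * c)" by (metis minus_minus)
    have cube: "det (Z p) = k * (\<alpha>*fst p+\<beta>*snd p)^3" for p
      unfolding detZ K by (simp add: power2_eq_square power3_eq_cube algebra_simps)
    have lin: "\<alpha>*b+\<beta>*c = 0" unfolding \<alpha> bc(3) by simp
    have d1: "3 * b^2 * K0 + 2 * b * c * K1 + c^2 * K2 = 3 * k * \<alpha>*(\<alpha>*b+\<beta>*c)^2" "b^2 * K1 + 2 * b * c * K2 + 3 * c^2 * K3 = 3 * k * \<beta>*(\<alpha>*b+\<beta>*c)^2"
      unfolding K by (simp_all add: power2_eq_square power3_eq_cube algebra_simps)
    have tbc: "tangent L (Z (b,c))" unfolding tan[OF bc(2)] cube fst_conv snd_conv d1 lin by simp
    have uniq: "p = (b,c)" if "p \<in> P1" "det (Z p) = 0" for p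
    proof -
      have "\<alpha>*fst p+\<beta>*snd p = 0" using that(2) k0 unfolding cube by simp
      then have "r * (b * snd p - fst p * c) = 0" unfolding \<alpha> bc(3) by (simp add: algebra_simps)
      then have "b * snd p = fst p * c" using bc(1) by simp
      then show ?thesis using P1_unique[OF bc(2), of "fst p" "snd p"] that(1) by (simp add: prod_eq_iff)
    qed
    have td: "det (Z p) = 0" if "tangent L (Z p)" for p using that unfolding tangent_def by (elim conjE)
    have "{p\<in>P1. tangent L (Z p)} \<subseteq> {(b,c)}" by (rule subsetI) (use uniq td in \<open>simp only: mem_Collect_eq singleton_iff\<close>)
    moreover have "{(b,c)} \<subseteq> {p\<in>P1. tangent L (Z p)}" using tbc bc(2) by (simp only: empty_subsetI insert_subset mem_Collect_eq)
    ultimately have "{p\<in>P1. tangent L (Z p)} = {(b,c)}" by (rule subset_antisym)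
    then have tp: "pts (tangent L) L = 1" by (simp add: pts[OF homog_tangent])
    have "{p\<in>P1. hyperbolic (Z p)} \<union> {p\<in>P1. elliptic (Z p)} \<subseteq> {(b,c)}"
      unfolding hyperbolic_def elliptic_def using uniq by blast
    then have "card ({p\<in>P1. hyperbolic (Z p)} \<union> {p\<in>P1. elliptic (Z p)}) \<le> card {(b,c)}"
      by (intro card_mono) simp_all
    then have "card ({p\<in>P1. hyperbolic (Z p)} \<union> {p\<in>P1. elliptic (Z p)}) \<le> 1" by (simp only: card.insert finite.emptyI empty_iff not_False_eq_True card.empty One_nat_def)
    then have sn: "pts hyperbolic L + pts elliptic L \<le> 1"
      unfolding pts[OF homog_simps(2)] pts[OF homog_simps(3)]
      by (subst card_Un_disjoint[symmetric]) (simp_all only: finite, unfold hyperbolic_def elliptic_def, blast)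
    have "standard_profile (ltype L) = (0, pts hyperbolic L, pts elliptic L, 1)"
      using profile_ltype(1)[OF PL r ns] tp r by (simp add: profile_def)
    then show "ltype L = o16" using sn by (cases "ltype L") auto
  qed
qed

end

text \<open>The plane spanned by the corner point and two matrices with zero corner entry, each given by its
  border and its lower block.\<close>

locale corner_plane = odd_field \<epsilon> for \<epsilon> :: "'a::{field,finite}" +
  fixes l m u v w l' m' u' v' w' :: 'a
begin

definition pL where "pL p = fst p * l + snd p * l'"
definition pM where "pM p = fst p * m + snd p * m'"
definition pU where "pU p = fst p * u + snd p * u'"
definition pV where "pV p = fst p * v + snd p * v'"
definition pW where "pW p = fst p * w + snd p * w'"

text \<open>The determinant of the point over \<open>p\<close> with corner entry \<open>a\<close> is \<open>a q2 p + q3 p\<close>.\<close>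

definition q2 where "q2 p = pU p * pW p - (pV p)^2"
definition q3 where "q3 p = 2 * pL p * pM p * pV p - (pL p)^2 * pW p - (pM p)^2 * pU p"

definition "plane = span3 (S 1 0 0 0 0 0) (S 0 l m u v w) (S 0 l' m' u' v' w')"
definition "line p = line_xy l m u v w l' m' u' v' w' (fst p) (snd p)"
definition "line_count t = card {p. ltype (line p) = t}"
definition "hyp_points = {p\<in>P1. q2 p \<noteq> 0 \<and> is_square (- q2 p)}"
definition "ell_points = {p\<in>P1. \<not> is_square (- q2 p)}"

end

text \<open>Here the point in the corner is the only point of rank one, every line through it contains at
  most one other singular point, and there is no line of singular points.\<close>

locale irreducible_plane = corner_plane +
  assumes no_common_root: "p \<in> P1 \<Longrightarrow> q2 p = 0 \<Longrightarrow> q3 p \<noteq> 0"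
    and not_divisible: "\<exists>p\<in>P1. (x * fst p + y * snd p) * q2 p + q3 p \<noteq> 0"
begin

lemma independent:
  assumes "b * l+c * l' = 0" "b * m+c * m' = 0" "b * u+c * u' = 0" "b * v+c * v' = 0" "b * w+c * w' = 0"
  shows "b = 0 \<and> c = 0"
proof (rule ccontr)
  assume "\<not> (b = 0 \<and> c = 0)"
  then obtain r b' c' where r: "r \<noteq> 0" "(b',c') \<in> P1" "b = r * b'" "c = r * c'" using P1_normalize[of b c] by metis
  have "r * (b' * z+c' * z') = b * z+c * z'" for z z' unfolding r by (simp add: algebra_simps)
  then have "b' * l+c' * l' = 0" "b' * m+c' * m' = 0" "b' * u+c' * u' = 0" "b' * v+c' * v' = 0" "b' * w+c' * w' = 0"
    using assms r(1) by (metis mult_eq_0_iff)+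
  then show False using no_common_root[OF r(2)] by (simp add: q2_def q3_def pL_def pM_def pU_def pV_def pW_def)
qed

definition Z where "Z x y p = S (x * fst p+y * snd p) (pL p) (pM p) (pU p) (pV p) (pW p)"

lemma Z_eq: "mscale (fst p) (S x l m u v w) + mscale (snd p) (S y l' m' u' v' w') = Z x y p"
  by (simp add: Z_def pL_def pM_def pU_def pV_def pW_def mult.commute)

lemma indep2_line: "indep2 (S x l m u v w) (S y l' m' u' v' w')"
  unfolding indep2_S using independent by blast

lemma PG5_line_line: "PG5_line (line p)"
  unfolding line_def line_xy_def by (rule PG5_line_S[OF indep2_line])

lemma pts_line: "homog Q \<Longrightarrow> pts Q (line q) = card {p\<in>P1. Q (Z (fst q) (snd q) p)}"
  unfolding line_def line_xy_def pts_span2[OF indep2_line] Z_eq ..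

lemma det_Z: "det (Z x y p) = (x * fst p+y * snd p) * q2 p + q3 p"
  by (simp add: Z_def det_S q2_def q3_def power2_eq_square algebra_simps)

lemma det_Z_q2: "p \<in> P1 \<Longrightarrow> det (Z x y p) = 0 \<Longrightarrow> q2 p \<noteq> 0"
  using no_common_root[of p] by (metis det_Z mult_zero_right add_0)

lemma det_Z_eq_0_iff: "q2 p \<noteq> 0 \<Longrightarrow> det (Z x y p) = 0 \<longleftrightarrow> x * fst p+y * snd p = - q3 p / q2 p"
  unfolding det_Z by (rule linear_root_iff)

lemma not_rank_one_Z: "p \<in> P1 \<Longrightarrow> \<not> rank_one (Z x y p)"
  using det_Z_q2[of p x y] unfolding Z_def rank_one_S' by (auto simp: q2_def)

lemma hyperbolic_Z: "p \<in> P1 \<Longrightarrow> hyperbolic (Z x y p) \<longleftrightarrow> p \<in> hyp_points \<and> det (Z x y p) = 0"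
proof -
  assume p: "p \<in> P1"
  have "split (Z x y p) \<longleftrightarrow> is_square (- q2 p)" if d: "det (Z x y p) = 0"
  proof -
    have "(pV p)^2 - pU p * pW p \<noteq> 0" using det_Z_q2[OF p d] by (simp add: q2_def)
    then show ?thesis using split_minor split_S d unfolding Z_def q2_def by (metis minus_diff_eq)
  qed
  then show ?thesis using p not_rank_one_Z[OF p] det_Z_q2[OF p] by (auto simp: hyperbolic_def hyp_points_def)
qed

lemma elliptic_Z: "p \<in> P1 \<Longrightarrow> elliptic (Z x y p) \<longleftrightarrow> p \<in> ell_points \<and> det (Z x y p) = 0"
  using hyperbolic_Z[of p x y] not_rank_one_Z[of p x y] det_Z_q2[of p x y]
  by (auto simp: hyperbolic_def elliptic_def hyp_points_def ell_points_def)

lemma rank_one_line: "pts rank_one (line p) = 0"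
  using not_rank_one_Z by (simp add: pts_line[OF homog_simps(1)])

lemma not_all_singular: "\<not> all_singular (line p)"
proof
  assume a: "all_singular (line p)"
  obtain r where r: "r \<in> P1" "(fst p * fst r + snd p * snd r) * q2 r + q3 r \<noteq> 0" using not_divisible by blast
  have "Z (fst p) (snd p) r \<in> line p"
    unfolding line_def line_xy_def Z_eq[symmetric] span2_def by blast
  then show False using a r(2) det_Z unfolding all_singular_def by metis
qed

lemmas line_profile = profile_ltype[OF PG5_line_line rank_one_line not_all_singular]

lemma points_q2: "p \<in> hyp_points \<union> ell_points \<Longrightarrow> p \<in> P1 \<and> q2 p \<noteq> 0"
  by (auto simp: hyp_points_def ell_points_def)

lemma points_disjoint: "hyp_points \<inter> ell_points = {}"
  by (auto simp: hyp_points_def ell_points_def)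

text \<open>A point lies on \<open>q\<close> of the lines, two points on one.\<close>

lemma lines_through_point:
  assumes p: "p \<in> P1" "q2 p \<noteq> 0"
  shows "card {r. det (Z (fst r) (snd r) p) = 0} = CARD('a)"
proof -
  define h where "h = - q3 p / q2 p"
  have e: "det (Z x y p) = 0 \<longleftrightarrow> x * fst p+y * snd p = h" for x y
    unfolding h_def by (rule det_Z_eq_0_iff[OF p(2)])
  consider "p = (0,1)" | t where "p = (1,t)" using P1_cases[OF p(1)] by blast
  then show ?thesis
  proof cases
    assume "p = (0,1)"
    then have f: "fst p = 0" "snd p = 1" by simp_all
    have "{r. det (Z (fst r) (snd r) p) = 0} = (\<lambda>x. (x,h)) ` UNIV"
      unfolding e f by auto
    also have "card \<dots> = CARD('a)" by (rule card_image) (auto simp: inj_on_def)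
    finally show ?thesis .
  next
    fix t assume "p = (1,t)"
    then have f: "fst p = 1" "snd p = t" by simp_all
    have "{r. det (Z (fst r) (snd r) p) = 0} = (\<lambda>y. (h - y * t,y)) ` UNIV" unfolding e f
      by (auto simp: image_def prod_eq_iff eq_diff_eq)
    also have "card \<dots> = CARD('a)" by (rule card_image) (auto simp: inj_on_def)
    finally show ?thesis .
  qed
qed

lemma lines_through_points:
  assumes p: "p \<in> P1" "q2 p \<noteq> 0" and p': "p' \<in> P1" "q2 p' \<noteq> 0" and ne: "p \<noteq> p'"
  shows "card {r. det (Z (fst r) (snd r) p) = 0 \<and> det (Z (fst r) (snd r) p') = 0} = 1"
proof -
  define h where "h = - q3 p / q2 p"
  define h' where "h' = - q3 p' / q2 p'"
  have e: "det (Z x y p) = 0 \<longleftrightarrow> x * fst p+y * snd p = h" "det (Z x y p') = 0 \<longleftrightarrow> x * fst p'+y * snd p' = h'" for x y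
    unfolding h_def h'_def by (rule det_Z_eq_0_iff[OF p(2)], rule det_Z_eq_0_iff[OF p'(2)])
  define D where "D = fst p * snd p' - fst p'*snd p"
  have D: "D \<noteq> 0" using P1_unique[of "fst p" "snd p" "fst p'" "snd p'"] p p' ne by (auto simp: D_def prod_eq_iff)
  have "x * fst p+y * snd p = h \<and> x * fst p'+y * snd p' = h' \<longleftrightarrow> x = (h * snd p' - h'*snd p)/D \<and> y = (h'*fst p - h * fst p')/D" for x y
  proof
    assume a: "x * fst p+y * snd p = h \<and> x * fst p'+y * snd p' = h'"
    have "x * D = h * snd p' - h'*snd p" "y * D = h'*fst p - h * fst p'"
      unfolding conjunct1[OF a, symmetric] conjunct2[OF a, symmetric] D_def by (simp_all add: algebra_simps)
    then show "x = (h * snd p' - h'*snd p)/D \<and> y = (h'*fst p - h * fst p')/D" using D by (simp add: eq_divide_eq)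
  next
    assume a: "x = (h * snd p' - h'*snd p)/D \<and> y = (h'*fst p - h * fst p')/D"
    have "(h * snd p' - h'*snd p) * fst p + (h'*fst p - h * fst p') * snd p = h * D" "(h * snd p' - h'*snd p) * fst p' + (h'*fst p - h * fst p') * snd p' = h'*D"
      unfolding D_def by (simp_all add: algebra_simps)
    then show "x * fst p+y * snd p = h \<and> x * fst p'+y * snd p' = h'"
      using a D by (simp flip: add_divide_distrib)
  qed
  then have "{r. det (Z (fst r) (snd r) p) = 0 \<and> det (Z (fst r) (snd r) p') = 0} = {((h * snd p' - h'*snd p)/D, (h'*fst p - h * fst p')/D)}"
    unfolding e by (auto simp: prod_eq_iff)
  then show ?thesis by simp
qed

text \<open>Each singular point off the corner is a smooth point of the cubic, and so lies on one tangent.\<close>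

lemma tangents_through_point:
  assumes p: "p \<in> P1" "q2 p \<noteq> 0"
  shows "card {r. tangent (line r) (Z (fst r) (snd r) p)} = 1"
proof -
  define h where "h = - q3 p / q2 p"
  have e: "det (Z x y p) = 0 \<longleftrightarrow> x * fst p+y * snd p = h" for x y
    unfolding h_def by (rule det_Z_eq_0_iff[OF p(2)])
  define R1 where "R1 = ddet h (pL p) (pM p) (pU p) (pV p) (pW p) 0 l m u v w"
  define R2 where "R2 = ddet h (pL p) (pM p) (pU p) (pV p) (pW p) 0 l' m' u' v' w'"
  have dd: "ddet h (pL p) (pM p) (pU p) (pV p) (pW p) x l m u v w = x * q2 p + R1"
    "ddet h (pL p) (pM p) (pU p) (pV p) (pW p) x l' m' u' v' w' = x * q2 p + R2" for x
    by (simp_all add: R1_def R2_def ddet_def q2_def algebra_simps)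
  have "fst p * R1 + snd p * R2 = ddet h (pL p) (pM p) (pU p) (pV p) (pW p) 0 (pL p) (pM p) (pU p) (pV p) (pW p)"
    by (simp add: R1_def R2_def ddet_def pL_def pM_def pU_def pV_def pW_def algebra_simps)
  also have "\<dots> = 3 * (h * q2 p + q3 p) - h * q2 p"
    by (simp add: ddet_def q2_def q3_def power2_eq_square algebra_simps)
  also have "\<dots> = - (h * q2 p)" using p(2) by (simp add: h_def)
  finally have R: "fst p * R1 + snd p * R2 = - (h * q2 p)" .
  have nz: "Z x y p \<noteq> 0" for x y using p(2) by (auto simp: Z_def q2_def)
  have "tangent (line (x,y)) (Z x y p) \<longleftrightarrow> x = -R1/q2 p \<and> y = -R2/q2 p" for x y
  proof -
    have "tangent (line (x,y)) (Z x y p) \<longleftrightarrow> x * fst p+y * snd p = h \<and> x * q2 p + R1 = 0 \<and> y * q2 p + R2 = 0"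
    proof (cases "x * fst p+y * snd p = h")
      case True
      have Zh: "Z x y p = S h (pL p) (pM p) (pU p) (pV p) (pW p)" unfolding Z_def True ..
      show ?thesis
        using nz[of x y] not_rank_one_Z[OF p(1), of x y] e[of x y] True
        unfolding line_def line_xy_def fst_conv snd_conv Zh tangent_S dd by blast
    next
      case False
      then show ?thesis using e[of x y] by (auto simp: tangent_def)
    qed
    also have "\<dots> \<longleftrightarrow> x = -R1/q2 p \<and> y = -R2/q2 p"
    proof
      assume a: "x = -R1/q2 p \<and> y = -R2/q2 p"
      have "x * fst p+y * snd p = - (fst p * R1 + snd p * R2)/q2 p"
        using a by (simp add: add_divide_distrib diff_divide_distrib mult.commute)
      then have "x * fst p+y * snd p = h" unfolding R using p(2) by simp
      then show "x * fst p+y * snd p = h \<and> x * q2 p + R1 = 0 \<and> y * q2 p + R2 = 0" using a p(2) by simp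
    qed (use linear_root_iff[OF p(2)] in blast)
    finally show ?thesis .
  qed
  then have "{r. tangent (line r) (Z (fst r) (snd r) p)} = {(-R1/q2 p, -R2/q2 p)}" by (auto simp: prod_eq_iff)
  then show ?thesis by simp
qed

text \<open>Lines are counted together with a pair of singular points on them. Distinct points span one
  line; a repeated one lies on \<open>q\<close> lines.\<close>

lemma sum_pairs:
  assumes "A \<subseteq> hyp_points \<union> ell_points" "B \<subseteq> hyp_points \<union> ell_points"
  shows "(\<Sum>r\<in>UNIV. card {p\<in>A. det (Z (fst r) (snd r) p) = 0} * card {p\<in>B. det (Z (fst r) (snd r) p) = 0}) + card (A \<inter> B)
    = card A * card B + card (A \<inter> B) * CARD('a)"
proof -
  have fin: "finite A" "finite B" by simp_all
  have "(\<Sum>r\<in>UNIV. card {p\<in>A. det (Z (fst r) (snd r) p) = 0} * card {p\<in>B. det (Z (fst r) (snd r) p) = 0}) =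
    (\<Sum>r\<in>UNIV. card {pp\<in>A\<times>B. det (Z (fst r) (snd r) (fst pp)) = 0 \<and> det (Z (fst r) (snd r) (snd pp)) = 0})"
  proof (rule sum.cong[OF refl])
    fix r
    have "{pp\<in>A\<times>B. det (Z (fst r) (snd r) (fst pp)) = 0 \<and> det (Z (fst r) (snd r) (snd pp)) = 0} =
      {p\<in>A. det (Z (fst r) (snd r) p) = 0} \<times> {p\<in>B. det (Z (fst r) (snd r) p) = 0}" by auto
    then show "card {p\<in>A. det (Z (fst r) (snd r) p) = 0} * card {p\<in>B. det (Z (fst r) (snd r) p) = 0} =
      card {pp\<in>A\<times>B. det (Z (fst r) (snd r) (fst pp)) = 0 \<and> det (Z (fst r) (snd r) (snd pp)) = 0}"
      by (simp add: card_cartesian_product)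
  qed
  also have "\<dots> = (\<Sum>pp\<in>A\<times>B. card {r\<in>UNIV. det (Z (fst r) (snd r) (fst pp)) = 0 \<and> det (Z (fst r) (snd r) (snd pp)) = 0})"
    by (rule double_count) simp_all
  also have "\<dots> = (\<Sum>pp\<in>A\<times>B. if fst pp = snd pp then CARD('a) else 1)"
  proof (rule sum.cong[OF refl])
    fix pp assume "pp \<in> A \<times> B"
    then have "fst pp \<in> P1" "q2 (fst pp) \<noteq> 0" "snd pp \<in> P1" "q2 (snd pp) \<noteq> 0" using assms points_q2 by auto
    then show "card {r\<in>UNIV. det (Z (fst r) (snd r) (fst pp)) = 0 \<and> det (Z (fst r) (snd r) (snd pp)) = 0} = (if fst pp = snd pp then CARD('a) else 1)"
      using lines_through_point lines_through_points by auto
  qed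
  also have "\<dots> = card {pp\<in>A\<times>B. fst pp = snd pp} * CARD('a) + card {pp\<in>A\<times>B. fst pp \<noteq> snd pp}"
    by (simp add: sum.If_cases Int_def Compl_eq)
  finally have 1: "(\<Sum>r\<in>UNIV. card {p\<in>A. det (Z (fst r) (snd r) p) = 0} * card {p\<in>B. det (Z (fst r) (snd r) p) = 0}) =
     card {pp\<in>A\<times>B. fst pp = snd pp} * CARD('a) + card {pp\<in>A\<times>B. fst pp \<noteq> snd pp}" .
  have "{pp\<in>A\<times>B. fst pp = snd pp} = (\<lambda>p. (p,p)) ` (A \<inter> B)" by auto
  then have 2: "card {pp\<in>A\<times>B. fst pp = snd pp} = card (A \<inter> B)" by (simp add: card_image inj_on_def)
  have "A \<times> B = {pp\<in>A\<times>B. fst pp = snd pp} \<union> {pp\<in>A\<times>B. fst pp \<noteq> snd pp}" by auto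
  then have "card (A \<times> B) = card {pp\<in>A\<times>B. fst pp = snd pp} + card {pp\<in>A\<times>B. fst pp \<noteq> snd pp}"
    by (subst card_Un_disjoint[symmetric]) (auto intro: finite_subset[OF _ finite_cartesian_product[OF fin]])
  then show ?thesis using 1 2 by (simp add: card_cartesian_product)
qed

text \<open>Counting lines; incidences of lines with points; with pairs of points; and with points of
  tangency determines all the counts but one.\<close>

lemma sum_types:
  fixes g :: "line_type \<Rightarrow> nat"
  shows "(\<Sum>r\<in>UNIV. g (ltype (line r))) = (\<Sum>t\<in>generic_types. line_count t * g t)"
proof -
  have "(\<Sum>t\<in>generic_types. sum (\<lambda>r. g (ltype (line r))) {r\<in>UNIV. ltype (line r) = t}) = (\<Sum>r\<in>UNIV. g (ltype (line r)))"
    by (rule sum.group) (use line_profile(2) in \<open>auto simp: generic_types_def\<close>)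
  moreover have "sum (\<lambda>r. g (ltype (line r))) {r\<in>UNIV. ltype (line r) = t} = line_count t * g t" for t
    by (simp add: line_count_def del: mult_cancel1 mult_cancel2)
  ultimately show ?thesis by (simp only:)
qed

lemma count_outside: "t \<notin> generic_types \<Longrightarrow> line_count t = 0"
  using line_profile(2) by (auto simp: line_count_def)

text \<open>The numbers of hyperbolic, elliptic and tangent points in the standard profile.\<close>

definition nh where "nh t = fst (snd (standard_profile t))"
definition ne where "ne t = fst (snd (snd (standard_profile t)))"
definition nt where "nt t = snd (snd (snd (standard_profile t)))"

lemma profile_line:
  "card {p\<in>hyp_points. det (Z (fst r) (snd r) p) = 0} = nh (ltype (line r))"
  "card {p\<in>ell_points. det (Z (fst r) (snd r) p) = 0} = ne (ltype (line r))"
  "card {p\<in>hyp_points\<union>ell_points. tangent (line r) (Z (fst r) (snd r) p)} = nt (ltype (line r))"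
proof -
  have "{p\<in>P1. hyperbolic (Z (fst r) (snd r) p)} = {p\<in>hyp_points. det (Z (fst r) (snd r) p) = 0}"
    "{p\<in>P1. elliptic (Z (fst r) (snd r) p)} = {p\<in>ell_points. det (Z (fst r) (snd r) p) = 0}"
    using hyperbolic_Z elliptic_Z points_q2 by blast+
  moreover have "{p\<in>P1. tangent (line r) (Z (fst r) (snd r) p)} = {p\<in>hyp_points\<union>ell_points. tangent (line r) (Z (fst r) (snd r) p)}"
  proof -
    have "p \<in> hyp_points \<union> ell_points" if "p \<in> P1" "tangent (line r) (Z (fst r) (snd r) p)" for p
      using that det_Z_q2[OF that(1)] by (auto simp: tangent_def hyp_points_def ell_points_def)
    then show ?thesis using points_q2 by blast
  qed
  ultimately show "card {p\<in>hyp_points. det (Z (fst r) (snd r) p) = 0} = nh (ltype (line r))"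
    "card {p\<in>ell_points. det (Z (fst r) (snd r) p) = 0} = ne (ltype (line r))"
    "card {p\<in>hyp_points\<union>ell_points. tangent (line r) (Z (fst r) (snd r) p)} = nt (ltype (line r))"
    using line_profile(1)[of r, symmetric]
    unfolding profile_def pts_line[OF homog_simps(2)] pts_line[OF homog_simps(3)] pts_line[OF homog_tangent] nh_def ne_def nt_def
    by simp_all
qed

lemma count_equations:
  defines "h \<equiv> card hyp_points" and "n \<equiv> card ell_points" and "q \<equiv> CARD('a)"
  shows "q^2 = line_count o13_1 + line_count o13_2 + line_count o14_1 + line_count o14_2 + line_count o15_1 + line_count o15_2 + line_count o16 + line_count o17"
    "h * q = 2 * line_count o13_1 + line_count o13_2 + 3 * line_count o14_1 + line_count o14_2 + line_count o15_1 + line_count o16"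
    "n * q = line_count o13_2 + 2 * line_count o14_2 + line_count o15_2"
    "h + n = line_count o13_1 + line_count o13_2 + line_count o16"
    "h * n = line_count o13_2 + 2 * line_count o14_2"
    "4 * line_count o13_1 + line_count o13_2 + 9 * line_count o14_1 + line_count o14_2 + line_count o15_1 + line_count o16 + h = h * h + h * q"
    "line_count o13_2 + 4 * line_count o14_2 + line_count o15_2 + n = n * n + n * q"
proof -
  have T: "(\<Sum>t\<in>generic_types. line_count t * g t) = line_count o13_1 * g o13_1 + line_count o13_2 * g o13_2 + line_count o14_1 * g o14_1 + line_count o14_2 * g o14_2
    + line_count o15_1 * g o15_1 + line_count o15_2 * g o15_2 + line_count o16 * g o16 + line_count o17 * g o17" for g :: "line_type \<Rightarrow> nat"
    by (simp add: generic_types_def)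
  have sum1: "(\<Sum>r\<in>UNIV. card {p\<in>A. det (Z (fst r) (snd r) p) = 0}) = card A * q" if "A \<subseteq> hyp_points \<union> ell_points" for A
  proof -
    have "(\<Sum>r\<in>UNIV. card {p\<in>A. det (Z (fst r) (snd r) p) = 0}) = (\<Sum>p\<in>A. card {r\<in>UNIV. det (Z (fst r) (snd r) p) = 0})"
      by (rule double_count) simp_all
    also have "\<dots> = (\<Sum>p\<in>A. q)" using that points_q2 lines_through_point by (intro sum.cong) (auto simp: q_def)
    finally show ?thesis by simp
  qed
  have "(\<Sum>r\<in>(UNIV::('a\<times>'a) set). 1) = (\<Sum>t\<in>generic_types. line_count t * 1)" using sum_types[of "\<lambda>_. 1"] by simp
  then show "q^2 = line_count o13_1 + line_count o13_2 + line_count o14_1 + line_count o14_2 + line_count o15_1 + line_count o15_2 + line_count o16 + line_count o17"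
    unfolding T by (simp add: q_def power2_eq_square)
  have "h * q = (\<Sum>t\<in>generic_types. line_count t * nh t)" 
    using sum1[of hyp_points] unfolding profile_line sum_types h_def by simp
  then show "h * q = 2 * line_count o13_1 + line_count o13_2 + 3 * line_count o14_1 + line_count o14_2 + line_count o15_1 + line_count o16"
    unfolding T by (simp add: nh_def)
  have "n * q = (\<Sum>t\<in>generic_types. line_count t * ne t)" 
    using sum1[of ell_points] unfolding profile_line sum_types n_def by simp
  then show "n * q = line_count o13_2 + 2 * line_count o14_2 + line_count o15_2" unfolding T by (simp add: ne_def)
  have "(\<Sum>t\<in>generic_types. line_count t * nt t) = (\<Sum>r\<in>UNIV. card {p\<in>hyp_points\<union>ell_points. tangent (line r) (Z (fst r) (snd r) p)})"
    unfolding profile_line sum_types ..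
  also have "\<dots> = (\<Sum>p\<in>hyp_points\<union>ell_points. card {r\<in>UNIV. tangent (line r) (Z (fst r) (snd r) p)})"
    by (rule double_count) simp_all
  also have "\<dots> = (\<Sum>p\<in>hyp_points\<union>ell_points. 1)" using points_q2 tangents_through_point by (intro sum.cong) auto
  also have "\<dots> = h + n" unfolding h_def n_def using points_disjoint by (simp add: card_Un_disjoint)
  finally show "h + n = line_count o13_1 + line_count o13_2 + line_count o16" unfolding T by (simp add: nt_def)
  have "(\<Sum>t\<in>generic_types. line_count t * (nh t * ne t)) = h * n"
    using sum_pairs[of hyp_points ell_points] points_disjoint unfolding profile_line sum_types[of "\<lambda>t. nh t * ne t"] h_def n_def by simp
  then show "h * n = line_count o13_2 + 2 * line_count o14_2" unfolding T by (simp add: nh_def ne_def)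
  have "(\<Sum>t\<in>generic_types. line_count t * (nh t * nh t)) + h = h * h + h * q"
    using sum_pairs[of hyp_points hyp_points] unfolding profile_line sum_types[of "\<lambda>t. nh t * nh t"] h_def q_def by simp
  then show "4 * line_count o13_1 + line_count o13_2 + 9 * line_count o14_1 + line_count o14_2 + line_count o15_1 + line_count o16 + h = h * h + h * q"
    unfolding T by (simp add: nh_def)
  have "(\<Sum>t\<in>generic_types. line_count t * (ne t * ne t)) + n = n * n + n * q"
    using sum_pairs[of ell_points ell_points] unfolding profile_line sum_types[of "\<lambda>t. ne t * ne t"] n_def q_def by simp
  then show "line_count o13_2 + 4 * line_count o14_2 + line_count o15_2 + n = n * n + n * q" unfolding T by (simp add: ne_def)
qed

lemma count_o16:
  "line_count o16 = card {p. \<exists>k \<alpha> \<beta>. det (S (fst p) l m u v w) = k * \<alpha>^3 \<and> 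
    ddet (fst p) l m u v w (snd p) l' m' u' v' w' = 3 * k * \<alpha>^2 * \<beta> \<and>
    ddet (snd p) l' m' u' v' w' (fst p) l m u v w = 3 * k * \<alpha>*\<beta>^2 \<and> det (S (snd p) l' m' u' v' w') = k * \<beta>^3}"
proof -
  have "ltype (line p) = o16 \<longleftrightarrow> (\<exists>k \<alpha> \<beta>. det (S (fst p) l m u v w) = k * \<alpha>^3 \<and> 
    ddet (fst p) l m u v w (snd p) l' m' u' v' w' = 3 * k * \<alpha>^2 * \<beta> \<and>
    ddet (snd p) l' m' u' v' w' (fst p) l m u v w = 3 * k * \<alpha>*\<beta>^2 \<and> det (S (snd p) l' m' u' v' w') = k * \<beta>^3)" for p
    using o16_iff_cube[OF indep2_line] rank_one_line[of p] not_all_singular[of p] unfolding line_def line_xy_def by blast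
  then show ?thesis unfolding line_count_def by simp
qed

lemma dist_plane:
  "type_count plane t = line_count t + card {s. rank_one_type (l+s * l') (m+s * m') (u+s * u') (v+s * v') (w+s * w') = t} +
    (if rank_one_type l' m' u' v' w' = t then 1 else 0)"
  unfolding plane_def line_count_def line_def by (rule dist_corner) (use independent in blast)

end

section \<open>Counting squares\<close>

lemma card_pairs_fst: "card {p::'a::finite\<times>'b::finite. P (fst p)} = card {x. P x} * CARD('b)"
proof -
  have "{p::'a\<times>'b. P (fst p)} = {x. P x} \<times> UNIV" by auto
  then show ?thesis by (simp add: card_cartesian_product)
qed

lemma card_pairs: "card {p::'a::finite\<times>'b::finite. P (fst p) \<and> Q (snd p)} = card {x. P x} * card {y. Q y}"
proof -
  have "{p::'a\<times>'b. P (fst p) \<and> Q (snd p)} = {x. P x} \<times> {y. Q y}" by auto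
  then show ?thesis by (simp add: card_cartesian_product)
qed

context odd_field
begin

definition half :: nat where "half = card (squares::'a set)"

lemma CARD_half: "CARD('a) = 2 * half + 1"
  using card_squares[OF odd_card] by (simp add: half_def)

lemma card_square_class:
  "card {x::'a. x \<noteq> 0 \<and> is_square x} = half" "card {x::'a. \<not> is_square x} = half"
  "card {x::'a. is_square x} = half + 1"
  "card {x::'a. x \<noteq> 0} = 2 * half"
proof -
  show s: "card {x::'a. x \<noteq> 0 \<and> is_square x} = half" by (simp add: half_def squares_def)
  show n: "card {x::'a. \<not> is_square x} = half" using card_nonsquares[OF odd_card] by (simp add: half_def nonsquares_def)
  have "{x::'a. is_square x} = insert 0 {x::'a. x \<noteq> 0 \<and> is_square x}" by auto
  then show "card {x::'a. is_square x} = half + 1" using s by simp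
  have "{x::'a. x \<noteq> 0} = UNIV - {0}" by auto
  then show "card {x::'a. x \<noteq> 0} = 2 * half" by (simp add: CARD_half)
qed

lemma card_affine:
  assumes "k \<noteq> (0::'a)" shows "card {x. P (k * x + c)} = card {x. P x}"
proof (rule bij_betw_same_card[of "\<lambda>x. k * x + c"], rule bij_betwI[where g="\<lambda>y. (y - c) / k"])
qed (use assms in auto)

lemma card_uminus: "card {x::'a. P (- x)} = card {x. P x}"
  using card_affine[of "-1" P 0] by simp

lemma card_square_class_uminus:
  "card {x::'a. x \<noteq> 0 \<and> is_square (- x)} = half" "card {x::'a. \<not> is_square (- x)} = half"
  "card {x::'a. is_square (- x)} = half + 1"
  using card_uminus[of "\<lambda>x. x \<noteq> 0 \<and> is_square x"] card_uminus[of is_square] card_uminus[of "\<lambda>x. \<not> is_square x"]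
  by (simp_all add: card_square_class)

text \<open>Pairs are counted by a discriminant that is, for each value of the second entry, an affine
  function of the first.\<close>

lemma card_disc: "card {p::'a\<times>'a. P ((snd p)^2 + 4 * fst p)} = card {d. P d} * CARD('a)"
proof -
  have "card {p::'a\<times>'a. P ((snd p)^2 + 4 * fst p)} = card {p::'a\<times>'a. P (fst p)}"
  proof (rule bij_betw_same_card[of "\<lambda>p. ((snd p)^2 + 4 * fst p, snd p)"],
      rule bij_betwI[where g="\<lambda>p. ((fst p - (snd p)^2) / 4, snd p)"])
  qed (use four in \<open>auto simp: diff_divide_distrib\<close>)
  then show ?thesis by (simp add: card_pairs_fst)
qed

lemma card_quadratic:
  "card {t::'a. t^2 = x + t * y} = (if y^2 + 4 * x = 0 then 1 else if is_square (y^2 + 4 * x) then 2 else 0)"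
proof -
  have e: "t^2 = x + t * y \<longleftrightarrow> (2 * t + - y)^2 = y^2 + 4 * x" for t
  proof -
    have "(2 * t + - y)^2 - (y^2 + 4 * x) = 4 * (t^2 - (x + t * y))" by (simp add: power2_eq_square algebra_simps)
    then show ?thesis using four by (metis eq_iff_diff_eq_0 mult_eq_0_iff)
  qed
  show ?thesis unfolding e card_affine[OF two, of "\<lambda>z. z^2 = y^2 + 4 * x" "- y"] by (rule card_sqrts[OF two])
qed

text \<open>The conic \<open>s\<^sup>2 - u\<^sup>2 = c\<close> has \<open>q - 1\<close> affine points,
  parametrised by \<open>s + u\<close>. Sorting them by \<open>s\<close> counts the squares among the values
  \<open>s\<^sup>2 - c\<close>.\<close>

lemma card_norm_form:
  assumes "c \<noteq> (0::'a)"
  shows "card {s. s^2 \<noteq> c \<and> is_square (s^2 - c)} = (if is_square c then half - 1 else half)"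
    "card {s. \<not> is_square (s^2 - c)} = (if is_square c then half else half + 1)"
proof -
  have "card {p::'a\<times>'a. (fst p)^2 - (snd p)^2 = c} = card {x::'a. x \<noteq> 0}"
  proof (rule bij_betw_same_card[of "\<lambda>p. fst p + snd p"], rule bij_betwI[where g="\<lambda>x. ((x + c / x) / 2, (x - c / x) / 2)"])
    have f: "(a / 2 + b / 2)^2 - (a / 2 - b / 2)^2 = a * b" for a b :: 'a
    proof -
      have "(a / 2 + b / 2)^2 - (a / 2 - b / 2)^2 = a * b * (4 / (2 * 2))"
        by (simp add: power2_eq_square algebra_simps)
      then show ?thesis using four by simp
    qed
    show "(\<lambda>x. ((x + c / x) / 2, (x - c / x) / 2)) \<in> {x::'a. x \<noteq> 0} \<rightarrow> {p. (fst p)^2 - (snd p)^2 = c}"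
    proof (intro funcsetI)
      fix x :: 'a assume "x \<in> {x. x \<noteq> 0}"
      then show "((x + c / x) / 2, (x - c / x) / 2) \<in> {p. (fst p)^2 - (snd p)^2 = c}"
        using f[of x "c / x"] by (simp add: add_divide_distrib diff_divide_distrib)
    qed
    show "(\<lambda>p. fst p + snd p) \<in> {p. (fst p)^2 - (snd p)^2 = c} \<rightarrow> {x::'a. x \<noteq> 0}"
    proof (intro funcsetI)
      fix p :: "'a \<times> 'a" assume p: "p \<in> {p. (fst p)^2 - (snd p)^2 = c}"
      have "(fst p + snd p) * (fst p - snd p) = c" using p by (simp add: power2_eq_square algebra_simps)
      then show "fst p + snd p \<in> {x. x \<noteq> 0}" using assms by auto
    qed
  next
    fix p assume p: "p \<in> {p. (fst p)^2 - (snd p)^2 = c}"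
    then have m: "(fst p + snd p) * (fst p - snd p) = c" by (simp add: power2_eq_square algebra_simps)
    then have "fst p + snd p \<noteq> 0" using assms by auto
    then have "c / (fst p + snd p) = fst p - snd p" using m by (simp add: field_simps)
    then show "((fst p + snd p + c / (fst p + snd p)) / 2, (fst p + snd p - c / (fst p + snd p)) / 2) = p"
      using two by (simp add: prod_eq_iff)
  qed (use assms in \<open>auto simp: power2_eq_square eq_neg_iff_add_eq_0 simp flip: add_divide_distrib diff_divide_distrib\<close>)
  then have tot: "card {p::'a\<times>'a. (fst p)^2 - (snd p)^2 = c} = 2 * half" by (simp add: card_square_class)
  have "{p::'a\<times>'a. (fst p)^2 - (snd p)^2 = c} = Sigma UNIV (\<lambda>s. {u. u^2 = s^2 - c})" by (auto simp: algebra_simps)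
  then have "card {p::'a\<times>'a. (fst p)^2 - (snd p)^2 = c} = (\<Sum>s\<in>UNIV. card {u. u^2 = s^2 - c})" by simp
  also have "\<dots> = (\<Sum>s\<in>UNIV. (if s^2 = c then 1 else 0) + 2 * (if s^2 \<noteq> c \<and> is_square (s^2 - c) then 1 else 0))"
    by (intro sum.cong refl) (simp add: card_sqrts[OF two])
  also have "\<dots> = card {s. s^2 = c} + 2 * card {s. s^2 \<noteq> c \<and> is_square (s^2 - c)}"
    by (simp add: sum.distrib sum.If_cases sum_distrib_left[symmetric] Int_def)
  finally have a: "card {s. s^2 = c} + 2 * card {s. s^2 \<noteq> c \<and> is_square (s^2 - c)} = 2 * half" using tot by simp
  have z: "card {s. s^2 = c} = (if is_square c then 2 else 0)" using card_sqrts[OF two, of c] assms by simp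
  show A: "card {s. s^2 \<noteq> c \<and> is_square (s^2 - c)} = (if is_square c then half - 1 else half)"
    using a unfolding z by (auto split: if_splits)
  have "(UNIV::'a set) = {s. s^2 = c} \<union> {s. s^2 \<noteq> c \<and> is_square (s^2 - c)} \<union> {s. \<not> is_square (s^2 - c)}" by auto
  then have "CARD('a) = card ({s. s^2 = c} \<union> {s. s^2 \<noteq> c \<and> is_square (s^2 - c)} \<union> {s. \<not> is_square (s^2 - c)})" by simp
  also have "\<dots> = card {s. s^2 = c} + card {s. s^2 \<noteq> c \<and> is_square (s^2 - c)} + card {s. \<not> is_square (s^2 - c)}"
    by (subst card_Un_disjoint, simp, simp, force)+ simp
  finally show "card {s. \<not> is_square (s^2 - c)} = (if is_square c then half else half + 1)"
    using a unfolding z CARD_half by (auto split: if_splits)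
qed

lemma not_all_singularI:
  assumes "det (S (s * a + t * a') (s * b + t * b') (s * c + t * c') (s * d + t * d') (s * e + t * e') (s * f + t * f')) \<noteq> 0"
  shows "\<not> all_singular (span2 (S a b c d e f) (S a' b' c' d' e' (f'::'a)))"
  using all_singular_SD assms by blast

text \<open>The quadratic character.\<close>

definition chi :: "'a \<Rightarrow> int" where "chi x = (if x = 0 then 0 else if is_square x then 1 else -1)"

lemma chi_simps: "chi x = 0 \<longleftrightarrow> x = 0" "chi x = 1 \<longleftrightarrow> x \<noteq> 0 \<and> is_square x" "chi x = -1 \<longleftrightarrow> \<not> is_square x"
  by (auto simp: chi_def)

lemma card_chi: "card {x. G (chi x)} = (if G 0 then 1 else 0) + (if G 1 then half else 0) + (if G (-1) then half else 0)"
proof -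
  have "{x. G (chi x)} = {x. x = 0 \<and> G 0} \<union> {x. (x \<noteq> 0 \<and> is_square x) \<and> G 1} \<union> {x. \<not> is_square x \<and> G (-1)}"
    by (auto simp: chi_def)
  also have "card \<dots> = card {x::'a. x = 0 \<and> G 0} + card {x::'a. (x \<noteq> 0 \<and> is_square x) \<and> G 1} + card {x::'a. \<not> is_square x \<and> G (-1)}"
    by (subst card_Un_disjoint, simp, simp, force)+ simp
  finally show ?thesis using card_square_class by simp
qed

lemma card_chi_uminus: "card {x. G (chi (- x))} = card {x. G (chi x)}"
  by (rule card_uminus)

lemma card_chi_disc: "card {p. G (chi ((snd p)^2 + 4 * fst p))} = card {x. G (chi x)} * CARD('a)"
  by (rule card_disc)

lemma card_chi_pair: "card {p. G (chi (fst p)) (chi (snd p))} =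
  (if G 0 0 then 1 else 0) + (if G 0 1 then half else 0) + (if G 0 (-1) then half else 0) +
  (if G 1 0 then half else 0) + (if G 1 1 then half * half else 0) + (if G 1 (-1) then half * half else 0) +
  (if G (-1) 0 then half else 0) + (if G (-1) 1 then half * half else 0) + (if G (-1) (-1) then half * half else 0)"
proof -
  have "{p::'a\<times>'a. G (chi (fst p)) (chi (snd p))} = Sigma UNIV (\<lambda>x. {y. G (chi x) (chi y)})" by auto
  then have "card {p. G (chi (fst p)) (chi (snd p))} = (\<Sum>x\<in>UNIV. card {y. G (chi x) (chi y)})" by simp
  also have "\<dots> = (\<Sum>x\<in>{0} \<union> (squares \<union> nonsquares). card {y. G (chi x) (chi y)})" unfolding UNIV_squares[symmetric] ..
  also have "\<dots> = (\<Sum>x\<in>{0}. card {y. G (chi x) (chi y)}) + ((\<Sum>x\<in>squares. card {y. G (chi x) (chi y)}) + (\<Sum>x\<in>nonsquares. card {y. G (chi x) (chi y)}))"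
    by (subst sum.union_disjoint; (subst sum.union_disjoint)?) (auto simp: squares_def nonsquares_def)
  also have "(\<Sum>x\<in>squares. card {y. G (chi x) (chi y)}) = (\<Sum>x\<in>(squares::'a set). card {y. G 1 (chi y)})"
    by (intro sum.cong) (auto simp: squares_def chi_def)
  also have "(\<Sum>x\<in>nonsquares. card {y. G (chi x) (chi y)}) = (\<Sum>x\<in>(nonsquares::'a set). card {y. G (-1) (chi y)})"
    by (intro sum.cong) (auto simp: nonsquares_def chi_def)
  finally show ?thesis
    using card_chi[of "G 0"] card_chi[of "G 1"] card_chi[of "G (-1)"] card_nonsquares[OF odd_card] half_def
    by (simp add: chi_def[of 0] distrib_left)
qed

lemma card_chi_pair_uminus: "card {p. G (chi (- fst p)) (chi (- snd p))} = card {p. G (chi (fst p)) (chi (snd p))}"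
proof (rule bij_betw_same_card[of "\<lambda>p. (- fst p, - snd p)"], rule bij_betwI[where g="\<lambda>p. (- fst p, - snd p)"])
qed auto

lemma card_ratio: "card {p::'a\<times>'a. snd p \<noteq> 0 \<and> P (fst p / snd p)} = card {s. P s} * (2 * half)"
proof -
  have "card {p::'a\<times>'a. snd p \<noteq> 0 \<and> P (fst p / snd p)} = card {p::'a\<times>'a. P (fst p) \<and> snd p \<noteq> 0}"
  proof (rule bij_betw_same_card[of "\<lambda>p. (fst p / snd p, snd p)"], rule bij_betwI[where g="\<lambda>p. (fst p * snd p, snd p)"])
  qed auto
  then show ?thesis using card_pairs[of P "\<lambda>y::'a. y \<noteq> 0"] by (simp add: card_square_class)
qed

text \<open>Monic quadratics with two distinct roots correspond to unordered pairs.\<close>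

lemma card_unordered:
  assumes sym: "\<And>m n. P m n \<Longrightarrow> P n m"
  shows "2 * card {p::'a\<times>'a. \<exists>m n. m \<noteq> n \<and> P m n \<and> fst p = m + n \<and> snd p = m * n} = card {p. fst p \<noteq> snd p \<and> P (fst p) (snd p)}"
proof -
  define B where "B = {p::'a\<times>'a. fst p \<noteq> snd p \<and> P (fst p) (snd p)}"
  define f where "f p = (fst p + snd p, fst p * snd p)" for p :: "'a\<times>'a"
  have im: "{p::'a\<times>'a. \<exists>m n. m \<noteq> n \<and> P m n \<and> fst p = m + n \<and> snd p = m * n} = f ` B"
    unfolding B_def f_def by (force simp: image_iff)
  have "card B = (\<Sum>y\<in>f ` B. card {p\<in>B. f p = y})"
    using sum.image_gen[of B "\<lambda>_. 1::nat" f] by simp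
  also have "\<dots> = (\<Sum>y\<in>f ` B. 2)"
  proof (rule sum.cong[OF refl])
    fix y assume "y \<in> f ` B"
    then obtain m n where mn: "m \<noteq> n" "P m n" "y = (m + n, m * n)" by (auto simp: B_def f_def)
    have "{p\<in>B. f p = y} = {(m,n), (n,m)}"
    proof (intro Set.set_eqI iffI)
      fix p assume "p \<in> {p\<in>B. f p = y}"
      then have s: "fst p + snd p = m + n" and q: "fst p * snd p = m * n" unfolding mn f_def by auto
      have "(fst p - m) * (fst p - n) = fst p * (fst p + snd p - (m + n)) - (fst p * snd p - m * n)" by (simp add: algebra_simps)
      then have "fst p = m \<or> fst p = n" unfolding s q by simp
      then show "p \<in> {(m,n), (n,m)}" using s by (auto simp: prod_eq_iff)
    next
      fix p assume "p \<in> {(m,n), (n,m)}"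
      then show "p \<in> {p\<in>B. f p = y}" using mn sym[OF mn(2)] by (auto simp: B_def f_def add.commute mult.commute)
    qed
    then show "card {p\<in>B. f p = y} = 2" using mn(1) by simp
  qed
  finally show ?thesis unfolding im B_def[symmetric] by simp
qed

lemma tangent_pos:
  assumes i: "indep2 (S a b c d e f) (S a' b' c' d' e' (f'::'a))"
    and t: "tangent (span2 (S a b c d e f) (S a' b' c' d' e' f')) (S a b c d e f)"
  shows "pts (tangent (span2 (S a b c d e f) (S a' b' c' d' e' f'))) (span2 (S a b c d e f) (S a' b' c' d' e' f')) \<noteq> 0"
proof -
  let ?T = "{r. tangent (span2 (S a b c d e f) (S a' b' c' d' e' f')) (S (a + r * a') (b + r * b') (c + r * c') (d + r * d') (e + r * e') (f + r * f'))}"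
  have "0 \<in> ?T" by (simp only: mem_Collect_eq mult_zero_left add_0_right t)
  then have "card ?T \<noteq> 0" using card_0_eq[OF finite, of ?T] by blast
  then show ?thesis unfolding pts_S[OF i homog_tangent] add_is_0 by blast
qed

end

section \<open>Reducible planes\<close>

context odd_field
begin

lemma if_type_eq: "(if c then a else b) = (t::line_type) \<longleftrightarrow> c \<and> a = t \<or> \<not> c \<and> b = t" by simp

lemmas point_simps = rank_one_S hyperbolic_S elliptic_S det_zero_S

lemma card_two: "a \<noteq> b \<Longrightarrow> card {t::'b. (t = a \<or> t = b) \<and> P t} = (if P a then 1 else 0) + (if P b then 1 else 0)"
proof -
  assume "a \<noteq> b"
  moreover have "{t. (t = a \<or> t = b) \<and> P t} = {t. t = a \<and> P a} \<union> {t. t = b \<and> P b}" by auto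
  ultimately show ?thesis by (simp add: Collect_conv_if)
qed

lemma half_pos: "half > 0"
proof -
  have "1 \<in> {x::'a. x \<noteq> 0 \<and> is_square x}" by simp
  then have "card {x::'a. x \<noteq> 0 \<and> is_square x} > 0" by (metis card_gt_0_iff empty_iff finite)
  then show ?thesis by (simp add: card_square_class)
qed

lemmas table_simps = table_def table_entries_def Let_def CARD_half

lemma is_square_quotient: "x \<noteq> 0 \<Longrightarrow> y \<noteq> 0 \<Longrightarrow> is_square (x / y) \<longleftrightarrow> is_square (x * (y::'a))"
proof -
  assume "x \<noteq> 0" "y \<noteq> 0"
  moreover have "x * y = (x / y) * y^2" using \<open>y \<noteq> 0\<close> by (simp add: power2_eq_square)
  moreover have "is_square (y^2)" by simp
  ultimately show ?thesis using is_square_mult_iff[OF odd_card, of "x / y" "y^2"] by simp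
qed

text \<open>For each representative the type of the line \<open>(x, y)\<close> follows from its singular
  points, the point \<open>t\<close> being the first basis matrix plus \<open>t\<close> times the
  second.\<close>

lemma ltype_Sigma1:
  fixes x y :: 'a
  shows "ltype (span2 (S x 0 0 1 0 0) (S y 1 0 0 0 0)) =
    (if chi (y^2 + 4 * x) = 0 then o6 else if chi (y^2 + 4 * x) = 1 then o5 else o10)"
proof -
  let ?L = "span2 (S x 0 0 1 0 0) (S y 1 0 0 0 0)"
  have i: "indep2 (S x 0 0 1 0 0) (S y 1 0 0 0 0)" by (simp add: indep2_S)
  have "pts rank_one ?L = card {t. t^2 = x + t * y}" by (simp add: pts_S_simps(1)[OF i] rank_one_S)
  moreover have "all_singular ?L" by (simp add: all_singular_S det_S)
  moreover have "common_kernel ?L" unfolding common_kernel_S by (intro exI[of _ 0] exI[of _ 0] exI[of _ 1]) simp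
  ultimately show ?thesis by (simp add: card_quadratic ltype_def Let_def chi_simps)
qed

lemma dist_Sigma1:
  "rat_of_nat (type_count (span3 (S 1 0 0 0 0 0) (S 0 0 0 1 0 0) (S 0 1 0 0 0 (0::'a))) t) = table Sigma1 CARD('a) t"
proof -
  define G where "G c \<longleftrightarrow> (if c = 0 then o6 else if c = 1 then o5 else o10) = t" for c :: int
  have d: "type_count (span3 (S 1 0 0 0 0 0) (S 0 0 0 1 0 0) (S 0 1 0 0 0 (0::'a))) t =
    card {p. G (chi ((snd p)^2 + 4 * fst p))} +
    card {s::'a. o5 = t} + (if o6 = t then 1 else 0)"
    by (subst dist_corner) (simp_all add: line_xy_def ltype_Sigma1 rank_one_type_def G_def)
  show ?thesis unfolding d card_chi_disc[of G] card_chi[of G]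
    by (cases t) (simp_all add: G_def table_simps field_simps)
qed

lemma ltype_Sigma2:
  fixes x y :: 'a
  shows "ltype (span2 (S x 0 0 1 0 0) (S y 0 0 0 0 1)) =
    (if chi (- x) = 0 then (if chi (- y) = 0 then o5 else if chi (- y) = 1 then o8_1 else o8_2)
     else if chi (- y) = 0 then (if chi (- x) = 1 then o8_1 else o8_2)
     else if chi (- x) = 1 \<and> chi (- y) = 1 then o14_1 else o14_2)"
proof -
  let ?L = "span2 (S x 0 0 1 0 0) (S y 0 0 0 0 1)"
  have i: "indep2 (S x 0 0 1 0 0) (S y 0 0 0 0 1)" by (simp add: indep2_S)
  have ns: "\<not> all_singular ?L" if h: "x \<noteq> 0 \<or> y \<noteq> 0"
  proof
    assume a: "all_singular ?L"
    have p: "x + y = 0" using all_singular_SD[OF a, of 1 1] by (simp add: det_S)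
    have m: "x - y = 0" using all_singular_SD[OF a, of 1 "-1"] by (simp add: det_S)
    have "2 * x = (x + y) + (x - y)" by simp
    then have "x = 0" unfolding p m using two by simp
    then show False using p h by simp
  qed
  have r: "rank_one (S (x + t * y) 0 0 1 0 t) \<longleftrightarrow> t = 0 \<and> x = 0" "rank_one (S y 0 0 0 0 1) \<longleftrightarrow> y = 0" for t by (auto simp: rank_one_S)
  have h2: "hyperbolic (S y 0 0 0 0 1) \<longleftrightarrow> y \<noteq> 0 \<and> is_square (- y)" "elliptic (S y 0 0 0 0 1) \<longleftrightarrow> \<not> is_square (- y)"
    unfolding hyperbolic_S elliptic_S r by (auto simp: det_zero_S)
  have h1: "hyperbolic (S (x + t * y) 0 0 1 0 t) \<longleftrightarrow> ((x + t * y) * t = 0 \<and> \<not> (t = 0 \<and> x = 0)) \<and> is_square (- (x + t * y)) \<and> is_square (- t)"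
    "elliptic (S (x + t * y) 0 0 1 0 t) \<longleftrightarrow> ((x + t * y) * t = 0 \<and> \<not> (t = 0 \<and> x = 0)) \<and> \<not> (is_square (- (x + t * y)) \<and> is_square (- t))" for t
    unfolding hyperbolic_S elliptic_S r by (auto simp: det_zero_S)
  have P: "pts rank_one ?L = card {t::'a. t = 0 \<and> x = 0} + (if y = 0 then 1 else 0)"
    "pts hyperbolic ?L = card {t. ((x + t * y) * t = 0 \<and> \<not> (t = 0 \<and> x = 0)) \<and> is_square (- (x + t * y)) \<and> is_square (- t)} + (if y \<noteq> 0 \<and> is_square (- y) then 1 else 0)"
    "pts elliptic ?L = card {t. ((x + t * y) * t = 0 \<and> \<not> (t = 0 \<and> x = 0)) \<and> \<not> (is_square (- (x + t * y)) \<and> is_square (- t))} + (if \<not> is_square (- y) then 1 else 0)"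
    unfolding pts_S_simps[OF i] mult_zero_right add_0_left add_0_right mult_1_right r h1 h2 by (rule refl)+
  consider "x = 0" "y = 0" | "x = 0" "y \<noteq> 0" | "x \<noteq> 0" "y = 0" | "x \<noteq> 0" "y \<noteq> 0" by blast
  then show ?thesis
  proof cases
    case 1
    have "pts rank_one ?L = 2" unfolding P using 1 by simp
    then show ?thesis using 1 by (simp add: ltype_def chi_simps)
  next
    case 2
    have e: "((x + t * y) * t = 0 \<and> \<not> (t = 0 \<and> x = 0)) = False" for t using 2 by auto
    have "pts rank_one ?L = 1" "pts hyperbolic ?L = (if is_square (- y) then 1 else 0)" "pts elliptic ?L = (if is_square (- y) then 0 else 1)"
      unfolding P e using 2 by simp_all
    then show ?thesis using ns 2 by (simp add: ltype_def Let_def chi_simps)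
  next
    case 3
    have e: "((x + t * y) * t = 0 \<and> \<not> (t = 0 \<and> x = 0)) \<longleftrightarrow> t = 0" for t using 3 by auto
    have "pts rank_one ?L = 1" "pts hyperbolic ?L = (if is_square (- x) then 1 else 0)" "pts elliptic ?L = (if is_square (- x) then 0 else 1)"
      unfolding P e using 3 by (simp_all add: Collect_conv_if)
    then show ?thesis using ns 3 by (simp add: ltype_def Let_def chi_simps)
  next
    case 4
    have e: "((x + t * y) * t = 0 \<and> \<not> (t = 0 \<and> x = 0)) \<longleftrightarrow> (t = 0 \<or> t = - x / y)" for t 
      using 4 linear_root_iff[of y t x] by (auto simp: add.commute)
    have ne: "0 \<noteq> - x / y" "x + (- x / y) * y = 0" "- (- x / y) = x / y" using 4 by auto
    have q: "is_square (x / y) \<longleftrightarrow> (is_square (- x) \<longleftrightarrow> is_square (- y))"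
      using is_square_quotient[of x y] is_square_mult_iff[OF odd_card, of "- x" "- y"] 4 by simp
    have z: "(if is_square (- (x + 0 * y)) \<and> is_square (- 0 :: 'a) then 1 else 0) = (if is_square (- x) then 1 else (0::nat))"
      "(if \<not> (is_square (- (x + 0 * y)) \<and> is_square (- 0 :: 'a)) then 1 else 0) = (if is_square (- x) then 0 else (1::nat))"
      "(if is_square (- 0 :: 'a) \<and> is_square (x / y) then 1 else 0) = (if is_square (- x) \<longleftrightarrow> is_square (- y) then 1 else (0::nat))"
      "(if \<not> (is_square (- 0 :: 'a) \<and> is_square (x / y)) then 1 else 0) = (if is_square (- x) \<longleftrightarrow> is_square (- y) then 0 else (1::nat))"
      using q by simp_all
    have n: "pts rank_one ?L = 0" 
       "pts hyperbolic ?L = (if is_square (- x) then 1 else 0) + (if is_square (- x) \<longleftrightarrow> is_square (- y) then 1 else 0) + (if y \<noteq> 0 \<and> is_square (- y) then 1 else 0)"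
       "pts elliptic ?L = (if is_square (- x) then 0 else 1) + (if is_square (- x) \<longleftrightarrow> is_square (- y) then 0 else 1) + (if \<not> is_square (- y) then 1 else 0)"
      unfolding P e card_two[OF ne(1)] ne(2,3) z using 4 by simp_all
    show ?thesis using ns n 4 by (simp add: ltype_def Let_def chi_simps)
  qed
qed

lemma dist_Sigma2:
  "rat_of_nat (type_count (span3 (S 1 0 0 0 0 0) (S 0 0 0 1 0 0) (S 0 0 0 0 0 (1::'a))) t) = table Sigma2 CARD('a) t"
proof -
  define G where "G c d \<longleftrightarrow> (if c = 0 then (if d = 0 then o5 else if d = 1 then o8_1 else o8_2)
     else if d = 0 then (if c = 1 then o8_1 else o8_2) else if c = 1 \<and> d = 1 then o14_1 else o14_2) = t" for c d :: int
  define H where "H c \<longleftrightarrow> (if c = 0 then o5 else if c = 1 then o8_1 else o8_2) = t" for c :: int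
  have d: "type_count (span3 (S 1 0 0 0 0 0) (S 0 0 0 1 0 0) (S 0 0 0 0 0 (1::'a))) t =
    card {p. G (chi (- fst p)) (chi (- snd p))} +
    card {s. H (chi (- s))} + (if o5 = t then 1 else 0)"
    by (subst dist_corner) (simp_all add: line_xy_def ltype_Sigma2 rank_one_type_def chi_simps G_def H_def conj_comms)
  show ?thesis unfolding d card_chi_pair_uminus[of G] card_chi_pair[of G] card_chi_uminus[of H] card_chi[of H]
    by (cases t) (simp_all add: G_def H_def table_simps field_simps power2_eq_square)
qed

lemma ltype_Sigma3:
  fixes x y :: 'a
  shows "ltype (span2 (S x 0 0 1 0 0) (S y 0 1 0 0 0)) = (if chi (- x) = 0 then o8_1 else if chi (- x) = 1 then o13_1 else o13_2)"
proof -
  let ?L = "span2 (S x 0 0 1 0 0) (S y 0 1 0 0 0)"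
  have i: "indep2 (S x 0 0 1 0 0) (S y 0 1 0 0 0)" by (simp add: indep2_S)
  have ns: "\<not> all_singular ?L" by (intro not_all_singularI[where s=1 and t=1]) (simp add: det_zero_S)
  have r: "rank_one (S (x + t * y) 0 t 1 0 0) \<longleftrightarrow> t = 0 \<and> x = 0" "rank_one (S y 0 1 0 0 0) \<longleftrightarrow> False" for t by (auto simp: rank_one_S)
  have h2: "hyperbolic (S y 0 1 0 0 0) \<longleftrightarrow> True" "elliptic (S y 0 1 0 0 0) \<longleftrightarrow> False"
    unfolding hyperbolic_S elliptic_S r by (auto simp: det_zero_S)
  have h1: "hyperbolic (S (x + t * y) 0 t 1 0 0) \<longleftrightarrow> t = 0 \<and> x \<noteq> 0 \<and> is_square (- x)"
    "elliptic (S (x + t * y) 0 t 1 0 0) \<longleftrightarrow> t = 0 \<and> x \<noteq> 0 \<and> \<not> is_square (- x)" for t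
    unfolding hyperbolic_S elliptic_S r by (auto simp: det_zero_S)
  have "pts rank_one ?L = card {t::'a. t = 0 \<and> x = 0} + (if False then 1 else 0)"
    "pts hyperbolic ?L = card {t::'a. t = 0 \<and> x \<noteq> 0 \<and> is_square (- x)} + (if True then 1 else 0)"
    "pts elliptic ?L = card {t::'a. t = 0 \<and> x \<noteq> 0 \<and> \<not> is_square (- x)} + (if False then 1 else 0)"
    unfolding pts_S_simps[OF i] mult_zero_right add_0_left add_0_right mult_1_right r h1 h2 by (rule refl)+
  then show ?thesis using ns by (cases "x = 0") (simp_all add: ltype_def Let_def chi_simps Collect_conv_if)
qed

lemma dist_Sigma3:
  "rat_of_nat (type_count (span3 (S 1 0 0 0 0 0) (S 0 0 0 1 0 0) (S 0 0 1 0 0 (0::'a))) t) = table Sigma3 CARD('a) t"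
proof -
  define G where "G c \<longleftrightarrow> (if c = 0 then o8_1 else if c = 1 then o13_1 else o13_2) = t" for c :: int
  define H where "H c \<longleftrightarrow> (if c = 0 then o5 else o9) = t" for c :: int
  have d: "type_count (span3 (S 1 0 0 0 0 0) (S 0 0 0 1 0 0) (S 0 0 1 0 0 (0::'a))) t =
    card {p::'a\<times>'a. G (chi (- fst p))} +
    card {s. H (chi s)} + (if o6 = t then 1 else 0)"
    by (subst dist_corner) (simp_all add: line_xy_def ltype_Sigma3 rank_one_type_def chi_simps G_def H_def conj_comms)
  show ?thesis unfolding d card_pairs_fst[of "\<lambda>x. G (chi (- x))"] card_chi_uminus[of G] card_chi[of G] card_chi[of H]
    by (cases t) (simp_all add: G_def H_def table_simps field_simps power2_eq_square)
qed

lemma ltype_Sigma4: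
  fixes x y :: 'a
  shows "ltype (span2 (S x 0 0 1 0 0) (S y 0 1 0 1 0)) =
    (if x = 0 then o8_1 else if x = -1 then (if y = 0 then o12 else o16) else if is_square (- x) then o13_1 else o13_2)"
proof -
  let ?L = "span2 (S x 0 0 1 0 0) (S y 0 1 0 1 0)"
  have i: "indep2 (S x 0 0 1 0 0) (S y 0 1 0 1 0)" by (simp add: indep2_S)
  have ns: "\<not> all_singular ?L" if h: "x \<noteq> -1 \<or> y \<noteq> 0"
  proof
    assume a: "all_singular ?L"
    have p: "x + y + 1 = 0" using all_singular_SD[OF a, of 1 1] by (simp add: det_zero_S)
    have m: "x - y + 1 = 0" using all_singular_SD[OF a, of 1 "-1"] by (simp add: det_zero_S)
    have "2 * y = (x + y + 1) - (x - y + 1)" by simp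
    then have "y = 0" unfolding p m using two by simp
    then show False using p h by (simp add: eq_neg_iff_add_eq_0)
  qed
  have r: "rank_one (S (x + t * y) 0 t 1 t 0) \<longleftrightarrow> t = 0 \<and> x = 0" "rank_one (S y 0 1 0 1 0) \<longleftrightarrow> False" for t by (auto simp: rank_one_S)
  have d: "a * t^2 + t^2 = 0 \<longleftrightarrow> t = 0 \<or> a = -1" for a t :: 'a
  proof -
    have "a * t^2 + t^2 = t^2 * (a + 1)" by (simp add: algebra_simps)
    then show ?thesis by (simp add: eq_neg_iff_add_eq_0)
  qed
  have h2: "hyperbolic (S y 0 1 0 1 0) \<longleftrightarrow> y = 0" "elliptic (S y 0 1 0 1 0) \<longleftrightarrow> False"
    unfolding hyperbolic_S elliptic_S r by (auto simp: det_zero_S)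
  have h0: "hyperbolic (S a 0 t 1 t 0) \<longleftrightarrow> (t = 0 \<and> a \<noteq> 0 \<and> is_square (- a)) \<or> (t \<noteq> 0 \<and> a = -1)"
    "elliptic (S a 0 t 1 t 0) \<longleftrightarrow> t = 0 \<and> a \<noteq> 0 \<and> \<not> is_square (- a)" for a t :: 'a
    unfolding hyperbolic_S elliptic_S using d[of a t] by (auto simp: det_zero_S rank_one_S eq_commute[of 0])
  have h1: "hyperbolic (S (x + t * y) 0 t 1 t 0) \<longleftrightarrow> (t = 0 \<and> x \<noteq> 0 \<and> is_square (- x)) \<or> (t \<noteq> 0 \<and> x + t * y = -1)"
    "elliptic (S (x + t * y) 0 t 1 t 0) \<longleftrightarrow> t = 0 \<and> x \<noteq> 0 \<and> \<not> is_square (- x)" for t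
    unfolding h0 by (cases "t = 0"; simp)+
  have P: "pts rank_one ?L = card {t::'a. t = 0 \<and> x = 0} + (if False then 1 else 0)"
    "pts hyperbolic ?L = card {t. (t = 0 \<and> x \<noteq> 0 \<and> is_square (- x)) \<or> (t \<noteq> 0 \<and> x + t * y = -1)} + (if y = 0 then 1 else 0)"
    "pts elliptic ?L = card {t::'a. t = 0 \<and> x \<noteq> 0 \<and> \<not> is_square (- x)} + (if False then 1 else 0)"
    unfolding pts_S_simps[OF i] mult_zero_right add_0_left add_0_right mult_1_right r h1 h2 by (rule refl)+
  have H: "pts hyperbolic ?L = (if x \<noteq> 0 \<and> is_square (- x) then 1 else 0) + (if x = -1 then 0 else 1)" if h: "x \<noteq> -1 \<or> y \<noteq> 0"
  proof (cases "y = 0")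
    case True
    then show ?thesis unfolding P using h by (simp add: Collect_conv_if)
  next
    case False
    have e: "x + t * y = -1 \<longleftrightarrow> t = - (x + 1) / y" for t 
      using linear_root_iff[OF False, of t "x + 1"] by (simp add: eq_neg_iff_add_eq_0 add_ac)
    show ?thesis
    proof (cases "x = -1")
      case True
      then show ?thesis unfolding P e using False by (simp add: Collect_conv_if)
    next
      case x: False
      then have ne: "0 \<noteq> - (x + 1) / y" using False by (metis divide_eq_0_iff neg_equal_0_iff_equal eq_neg_iff_add_eq_0)
      have "{t. (t = 0 \<and> x \<noteq> 0 \<and> is_square (- x)) \<or> (t \<noteq> 0 \<and> t = - (x + 1) / y)} =
        {t. (t = 0 \<or> t = - (x + 1) / y) \<and> (t = 0 \<longrightarrow> x \<noteq> 0 \<and> is_square (- x))}" using ne by auto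
      then show ?thesis unfolding P e using card_two[OF ne, of "\<lambda>t. t = 0 \<longrightarrow> x \<noteq> 0 \<and> is_square (- x)"] ne x False by simp
    qed
  qed
  consider "x = -1" "y = 0" | "x = -1" "y \<noteq> 0" | "x \<noteq> -1" by blast
  then show ?thesis
  proof cases
    case 1
    have "all_singular ?L" unfolding 1 all_singular_S by (simp add: det_S algebra_simps)
    moreover have "\<not> common_kernel ?L" unfolding 1 common_kernel_S by (auto simp: eq_neg_iff_add_eq_0)
    ultimately show ?thesis using P(1) 1 by (simp add: ltype_def)
  next
    case 2
    have "tangent ?L (S x 0 0 1 0 0)" unfolding tangent_S using r(1)[of 0] 2 by (simp add: det_zero_S ddet_def)
    then have "pts (tangent ?L) ?L \<noteq> 0" by (rule tangent_pos[OF i])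
    then show ?thesis using ns H P(1,3) 2 by (simp add: ltype_def Let_def)
  next
    case 3
    then show ?thesis using ns H P(1,3) by (cases "x = 0") (simp_all add: ltype_def Let_def Collect_conv_if)
  qed
qed

lemma dist_Sigma4:
  "rat_of_nat (type_count (span3 (S 1 0 0 0 0 0) (S 0 0 0 1 0 0) (S 0 0 1 0 1 (0::'a))) t) = table Sigma4 CARD('a) t"
proof -
  define H where "H c \<longleftrightarrow> (if c = 0 then o5 else o8_1) = t" for c :: int
  have d: "type_count (span3 (S 1 0 0 0 0 0) (S 0 0 0 1 0 0) (S 0 0 1 0 1 (0::'a))) t =
    card {p::'a\<times>'a. (if fst p = 0 then o8_1 else if fst p = -1 then (if snd p = 0 then o12 else o16) else if is_square (- fst p) then o13_1 else o13_2) = t} +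
    card {s. H (chi s)} + (if o8_1 = t then 1 else 0)"
    by (subst dist_corner) (simp_all add: line_xy_def ltype_Sigma4 rank_one_type_def chi_simps H_def conj_comms)
  have "{x::'a. x \<noteq> 0 \<and> x \<noteq> -1 \<and> is_square (- x)} = {x::'a. x \<noteq> 0 \<and> is_square (- x)} - {-1}" by auto
  then have c: "card {x::'a. x \<noteq> 0 \<and> x \<noteq> -1 \<and> is_square (- x)} = half - 1"
    using card_square_class_uminus(1) by (simp add: card_Diff_singleton)
  have e: "{x::'a. x \<noteq> 0 \<and> x \<noteq> -1 \<and> \<not> is_square (- x)} = {x. \<not> is_square (- x)}" by auto
  have cc: "card {p::'a\<times>'a. fst p = 0} = CARD('a)" "card {p::'a\<times>'a. fst p = -1 \<and> fst p \<noteq> 0 \<and> snd p = 0} = 1" "card {p::'a\<times>'a. fst p = -1 \<and> fst p \<noteq> 0 \<and> snd p \<noteq> 0} = 2 * half"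
    "card {p::'a\<times>'a. fst p \<noteq> 0 \<and> fst p \<noteq> -1 \<and> is_square (- fst p)} = (half - 1) * CARD('a)"
    "card {p::'a\<times>'a. fst p \<noteq> 0 \<and> fst p \<noteq> -1 \<and> \<not> is_square (- fst p)} = half * CARD('a)"
    using card_pairs_fst[of "\<lambda>x. x = (0::'a)", where 'b='a] card_pairs[of "\<lambda>x. x = -1 \<and> x \<noteq> (0::'a)" "\<lambda>y. y = (0::'a)"] card_pairs[of "\<lambda>x. x = -1 \<and> x \<noteq> (0::'a)" "\<lambda>y. y \<noteq> (0::'a)"]
      card_pairs_fst[of "\<lambda>x. x \<noteq> 0 \<and> x \<noteq> -1 \<and> is_square (- x::'a)", where 'b='a] card_pairs_fst[of "\<lambda>x. x \<noteq> 0 \<and> x \<noteq> -1 \<and> \<not> is_square (- x::'a)", where 'b='a]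
    by (simp_all add: c e card_square_class card_square_class_uminus Collect_conv_if)
  have s: "(if a = 0 then o8_1 else if a = -1 then (if b = 0 then o12 else o16) else if is_square (- a) then o13_1 else o13_2) = t \<longleftrightarrow>
    (case t of o8_1 \<Rightarrow> a = 0 | o12 \<Rightarrow> a = -1 \<and> a \<noteq> 0 \<and> b = 0 | o16 \<Rightarrow> a = -1 \<and> a \<noteq> 0 \<and> b \<noteq> 0 | o13_1 \<Rightarrow> a \<noteq> 0 \<and> a \<noteq> -1 \<and> is_square (- a)
      | o13_2 \<Rightarrow> a \<noteq> 0 \<and> a \<noteq> -1 \<and> \<not> is_square (- a) | _ \<Rightarrow> False)" for a b :: 'a
    by (cases t) auto
  show ?thesis unfolding d s card_chi[of H]
    by (cases t) (use half_pos in \<open>simp_all only: cc line_type.case\<close>, simp_all add: H_def table_simps field_simps power2_eq_square of_nat_diff)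
qed

lemma ltype_Sigma6:
  fixes x y :: 'a
  shows "ltype (span2 (S x 0 0 1 0 \<epsilon>) (S y 0 0 0 1 0)) =
    (if y = 0 then (if x = 0 then o10 else o15_1) else if is_square ((x / y)^2 - \<epsilon>) then o15_1 else o15_2)"
proof -
  let ?L = "span2 (S x 0 0 1 0 \<epsilon>) (S y 0 0 0 1 0)"
  have i: "indep2 (S x 0 0 1 0 \<epsilon>) (S y 0 0 0 1 0)" by (simp add: indep2_S)
  have e: "t^2 \<noteq> \<epsilon>" "t * t \<noteq> \<epsilon>" for t using nonsquare by (metis is_nth_power_nth_power, metis is_square_sq)
  have r: "rank_one (S (x + t * y) 0 0 1 t \<epsilon>) \<longleftrightarrow> False" "rank_one (S y 0 0 0 1 0) \<longleftrightarrow> False" for t using e by (auto simp: rank_one_S)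
  have d: "det (S (x + t * y) 0 0 1 t \<epsilon>) = 0 \<longleftrightarrow> x + t * y = 0" for t
  proof -
    have "det (S (x + t * y) 0 0 1 t \<epsilon>) = (x + t * y) * (\<epsilon> - t^2)" by (simp add: det_S power2_eq_square algebra_simps)
    then show ?thesis using e[of t] by auto
  qed
  have h2: "hyperbolic (S y 0 0 0 1 0) \<longleftrightarrow> y = 0" "elliptic (S y 0 0 0 1 0) \<longleftrightarrow> False"
    unfolding hyperbolic_S elliptic_S r by (auto simp: det_zero_S)
  have h0: "hyperbolic (S a 0 0 1 t \<epsilon>) \<longleftrightarrow> a = 0 \<and> is_square (t^2 - \<epsilon>)"
    "elliptic (S a 0 0 1 t \<epsilon>) \<longleftrightarrow> a = 0 \<and> \<not> is_square (t^2 - \<epsilon>)" for a t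
  proof -
    have "det (S a 0 0 1 t \<epsilon>) = a * (\<epsilon> - t^2)" by (simp add: det_S power2_eq_square algebra_simps)
    then have "det (S a 0 0 1 t \<epsilon>) = 0 \<longleftrightarrow> a = 0" using e[of t] by auto
    moreover have "\<not> rank_one (S a 0 0 1 t \<epsilon>)" using e by (auto simp: rank_one_S)
    ultimately show "hyperbolic (S a 0 0 1 t \<epsilon>) \<longleftrightarrow> a = 0 \<and> is_square (t^2 - \<epsilon>)"
      "elliptic (S a 0 0 1 t \<epsilon>) \<longleftrightarrow> a = 0 \<and> \<not> is_square (t^2 - \<epsilon>)"
      unfolding hyperbolic_S elliptic_S by auto
  qed
  note h1 = h0[of "x + t * y" t for t]
  have tg: "\<not> tangent ?L (S (x + t * y) 0 0 1 t \<epsilon>)" "\<not> tangent ?L (S y 0 0 0 1 0)" if "x \<noteq> 0 \<or> y \<noteq> 0" for t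
  proof -
    show "\<not> tangent ?L (S (x + t * y) 0 0 1 t \<epsilon>)"
    proof
      assume "tangent ?L (S (x + t * y) 0 0 1 t \<epsilon>)"
      then have a: "x + t * y = 0" and b: "ddet (x + t * y) 0 0 1 t \<epsilon> y 0 0 0 1 0 = 0" unfolding tangent_S d by blast+
      have "ddet 0 0 0 1 t \<epsilon> y 0 0 0 1 0 = y * (\<epsilon> - t^2)" by (simp add: ddet_def power2_eq_square algebra_simps)
      then have "y = 0" using b e[of t] unfolding a by auto
      then show False using a that by simp
    qed
    show "\<not> tangent ?L (S y 0 0 0 1 0)"
      unfolding tangent_S using that by (auto simp: det_zero_S ddet_def)
  qed
  have P: "pts rank_one ?L = card {t::'a. False} + (if False then 1 else 0)"
    "pts hyperbolic ?L = card {t. x + t * y = 0 \<and> is_square (t^2 - \<epsilon>)} + (if y = 0 then 1 else 0)"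
    "pts elliptic ?L = card {t. x + t * y = 0 \<and> \<not> is_square (t^2 - \<epsilon>)} + (if False then 1 else 0)"
    unfolding pts_S_simps[OF i] mult_zero_right add_0_left add_0_right mult_1_right r h1 h2 by (rule refl)+
  have T: "pts (tangent ?L) ?L = 0" if "x \<noteq> 0 \<or> y \<noteq> 0"
    unfolding pts_S[OF i homog_tangent] mult_zero_right add_0_left add_0_right mult_1_right using tg[OF that] by simp
  have ns: "\<not> all_singular ?L" if h: "x \<noteq> 0 \<or> y \<noteq> 0"
  proof
    assume a: "all_singular ?L"
    have "x = 0" using all_singular_SD[OF a, of 1 0] d[of 0] by simp
    moreover have "y = 0" using all_singular_SD[OF a, of 0 1] by (simp add: det_zero_S)
    ultimately show False using h by simp
  qed
  show ?thesis
  proof (cases "y = 0")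
    case y: True
    show ?thesis
    proof (cases "x = 0")
      case True
      have "all_singular ?L" unfolding y True all_singular_S by (simp add: det_S algebra_simps)
      moreover have "common_kernel ?L" unfolding y True common_kernel_S by (intro exI[of _ 1] exI[of _ 0] exI[of _ 0]) simp
      ultimately show ?thesis using P(1) y True by (simp add: ltype_def)
    next
      case False
      then show ?thesis using P T ns y by (simp add: ltype_def Let_def)
    qed
  next
    case False
    have "x + t * y = 0 \<longleftrightarrow> t = - x / y" for t using linear_root_iff[OF False, of t x] by (simp add: add.commute)
    then show ?thesis using P T ns False by (simp add: ltype_def Let_def Collect_conv_if)
  qed
qed

lemma dist_Sigma6:
  "rat_of_nat (type_count (span3 (S 1 0 0 0 0 0) (S 0 0 0 1 0 \<epsilon>) (S 0 0 0 0 1 0)) t) = table Sigma6 CARD('a) t"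
proof -
  have n: "card {s. is_square (s^2 - \<epsilon>)} = half" "card {s. \<not> is_square (s^2 - \<epsilon>)} = half + 1"
  proof -
    have "s^2 \<noteq> \<epsilon>" for s using nonsquare by (metis is_nth_power_nth_power)
    then show "card {s. is_square (s^2 - \<epsilon>)} = half" "card {s. \<not> is_square (s^2 - \<epsilon>)} = half + 1"
      using card_norm_form[OF eps_nonzero] nonsquare by simp_all
  qed
  have d: "type_count (span3 (S 1 0 0 0 0 0) (S 0 0 0 1 0 \<epsilon>) (S 0 0 0 0 1 0)) t =
    card {p::'a\<times>'a. (if snd p = 0 then (if fst p = 0 then o10 else o15_1) else if is_square ((fst p / snd p)^2 - \<epsilon>) then o15_1 else o15_2) = t} +
    card {s. (if is_square (s^2 - \<epsilon>) then o8_1 else o8_2) = t} + (if o8_1 = t then 1 else 0)"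
  proof (subst dist_corner)
    have ne: "s^2 \<noteq> \<epsilon>" for s using nonsquare by (metis is_nth_power_nth_power)
    show "card {p. ltype (line_xy 0 0 1 0 \<epsilon> 0 0 0 1 0 (fst p) (snd p)) = t} + card {s. rank_one_type (0 + s * 0) (0 + s * 0) (1 + s * 0) (0 + s * 1) (\<epsilon> + s * 0) = t} +
      (if rank_one_type 0 0 0 1 0 = t then 1 else 0) = card {p::'a\<times>'a. (if snd p = 0 then (if fst p = 0 then o10 else o15_1) else if is_square ((fst p / snd p)^2 - \<epsilon>) then o15_1 else o15_2) = t} +
    card {s. (if is_square (s^2 - \<epsilon>) then o8_1 else o8_2) = t} + (if o8_1 = t then 1 else 0)"
      by (simp add: line_xy_def ltype_Sigma6 rank_one_type_def ne)
  qed simp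
  have un: "card {p::'a\<times>'a. P p \<or> Q p} = card {p. P p} + card {p. Q p}" if "\<And>p. \<not> (P p \<and> Q p)" for P Q
    using that by (subst card_Un_disjoint[symmetric]) (auto simp: Collect_disj_eq)
  have c1: "card {p::'a\<times>'a. fst p = 0 \<and> snd p = 0} = 1" "card {p::'a\<times>'a. fst p \<noteq> 0 \<and> snd p = 0} = 2 * half"
    using card_pairs[of "\<lambda>x. x = (0::'a)" "\<lambda>y. y = (0::'a)"] card_pairs[of "\<lambda>x. x \<noteq> (0::'a)" "\<lambda>y. y = (0::'a)"] card_square_class(4) by simp_all
  have c2: "card {p::'a\<times>'a. snd p \<noteq> 0 \<and> is_square ((fst p / snd p)^2 - \<epsilon>)} = half * (2 * half)"
    "card {p::'a\<times>'a. snd p \<noteq> 0 \<and> \<not> is_square ((fst p / snd p)^2 - \<epsilon>)} = (half + 1) * (2 * half)"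
    using card_ratio[of "\<lambda>s. is_square (s^2 - \<epsilon>)"] card_ratio[of "\<lambda>s. \<not> is_square (s^2 - \<epsilon>)"] unfolding n by blast+
  have c3: "card {p::'a\<times>'a. (fst p \<noteq> 0 \<and> snd p = 0) \<or> (snd p \<noteq> 0 \<and> is_square ((fst p / snd p)^2 - \<epsilon>))} = 2 * half + half * (2 * half)"
    unfolding c2(1)[symmetric] by (subst c1(2)[symmetric], rule un) blast
  note cc = c1(1) c2(2) c3
  have s: "(if b = 0 then (if a = 0 then o10 else o15_1) else if is_square ((a / b)^2 - \<epsilon>) then o15_1 else o15_2) = t \<longleftrightarrow>
    (case t of o10 \<Rightarrow> a = 0 \<and> b = 0 | o15_1 \<Rightarrow> (a \<noteq> 0 \<and> b = 0) \<or> (b \<noteq> 0 \<and> is_square ((a / b)^2 - \<epsilon>)) 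
      | o15_2 \<Rightarrow> b \<noteq> 0 \<and> \<not> is_square ((a / b)^2 - \<epsilon>) | _ \<Rightarrow> False)" for a b :: 'a
    by (cases t) auto
  show ?thesis unfolding d s
    by (cases t) (simp_all only: cc line_type.case, simp_all add: if_type_eq n n[unfolded power2_eq_square] table_simps field_simps power2_eq_square)
qed

lemma dist_Sigma7:
  "rat_of_nat (type_count (span3 (S 1 0 0 0 0 0) (S 0 1 0 0 0 0) (S 0 0 1 0 0 (0::'a))) t) = table Sigma7 CARD('a) t"
proof -
  have l: "ltype (span2 (S x 1 0 0 0 0) (S y 0 1 0 0 0)) = o12" for x y :: 'a
  proof -
    have i: "indep2 (S x 1 0 0 0 0) (S y 0 1 0 0 0)" by (simp add: indep2_S)
    have "pts rank_one (span2 (S x 1 0 0 0 0) (S y 0 1 0 0 0)) = 0" by (simp add: pts_S_simps(1)[OF i] rank_one_S)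
    moreover have "all_singular (span2 (S x 1 0 0 0 0) (S y 0 1 0 0 0))" by (simp add: all_singular_S det_S)
    moreover have "\<not> common_kernel (span2 (S x 1 0 0 0 0) (S y 0 1 0 0 0))" by (auto simp: common_kernel_S)
    ultimately show ?thesis by (rule ltype_cases)
  qed
  have d: "type_count (span3 (S 1 0 0 0 0 0) (S 0 1 0 0 0 0) (S 0 0 1 0 0 (0::'a))) t =
    card {p::'a\<times>'a. o12 = t} + card {s::'a. o6 = t} + (if o6 = t then 1 else 0)"
    by (subst dist_corner) (simp_all add: line_xy_def l rank_one_type_def)
  show ?thesis unfolding d by (cases t) (simp_all add: table_simps power2_eq_square algebra_simps)
qed

lemma ltype_Sigma8:
  fixes x y :: 'a
  shows "ltype (span2 (S x 1 0 0 0 0) (S y 0 0 0 1 0)) = (if chi x = 0 then (if chi y = 0 then o12 else o16) else o13_1)"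
proof -
  let ?L = "span2 (S x 1 0 0 0 0) (S y 0 0 0 1 0)"
  have i: "indep2 (S x 1 0 0 0 0) (S y 0 0 0 1 0)" by (simp add: indep2_S)
  have r: "rank_one (S (x + t * y) 1 0 0 t 0) \<longleftrightarrow> False" "rank_one (S y 0 0 0 1 0) \<longleftrightarrow> False" for t by (auto simp: rank_one_S)
  have h2: "hyperbolic (S y 0 0 0 1 0) \<longleftrightarrow> y = 0" "elliptic (S y 0 0 0 1 0) \<longleftrightarrow> False"
    unfolding hyperbolic_S elliptic_S r by (auto simp: det_zero_S)
  have h1: "hyperbolic (S (x + t * y) 1 0 0 t 0) \<longleftrightarrow> t = 0 \<or> x + t * y = 0"
    "elliptic (S (x + t * y) 1 0 0 t 0) \<longleftrightarrow> False" for t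
    unfolding hyperbolic_S elliptic_S r by (auto simp: det_zero_S)
  have P: "pts rank_one ?L = card {t::'a. False} + (if False then 1 else 0)"
    "pts hyperbolic ?L = card {t. t = 0 \<or> x + t * y = 0} + (if y = 0 then 1 else 0)"
    "pts elliptic ?L = card {t::'a. False} + (if False then 1 else 0)"
    unfolding pts_S_simps[OF i] mult_zero_right add_0_left add_0_right mult_1_right r h1 h2 by (rule refl)+
  consider "x = 0" "y = 0" | "x = 0" "y \<noteq> 0" | "x \<noteq> 0" "y = 0" | "x \<noteq> 0" "y \<noteq> 0" by blast
  then show ?thesis
  proof cases
    case 1
    then show ?thesis using ltype_o12 by (simp add: chi_simps)
  next
    case 2
    have "tangent ?L (S x 1 0 0 0 0)" unfolding tangent_S using r(1)[of 0] 2 by (simp add: det_zero_S ddet_def)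
    then have "pts (tangent ?L) ?L \<noteq> 0" by (rule tangent_pos[OF i])
    moreover have "\<not> all_singular ?L" using 2 by (intro not_all_singularI[where s=0 and t=1]) (simp add: det_zero_S)
    ultimately show ?thesis using P 2 by (simp add: ltype_def Let_def chi_simps)
  next
    case 3
    have "\<not> all_singular ?L" using 3 by (intro not_all_singularI[where s=1 and t=1]) (simp add: det_zero_S)
    then show ?thesis using P 3 by (simp add: ltype_def Let_def chi_simps)
  next
    case 4
    have "x + t * y = 0 \<longleftrightarrow> t = - x / y" for t using linear_root_iff[OF 4(2), of t x] by (simp add: add.commute)
    then have e: "{t. t = 0 \<or> x + t * y = 0} = {0, - x / y}" by auto
    have "card {t. t = 0 \<or> x + t * y = 0} = 2" unfolding e using 4 by simp
    moreover have "\<not> all_singular ?L" using 4 by (intro not_all_singularI[where s=0 and t=1]) (simp add: det_zero_S)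
    ultimately show ?thesis using P 4 by (simp add: ltype_def Let_def chi_simps)
  qed
qed

lemma dist_Sigma8:
  "rat_of_nat (type_count (span3 (S 1 0 0 0 0 0) (S 0 1 0 0 0 0) (S 0 0 0 0 1 (0::'a))) t) = table Sigma8 CARD('a) t"
proof -
  define G where "G c d \<longleftrightarrow> (if c = 0 then (if d = 0 then o12 else o16) else o13_1) = t" for c d :: int
  define H where "H c \<longleftrightarrow> (if c = 0 then o6 else o8_1) = t" for c :: int
  have d: "type_count (span3 (S 1 0 0 0 0 0) (S 0 1 0 0 0 0) (S 0 0 0 0 1 (0::'a))) t =
    card {p. G (chi (fst p)) (chi (snd p))} +
    card {s. H (chi s)} + (if o8_1 = t then 1 else 0)"
    by (subst dist_corner) (simp_all add: line_xy_def ltype_Sigma8 rank_one_type_def chi_simps G_def H_def conj_comms)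
  show ?thesis unfolding d card_chi_pair[of G] card_chi[of H]
    by (cases t) (simp_all add: G_def H_def table_simps field_simps power2_eq_square)
qed

lemma ltype_Sigma9:
  fixes x y k :: 'a
  assumes k: "k \<noteq> 0"
  shows "ltype (span2 (S x 0 0 1 0 (- k)) (S y 1 0 0 0 0)) =
    (if chi (y^2 + 4 * x) = 0 then (if is_square k then o13_1 else o13_2)
     else if chi (y^2 + 4 * x) = 1 then (if is_square k then o14_1 else o14_2) else o15_1)"
proof -
  let ?L = "span2 (S x 0 0 1 0 (- k)) (S y 1 0 0 0 0)"
  have i: "indep2 (S x 0 0 1 0 (- k)) (S y 1 0 0 0 0)" by (simp add: indep2_S)
  have r: "rank_one (S (x + t * y) t 0 1 0 (- k)) \<longleftrightarrow> False" "rank_one (S y 1 0 0 0 0) \<longleftrightarrow> False" for t using k by (auto simp: rank_one_S)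
  have d: "det (S (x + t * y) t 0 1 0 (- k)) = 0 \<longleftrightarrow> t^2 = x + t * y" for t
  proof -
    have "det (S (x + t * y) t 0 1 0 (- k)) = k * (t^2 - (x + t * y))" by (simp add: det_S power2_eq_square algebra_simps)
    then show ?thesis using k by simp
  qed
  have h2: "hyperbolic (S y 1 0 0 0 0) \<longleftrightarrow> True" "elliptic (S y 1 0 0 0 0) \<longleftrightarrow> False"
    unfolding hyperbolic_S elliptic_S r by (auto simp: det_zero_S)
  have sk: "is_square (t^2 - (x + t * y) * 1) \<and> is_square (0^2 - (x + t * y) * (- k)) \<and> is_square (0^2 - 1 * (- k)) \<longleftrightarrow> is_square k" if "t^2 = x + t * y" for t
    unfolding that[symmetric] using is_square_mult[of "t^2" k] by auto
  have h1: "hyperbolic (S (x + t * y) t 0 1 0 (- k)) \<longleftrightarrow> t^2 = x + t * y \<and> is_square k"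
    "elliptic (S (x + t * y) t 0 1 0 (- k)) \<longleftrightarrow> t^2 = x + t * y \<and> \<not> is_square k" for t
    unfolding hyperbolic_S elliptic_S r d using sk[of t] by blast+
  have tg: "\<not> tangent ?L (S y 1 0 0 0 0)" unfolding tangent_S using k by (auto simp: ddet_def)
  have P: "pts rank_one ?L = card {t::'a. False} + (if False then 1 else 0)"
    "pts hyperbolic ?L = card {t. t^2 = x + t * y \<and> is_square k} + (if True then 1 else 0)"
    "pts elliptic ?L = card {t. t^2 = x + t * y \<and> \<not> is_square k} + (if False then 1 else 0)"
    unfolding pts_S_simps[OF i] mult_zero_right add_0_left add_0_right mult_1_right r h1 h2 by (rule refl)+
  have ns: "\<not> all_singular ?L"
  proof
    assume a: "all_singular ?L"
    have "0 = x" "1 = x + y" using all_singular_SD[OF a, of 1 0] all_singular_SD[OF a, of 1 1] d[of 0] d[of 1] by simp_all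
    moreover have "1 = x - y" using all_singular_SD[OF a, of 1 "-1"] d[of "-1"] by simp
    ultimately show False by simp
  qed
  have T: "pts (tangent ?L) ?L = 0" if "\<not> is_square (y^2 + 4 * x)"
  proof -
    have "{t. t^2 = x + t * y} = {}" using card_quadratic[of x y] that by (auto simp: card_0_eq split: if_splits)
    then have "\<not> tangent ?L (S (x + t * y) t 0 1 0 (- k))" for t unfolding tangent_S d by blast
    then show ?thesis using tg
      unfolding pts_S[OF i homog_tangent] mult_zero_right add_0_left add_0_right mult_1_right by simp
  qed
  show ?thesis using ns P T card_quadratic[of x y] by (cases "is_square k") (auto simp: ltype_def Let_def chi_simps)
qed

lemma dist_Sigma9_10:
  fixes k :: 'a and t :: line_type
  defines "G \<equiv> \<lambda>c::int. (if c = 0 then (if is_square k then o13_1 else o13_2)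
     else if c = 1 then (if is_square k then o14_1 else o14_2) else o15_1) = t"
  assumes k: "k \<noteq> 0"
  shows "type_count (span3 (S 1 0 0 0 0 0) (S 0 0 0 1 0 (- k)) (S 0 1 0 0 0 0)) t =
    ((if G 0 then 1 else 0) + (if G 1 then half else 0) + (if G (-1) then half else 0)) * CARD('a) +
    (if (if is_square k then o8_1 else o8_2) = t then CARD('a) else 0) + (if o6 = t then 1 else 0)"
proof -
  have "type_count (span3 (S 1 0 0 0 0 0) (S 0 0 0 1 0 (- k)) (S 0 1 0 0 0 0)) t =
    card {p. G (chi ((snd p)^2 + 4 * fst p))} +
    card {s::'a. (if is_square k then o8_1 else o8_2) = t} + (if o6 = t then 1 else 0)"
    using k by (subst dist_corner) (simp_all add: line_xy_def ltype_Sigma9 rank_one_type_def G_def)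
  then show ?thesis unfolding card_chi_disc[of G] card_chi[of G] by simp
qed

lemma dist_Sigma9:
  "rat_of_nat (type_count (span3 (S 1 0 0 0 0 0) (S 0 0 0 1 0 (- 1)) (S 0 1 0 0 0 (0::'a))) t) = table Sigma9 CARD('a) t"
  unfolding dist_Sigma9_10[OF one_neq_zero]
  by (cases t) (simp_all add: table_simps field_simps)

lemma dist_Sigma10:
  "rat_of_nat (type_count (span3 (S 1 0 0 0 0 0) (S 0 0 0 1 0 (- \<epsilon>)) (S 0 1 0 0 0 0)) t) = table Sigma10 CARD('a) t"
  unfolding dist_Sigma9_10[OF eps_nonzero]
  by (cases t) (simp_all add: table_simps field_simps)

lemma dist_Sigma15:
  "rat_of_nat (type_count (span3 (S 1 0 0 0 0 0) (S 0 1 0 0 0 0) (S 0 0 1 1 0 (0::'a))) t) = table Sigma15 CARD('a) t"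
proof -
  define H where "H c \<longleftrightarrow> (if c = 0 then o6 else o9) = t" for c :: int
  have l: "ltype (span2 (S x 1 0 0 0 0) (S y 0 1 1 0 0)) = o16" for x y :: 'a
  proof -
    let ?L = "span2 (S x 1 0 0 0 0) (S y 0 1 1 0 0)"
    have i: "indep2 (S x 1 0 0 0 0) (S y 0 1 1 0 0)" by (simp add: indep2_S)
    have r: "rank_one (S (x + t * y) 1 t t 0 0) \<longleftrightarrow> False" "rank_one (S y 0 1 1 0 0) \<longleftrightarrow> False" for t by (auto simp: rank_one_S)
    have h2: "hyperbolic (S y 0 1 1 0 0) \<longleftrightarrow> False" "elliptic (S y 0 1 1 0 0) \<longleftrightarrow> False"
      unfolding hyperbolic_S elliptic_S r by (auto simp: det_zero_S)
    have h1: "hyperbolic (S (x + t * y) 1 t t 0 0) \<longleftrightarrow> t = 0" "elliptic (S (x + t * y) 1 t t 0 0) \<longleftrightarrow> False" for t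
      unfolding hyperbolic_S elliptic_S r by (auto simp: det_zero_S)
    have "pts rank_one ?L = card {t::'a. False} + (if False then 1 else 0)"
      "pts hyperbolic ?L = card {t::'a. t = 0} + (if False then 1 else 0)"
      "pts elliptic ?L = card {t::'a. False} + (if False then 1 else 0)"
      unfolding pts_S_simps[OF i] mult_zero_right add_0_left add_0_right mult_1_right r h1 h2 by (rule refl)+
    moreover have "\<not> all_singular ?L" by (intro not_all_singularI[where s=0 and t=1]) (simp add: det_zero_S)
    moreover have "tangent ?L (S x 1 0 0 0 0)" unfolding tangent_S using r(1)[of 0] by (simp add: det_zero_S ddet_def)
    then have "pts (tangent ?L) ?L \<noteq> 0" by (rule tangent_pos[OF i])
    ultimately show ?thesis by (simp add: ltype_def Let_def)
  qed
  have d: "type_count (span3 (S 1 0 0 0 0 0) (S 0 1 0 0 0 0) (S 0 0 1 1 0 (0::'a))) t =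
    card {p::'a\<times>'a. o16 = t} + card {s. H (chi s)} + (if o9 = t then 1 else 0)"
    by (subst dist_corner) (simp_all add: line_xy_def l rank_one_type_def chi_simps H_def conj_comms)
  show ?thesis unfolding d card_chi[of H]
    by (cases t) (simp_all add: H_def table_simps power2_eq_square algebra_simps)
qed

end

section \<open>Irreducible planes\<close>

text \<open>The equations of the double counting, solved.\<close>

lemma (in irreducible_plane) line_counts:
  defines "h \<equiv> rat_of_nat (card hyp_points)" and "n \<equiv> rat_of_nat (card ell_points)" and "q \<equiv> rat_of_nat CARD('a)"
    and "c \<equiv> \<lambda>t. rat_of_nat (line_count t)"
  shows "c o14_2 = n * (n - 1) / 2" "c o13_2 = h * n - n * (n - 1)"
    "c o13_1 = h + n - c o13_2 - c o16" "c o14_1 = (h * (h - 1) - 2 * c o13_1) / 6"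
    "c o15_2 = n * q - h * n" "c o15_1 = h * q - 2 * c o13_1 - c o13_2 - 3 * c o14_1 - c o14_2 - c o16"
    "c o17 = q^2 - h - n - c o14_1 - c o14_2 - c o15_1 - c o15_2"
proof -
  note E = count_equations[THEN arg_cong[where f=rat_of_nat], unfolded of_nat_add of_nat_mult of_nat_power of_nat_numeral of_nat_1]
  note E' = E[folded h_def n_def q_def c_def]
  have e: "q^2 = c o13_1 + c o13_2 + c o14_1 + c o14_2 + c o15_1 + c o15_2 + c o16 + c o17"
    "h * q = 2 * c o13_1 + c o13_2 + 3 * c o14_1 + c o14_2 + c o15_1 + c o16"
    "n * q = c o13_2 + 2 * c o14_2 + c o15_2"
    "h + n = c o13_1 + c o13_2 + c o16"
    "h * n = c o13_2 + 2 * c o14_2"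
    "4 * c o13_1 + c o13_2 + 9 * c o14_1 + c o14_2 + c o15_1 + c o16 + h = h * h + h * q"
    "c o13_2 + 4 * c o14_2 + c o15_2 + n = n * n + n * q"
    unfolding c_def using E unfolding h_def n_def q_def by simp_all
  have s: "h * (h - 1) = h * h - h" "n * (n - 1) = n * n - n" by (simp_all add: algebra_simps)
  show a: "c o14_2 = n * (n - 1) / 2" using e(3,7) unfolding s by simp
  show "c o13_2 = h * n - n * (n - 1)" using e(3,5,7) unfolding s by linarith
  show "c o13_1 = h + n - c o13_2 - c o16" using e(4) by linarith
  have "6 * c o14_1 = h * h - h - 2 * c o13_1" using e(2,6) by linarith
  then show "c o14_1 = (h * (h - 1) - 2 * c o13_1) / 6" unfolding s by simp
  show "c o15_2 = n * q - h * n" using e(3,5) by linarith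
  show "c o15_1 = h * q - 2 * c o13_1 - c o13_2 - 3 * c o14_1 - c o14_2 - c o16" using e(2) by linarith
  show "c o17 = q^2 - h - n - c o14_1 - c o14_2 - c o15_1 - c o15_2" using e(1,4) by linarith
qed

text \<open>After scaling, a cube with nonzero last coefficient is the cube of \<open>r b +
  c\<close>.\<close>

lemma cube_iff:
  fixes K0 :: "'a::field"
  assumes "K3 \<noteq> 0"
  shows "(\<exists>k \<alpha> \<beta>. K0 = k * \<alpha>^3 \<and> K1 = 3 * k * \<alpha>^2 * \<beta> \<and> K2 = 3 * k * \<alpha> * \<beta>^2 \<and> K3 = k * \<beta>^3) \<longleftrightarrow>
    (\<exists>r. K0 = r^3 * K3 \<and> K1 = 3 * r^2 * K3 \<and> K2 = 3 * r * K3)"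
proof
  assume "\<exists>k \<alpha> \<beta>. K0 = k * \<alpha>^3 \<and> K1 = 3 * k * \<alpha>^2 * \<beta> \<and> K2 = 3 * k * \<alpha> * \<beta>^2 \<and> K3 = k * \<beta>^3"
  then obtain k \<alpha> \<beta> where K: "K0 = k * \<alpha>^3" "K1 = 3 * k * \<alpha>^2 * \<beta>" "K2 = 3 * k * \<alpha> * \<beta>^2" "K3 = k * \<beta>^3" by blast
  have b: "\<beta> \<noteq> 0" using assms K by auto
  define r where "r = \<alpha> / \<beta>"
  have a: "\<alpha> = r * \<beta>" using b by (simp add: r_def)
  show "\<exists>r. K0 = r^3 * K3 \<and> K1 = 3 * r^2 * K3 \<and> K2 = 3 * r * K3"
    unfolding K a by (intro exI[of _ r]) (simp add: power2_eq_square power3_eq_cube algebra_simps)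
next
  assume "\<exists>r. K0 = r^3 * K3 \<and> K1 = 3 * r^2 * K3 \<and> K2 = 3 * r * K3"
  then obtain r where "K0 = r^3 * K3" "K1 = 3 * r^2 * K3" "K2 = 3 * r * K3" by blast
  then show "\<exists>k \<alpha> \<beta>. K0 = k * \<alpha>^3 \<and> K1 = 3 * k * \<alpha>^2 * \<beta> \<and> K2 = 3 * k * \<alpha> * \<beta>^2 \<and> K3 = k * \<beta>^3"
    by (intro exI[of _ K3] exI[of _ r] exI[of _ 1]) (simp add: mult_ac)
qed

context odd_field
begin

lemma card_norm_eps: "card {s. is_square (s^2 - \<epsilon>)} = half" "card {s. \<not> is_square (s^2 - \<epsilon>)} = half + 1" "s^2 \<noteq> \<epsilon>"
proof -
  show n: "s^2 \<noteq> \<epsilon>" for s using nonsquare by (metis is_nth_power_nth_power)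
  show "card {s. is_square (s^2 - \<epsilon>)} = half" "card {s. \<not> is_square (s^2 - \<epsilon>)} = half + 1"
    using card_norm_form[OF eps_nonzero] nonsquare n by simp_all
qed

text \<open>Besides \<open>-1\<close> the roots are those of \<open>r\<^sup>2 - r + 1\<close>, a quadratic
  of discriminant \<open>-3\<close>.\<close>

lemma card_cube_roots:
  "card {r::'a. r^3 = -1} = (if CARD('a) mod 3 = 1 then 3 else 1)"
proof -
  have f: "r^3 = -1 \<longleftrightarrow> r = -1 \<or> r^2 = -1 + r * 1" for r :: 'a
  proof -
    have "r^3 + 1 = (r + 1) * (r^2 - (-1 + r * 1))" by (simp add: power2_eq_square power3_eq_cube algebra_simps)
    then show ?thesis by (metis eq_iff_diff_eq_0 eq_neg_iff_add_eq_0 mult_eq_0_iff)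
  qed
  have q: "card {r::'a. r^2 = -1 + r * 1} = (if (3::'a) = 0 then 1 else if is_square (- 3 :: 'a) then 2 else 0)"
    using card_quadratic[of "-1" 1] by simp
  have m: "(-1)^2 = -1 + (-1) * (1::'a) \<longleftrightarrow> (3::'a) = 0"
  proof -
    have "(-1)^2 - (-1 + (-1) * (1::'a)) = 3" by simp
    then show ?thesis by (metis eq_iff_diff_eq_0)
  qed
  show ?thesis
  proof (cases "(3::'a) = 0")
    case True
    then have "{r::'a. r^3 = -1} = {r::'a. r^2 = -1 + r * 1}" using m unfolding f by blast
    then have "card {r::'a. r^3 = -1} = 1" using q True by simp
    moreover have "CARD('a) mod 3 = 0" using True three_eq_0_iff[OF odd_card] by simp
    ultimately show ?thesis by simp
  next
    case False
    have "{r::'a. r^3 = -1} = insert (-1) {r::'a. r^2 = -1 + r * 1}" unfolding f by blast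
    moreover have "-1 \<notin> {r::'a. r^2 = -1 + r * 1}" using m False by blast
    ultimately have "card {r::'a. r^3 = -1} = Suc (card {r::'a. r^2 = -1 + r * 1})" by simp
    then show ?thesis using q False is_square_minus_3_iff[OF odd_card False] by simp
  qed
qed

text \<open>Here \<open>- q2 = b\<^sup>2\<close>, so all relevant points are hyperbolic. The middle
  coefficient of the cubic forces \<open>3 r = -2\<close> for a cube, which has one solution unless the
  characteristic is three.\<close>

lemma dist_Sigma11:
  "rat_of_nat (type_count (span3 (S 1 0 0 0 0 0) (S 0 (-1) 0 0 1 0) (S 0 1 0 0 0 (1::'a))) t) = table Sigma11 CARD('a) t"
proof -
  interpret corner_plane \<epsilon> "-1" 0 0 1 0 1 0 0 0 1 by unfold_locales
  have q: "q2 (b,c) = - (b^2)" "q3 (b,c) = - ((c - b)^2 * c)" for b c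
    by (simp_all add: q2_def q3_def pL_def pM_def pU_def pV_def pW_def)
  interpret irreducible_plane \<epsilon> "-1" 0 0 1 0 1 0 0 0 1
  proof unfold_locales
    fix p assume "p \<in> P1" "q2 p = 0" then show "q3 p \<noteq> 0" by (elim P1_cases) (simp_all add: q)
  next
    fix x y show "\<exists>p\<in>P1. (x * fst p + y * snd p) * q2 p + q3 p \<noteq> 0" by (intro bexI[of _ "(0,1)"]) (simp_all add: q)
  qed
  have hn: "card hyp_points = CARD('a)" "card ell_points = 0"
    unfolding hyp_points_def ell_points_def card_P1_Collect by (simp_all add: q)
  have F: "line_count o16 = (if CARD('a) mod 3 = 0 then 0 else 1)"
  proof -
    have K: "det (S x (-1) 0 0 1 0) = - x" "ddet x (-1) 0 0 1 0 y 1 0 0 0 1 = - (y + 1)"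
      "ddet y 1 0 0 0 1 x (-1) 0 0 1 0 = 2" "det (S y 1 0 0 0 1) = -1" for x y :: 'a
      by (simp_all add: det_S ddet_def)
    have "line_count o16 = card {p::'a\<times>'a. \<exists>r. - fst p = r^3 * -1 \<and> - (snd p + 1) = 3 * r^2 * -1 \<and> 2 = 3 * r * -1}"
      unfolding count_o16 K by (subst cube_iff) simp_all
    also have "\<dots> = (if (3::'a) = 0 then 0 else 1)"
    proof (cases "(3::'a) = 0")
      case True
      then have "{p::'a\<times>'a. \<exists>r. - fst p = r^3 * -1 \<and> - (snd p + 1) = 3 * r^2 * -1 \<and> 2 = 3 * r * -1} = {}"
        using two by simp
      then have c: "card {p::'a\<times>'a. \<exists>r. - fst p = r^3 * -1 \<and> - (snd p + 1) = 3 * r^2 * -1 \<and> 2 = 3 * r * -1} = 0" by (simp only: card.empty)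
      show ?thesis unfolding c using True by simp
    next
      case False
      define r0 :: 'a where "r0 = - 2 / 3"
      have r: "2 = 3 * r * -1 \<longleftrightarrow> r = r0" for r :: 'a
      proof -
        have "2 - 3 * r * -1 = r * 3 - (-2)" by simp
        then have "2 = 3 * r * -1 \<longleftrightarrow> r * 3 = -2" by (metis eq_iff_diff_eq_0)
        then show ?thesis unfolding r0_def nonzero_eq_divide_eq[OF False] .
      qed
      have "{p::'a\<times>'a. \<exists>r. - fst p = r^3 * -1 \<and> - (snd p + 1) = 3 * r^2 * -1 \<and> 2 = 3 * r * -1} = {(r0^3, 3 * r0^2 - 1)}"
      proof -
        have "- (y + 1) - 3 * r0^2 * -1 = - (y - (3 * r0^2 - 1))" for y by simp
        then have y: "- (y + 1) = 3 * r0^2 * -1 \<longleftrightarrow> y = 3 * r0^2 - 1" for y by (metis eq_iff_diff_eq_0 neg_equal_0_iff_equal)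
        have "(\<exists>r. - fst p = r^3 * -1 \<and> - (snd p + 1) = 3 * r^2 * -1 \<and> r = r0) \<longleftrightarrow> fst p = r0^3 \<and> snd p = 3 * r0^2 - 1" for p :: "'a \<times> 'a"
          using y[of "snd p"] by auto
        then show ?thesis unfolding r by (auto simp only: prod_eq_iff fst_conv snd_conv)
      qed
      then show ?thesis using False by simp
    qed
    finally show ?thesis using three_eq_0_iff[OF odd_card] by simp
  qed
  have r: "rank_one_type (-1 + s * 1) (0 + s * 0) (0 + s * 0) (1 + s * 0) (0 + s * 1) = o8_1" "rank_one_type 1 0 0 0 1 = o9" for s :: 'a
    by (simp_all add: rank_one_type_def)
  show ?thesis unfolding plane_def[symmetric] dist_plane r
    by (cases "CARD('a) mod 3 = 0"; cases t)
      (simp_all add: table_def table_entries_def Let_def count_outside generic_types_def line_counts hn F field_simps power2_eq_square)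
qed

text \<open>In this basis \<open>- q2 = 4 b c\<close> is a hyperbolic form, and the lines whose cubic is a
  cube correspond to the cube roots of \<open>-1\<close>.\<close>

lemma dist_Sigma12:
  "rat_of_nat (type_count (span3 (S 1 0 0 0 0 0) (S 0 1 0 1 1 1) (S 0 1 0 (-1) 1 (-1::'a))) t) = table Sigma12 CARD('a) t"
proof -
  interpret corner_plane \<epsilon> 1 0 1 1 1 1 0 "-1" 1 "-1" by unfold_locales
  have q: "q2 (b,c) = - (4 * b * c)" "q3 (b,c) = - ((b + c)^2 * (b - c))" for b c
    by (simp_all add: q2_def q3_def pL_def pM_def pU_def pV_def pW_def power2_eq_square algebra_simps)
  interpret irreducible_plane \<epsilon> 1 0 1 1 1 1 0 "-1" 1 "-1"
  proof unfold_locales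
    fix p assume "p \<in> P1" "q2 p = 0" then show "q3 p \<noteq> 0" using four by (elim P1_cases) (auto simp add: q)
  next
    fix x y show "\<exists>p\<in>P1. (x * fst p + y * snd p) * q2 p + q3 p \<noteq> 0" by (intro bexI[of _ "(0,1)"]) (simp_all add: q)
  qed
  have s4: "is_square (4 * t) \<longleftrightarrow> is_square t" for t :: 'a
  proof -
    have "4 * t = 2^2 * t" by simp
    moreover have "is_square (2^2::'a)" by (rule is_nth_power_nth_power)
    ultimately show ?thesis using is_square_mult_iff[OF odd_card, of "2^2" t] two by (cases "t = 0") simp_all
  qed
  have hn: "card hyp_points = half" "card ell_points = half"
    unfolding hyp_points_def ell_points_def card_P1_Collect using four by (simp_all add: q s4 card_square_class)
  have F: "line_count o16 = (if CARD('a) mod 3 = 1 then 3 else 1)"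
  proof -
    have K: "det (S x 1 0 1 1 1) = - 1" "ddet x 1 0 1 1 1 y 1 0 (-1) 1 (-1) = - 4 * x - 1"
      "ddet y 1 0 (-1) 1 (-1) x 1 0 1 1 1 = 1 - 4 * y" "det (S y 1 0 (-1) 1 (-1)) = 1" for x y :: 'a
      by (simp_all add: det_S ddet_def algebra_simps)
    have "line_count o16 = card {p::'a\<times>'a. \<exists>r. - 1 = r^3 * 1 \<and> - 4 * fst p - 1 = 3 * r^2 * 1 \<and> 1 - 4 * snd p = 3 * r * 1}"
      unfolding count_o16 K by (subst cube_iff) simp_all
    also have "{p::'a\<times>'a. \<exists>r. - 1 = r^3 * 1 \<and> - 4 * fst p - 1 = 3 * r^2 * 1 \<and> 1 - 4 * snd p = 3 * r * 1} =
      (\<lambda>r. ((- 1 - 3 * r^2) / 4, (1 - 3 * r) / 4)) ` {r. r^3 = -1}"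
    proof -
      have "- 4 * x - 1 = 3 * r^2 * 1 \<longleftrightarrow> x = (- 1 - 3 * r^2) / 4" "1 - 4 * y = 3 * r * 1 \<longleftrightarrow> y = (1 - 3 * r) / 4" for x y r :: 'a
      proof -
        have "x = (- 1 - 3 * r^2) / 4 \<longleftrightarrow> 4 * x = - 1 - 3 * r^2" "y = (1 - 3 * r) / 4 \<longleftrightarrow> 4 * y = 1 - 3 * r" using four by (auto simp: field_simps)
        moreover have "(- 4 * x - 1) - 3 * r^2 * 1 = - (4 * x - (- 1 - 3 * r^2))" "(1 - 4 * y) - 3 * r * 1 = - (4 * y - (1 - 3 * r))" by simp_all
        then have "- 4 * x - 1 = 3 * r^2 * 1 \<longleftrightarrow> 4 * x = - 1 - 3 * r^2" "1 - 4 * y = 3 * r * 1 \<longleftrightarrow> 4 * y = 1 - 3 * r"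
          by (metis eq_iff_diff_eq_0 neg_equal_0_iff_equal)+
        ultimately show "- 4 * x - 1 = 3 * r^2 * 1 \<longleftrightarrow> x = (- 1 - 3 * r^2) / 4" "1 - 4 * y = 3 * r * 1 \<longleftrightarrow> y = (1 - 3 * r) / 4"
          by blast+
      qed
      note e = this
      have p: "- 1 = r^3 * 1 \<and> fst p = a \<and> snd p = b \<longleftrightarrow> r^3 = - 1 \<and> p = (a, b)" for r a b :: 'a and p by auto
      show ?thesis unfolding e p by blast
    qed
    also have "card \<dots> = card {r::'a. r^3 = -1}"
    proof (rule card_image, rule inj_onI)
      fix r s :: 'a assume rs: "r \<in> {r. r^3 = -1}" "s \<in> {r. r^3 = -1}" "((- 1 - 3 * r^2) / 4, (1 - 3 * r) / 4) = ((- 1 - 3 * s^2) / 4, (1 - 3 * s) / 4)"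
      show "r = s"
      proof (cases "(3::'a) = 0")
        case True
        have "(r - s)^3 = r^3 - s^3 - 3 * (r * s * (r - s))" by (simp add: power3_eq_cube algebra_simps)
        then have "(r - s)^3 = 0" using rs True by simp
        then show ?thesis by simp
      next
        case False
        moreover have "(12::'a) = 3 * 4" by simp
        ultimately have "(12::'a) \<noteq> 0" using four by (metis mult_eq_0_iff)
        then show ?thesis using rs(3) four False by simp
      qed
    qed
    finally show ?thesis by (simp add: card_cube_roots)
  qed
  define G where "G c \<longleftrightarrow> (if c = 0 then o9 else if c = 1 then o8_1 else o8_2) = t" for c :: int
  have r: "rank_one_type (1 + s * 1) (0 + s * 0) (1 + s * -1) (1 + s * 1) (1 + s * -1) = t \<longleftrightarrow> G (chi s)" "rank_one_type 1 0 (-1) 1 (-1) = o9" for s :: 'a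
  proof -
    have e: "(1 + s)^2 - (1 - s) * (1 - s) = 4 * s" by (simp add: power2_eq_square algebra_simps)
    then have e': "(1 + s)^2 = (1 - s) * (1 - s) \<longleftrightarrow> s = 0" using four by (metis eq_iff_diff_eq_0 mult_eq_0_iff)
    show "rank_one_type (1 + s * 1) (0 + s * 0) (1 + s * -1) (1 + s * 1) (1 + s * -1) = t \<longleftrightarrow> G (chi s)"
      by (simp add: rank_one_type_def G_def e e' s4 chi_simps)
    show "rank_one_type 1 0 (-1) 1 (-1) = o9" by (simp add: rank_one_type_def)
  qed
  show ?thesis unfolding plane_def[symmetric] dist_plane r card_chi[of G]
    by (cases "CARD('a) mod 3 = 1"; cases t)
      (simp_all add: table_def table_entries_def Let_def count_outside generic_types_def line_counts hn F G_def,
       simp_all add: CARD_half field_simps power2_eq_square)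
qed

text \<open>Here \<open>- q2\<close> is the norm form \<open>c\<^sup>2 - \<epsilon> b\<^sup>2\<close>. One
  cube has \<open>y = 0\<close>; the others correspond to the solutions of \<open>3 r\<^sup>2 = -
  \<epsilon>\<close>, which exist exactly if \<open>-3\<close> is a nonsquare.\<close>

lemma dist_Sigma13:
  "rat_of_nat (type_count (span3 (S 1 0 0 0 0 0) (S 0 0 0 1 0 \<epsilon>) (S 0 1 0 0 1 0)) t) = table Sigma13 CARD('a) t"
proof -
  interpret corner_plane \<epsilon> 0 0 1 0 \<epsilon> 1 0 0 1 0 by unfold_locales
  have q: "q2 (b,c) = \<epsilon> * b^2 - c^2" "q3 (b,c) = - (c^2 * b * \<epsilon>)" for b c
    by (simp_all add: q2_def q3_def pL_def pM_def pU_def pV_def pW_def power2_eq_square algebra_simps)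
  have ne: "\<epsilon> \<noteq> s^2" for s using card_norm_eps(3) by metis
  interpret irreducible_plane \<epsilon> 0 0 1 0 \<epsilon> 1 0 0 1 0
  proof unfold_locales
    fix p assume "p \<in> P1" "q2 p = 0" then show "q3 p \<noteq> 0" using ne by (elim P1_cases) (simp_all add: q)
  next
    fix x y show "\<exists>p\<in>P1. (x * fst p + y * snd p) * q2 p + q3 p \<noteq> 0"
    proof (cases "x = 0")
      case False then show ?thesis by (intro bexI[of _ "(1,0)"]) (simp_all add: q)
    next
      case x: True
      show ?thesis
      proof (cases "y = 0")
        case False then show ?thesis by (intro bexI[of _ "(0,1)"]) (simp_all add: q)
      next
        case True then show ?thesis using x by (intro bexI[of _ "(1,1)"]) (simp_all add: q)
      qed
    qed
  qed
  have hn: "card hyp_points = half + 1" "card ell_points = half + 1"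
    unfolding hyp_points_def ell_points_def card_P1_Collect using ne card_norm_eps(1,2) by (simp_all add: q)
  have F: "line_count o16 = (if CARD('a) mod 3 = 2 then 3 else 1)"
  proof -
    define f where "f r = (3 * r * (- 9 * r / 8) - \<epsilon>, - 9 * r / 8)" for r :: 'a
    have K: "det (S x 0 0 1 0 \<epsilon>) = x * \<epsilon>" "ddet x 0 0 1 0 \<epsilon> y 1 0 0 1 0 = \<epsilon> * y"
      "ddet y 1 0 0 1 0 x 0 0 1 0 \<epsilon> = - (x + \<epsilon>)" "det (S y 1 0 0 1 0) = - y" for x y :: 'a
      by (simp_all add: det_S ddet_def algebra_simps)
    have eight: "(8::'a) \<noteq> 0" using eight by simp
    have y0: "(\<exists>k \<alpha> \<beta>. x * \<epsilon> = k * \<alpha>^3 \<and> \<epsilon> * 0 = 3 * k * \<alpha>^2 * \<beta> \<and> - (x + \<epsilon>) = 3 * k * \<alpha> * \<beta>^2 \<and> - 0 = k * \<beta>^3) \<longleftrightarrow> x = - \<epsilon>" for x :: 'a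
    proof
      assume "x = - \<epsilon>"
      then show "\<exists>k \<alpha> \<beta>. x * \<epsilon> = k * \<alpha>^3 \<and> \<epsilon> * 0 = 3 * k * \<alpha>^2 * \<beta> \<and> - (x + \<epsilon>) = 3 * k * \<alpha> * \<beta>^2 \<and> - 0 = k * \<beta>^3"
        by (intro exI[of _ "x * \<epsilon>"] exI[of _ 1] exI[of _ 0]) simp
    qed (auto simp: eq_neg_iff_add_eq_0)
    have y1: "(\<exists>k \<alpha> \<beta>. x * \<epsilon> = k * \<alpha>^3 \<and> \<epsilon> * y = 3 * k * \<alpha>^2 * \<beta> \<and> - (x + \<epsilon>) = 3 * k * \<alpha> * \<beta>^2 \<and> - y = k * \<beta>^3) \<longleftrightarrow> (\<exists>r. 3 * r^2 = - \<epsilon> \<and> (x,y) = f r)" 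
      if y: "y \<noteq> 0" for x y :: 'a
    proof -
      have "x * \<epsilon> = r^3 * - y \<and> \<epsilon> * y = 3 * r^2 * - y \<and> - (x + \<epsilon>) = 3 * r * - y \<longleftrightarrow> 3 * r^2 = - \<epsilon> \<and> (x,y) = f r" for r
      proof
        assume h: "x * \<epsilon> = r^3 * - y \<and> \<epsilon> * y = 3 * r^2 * - y \<and> - (x + \<epsilon>) = 3 * r * - y"
        then have "y * \<epsilon> = y * - (3 * r^2)" by (simp add: mult_ac)
        then have e: "\<epsilon> = - (3 * r^2)" using mult_left_cancel[OF y, of \<epsilon> "- (3 * r^2)"] by blast
        have x: "x = 3 * r * y - \<epsilon>" using h by (simp add: algebra_simps eq_neg_iff_add_eq_0)
        have "(3 * r * y - \<epsilon>) * \<epsilon> = r^3 * - y" using h unfolding x by blast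
        moreover have "r^3 * (8 * y + 9 * r) = - ((3 * r * y - \<epsilon>) * \<epsilon> - r^3 * - y)"
          unfolding e by (simp add: power2_eq_square power3_eq_cube algebra_simps)
        ultimately have "r^3 * (8 * y + 9 * r) = 0" by simp
        moreover have "r \<noteq> 0" using e eps_nonzero by auto
        ultimately have "y * 8 + 9 * r = 0" by (simp add: mult.commute)
        then have y': "y = - 9 * r / 8" using linear_root_iff[OF eight, of y "9 * r"] by simp
        show "3 * r^2 = - \<epsilon> \<and> (x,y) = f r" using e x y' unfolding f_def by simp
      next
        assume h: "3 * r^2 = - \<epsilon> \<and> (x,y) = f r"
        then have e: "\<epsilon> = - (3 * r^2)" by simp
        have x: "x = 3 * r * y - \<epsilon>" and y': "y = - 9 * r / 8" using h by (auto simp: f_def)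
        have y8: "8 * y = - 9 * r" unfolding y' using eight by simp
        have "x * \<epsilon> + r^3 * y = - (r^3) * (8 * y + 9 * r)" unfolding x e by (simp add: power2_eq_square power3_eq_cube algebra_simps)
        then have "x * \<epsilon> + r^3 * y = 0" unfolding y8 by simp
        then have "x * \<epsilon> = r^3 * - y" by (simp add: eq_neg_iff_add_eq_0)
        moreover have "- (x + \<epsilon>) = 3 * r * - y" unfolding x by simp
        moreover have "\<epsilon> * y = 3 * r^2 * - y" unfolding e by simp
        ultimately show "x * \<epsilon> = r^3 * - y \<and> \<epsilon> * y = 3 * r^2 * - y \<and> - (x + \<epsilon>) = 3 * r * - y" by blast
      qed
      then show ?thesis using y by (subst cube_iff) simp_all
    qed
    have fy: "snd (f r) \<noteq> 0" if h: "3 * r^2 = - \<epsilon>" for r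
    proof -
      have "(3::'a) \<noteq> 0" "r \<noteq> 0" using h eps_nonzero by auto
      moreover have "(9::'a) = 3 * 3" by simp
      ultimately show ?thesis using eight unfolding f_def by (metis divide_eq_0_iff mult_eq_0_iff neg_equal_0_iff_equal snd_conv)
    qed
    have P: "(\<exists>k \<alpha> \<beta>. fst p * \<epsilon> = k * \<alpha>^3 \<and> \<epsilon> * snd p = 3 * k * \<alpha>^2 * \<beta> \<and> - (fst p + \<epsilon>) = 3 * k * \<alpha> * \<beta>^2 \<and> - snd p = k * \<beta>^3) \<longleftrightarrow>
      p = (- \<epsilon>, 0) \<or> (\<exists>r. 3 * r^2 = - \<epsilon> \<and> p = f r)" for p :: "'a \<times> 'a"
    proof (cases "snd p = 0")
      case True
      have "\<not> (\<exists>r. 3 * r^2 = - \<epsilon> \<and> p = f r)" using fy True by metis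
      moreover have "p = (- \<epsilon>, 0) \<longleftrightarrow> fst p = - \<epsilon>" using True by (simp add: prod_eq_iff)
      ultimately show ?thesis using y0[of "fst p"] unfolding True by blast
    next
      case False
      then have "p \<noteq> (- \<epsilon>, 0)" by auto
      then show ?thesis using y1[OF False, of "fst p"] by simp
    qed
    have "line_count o16 = card (insert (- \<epsilon>, 0) (f ` {r. 3 * r^2 = - \<epsilon>}))"
      unfolding count_o16 K P by (rule arg_cong[where f=card]) auto
    also have "\<dots> = Suc (card (f ` {r. 3 * r^2 = - \<epsilon>}))" using fy by (subst card_insert_disjoint) (auto, metis snd_conv)
    also have "card (f ` {r. 3 * r^2 = - \<epsilon>}) = card {r. 3 * r^2 = - \<epsilon>}"
    proof (rule card_image, rule inj_onI)
      fix r s assume r: "r \<in> {r. 3 * r^2 = - \<epsilon>}" "f r = f s"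
      then have "(3::'a) \<noteq> 0" using eps_nonzero by auto
      moreover have "(9::'a) = 3 * 3" by simp
      ultimately have "(9::'a) \<noteq> 0" by (metis mult_eq_0_iff)
      moreover have "(72::'a) = 9 * 8" by simp
      ultimately have "(72::'a) \<noteq> 0" using eight by (metis mult_eq_0_iff)
      then show "r = s" using r(2) unfolding f_def by simp
    qed
    also have "card {r. 3 * r^2 = - \<epsilon>} = (if CARD('a) mod 3 = 2 then 2 else 0)"
    proof (cases "(3::'a) = 0")
      case True
      then have "{r. 3 * r^2 = - \<epsilon>} = {}" using eps_nonzero by auto
      then show ?thesis using True three_eq_0_iff[OF odd_card] by (simp only: card.empty) simp
    next
      case False
      have e: "3 * r^2 = - \<epsilon> \<longleftrightarrow> r^2 = - \<epsilon> / 3" for r using False by (auto simp: field_simps)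
      have "is_square (- \<epsilon> / 3) \<longleftrightarrow> is_square (\<epsilon> * (- 3))" using is_square_quotient[of "- \<epsilon>" 3] False eps_nonzero by simp
      also have "\<dots> \<longleftrightarrow> \<not> is_square (- 3 :: 'a)" using False by (intro is_square_eps_mult) simp
      also have "\<dots> \<longleftrightarrow> CARD('a) mod 3 = 2"
        using is_square_minus_3_iff[OF odd_card False] three_eq_0_iff[OF odd_card] False by linarith
      finally show ?thesis unfolding e card_sqrts[OF two] using False eps_nonzero by simp
    qed
    finally show ?thesis by simp
  qed
  have r: "rank_one_type (0 + s * 1) (0 + s * 0) (1 + s * 0) (0 + s * 1) (\<epsilon> + s * 0) = (if is_square (s^2 - \<epsilon>) then o8_1 else o8_2)" "rank_one_type 1 0 0 1 0 = o8_1" for s :: 'a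
    using card_norm_eps(3)[of s] by (simp_all add: rank_one_type_def)
  show ?thesis unfolding plane_def[symmetric] dist_plane r
    by (cases "CARD('a) mod 3 = 2"; cases t)
      (simp_all add: table_def table_entries_def Let_def count_outside generic_types_def line_counts hn F if_type_eq card_norm_eps,
       simp_all add: CARD_half field_simps power2_eq_square)
qed

end

subsection \<open>The planes \<open>\<Sigma>\<^sub>1\<^sub>4\<close> and \<open>\<Sigma>\<^sub>1\<^sub>4'\<close>\<close>

text \<open>For a fixed root \<open>\<rho>\<close> the elements \<open>a + b \<rho>\<close> form a field. If
  \<open>a\<^sup>2 + 3 b\<^sup>2 = 0\<close>, then a nonzero \<open>a + b \<rho>\<close> lies in the ground
  field.\<close>

lemma adjoin_closed:
  fixes \<rho> :: "'a::field alg_closure"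
  assumes \<rho>: "\<rho>^2 = - 3"
  defines "A \<equiv> {to_ac a + to_ac b * \<rho> | a b. True}"
  shows "A \<subseteq> adjoin_sqrt_minus3" "to_ac a \<in> A" "x \<in> A \<Longrightarrow> y \<in> A \<Longrightarrow> x + y \<in> A" "x \<in> A \<Longrightarrow> y \<in> A \<Longrightarrow> x - y \<in> A"
    "x \<in> A \<Longrightarrow> y \<in> A \<Longrightarrow> x * y \<in> A" "x \<in> A \<Longrightarrow> inverse x \<in> A"
proof -
  have I: "z \<in> A" if "z = to_ac a + to_ac b * \<rho>" for z a b unfolding A_def using that by blast
  show "A \<subseteq> adjoin_sqrt_minus3" unfolding A_def adjoin_sqrt_minus3_def using \<rho> by blast
  show "to_ac a \<in> A" by (rule I[of _ a 0]) simp
  {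
    assume "x \<in> A" "y \<in> A"
    then obtain a b a' b' where xy: "x = to_ac a + to_ac b * \<rho>" "y = to_ac a' + to_ac b' * \<rho>" unfolding A_def by blast
    show "x + y \<in> A" by (rule I[of _ "a + a'" "b + b'"]) (simp add: xy algebra_simps)
    show "x - y \<in> A" by (rule I[of _ "a - a'" "b - b'"]) (simp add: xy algebra_simps)
    have "x * y = to_ac a * to_ac a' + to_ac b * to_ac b' * \<rho>^2 + (to_ac a * to_ac b' + to_ac b * to_ac a') * \<rho>"
      unfolding xy by (simp add: power2_eq_square algebra_simps)
    then show "x * y \<in> A" unfolding \<rho> by (intro I[of _ "a * a' - 3 * (b * b')" "a * b' + b * a'"]) (simp add: algebra_simps)
  }
  assume "x \<in> A"
  then obtain a b where x: "x = to_ac a + to_ac b * \<rho>" unfolding A_def by blast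
  have "x * (to_ac a - to_ac b * \<rho>) = to_ac a * to_ac a - to_ac b * to_ac b * \<rho>^2" unfolding x by (simp add: power2_eq_square algebra_simps)
  then have n: "x * (to_ac a - to_ac b * \<rho>) = to_ac (a * a + 3 * (b * b))" unfolding \<rho> by simp
  show "inverse x \<in> A"
  proof (cases "a * a + 3 * (b * b) = 0")
    case True
    then have "x = 0 \<or> to_ac a - to_ac b * \<rho> = 0" using n by simp
    then have "x = to_ac 0 \<or> x = to_ac (a + a)" unfolding x by auto
    then obtain z where z: "x = to_ac z" by blast
    show ?thesis by (rule I[of _ "inverse z" 0]) (simp only: z to_ac_inverse to_ac_0 mult_zero_left add_0_right)
  next
    case False
    let ?N = "a * a + 3 * (b * b)"
    have "x * (to_ac (a / ?N) + to_ac (- b / ?N) * \<rho>) = x * (to_ac a - to_ac b * \<rho>) / to_ac ?N"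
      by (simp only: to_ac_divide to_ac_minus) (simp add: algebra_simps add_divide_distrib diff_divide_distrib del: to_ac_add to_ac_mult)
    also have "\<dots> = 1" unfolding n by (rule divide_self) (use False in \<open>simp only: to_ac_eq_0_iff not_False_eq_True\<close>)
    finally have "inverse x = to_ac (a / ?N) + to_ac (- b / ?N) * \<rho>" by (rule inverse_unique)
    then show ?thesis by (rule I)
  qed
qed

text \<open>A line whose cubic is a cube would make \<open>(s + 1) / (s - 1)\<close> a cube, where \<open>s\<^sup>2 = c\<close>.\<close>

lemma cond_c_no_cube:
  fixes c y r :: "'a::field"
  assumes c: "cond_c c" and two: "(2::'a) \<noteq> 0" and e: "y * (r^3 + 3 * r * c) = c + 1" "y * (c + 3 * r^2) = 2"
  shows False
proof -
  obtain s where s: "s \<in> adjoin_sqrt_minus3" "s^2 = to_ac c" and nc: "\<not> (\<exists>t\<in>adjoin_sqrt_minus3. t^3 = (s + 1) / (s - 1))"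
    and c1: "c \<noteq> 1" using c unfolding cond_c_def by blast
  define Y R where "Y = to_ac y" and "R = to_ac r"
  have "to_ac (y * (r^3 + 3 * r * c)) = to_ac (c + 1)" "to_ac (y * (c + 3 * r^2)) = to_ac 2" unfolding e by (rule refl)+
  then have E: "Y * (R^3 + 3 * R * s^2) = s^2 + 1" "Y * (s^2 + 3 * R^2) = 2" unfolding s(2) Y_def R_def by simp_all
  have "Y * (R + s)^3 = Y * (R^3 + 3 * R * s^2) + s * (Y * (s^2 + 3 * R^2))" "Y * (R - s)^3 = Y * (R^3 + 3 * R * s^2) - s * (Y * (s^2 + 3 * R^2))"
    by (simp_all add: power2_eq_square power3_eq_cube algebra_simps)
  then have F: "Y * (R + s)^3 = (s + 1)^2" "Y * (R - s)^3 = (s - 1)^2" unfolding E by (simp_all add: power2_eq_square algebra_simps)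
  have s1: "s + 1 \<noteq> 0" "s - 1 \<noteq> 0"
  proof -
    have "s^2 \<noteq> 1" using c1 s(2) by simp
    moreover have "s^2 - 1 = (s + 1) * (s - 1)" by (simp add: power2_eq_square algebra_simps)
    ultimately show "s + 1 \<noteq> 0" "s - 1 \<noteq> 0" by auto
  qed
  have Rs: "R + s \<noteq> 0" "Y \<noteq> 0" using F s1 by auto
  define t where "t = ((s + 1) * inverse (s - 1)) * ((R - s) * inverse (R + s))"
  have "t^3 * ((s - 1)^3 * (Y * (R + s)^3)) = (s + 1)^3 * (Y * (R - s)^3)"
  proof -
    have "t * ((s - 1) * (R + s)) = ((s + 1) * (R - s)) * (inverse (s - 1) * (s - 1)) * (inverse (R + s) * (R + s))"
      unfolding t_def by (simp only: mult_ac)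
    then have "t * ((s - 1) * (R + s)) = (s + 1) * (R - s)"
      by (simp only: left_inverse[OF s1(2)] left_inverse[OF Rs(1)] mult_1_right)
    then have "(t * ((s - 1) * (R + s)))^3 = ((s + 1) * (R - s))^3" by simp
    then have "t^3 * (s - 1)^3 * (R + s)^3 = (s + 1)^3 * (R - s)^3" by (simp add: power_mult_distrib mult_ac)
    then have "Y * (t^3 * (s - 1)^3 * (R + s)^3) = Y * ((s + 1)^3 * (R - s)^3)" by (rule arg_cong)
    then show ?thesis by (simp only: mult_ac)
  qed
  then have "t^3 * ((s - 1) * ((s - 1)^2 * (s + 1)^2)) = (s + 1) * ((s - 1)^2 * (s + 1)^2)"
    unfolding F by (simp add: power2_eq_square power3_eq_cube mult_ac)
  then have "t^3 * (s - 1) * ((s - 1)^2 * (s + 1)^2) = (s + 1) * ((s - 1)^2 * (s + 1)^2)" by (simp only: mult.assoc)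
  then have "t^3 * (s - 1) = s + 1" using s1 by (simp only: mult_cancel_right) simp
  then have "t^3 = (s + 1) / (s - 1)" using nonzero_eq_divide_eq[OF s1(2)] by blast
  moreover have "t \<in> adjoin_sqrt_minus3"
  proof -
    obtain a b \<rho> where \<rho>: "\<rho>^2 = - 3" "s = to_ac a + to_ac b * \<rho>" using s(1) unfolding adjoin_sqrt_minus3_def by blast
    note cl = adjoin_closed[OF \<rho>(1)]
    have sA: "s \<in> {to_ac a + to_ac b * \<rho> | a b. True}" using \<rho>(2) by blast
    note oA = cl(2)[of 1, unfolded to_ac_1]
    have "t \<in> {to_ac a + to_ac b * \<rho> | a b. True}"
      unfolding t_def R_def by (intro cl(5) cl(6) cl(3)[OF sA oA] cl(4)[OF sA oA] cl(3)[OF cl(2) sA] cl(4)[OF cl(2) sA])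
    then show ?thesis using cl(1) by blast
  qed
  ultimately show False using nc by blast
qed

context odd_field
begin

text \<open>Here \<open>- q2 = d\<^sup>2 - c b\<^sup>2\<close>, and \<open>c\<close> is a square exactly if
  \<open>-3\<close> is, that is for \<open>q \<equiv> 1\<close> modulo three. There are no cubes at
  all.\<close>

lemma dist_Sigma14:
  assumes q3: "CARD('a) mod 3 \<noteq> 0" and cc: "cond_c (c::'a)"
  shows "rat_of_nat (type_count (span3 (S 1 0 0 0 0 0) (S 0 1 0 c 0 1) (S 0 1 0 0 1 0)) t) = table Sigma14 CARD('a) t"
proof -
  have three: "(3::'a) \<noteq> 0" using q3 three_eq_0_iff[OF odd_card] by simp
  have c: "c \<noteq> 0" "c \<noteq> 1" "is_square (- 3 * c)" using cc unfolding cond_c_def by blast+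
  have csq: "is_square c \<longleftrightarrow> CARD('a) mod 3 = 1"
    using is_square_mult_iff[OF odd_card, of "- 3" c] is_square_minus_3_iff[OF odd_card three] three c by simp
  interpret corner_plane \<epsilon> 1 0 c 0 1 1 0 0 1 0 by unfold_locales
  have q: "q2 (b,d) = c * b^2 - d^2" "q3 (b,d) = - ((b + d)^2 * b)" for b d
    by (simp_all add: q2_def q3_def pL_def pM_def pU_def pV_def pW_def power2_eq_square algebra_simps)
  have p1: "1 + s \<noteq> 0" if "s^2 = c" for s :: 'a
  proof
    assume "1 + s = 0"
    then have "s = - 1" by (simp add: eq_neg_iff_add_eq_0 add.commute)
    then show False using that c(2) by simp
  qed
  interpret irreducible_plane \<epsilon> 1 0 c 0 1 1 0 0 1 0
  proof unfold_locales
    fix p assume p: "p \<in> P1" "q2 p = 0"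
    consider "p = (0,1)" | t where "p = (1,t)" using P1_cases[OF p(1)] by blast
    then show "q3 p \<noteq> 0"
    proof cases
      case 1 then show ?thesis using p(2) by (simp add: q)
    next
      case (2 t)
      have "t^2 = c" using p(2) unfolding 2 q by simp
      then have "1 + t \<noteq> 0" by (rule p1)
      then show ?thesis unfolding 2 q by simp
    qed
  next
    fix x y show "\<exists>p\<in>P1. (x * fst p + y * snd p) * q2 p + q3 p \<noteq> 0"
    proof (cases "y = 0")
      case False then show ?thesis by (intro bexI[of _ "(0,1)"]) (simp_all add: q)
    next
      case y: True
      show ?thesis
      proof (cases "x = 0")
        case False then show ?thesis using y c by (intro bexI[of _ "(1,-1)"]) (simp_all add: q)
      next
        case True then show ?thesis using y by (intro bexI[of _ "(1,0)"]) (simp_all add: q)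
      qed
    qed
  qed
  have hn: "card hyp_points = (if CARD('a) mod 3 = 1 then half else half + 1)" "card ell_points = (if CARD('a) mod 3 = 1 then half else half + 1)"
  proof -
    have e: "{t. q2 (1,t) \<noteq> 0 \<and> is_square (- q2 (1,t))} = {s. s^2 \<noteq> c \<and> is_square (s^2 - c)}" "{t. \<not> is_square (- q2 (1,t))} = {s. \<not> is_square (s^2 - c)}"
      by (auto simp: q)
    have f: "q2 (0,1) \<noteq> 0 \<and> is_square (- q2 (0,1))" by (simp add: q)
    show "card hyp_points = (if CARD('a) mod 3 = 1 then half else half + 1)" "card ell_points = (if CARD('a) mod 3 = 1 then half else half + 1)"
      unfolding hyp_points_def ell_points_def card_P1_Collect e card_norm_form[OF c(1)] csq using f half_pos by simp_all
  qed
  have F: "line_count o16 = 0"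
  proof -
    have K: "det (S x 1 0 c 0 1) = x * c - 1" "ddet x 1 0 c 0 1 y 1 0 0 1 0 = y * c - 2"
      "ddet y 1 0 0 1 0 x 1 0 c 0 1 = - (x + 1)" "det (S y 1 0 0 1 0) = - y" for x y :: 'a
      by (simp_all add: det_S ddet_def algebra_simps)
    have "\<not> (\<exists>k \<alpha> \<beta>. x * c - 1 = k * \<alpha>^3 \<and> y * c - 2 = 3 * k * \<alpha>^2 * \<beta> \<and> - (x + 1) = 3 * k * \<alpha> * \<beta>^2 \<and> - y = k * \<beta>^3)" for x y :: 'a
    proof (cases "y = 0")
      case True then show ?thesis using two two[THEN not_sym] by auto
    next
      case False
      have "\<not> (x * c - 1 = r^3 * - y \<and> y * c - 2 = 3 * r^2 * - y \<and> - (x + 1) = 3 * r * - y)" for r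
      proof
        assume h: "x * c - 1 = r^3 * - y \<and> y * c - 2 = 3 * r^2 * - y \<and> - (x + 1) = 3 * r * - y"
        have h1: "r^3 * y = 1 - x * c" "3 * r * y = x + 1" using h by (metis minus_diff_eq minus_minus mult_minus_right)+
        have "y * c + 3 * r^2 * y = 2 + ((y * c - 2) - 3 * r^2 * - y)" by simp
        then have h2: "y * (c + 3 * r^2) = 2" using h by (simp add: algebra_simps)
        have "y * (r^3 + 3 * r * c) = r^3 * y + (3 * r * y) * c" by (simp add: algebra_simps)
        also have "\<dots> = c + 1" unfolding h1 by (simp add: algebra_simps)
        finally show False using cond_c_no_cube[OF cc two _ h2] by blast
      qed
      then show ?thesis using False by (subst cube_iff) simp_all
    qed
    then show ?thesis unfolding count_o16 K by (simp only: simp_thms Collect_empty_eq card.empty) simp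
  qed
  have r: "rank_one_type (1 + s * 1) (0 + s * 0) (c + s * 0) (0 + s * 1) (1 + s * 0) = (if s^2 = c then o9 else if is_square (s^2 - c) then o8_1 else o8_2)" "rank_one_type 1 0 0 1 0 = o8_1" for s :: 'a
    using p1[of s] by (simp_all add: rank_one_type_def)
  have s1: "{s. (if s^2 = c then o9 else if is_square (s^2 - c) then o8_1 else o8_2) = o9} = {s. s^2 = c}"
    "{s. (if s^2 = c then o9 else if is_square (s^2 - c) then o8_1 else o8_2) = o8_1} = {s. s^2 \<noteq> c \<and> is_square (s^2 - c)}"
    "{s. (if s^2 = c then o9 else if is_square (s^2 - c) then o8_1 else o8_2) = o8_2} = {s. \<not> is_square (s^2 - c)}"
    by auto
  note s2 = card_norm_form[OF c(1)] card_sqrts[OF two, of c]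
  show ?thesis unfolding plane_def[symmetric] dist_plane r
    using half_pos c(1) q3
    by (cases "CARD('a) mod 3 = 1"; cases t)
      (simp_all only: s1 s2 csq,
       simp_all add: table_def table_entries_def Let_def count_outside generic_types_def line_counts hn F if_type_eq,
       simp_all add: CARD_half field_simps power2_eq_square of_nat_diff)
qed

text \<open>In characteristic three \<open>- q2 = b\<^sup>2\<close>, and the lines whose cubic is a cube are
  those with \<open>y = 0\<close>, since cubing is bijective.\<close>

lemma dist_Sigma14':
  assumes q3: "CARD('a) mod 3 = 0"
  shows "rat_of_nat (type_count (span3 (S 1 0 0 0 0 0) (S 0 0 0 1 0 (-1)) (S 0 1 1 2 1 (-1::'a))) t) = table Sigma14' CARD('a) t"
proof -
  have three: "(3::'a) = 0" using q3 three_eq_0_iff[OF odd_card] by simp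
  have three': "3 * x = (0::'a)" for x using three by simp
  interpret corner_plane \<epsilon> 0 0 1 0 "-1" 1 1 2 1 "-1" by unfold_locales
  have q: "q2 (b,d) = - (b^2)" "q3 (b,d) = d^3" for b d
  proof -
    have "q2 (b,d) = - (b^2) - 3 * (b * d + d^2)"
      by (simp add: q2_def pU_def pV_def pW_def power2_eq_square algebra_simps)
    then show "q2 (b,d) = - (b^2)" unfolding three' by simp
    show "q3 (b,d) = d^3"
      by (simp add: q3_def pL_def pM_def pU_def pV_def pW_def power2_eq_square power3_eq_cube algebra_simps)
  qed
  interpret irreducible_plane \<epsilon> 0 0 1 0 "-1" 1 1 2 1 "-1"
  proof unfold_locales
    fix p assume "p \<in> P1" "q2 p = 0" then show "q3 p \<noteq> 0" by (elim P1_cases) (simp_all add: q)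
  next
    fix x y show "\<exists>p\<in>P1. (x * fst p + y * snd p) * q2 p + q3 p \<noteq> 0" by (intro bexI[of _ "(0,1)"]) (simp_all add: q)
  qed
  have hn: "card hyp_points = CARD('a)" "card ell_points = 0"
    unfolding hyp_points_def ell_points_def card_P1_Collect by (simp_all add: q)
  have F: "line_count o16 = CARD('a)"
  proof -
    have "det (S x 0 0 1 0 (-1)) = - x" "ddet x 0 0 1 0 (-1) y 1 1 2 1 (-1) = - y - 3 * x"
      "ddet y 1 1 2 1 (-1) x 0 0 1 0 (-1) = - (3 * (x + y))" "det (S y 1 1 2 1 (-1)) = 1 - 3 * y" for x y :: 'a
      by (simp_all add: det_S ddet_def algebra_simps)
    note K = this[unfolded three' diff_0_right minus_zero]
    have "line_count o16 = card {p::'a\<times>'a. \<exists>r. - fst p = r^3 * 1 \<and> - snd p = 3 * r^2 * 1 \<and> 0 = 3 * r * 1}"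
      unfolding count_o16 K by (subst cube_iff) simp_all
    also have "{p::'a\<times>'a. \<exists>r. - fst p = r^3 * 1 \<and> - snd p = 3 * r^2 * 1 \<and> 0 = 3 * r * 1} = range (\<lambda>r. (- (r^3), 0))"
    proof -
      have "- fst p = r^3 * 1 \<and> - snd p = 3 * r^2 * 1 \<and> 0 = 3 * r * 1 \<longleftrightarrow> p = (- (r^3), 0)" for p and r :: 'a
      proof -
        have "- fst p = r^3 \<longleftrightarrow> fst p = - (r^3)" by (metis minus_minus)
        then show ?thesis unfolding three' by (simp add: prod_eq_iff)
      qed
      then show ?thesis by blast
    qed
    also have "card \<dots> = CARD('a)"
    proof (rule card_image, rule injI)
      fix r s :: 'a assume rs: "(- (r^3), 0::'a) = (- (s^3), 0)"
      have "(r - s)^3 = r^3 - s^3 - 3 * (r * s * (r - s))" by (simp add: power3_eq_cube algebra_simps)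
      then have "(r - s)^3 = 0" unfolding three' using rs by simp
      then show "r = s" by simp
    qed
    finally show ?thesis .
  qed
  have r: "rank_one_type (0 + s * 1) (0 + s * 1) (1 + s * 2) (0 + s * 1) (-1 + s * -1) = o8_1" "rank_one_type 1 1 2 1 (-1) = o9" for s :: 'a
  proof -
    have "(0 + s * 1)^2 - (1 + s * 2) * (-1 + s * -1) = 1 + 3 * (s + s^2)" by (simp add: power2_eq_square algebra_simps)
    then have e: "(0 + s * 1)^2 - (1 + s * 2) * (-1 + s * -1) = 1" unfolding three' by simp
    then have "(0 + s * 1)^2 \<noteq> (1 + s * 2) * (-1 + s * -1)" by (metis diff_self zero_neq_one)
    then show "rank_one_type (0 + s * 1) (0 + s * 1) (1 + s * 2) (0 + s * 1) (-1 + s * -1) = o8_1"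
      unfolding rank_one_type_def e by simp
    have "(1::'a)^2 - 2 * -1 = 3" by simp
    then have f: "(1::'a)^2 = 2 * -1" using three by (metis eq_iff_diff_eq_0)
    have "(2 * 1 * 1 * 1) - (1^2 * -1 + 1^2 * 2) = (1::'a)" by simp
    then have "1^2 * -1 + 1^2 * 2 \<noteq> (2 * 1 * 1 * 1 :: 'a)" by (metis diff_self zero_neq_one)
    then show "rank_one_type 1 1 2 1 (-1) = o9" unfolding rank_one_type_def using f by (simp only: simp_thms if_True if_False)
  qed
  show ?thesis unfolding plane_def[symmetric] dist_plane r
    by (cases t) (simp_all add: table_def table_entries_def Let_def count_outside generic_types_def line_counts hn F field_simps power2_eq_square)
qed

end

section \<open>The plane \<open>\<Sigma>\<^sub>5\<close>\<close>

context odd_field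
begin

text \<open>The singular points other than the second point of rank one correspond to the roots of a monic
  quadratic with coefficients \<open>-u\<close> and \<open>y\<close>.\<close>

lemma ltype_Sigma5:
  fixes u y :: 'a
  defines "L \<equiv> span2 (S (1 - u) 0 1 1 1 1) (S y 0 0 (-1) 0 0)"
  shows "y = 0 \<Longrightarrow> u = 0 \<Longrightarrow> ltype L = o9" "y = 0 \<Longrightarrow> u \<noteq> 0 \<Longrightarrow> ltype L = (if is_square u then o8_1 else o8_2)"
    "m \<noteq> n \<Longrightarrow> m \<noteq> 0 \<Longrightarrow> n \<noteq> 0 \<Longrightarrow> u = m + n \<Longrightarrow> y = m * n \<Longrightarrow> ltype L = (if is_square m \<and> is_square n then o14_1 else o14_2)"
    "m \<noteq> 0 \<Longrightarrow> u = 2 * m \<Longrightarrow> y = m^2 \<Longrightarrow> ltype L = (if is_square m then o13_1 else o13_2)"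
    "y \<noteq> 0 \<Longrightarrow> (\<And>m. m * m - u * m + y \<noteq> 0) \<Longrightarrow> ltype L = (if is_square y then o15_1 else o15_2)"
proof -
  define Q where "Q t = y * t^2 - u * t + 1" for t
  have i: "indep2 (S (1 - u) 0 1 1 1 1) (S y 0 0 (-1) 0 0)" by (simp add: indep2_S)
  have d: "det (S (1 - u + t * y) 0 1 (1 + t * -1) 1 1) = - Q t" for t
    by (simp add: det_S Q_def power2_eq_square algebra_simps)
  have t0: "t \<noteq> 0" if "Q t = 0" for t using that by (auto simp: Q_def)
  have m: "1^2 - (1 + t * -1) * 1 = t" for t :: 'a by simp
  have r: "rank_one (S (1 - u + t * y) 0 1 (1 + t * -1) 1 1) \<longleftrightarrow> False" for t
  proof -
    have "\<not> rank_one (S (1 - u + t * y) 0 1 (1 + t * -1) 1 1)"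
    proof
      assume h: "rank_one (S (1 - u + t * y) 0 1 (1 + t * -1) 1 1)"
      have "- Q t = 0" using h unfolding rank_one_S' d by blast
      then have "Q t = 0" by simp
      moreover have "1^2 = (1 + t * -1) * 1" using h unfolding rank_one_S by blast
      then have "t = 0" using m[of t] by simp
      ultimately show False using t0 by blast
    qed
    then show ?thesis by simp
  qed
  have sp: "split (S (1 - u + t * y) 0 1 (1 + t * -1) 1 1) \<longleftrightarrow> is_square t" if q: "Q t = 0" for t
  proof -
    have d0: "det (S (1 - u + t * y) 0 1 (1 + t * -1) 1 1) = 0" using d q by simp
    show ?thesis using split_S[OF d0] split_minor[OF d0] t0[OF q] unfolding m by blast
  qed
  have h1: "hyperbolic (S (1 - u + t * y) 0 1 (1 + t * -1) 1 1) \<longleftrightarrow> Q t = 0 \<and> is_square t"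
    "elliptic (S (1 - u + t * y) 0 1 (1 + t * -1) 1 1) \<longleftrightarrow> Q t = 0 \<and> \<not> is_square t" for t
    unfolding hyperbolic_def elliptic_def r d using sp[of t] by auto
  have r2: "rank_one (S y 0 0 (-1) 0 0) \<longleftrightarrow> y = 0" by (auto simp: rank_one_S)
  have h2: "hyperbolic (S y 0 0 (-1) 0 0) \<longleftrightarrow> y \<noteq> 0 \<and> is_square y" "elliptic (S y 0 0 (-1) 0 0) \<longleftrightarrow> \<not> is_square y"
    unfolding hyperbolic_S elliptic_S r2 by (auto simp: det_zero_S)
  have P: "pts rank_one L = card {t::'a. False} + (if y = 0 then 1 else 0)"
    "pts hyperbolic L = card {t. Q t = 0 \<and> is_square t} + (if y \<noteq> 0 \<and> is_square y then 1 else 0)"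
    "pts elliptic L = card {t. Q t = 0 \<and> \<not> is_square t} + (if \<not> is_square y then 1 else 0)"
    unfolding L_def pts_S_simps[OF i] mult_zero_right add_0_left add_0_right mult_1_right r h1 r2 h2 by (rule refl)+
  have ns: "\<not> all_singular L" unfolding L_def by (rule not_all_singularI[where s=1 and t=0]) (simp add: det_S)
  have inv: "is_square (1 / k) \<longleftrightarrow> is_square k" if "k \<noteq> 0" for k :: 'a using is_square_quotient[of 1 k] that by simp
  {
    assume y: "y = 0" and u: "u = 0"
    have "Q t \<noteq> 0" for t unfolding Q_def y u by simp
    then show "ltype L = o9" using P ns y by (simp add: ltype_def Let_def)
  }
  {
    assume y: "y = 0" and u: "u \<noteq> 0"
    have "Q t = 0 \<longleftrightarrow> t = 1 / u" for t unfolding Q_def y using u by (auto simp: field_simps)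
    then show "ltype L = (if is_square u then o8_1 else o8_2)" using P ns y u inv[OF u] by (simp add: ltype_def Let_def Collect_conv_if)
  }
  {
    assume h: "m \<noteq> n" "m \<noteq> 0" "n \<noteq> 0" "u = m + n" "y = m * n"
    have "Q t = (m * t - 1) * (n * t - 1)" for t unfolding Q_def h(4,5) by (simp add: power2_eq_square algebra_simps)
    then have "Q t = 0 \<longleftrightarrow> m * t = 1 \<or> n * t = 1" for t by (simp only: mult_eq_0_iff right_minus_eq)
    moreover have "m * t = 1 \<longleftrightarrow> t = 1 / m" "n * t = 1 \<longleftrightarrow> t = 1 / n" for t using h(2,3) by (auto simp: field_simps)
    ultimately have Q: "Q t = 0 \<longleftrightarrow> t = 1 / m \<or> t = 1 / n" for t by blast
    have ne: "1 / m \<noteq> 1 / n" using h by simp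
    have ys: "is_square y \<longleftrightarrow> (is_square m \<longleftrightarrow> is_square n)" "y \<noteq> 0" unfolding h(5) using is_square_mult_iff[OF odd_card h(2,3)] h(2,3) by simp_all
    have "pts hyperbolic L = (if is_square m then 1 else 0) + (if is_square n then 1 else 0) + (if is_square m \<longleftrightarrow> is_square n then 1 else 0)"
      "pts elliptic L = (if is_square m then 0 else 1) + (if is_square n then 0 else 1) + (if is_square m \<longleftrightarrow> is_square n then 0 else 1)"
      "pts rank_one L = 0"
      unfolding P Q card_two[OF ne] inv[OF h(2)] inv[OF h(3)] ys(1) using ys(2) by simp_all
    then show "ltype L = (if is_square m \<and> is_square n then o14_1 else o14_2)" using ns by (simp add: ltype_def Let_def)
  }
  {
    assume h: "m \<noteq> 0" "u = 2 * m" "y = m^2"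
    have "Q t = (m * t - 1)^2" for t unfolding Q_def h(2,3) by (simp add: power2_eq_square algebra_simps)
    then have Q: "Q t = 0 \<longleftrightarrow> t = 1 / m" for t using h(1) by (auto simp: field_simps)
    have "is_square y" "y \<noteq> 0" unfolding h(3) using h(1) by simp_all
    then show "ltype L = (if is_square m then o13_1 else o13_2)" using P ns inv[OF h(1)] by (simp add: Q ltype_def Let_def Collect_conv_if)
  }
  assume y: "y \<noteq> 0" and nr: "\<And>m. m * m - u * m + y \<noteq> 0"
  have Q: "Q t \<noteq> 0" for t
  proof
    assume q: "Q t = 0"
    have "(1 / t) * (1 / t) - u * (1 / t) + y = Q t / t^2" using t0[OF q] unfolding Q_def by (simp add: field_simps power2_eq_square)
    then show False using nr[of "1 / t"] q by simp
  qed
  have "ddet y 0 0 (-1) 0 0 (1 - u) 0 1 1 1 1 = - y" by (simp add: ddet_def)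
  then have "\<not> tangent L (S y 0 0 (-1) 0 0)" unfolding L_def tangent_S using y by simp
  moreover have "\<not> tangent L (S (1 - u + t * y) 0 1 (1 + t * -1) 1 1)" for t unfolding L_def tangent_S d using Q by simp
  ultimately have "pts (tangent L) L = 0"
    unfolding L_def pts_S[OF i homog_tangent] mult_zero_right add_0_left add_0_right mult_1_right by simp
  then show "ltype L = (if is_square y then o15_1 else o15_2)" using P ns y Q by (simp add: ltype_def Let_def)
qed

lemma card_offdiagonal: "card {p::'a\<times>'a. fst p \<noteq> snd p \<and> fst p \<in> A \<and> snd p \<in> A} + card A = card A * card A"
proof -
  have "A \<times> A = {p. fst p \<noteq> snd p \<and> fst p \<in> A \<and> snd p \<in> A} \<union> (\<lambda>a. (a,a)) ` A" by auto
  then have "card (A \<times> A) = card ({p. fst p \<noteq> snd p \<and> fst p \<in> A \<and> snd p \<in> A} \<union> (\<lambda>a. (a,a)) ` A)" by simp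
  also have "\<dots> = card {p. fst p \<noteq> snd p \<and> fst p \<in> A \<and> snd p \<in> A} + card ((\<lambda>a. (a,a)) ` A)"
    by (rule card_Un_disjoint) auto
  also have "card ((\<lambda>a. (a,a)) ` A) = card A" by (rule card_image) (auto simp: inj_on_def)
  finally show ?thesis by (simp add: card_cartesian_product)
qed

lemma dist_Sigma5:
  "rat_of_nat (type_count (span3 (S 1 0 0 0 0 0) (S 0 0 1 1 1 1) (S 0 0 0 (-1) 0 (0::'a))) t) = table Sigma5 CARD('a) t"
proof -
  define f where "f p = ltype (span2 (S (1 - fst p) 0 1 1 1 1) (S (snd p) 0 0 (-1) 0 0))" for p :: "'a \<times> 'a"
  note T = ltype_Sigma5[where u="fst p" and y="snd p" for p, folded f_def]
  define E where "E P p \<longleftrightarrow> (\<exists>m n. m \<noteq> n \<and> P m n \<and> fst p = m + n \<and> snd p = m * n)" for P and p :: "'a \<times> 'a"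
  let ?A = "\<lambda>m n. (m \<noteq> 0 \<and> is_square m) \<and> (n \<noteq> 0 \<and> is_square (n::'a))"
  let ?B = "\<lambda>m n. (m \<noteq> 0 \<and> n \<noteq> (0::'a)) \<and> \<not> (is_square m \<and> is_square n)"
  let ?C = "\<lambda>m n. (m \<noteq> 0 \<and> n \<noteq> (0::'a)) \<and> (is_square m \<longleftrightarrow> \<not> is_square n)"
  have i1: "f p = o14_1" if h: "E ?A p" for p
  proof -
    obtain m n where "m \<noteq> n" "?A m n" "fst p = m + n" "snd p = m * n" using h unfolding E_def by blast
    then show ?thesis using T(3)[of m n p] by simp
  qed
  have i2: "f p = o14_2" if h: "E ?B p" for p
  proof -
    obtain m n where "m \<noteq> n" "?B m n" "fst p = m + n" "snd p = m * n" using h unfolding E_def by blast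
    then show ?thesis using T(3)[of m n p] by simp
  qed
  have i3: "f p = o13_1" if h: "\<exists>m. (m \<noteq> 0 \<and> is_square m) \<and> p = (2 * m, m^2)" for p
  proof -
    obtain m where "m \<noteq> 0" "is_square m" "p = (2 * m, m^2)" using h by blast
    then show ?thesis using T(4)[of m p] by simp
  qed
  have i4: "f p = o13_2" if h: "\<exists>m. \<not> is_square m \<and> p = (2 * m, m^2)" for p
  proof -
    obtain m where m: "\<not> is_square m" "p = (2 * m, m^2)" using h by blast
    then have "m \<noteq> 0" by auto
    then show ?thesis using m T(4)[of m p] by simp
  qed
  have cases: "(snd p = 0 \<and> fst p = 0 \<and> f p = o9) \<or> (snd p = 0 \<and> fst p \<noteq> 0 \<and> is_square (fst p) \<and> f p = o8_1) \<or> (snd p = 0 \<and> \<not> is_square (fst p) \<and> f p = o8_2)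
    \<or> E ?A p \<or> E ?B p \<or> (\<exists>m. (m \<noteq> 0 \<and> is_square m) \<and> p = (2 * m, m^2)) \<or> (\<exists>m. \<not> is_square m \<and> p = (2 * m, m^2))
    \<or> (snd p \<noteq> 0 \<and> is_square (snd p) \<and> f p = o15_1) \<or> (\<not> is_square (snd p) \<and> f p = o15_2)" for p
  proof (cases "snd p = 0")
    case True
    have "f p = o9" if "fst p = 0" using T(1) True that by blast
    moreover have "f p = (if is_square (fst p) then o8_1 else o8_2)" if "fst p \<noteq> 0" using T(2) True that by blast
    moreover have "is_square (fst p)" if "fst p = 0" using that by simp
    ultimately show ?thesis using True by (metis (full_types))
  next
    case False
    show ?thesis
    proof (cases "\<exists>m. m * m - fst p * m + snd p = 0")
      case True
      then obtain m where m: "m * m - fst p * m + snd p = 0" by blast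
      define n where "n = fst p - m"
      have "snd p = m * n + (m * m - fst p * m + snd p)" unfolding n_def by (simp add: algebra_simps)
      then have sn: "fst p = m + n" "snd p = m * n" unfolding m by (simp_all add: n_def)
      have nz: "m \<noteq> 0" "n \<noteq> 0" using False sn by auto
      show ?thesis
      proof (cases "m = n")
        case True
        then have "p = (2 * m, m^2)" using sn by (simp add: prod_eq_iff power2_eq_square)
        then show ?thesis using nz by blast
      next
        case False
        then have "E ?A p \<or> E ?B p" unfolding E_def using sn nz by blast
        then show ?thesis by blast
      qed
    next
      case nr: False
      then have "f p = (if is_square (snd p) then o15_1 else o15_2)" using T(5)[of p] False by blast
      then show ?thesis using False by (cases "is_square (snd p)") simp_all
    qed
  qed
  let ?T = "{o9, o8_1, o8_2, o14_1, o14_2, o13_1, o13_2, o15_1, o15_2}"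
  define EA EB EC ED EE where "EA p \<longleftrightarrow> E ?A p" and "EB p \<longleftrightarrow> E ?B p" and "EC p \<longleftrightarrow> E ?C p"
    and "ED p \<longleftrightarrow> (\<exists>m. (m \<noteq> 0 \<and> is_square m) \<and> p = (2 * m, m^2))" and "EE p \<longleftrightarrow> (\<exists>m. \<not> is_square m \<and> p = (2 * m, m^2))" for p
  note cases' = cases[folded EA_def EB_def ED_def EE_def]
  have imp: "EA p \<longrightarrow> f p = o14_1" "EB p \<longrightarrow> f p = o14_2" "ED p \<longrightarrow> f p = o13_1" "EE p \<longrightarrow> f p = o13_2" for p
    unfolding EA_def EB_def ED_def EE_def using i1 i2 i3 i4 by blast+
  have tab: "(f p = o14_1 \<longleftrightarrow> EA p) \<and> (f p = o14_2 \<longleftrightarrow> EB p) \<and> (f p = o13_1 \<longleftrightarrow> ED p) \<and> (f p = o13_2 \<longleftrightarrow> EE p) \<and> f p \<in> ?T" for p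
    using cases'[of p] imp[of p] by (elim disjE) auto
  have A: "{p. f p = o14_1} = {p. E ?A p}" "{p. f p = o14_2} = {p. E ?B p}"
    unfolding EA_def[symmetric] EB_def[symmetric] by (rule Collect_cong, use tab in blast)+
  have C: "{p. f p = o13_1} = (\<lambda>m. (2 * m, m^2)) ` {m. m \<noteq> 0 \<and> is_square m}" "{p. f p = o13_2} = (\<lambda>m. (2 * m, m^2)) ` {m. \<not> is_square m}"
  proof -
    have "{p. f p = o13_1} = {p. ED p}" "{p. f p = o13_2} = {p. EE p}" by (rule Collect_cong, use tab in blast)+
    moreover have "{p. ED p} = (\<lambda>m. (2 * m, m^2)) ` {m. m \<noteq> 0 \<and> is_square m}" "{p. EE p} = (\<lambda>m. (2 * m, m^2)) ` {m. \<not> is_square m}"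
      unfolding ED_def EE_def by blast+
    ultimately show "{p. f p = o13_1} = (\<lambda>m. (2 * m, m^2)) ` {m. m \<noteq> 0 \<and> is_square m}" "{p. f p = o13_2} = (\<lambda>m. (2 * m, m^2)) ` {m. \<not> is_square m}"
      by simp_all
  qed
  have inj: "inj_on (\<lambda>m::'a. (2 * m, m^2)) Z" for Z using two by (intro inj_onI) simp
  have c13: "card {p. f p = o13_1} = half" "card {p. f p = o13_2} = half"
    unfolding C card_image[OF inj] by (simp_all add: card_square_class)
  have sA: "2 * card {p. E ?A p} + half = half * half"
    unfolding E_def using card_offdiagonal[of "{m. m \<noteq> 0 \<and> is_square m}"] by (subst card_unordered) (auto simp: card_square_class)
  have sB: "2 * card {p. E ?B p} + 2 * half + half * half = 4 * half * half + half"
  proof -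
    have "2 * card {p. E ?B p} = card {p::'a\<times>'a. fst p \<noteq> snd p \<and> ?B (fst p) (snd p)}" unfolding E_def by (rule card_unordered) blast
    moreover have "{p::'a\<times>'a. fst p \<noteq> snd p \<and> fst p \<in> {m. m \<noteq> 0} \<and> snd p \<in> {m. m \<noteq> 0}} =
      {p. fst p \<noteq> snd p \<and> ?B (fst p) (snd p)} \<union> {p. fst p \<noteq> snd p \<and> fst p \<in> {m. m \<noteq> 0 \<and> is_square m} \<and> snd p \<in> {m. m \<noteq> 0 \<and> is_square m}}" by auto
    then have "card {p::'a\<times>'a. fst p \<noteq> snd p \<and> fst p \<in> {m. m \<noteq> 0} \<and> snd p \<in> {m. m \<noteq> 0}} =
      card ({p::'a\<times>'a. fst p \<noteq> snd p \<and> ?B (fst p) (snd p)} \<union> {p. fst p \<noteq> snd p \<and> fst p \<in> {m. m \<noteq> 0 \<and> is_square m} \<and> snd p \<in> {m. m \<noteq> 0 \<and> is_square m}})"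
      by (simp only:)
    then have "card {p::'a\<times>'a. fst p \<noteq> snd p \<and> fst p \<in> {m. m \<noteq> 0} \<and> snd p \<in> {m. m \<noteq> 0}} =
      card {p::'a\<times>'a. fst p \<noteq> snd p \<and> ?B (fst p) (snd p)} + card {p::'a\<times>'a. fst p \<noteq> snd p \<and> fst p \<in> {m. m \<noteq> 0 \<and> is_square m} \<and> snd p \<in> {m. m \<noteq> 0 \<and> is_square m}}"
      by (subst (asm) card_Un_disjoint) auto
    ultimately show ?thesis
      using card_offdiagonal[of "{m::'a. m \<noteq> 0}"] card_offdiagonal[of "{m::'a. m \<noteq> 0 \<and> is_square m}"] unfolding card_square_class by linarith
  qed
  have sC: "2 * card {p. E ?C p} = 2 * (half * half)"
  proof -
    have "2 * card {p. E ?C p} = card {p::'a\<times>'a. fst p \<noteq> snd p \<and> ?C (fst p) (snd p)}" unfolding E_def by (rule card_unordered) blast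
    also have "{p::'a\<times>'a. fst p \<noteq> snd p \<and> ?C (fst p) (snd p)} = {p. (\<lambda>c d. c \<noteq> 0 \<and> d = - c) (chi (fst p)) (chi (snd p))}"
      by (auto simp: chi_def split: if_splits)
    also have "card \<dots> = 2 * (half * half)" unfolding card_chi_pair[of "\<lambda>c d. c \<noteq> 0 \<and> d = - c"] by simp
    finally show ?thesis .
  qed
  have c15: "card {p. f p = o15_2} = half + half * half"
  proof -
    have sq: "EC p \<longrightarrow> \<not> is_square (snd p)" "EB p \<longrightarrow> \<not> is_square (snd p) \<longrightarrow> EC p" "EA p \<longrightarrow> is_square (snd p)"
      "ED p \<longrightarrow> is_square (snd p)" "EE p \<longrightarrow> is_square (snd p)" "EC p \<longrightarrow> EB p" "snd p = 0 \<longrightarrow> is_square (snd p)" for p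
    proof -
      have m: "is_square (m * n) \<longleftrightarrow> (is_square m \<longleftrightarrow> is_square n)" if "m \<noteq> 0" "n \<noteq> 0" for m n :: 'a
        by (rule is_square_mult_iff[OF odd_card that])
      show "EC p \<longrightarrow> \<not> is_square (snd p)" "EB p \<longrightarrow> \<not> is_square (snd p) \<longrightarrow> EC p" "EA p \<longrightarrow> is_square (snd p)"
        unfolding EA_def EB_def EC_def E_def using m by (metis (no_types))+
      show "ED p \<longrightarrow> is_square (snd p)" "EE p \<longrightarrow> is_square (snd p)" "snd p = 0 \<longrightarrow> is_square (snd p)" unfolding ED_def EE_def by auto
      show "EC p \<longrightarrow> EB p" unfolding EB_def EC_def E_def by blast
    qed
    have ns: "\<not> is_square (snd p) \<longleftrightarrow> E ?C p \<or> f p = o15_2" for p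
      unfolding EC_def[symmetric] using cases'[of p] imp[of p] sq[of p] by (elim disjE) auto
    have dj: "\<not> (E ?C p \<and> f p = o15_2)" for p
      unfolding EC_def[symmetric] using imp(2)[of p] sq(6)[of p] by auto
    have "{p::'a\<times>'a. \<not> is_square (snd p)} = {p. E ?C p} \<union> {p. f p = o15_2}" using ns by blast
    then have "card {p::'a\<times>'a. \<not> is_square (snd p)} = card {p. E ?C p} + card {p. f p = o15_2}"
      using dj by (subst card_Un_disjoint[symmetric]) auto
    moreover have "card {p::'a\<times>'a. \<not> is_square (snd p)} = CARD('a) * half"
      using card_pairs[of "\<lambda>_::'a. True" "\<lambda>y::'a. \<not> is_square y"] by (simp add: card_square_class)
    ultimately show ?thesis using sC by (simp add: CARD_half algebra_simps)
  qed
  have c8: "card {p. f p = o9} = 1" "card {p. f p = o8_1} = half" "card {p. f p = o8_2} = half"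
  proof -
    have z: "snd p = 0 \<longrightarrow> \<not> EA p \<and> \<not> EB p \<and> \<not> ED p \<and> \<not> EE p" for p
      unfolding EA_def EB_def ED_def EE_def E_def by auto
    have "(f p = o9 \<longleftrightarrow> fst p = 0 \<and> snd p = 0) \<and> (f p = o8_1 \<longleftrightarrow> (fst p \<noteq> 0 \<and> is_square (fst p)) \<and> snd p = 0) \<and> (f p = o8_2 \<longleftrightarrow> \<not> is_square (fst p) \<and> snd p = 0)" for p
      using cases'[of p] imp[of p] z[of p] by (elim disjE) auto
    then have e: "f p = o9 \<longleftrightarrow> fst p = 0 \<and> snd p = 0" "f p = o8_1 \<longleftrightarrow> (fst p \<noteq> 0 \<and> is_square (fst p)) \<and> snd p = 0" "f p = o8_2 \<longleftrightarrow> \<not> is_square (fst p) \<and> snd p = 0" for p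
      by blast+
    show "card {p. f p = o9} = 1" "card {p. f p = o8_1} = half" "card {p. f p = o8_2} = half"
      unfolding e using card_pairs[of "\<lambda>x. x = (0::'a)" "\<lambda>y. y = (0::'a)"] card_pairs[of "\<lambda>x::'a. x \<noteq> 0 \<and> is_square x" "\<lambda>y. y = (0::'a)"] card_pairs[of "\<lambda>x::'a. \<not> is_square x" "\<lambda>y. y = (0::'a)"]
      by (simp_all add: card_square_class)
  qed
  have fT: "f p \<in> ?T" for p using tab by blast
  have "(\<Sum>t\<in>?T. sum (\<lambda>_. 1) {p\<in>UNIV. f p = t}) = sum (\<lambda>_. 1::nat) (UNIV :: ('a\<times>'a) set)"
    by (rule sum.group) (use fT in auto)
  then have tot: "card {p. f p = o9} + card {p. f p = o8_1} + card {p. f p = o8_2} + card {p. f p = o14_1} + card {p. f p = o14_2} + card {p. f p = o13_1}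
    + card {p. f p = o13_2} + card {p. f p = o15_1} + card {p. f p = o15_2} = CARD('a) * CARD('a)" by simp
  have c: "rat_of_nat (card {p. f p = o14_1}) = (rat_of_nat half * rat_of_nat half - rat_of_nat half) / 2"
    "rat_of_nat (card {p. f p = o14_2}) = (3 * (rat_of_nat half * rat_of_nat half) - rat_of_nat half) / 2"
    "rat_of_nat (card {p. f p = o15_1}) = rat_of_nat half * rat_of_nat half"
  proof -
    have a: "2 * rat_of_nat (card {p. f p = o14_1}) + rat_of_nat half = rat_of_nat half * rat_of_nat half"
      using arg_cong[OF sA, of rat_of_nat] unfolding A(1) by simp
    have b: "2 * rat_of_nat (card {p. f p = o14_2}) + 2 * rat_of_nat half + rat_of_nat half * rat_of_nat half = 4 * (rat_of_nat half * rat_of_nat half) + rat_of_nat half"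
      using arg_cong[OF sB, of rat_of_nat] unfolding A(2) by simp
    have d: "1 + 4 * rat_of_nat half + rat_of_nat (card {p. f p = o14_1}) + rat_of_nat (card {p. f p = o14_2}) + rat_of_nat (card {p. f p = o15_1}) + rat_of_nat half + rat_of_nat half * rat_of_nat half
      = 4 * (rat_of_nat half * rat_of_nat half) + 4 * rat_of_nat half + 1"
      using arg_cong[OF tot, of rat_of_nat] unfolding c8 c13 c15 CARD_half by (simp add: algebra_simps)
    have l: "x = (k - h) / 2 \<and> y = (3 * k - h) / 2 \<and> z = k" if e: "2 * x + h = k" "2 * y + 2 * h + k = 4 * k + h" "1 + 4 * h + x + y + z + h + k = 4 * k + 4 * h + 1" for x y z h k :: rat
    proof -
      have x: "x = (k - h) / 2" using e(1) by simp
      have y: "y = (3 * k - h) / 2" using e(2) by simp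
      show ?thesis using x y e(3) by (simp add: field_simps)
    qed
    show "rat_of_nat (card {p. f p = o14_1}) = (rat_of_nat half * rat_of_nat half - rat_of_nat half) / 2"
      "rat_of_nat (card {p. f p = o14_2}) = (3 * (rat_of_nat half * rat_of_nat half) - rat_of_nat half) / 2"
      "rat_of_nat (card {p. f p = o15_1}) = rat_of_nat half * rat_of_nat half"
      using l[OF a b d] by blast+
  qed
  have z: "card {p. f p = t} = 0" if "t \<notin> ?T" for t
  proof -
    have "{p. f p = t} = {}" using fT that by blast
    then show ?thesis by (simp only: card.empty)
  qed
  have sub: "card {p::'a\<times>'a. ltype (span2 (S (fst p) 0 1 1 1 1) (S (snd p) 0 0 (-1) 0 0)) = t} = card {p. f p = t}" for t :: line_type
  proof -
    have "{p. f p = t} = (\<lambda>p. (1 - fst p, snd p)) ` {p::'a\<times>'a. ltype (span2 (S (fst p) 0 1 1 1 1) (S (snd p) 0 0 (-1) 0 0)) = t}"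
    proof (intro Set.set_eqI iffI)
      fix p assume p: "p \<in> {p. f p = t}"
      show "p \<in> (\<lambda>p. (1 - fst p, snd p)) ` {p::'a\<times>'a. ltype (span2 (S (fst p) 0 1 1 1 1) (S (snd p) 0 0 (-1) 0 0)) = t}"
        by (rule image_eqI[of _ _ "(1 - fst p, snd p)"]) (use p in \<open>simp_all add: f_def\<close>)
    next
      fix p assume "p \<in> (\<lambda>p. (1 - fst p, snd p)) ` {p::'a\<times>'a. ltype (span2 (S (fst p) 0 1 1 1 1) (S (snd p) 0 0 (-1) 0 0)) = t}"
      then obtain r where "p = (1 - fst r, snd r)" "ltype (span2 (S (fst r) 0 1 1 1 1) (S (snd r) 0 0 (-1) 0 0)) = t" by blast
      then show "p \<in> {p. f p = t}" by (simp add: f_def)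
    qed
    moreover have "inj_on (\<lambda>p::'a\<times>'a. (1 - fst p, snd p)) Z" for Z by (auto simp: inj_on_def prod_eq_iff)
    ultimately show ?thesis by (simp add: card_image)
  qed
  define H where "H c \<longleftrightarrow> (if c = 0 then o9 else if c = 1 then o8_1 else o8_2) = t" for c :: int
  have d: "type_count (span3 (S 1 0 0 0 0 0) (S 0 0 1 1 1 1) (S 0 0 0 (-1) 0 (0::'a))) t = card {p. f p = t} + card {s. H (chi s)} + (if o5 = t then 1 else 0)"
  proof (subst dist_corner)
    have e: "rank_one_type (0 + s * 0) (1 + s * 0) (1 + s * -1) (1 + s * 0) (1 + s * 0) = t \<longleftrightarrow> H (chi s)" for s :: 'a
      by (simp add: rank_one_type_def H_def chi_simps)
    have e2: "rank_one_type 0 0 (-1) 0 0 = o5" by (simp add: rank_one_type_def)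
    show "card {p. ltype (line_xy 0 1 1 1 1 0 0 (-1) 0 0 (fst p) (snd p)) = t} + card {s. rank_one_type (0 + s * 0) (1 + s * 0) (1 + s * -1) (1 + s * 0) (1 + s * 0) = t} +
      (if rank_one_type 0 0 (-1) 0 0 = t then 1 else 0) = card {p. f p = t} + card {s. H (chi s)} + (if o5 = t then 1 else 0)"
      unfolding e e2 line_xy_def sub by (rule refl)
  qed simp
  show ?thesis unfolding d card_chi[of H]
    by (cases t) (simp_all add: H_def z c c8 c13 c15 table_simps field_simps power2_eq_square)
qed

end

section \<open>The planes of each type\<close>

lemma parametrised_span3:
  assumes "P = {F \<alpha> \<beta> \<gamma> | \<alpha> \<beta> \<gamma>. True}"
    and "\<And>\<alpha> \<beta> \<gamma>. F \<alpha> \<beta> \<gamma> = mscale (a \<alpha> \<beta> \<gamma>) E + mscale (b \<alpha> \<beta> \<gamma>) M + mscale (c \<alpha> \<beta> \<gamma>) N"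
    and "\<And>x y z. mscale x E + mscale y M + mscale z N = F (a' x y z) (b' x y z) (c' x y z)"
  shows "P = span3 E M N"
  unfolding assms(1) span3_def
proof (intro Set.set_eqI iffI)
  fix Z assume "Z \<in> {F \<alpha> \<beta> \<gamma> | \<alpha> \<beta> \<gamma>. True}"
  then show "Z \<in> {mscale a E + mscale b M + mscale c N | a b c. True}" using assms(2) by blast
next
  fix Z assume "Z \<in> {mscale a E + mscale b M + mscale c N | a b c. True}"
  then show "Z \<in> {F \<alpha> \<beta> \<gamma> | \<alpha> \<beta> \<gamma>. True}" using assms(3) by blast
qed

lemma image_parametrised: "f ` {F \<alpha> \<beta> \<gamma> | \<alpha> \<beta> \<gamma>. True} = {f (F \<alpha> \<beta> \<gamma>) | \<alpha> \<beta> \<gamma>. True}"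
  by blast

context odd_field
begin

text \<open>The representatives of \<open>\<Sigma>\<^sub>6\<close> and
  \<open>\<Sigma>\<^sub>1\<^sub>1\<close> have their point of rank one elsewhere and are first moved by a
  congruence; the others are the planes treated above in other parameters.\<close>

lemma dist_plane_reps:
  assumes P: "P \<in> plane_reps \<epsilon> T"
  shows "rat_of_nat (type_count P t) = table T CARD('a) t"
proof (cases T)
  case Sigma1
  have "P = {S \<alpha> \<gamma> 0 \<beta> 0 0 | \<alpha> \<beta> \<gamma>. True}" using P by (simp add: Sigma1 S_def)
  then have "P = span3 (S 1 0 0 0 0 0) (S 0 0 0 1 0 0) (S 0 1 0 0 0 0)"
    by (rule parametrised_span3[where a="\<lambda>a b c. a" and b="\<lambda>a b c. b" and c="\<lambda>a b c. c" and a'="\<lambda>a b c. a" and b'="\<lambda>a b c. b" and c'="\<lambda>a b c. c"]) simp_all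
  then show ?thesis using dist_Sigma1 Sigma1 by simp
next
  case Sigma2
  have "P = {S \<alpha> 0 0 \<beta> 0 \<gamma> | \<alpha> \<beta> \<gamma>. True}" using P by (simp add: Sigma2 S_def)
  then have "P = span3 (S 1 0 0 0 0 0) (S 0 0 0 1 0 0) (S 0 0 0 0 0 1)"
    by (rule parametrised_span3[where a="\<lambda>a b c. a" and b="\<lambda>a b c. b" and c="\<lambda>a b c. c" and a'="\<lambda>a b c. a" and b'="\<lambda>a b c. b" and c'="\<lambda>a b c. c"]) simp_all
  then show ?thesis using dist_Sigma2 Sigma2 by simp
next
  case Sigma3
  have "P = {S \<alpha> 0 \<gamma> \<beta> 0 0 | \<alpha> \<beta> \<gamma>. True}" using P by (simp add: Sigma3 S_def)
  then have "P = span3 (S 1 0 0 0 0 0) (S 0 0 0 1 0 0) (S 0 0 1 0 0 0)"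
    by (rule parametrised_span3[where a="\<lambda>a b c. a" and b="\<lambda>a b c. b" and c="\<lambda>a b c. c" and a'="\<lambda>a b c. a" and b'="\<lambda>a b c. b" and c'="\<lambda>a b c. c"]) simp_all
  then show ?thesis using dist_Sigma3 Sigma3 by simp
next
  case Sigma4
  have "P = {S \<alpha> 0 \<gamma> \<beta> \<gamma> 0 | \<alpha> \<beta> \<gamma>. True}" using P by (simp add: Sigma4 S_def)
  then have "P = span3 (S 1 0 0 0 0 0) (S 0 0 0 1 0 0) (S 0 0 1 0 1 0)"
    by (rule parametrised_span3[where a="\<lambda>a b c. a" and b="\<lambda>a b c. b" and c="\<lambda>a b c. c" and a'="\<lambda>a b c. a" and b'="\<lambda>a b c. b" and c'="\<lambda>a b c. c"]) simp_all
  then show ?thesis using dist_Sigma4 Sigma4 by simp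
next
  case Sigma5
  have "P = {S \<alpha> 0 \<gamma> \<beta> \<gamma> \<gamma> | \<alpha> \<beta> \<gamma>. True}" using P by (simp add: Sigma5 S_def)
  then have "P = span3 (S 1 0 0 0 0 0) (S 0 0 1 1 1 1) (S 0 0 0 (-1) 0 0)"
    by (rule parametrised_span3[where a="\<lambda>a b c. a" and b="\<lambda>a b c. c" and c="\<lambda>a b c. c - b" and a'="\<lambda>a b c. a" and b'="\<lambda>a b c. b - c" and c'="\<lambda>a b c. b"]) simp_all
  then show ?thesis using dist_Sigma5 Sigma5 by simp
next
  case Sigma6
  let ?A = "mat3 [[0,0,1],[1,0,0],[0,1,0]] :: 'a^3^3"
  have A: "invertible ?A" by (simp add: invertible_mat3)
  have "P = {S \<alpha> \<beta> 0 (\<epsilon> * \<alpha>) 0 \<gamma> | \<alpha> \<beta> \<gamma>. True}" using P by (simp add: Sigma6 S_def)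
  then have "act ?A ` P = {act ?A (S \<alpha> \<beta> 0 (\<epsilon> * \<alpha>) 0 \<gamma>) | \<alpha> \<beta> \<gamma>. True}" by (simp only: image_parametrised)
  moreover have "act ?A (S \<alpha> \<beta> 0 (\<epsilon> * \<alpha>) 0 \<gamma>) = S \<gamma> 0 0 \<alpha> \<beta> (\<epsilon> * \<alpha>)" for \<alpha> \<beta> \<gamma> by (simp add: act_S)
  ultimately have "act ?A ` P = {S \<gamma> 0 0 \<alpha> \<beta> (\<epsilon> * \<alpha>) | \<alpha> \<beta> \<gamma>. True}" by simp
  then have "act ?A ` P = span3 (S 1 0 0 0 0 0) (S 0 0 0 1 0 \<epsilon>) (S 0 0 0 0 1 0)"
    by (rule parametrised_span3[where a="\<lambda>a b c. c" and b="\<lambda>a b c. a" and c="\<lambda>a b c. b" and a'="\<lambda>a b c. b" and b'="\<lambda>a b c. c" and c'="\<lambda>a b c. a"]) simp_all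
  then show ?thesis using dist_Sigma6 Sigma6 dist_act[OF A, of P] by simp
next
  case Sigma7
  have "P = {S \<alpha> \<beta> \<gamma> 0 0 0 | \<alpha> \<beta> \<gamma>. True}" using P by (simp add: Sigma7 S_def)
  then have "P = span3 (S 1 0 0 0 0 0) (S 0 1 0 0 0 0) (S 0 0 1 0 0 0)"
    by (rule parametrised_span3[where a="\<lambda>a b c. a" and b="\<lambda>a b c. b" and c="\<lambda>a b c. c" and a'="\<lambda>a b c. a" and b'="\<lambda>a b c. b" and c'="\<lambda>a b c. c"]) simp_all
  then show ?thesis using dist_Sigma7 Sigma7 by simp
next
  case Sigma8
  have "P = {S \<alpha> \<beta> 0 0 \<gamma> 0 | \<alpha> \<beta> \<gamma>. True}" using P by (simp add: Sigma8 S_def)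
  then have "P = span3 (S 1 0 0 0 0 0) (S 0 1 0 0 0 0) (S 0 0 0 0 1 0)"
    by (rule parametrised_span3[where a="\<lambda>a b c. a" and b="\<lambda>a b c. b" and c="\<lambda>a b c. c" and a'="\<lambda>a b c. a" and b'="\<lambda>a b c. b" and c'="\<lambda>a b c. c"]) simp_all
  then show ?thesis using dist_Sigma8 Sigma8 by simp
next
  case Sigma9
  have "P = {S \<alpha> \<beta> 0 \<gamma> 0 (- \<gamma>) | \<alpha> \<beta> \<gamma>. True}" using P by (simp add: Sigma9 S_def)
  then have "P = span3 (S 1 0 0 0 0 0) (S 0 0 0 1 0 (-1)) (S 0 1 0 0 0 0)"
    by (rule parametrised_span3[where a="\<lambda>a b c. a" and b="\<lambda>a b c. c" and c="\<lambda>a b c. b" and a'="\<lambda>a b c. a" and b'="\<lambda>a b c. c" and c'="\<lambda>a b c. b"]) simp_all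
  then show ?thesis using dist_Sigma9 Sigma9 by simp
next
  case Sigma10
  have "P = {S \<alpha> \<beta> 0 \<gamma> 0 (- \<epsilon> * \<gamma>) | \<alpha> \<beta> \<gamma>. True}" using P by (simp add: Sigma10 S_def)
  then have "P = span3 (S 1 0 0 0 0 0) (S 0 0 0 1 0 (- \<epsilon>)) (S 0 1 0 0 0 0)"
    by (rule parametrised_span3[where a="\<lambda>a b c. a" and b="\<lambda>a b c. c" and c="\<lambda>a b c. b" and a'="\<lambda>a b c. a" and b'="\<lambda>a b c. c" and c'="\<lambda>a b c. b"]) simp_all
  then show ?thesis using dist_Sigma10 Sigma10 by simp
next
  case Sigma11
  let ?A = "mat3 [[0,1,0],[1,0,0],[0,-1,1]] :: 'a^3^3"
  have A: "invertible ?A" by (simp add: invertible_mat3)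
  have "P = {S 0 \<beta> \<gamma> \<alpha> \<alpha> (\<alpha> + \<gamma>) | \<alpha> \<beta> \<gamma>. True}" using P by (simp add: Sigma11 S_def)
  then have "act ?A ` P = {act ?A (S 0 \<beta> \<gamma> \<alpha> \<alpha> (\<alpha> + \<gamma>)) | \<alpha> \<beta> \<gamma>. True}" by (simp only: image_parametrised)
  moreover have "act ?A (S 0 \<beta> \<gamma> \<alpha> \<alpha> (\<alpha> + \<gamma>)) = S \<alpha> \<beta> 0 0 (\<gamma> - \<beta>) \<gamma>" for \<alpha> \<beta> \<gamma> by (simp add: act_S)
  ultimately have "act ?A ` P = {S \<alpha> \<beta> 0 0 (\<gamma> - \<beta>) \<gamma> | \<alpha> \<beta> \<gamma>. True}" by simp
  then have "act ?A ` P = span3 (S 1 0 0 0 0 0) (S 0 (-1) 0 0 1 0) (S 0 1 0 0 0 1)"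
    by (rule parametrised_span3[where a="\<lambda>a b c. a" and b="\<lambda>a b c. c - b" and c="\<lambda>a b c. c" and a'="\<lambda>a b c. a" and b'="\<lambda>a b c. c - b" and c'="\<lambda>a b c. c"]) simp_all
  then show ?thesis using dist_Sigma11 Sigma11 dist_act[OF A, of P] by simp
next
  case Sigma12
  have h: "x / 2 + x / 2 = x" for x :: 'a using two by (simp flip: add_divide_distrib mult_2)
  have "P = {S \<alpha> \<beta> 0 \<gamma> \<beta> \<gamma> | \<alpha> \<beta> \<gamma>. True}" using P by (simp add: Sigma12 S_def)
  then have "P = span3 (S 1 0 0 0 0 0) (S 0 1 0 1 1 1) (S 0 1 0 (-1) 1 (-1))"
    by (rule parametrised_span3[where a="\<lambda>a b c. a" and b="\<lambda>a b c. (b + c) / 2" and c="\<lambda>a b c. (b - c) / 2" and a'="\<lambda>a b c. a" and b'="\<lambda>a b c. b + c" and c'="\<lambda>a b c. b - c"])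
      (simp_all add: add_divide_distrib diff_divide_distrib h)
  then show ?thesis using dist_Sigma12 Sigma12 by simp
next
  case Sigma13
  have "P = {S \<alpha> \<beta> 0 \<gamma> \<beta> (\<epsilon> * \<gamma>) | \<alpha> \<beta> \<gamma>. True}" using P by (simp add: Sigma13 S_def)
  then have "P = span3 (S 1 0 0 0 0 0) (S 0 0 0 1 0 \<epsilon>) (S 0 1 0 0 1 0)"
    by (rule parametrised_span3[where a="\<lambda>a b c. a" and b="\<lambda>a b c. c" and c="\<lambda>a b c. b" and a'="\<lambda>a b c. a" and b'="\<lambda>a b c. c" and c'="\<lambda>a b c. b"]) simp_all
  then show ?thesis using dist_Sigma13 Sigma13 by simp
next
  case Sigma14
  obtain c where c: "CARD('a) mod 3 \<noteq> 0" "cond_c c" "P = {S \<alpha> \<beta> 0 (c * \<gamma>) (\<beta> - \<gamma>) \<gamma> | \<alpha> \<beta> \<gamma>. True}"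
    using P by (auto simp: Sigma14 S_def)
  from c(3) have "P = span3 (S 1 0 0 0 0 0) (S 0 1 0 c 0 1) (S 0 1 0 0 1 0)"
    by (rule parametrised_span3[where a="\<lambda>a b c. a" and b="\<lambda>a b c. c" and c="\<lambda>a b c. b - c" and a'="\<lambda>a b c. a" and b'="\<lambda>a b c. b + c" and c'="\<lambda>a b c. b"]) simp_all
  then show ?thesis using dist_Sigma14[OF c(1,2)] Sigma14 by simp
next
  case Sigma14'
  have c: "CARD('a) mod 3 = 0" "P = {S (\<alpha> + \<gamma>) \<gamma> \<gamma> (\<beta> + \<gamma>) \<gamma> (- \<beta>) | \<alpha> \<beta> \<gamma>. True}"
    using P by (simp_all add: Sigma14' S_def split: if_splits)
  from c(2) have "P = span3 (S 1 0 0 0 0 0) (S 0 0 0 1 0 (-1)) (S 0 1 1 2 1 (-1))"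
    by (rule parametrised_span3[where a="\<lambda>a b c. a + c" and b="\<lambda>a b c. b - c" and c="\<lambda>a b c. c" and a'="\<lambda>a b c. a - c" and b'="\<lambda>a b c. b + c" and c'="\<lambda>a b c. c"]) simp_all
  then show ?thesis using dist_Sigma14'[OF c(1)] Sigma14' by simp
next
  case Sigma15
  have "P = {S \<alpha> \<beta> \<gamma> \<gamma> 0 0 | \<alpha> \<beta> \<gamma>. True}" using P by (simp add: Sigma15 S_def)
  then have "P = span3 (S 1 0 0 0 0 0) (S 0 1 0 0 0 0) (S 0 0 1 1 0 0)"
    by (rule parametrised_span3[where a="\<lambda>a b c. a" and b="\<lambda>a b c. b" and c="\<lambda>a b c. c" and a'="\<lambda>a b c. a" and b'="\<lambda>a b c. b" and c'="\<lambda>a b c. c"]) simp_all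
  then show ?thesis using dist_Sigma15 Sigma15 by simp
qed

end

theorem theorem1p1:
  fixes q :: nat
    and \<epsilon> :: "'a::{field, finite}"
    and R :: "line_type \<Rightarrow> ('a^3^3) set"
  assumes "q = CARD('a)" and "odd q"
    and "\<not> is_square \<epsilon>"
    and "\<And>t. R t \<in> line_reps \<epsilon> t"
  shows "(\<forall>T P. plane_of_type \<epsilon> T P \<longrightarrow>
            (\<forall>t. rat_of_nat (line_orbit_distribution R P t) = table T q t)) \<and>
         (\<forall>T N. rank_one_net N \<and> plane_of_type \<epsilon> T (plane_of_net N) \<longrightarrow>
            (\<forall>t. rat_of_nat (line_orbit_distribution R (plane_of_net N) t) = table T q t))"
proof -
  interpret odd_field \<epsilon> by unfold_locales (use assms in auto)
  have "rat_of_nat (line_orbit_distribution R P t) = table T q t" if h: "plane_of_type \<epsilon> T P" for T P t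
  proof -
    obtain P0 where P0: "P0 \<in> plane_reps \<epsilon> T" "P \<in> K_orbit P0" using h by (auto simp: plane_of_type_def)
    obtain A where A: "invertible A" "P = act A ` P0" using P0(2) unfolding K_orbit_def' by blast
    have "line_orbit_distribution R P t = type_count P0 t"
      unfolding A(2) line_orbit_distribution_eq[of R, OF assms(4)] by (rule dist_act[OF A(1)])
    then show ?thesis using dist_plane_reps[OF P0(1), of t] assms(1) by simp
  qed
  then show ?thesis by blast
qed

end
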